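(* Let $n\in\mathbb{N}$ and assume that $Ct^E_{\mathbb{R}}(n+1)=Ct^S_{\mathbb{R}}(n+1)$. Then $\mathcal{R}(Ct_{\mathbb{N}}(n))$ is zero-dimensional.
   Context: For a topological space $T$, $\mathcal{R}(T)$ is the topology on the same set whose open sets are exactly the sets $f^{-1}(O)$ with $f:T\to\mathbb{R}$ continuous and $O\subseteq\mathbb{R}$ open; zero-dimensional means having a basis of clopen sets. All domains are bounded-complete $\omega$-algebraic with the Scott topology; $D\to D'$ is the domain of Scott-continuous maps. Kleene–Kreisel: $N(0)=\mathbb{N}_\bot$, $N(k+1)=N(k)\to N(0)$; $n\approx^N_0 m$ iff $n=m\in\mathbb{N}$; $f\approx^N_{k+1}g$ iff $f(a)\approx^N_0 g(b)$ whenever $a\approx^N_k b$; $\bar N(k)=\{x:x\approx^N_kx\}$; $Ct_{\mathbb{N}}(k)=\bar N(k)/\approx^N_k$ with the quotient topology. Extensional hierarchy: $E(0)$ is the ideal completion of $\{\mathbb{R}\}\cup\{[p,q]:p\le q\text{ rational}\}$ under reverse inclusion, $E(k+1)=E(k)\to E(0)$; $\alpha\approx^E_0\beta$ iff $\bigcap\alpha=\bigcap\beta=\{x\}$, $x\in\mathbb{R}$; higher $\approx^E_k$, $\bar E(k)$ analogous; $\rho^E_0(\alpha)=x$ where $\bigcap\alpha=\{x\}$, $\rho^E_{k+1}(f)(\rho^E_k(y))=\rho^E_0(f(y))$; $Ct^E_{\mathbb{R}}(0)=\mathbb{R}$, $Ct^E_{\mathbb{R}}(k+1)=\rho^E_{k+1}[\bar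 E(k+1)]$ (functions $Ct^E_{\mathbb{R}}(k)\to\mathbb{R}$). Smoothened intensional hierarchy: $S(0)$ consists of the empty sequence and all finite and infinite sequences $ab_1b_2\dots$ with $a\in\mathbb{Z}$, $b_i\in\{-1,0,1\}$, ordered by extension; for maximal elements $\rho^S_0(ab_1b_2\cdots)=a+\sum_{n\ge1}b_n2^{-n}$; $x_1\sim_0x_2$ iff they have maximal extensions with equal $\rho^S_0$-value; $S(k+1)$ is the set of Scott-continuous $f:S(k)\to S(0)$ with $x_1\sim_kx_2\Rightarrow f(x_1)\sim_0f(x_2)$, ordered pointwise; $f_1\sim_{k+1}f_2$ iff $x_1\sim_kx_2\Rightarrow f_1(x_1)\sim_0f_2(x_2)$. $\bar S(0)$ = maximal elements, $\approx^S_0$ = $\sim_0$ restricted to them; $f\approx^S_{k+1}g$ iff $f(x)\approx^S_0 g(y)$ whenever $x\approx^S_k y$; $\bar S(k)=\{x:x\approx^S_kx\}$; $\rho^S_{k+1}(f)(\rho^S_k(y))=\rho^S_0(f(y))$; $Ct^S_{\mathbb{R}}(0)=\mathbb{R}$, $Ct^S_{\mathbb{R}}(k+1)=\rho^S_{k+1}[\bar S(k+1)]$ (functions $Ct^S_{\mathbb{R}}(k)\to\mathbb{R}$). The assumed equality is equality as sets of real-valued functions. *)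

theory Defs
  imports "HOL-Analysis.Analysis"
begin

section \<open>A single type for all levels of a type hierarchy\<close>

text \<open>
  The levels of the hierarchies are sets of functions between sets of functions, with the level a
  natural number, so all levels have to live in one HOL type. A function is an element
  \<open>Graph p\<close>, where the range of \<open>p\<close> is its graph. Such families reach exactly the
  nonempty sets of at most continuum many pairs. This is enough for everything below: a
  bounded-complete omega-algebraic domain has at most continuum many elements, and hence so have its
  subsets and their images. As \<open>p\<close> is chosen by \<open>graph_code\<close> from the graph alone,
  equality of codes is equality of functions, including equality of their domains
  (see \<open>fun_code_eq_iff\<close> and \<open>app_fun_code\<close>).
\<close>

datatype 'b hval = Base (base_val: 'b) | Graph "real \<Rightarrow> 'b hval \<times> 'b hval"

definition graph_code :: "('b hval \<times> 'b hval) set \<Rightarrow> 'b hval" where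
  "graph_code G = Graph (SOME p. range p = G)"

definition fun_code :: "'b hval set \<Rightarrow> ('b hval \<Rightarrow> 'b hval) \<Rightarrow> 'b hval" where
  "fun_code A f = graph_code ((\<lambda>x. (x, f x)) ` A)"

fun app :: "'b hval \<Rightarrow> 'b hval \<Rightarrow> 'b hval" where
  "app (Graph p) x = (THE y. (x, y) \<in> range p)"
| "app (Base b) x = undefined"

lemma graph_code_range:
  fixes G :: "('b hval \<times> 'b hval) set" and g :: "'b hval \<times> 'b hval \<Rightarrow> real"
  assumes "G \<noteq> {}" "inj_on g G"
  obtains p where "graph_code G = Graph p" "range p = G"
proof -
  obtain z where z: "z \<in> G" using assms(1) by blast
  define p where "p = (\<lambda>t. if t \<in> g ` G then inv_into G g t else z)"
  have "range p = G"
  proof (intro equalityI subsetI)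
    fix w assume "w \<in> range p"
    then show "w \<in> G" using z by (auto simp: p_def inv_into_into)
  next
    fix w assume "w \<in> G"
    then have "w = p (g w)" using assms(2) by (simp add: p_def)
    then show "w \<in> range p" by blast
  qed
  then have "\<exists>p::real \<Rightarrow> _. range p = G" by blast
  then have "range (SOME p::real \<Rightarrow> _. range p = G) = G" by (rule someI_ex)
  then show thesis using that unfolding graph_code_def by blast
qed

lemma fun_code_range:
  fixes A :: "'b hval set" and c :: "'b hval \<Rightarrow> real"
  assumes "A \<noteq> {}" "inj_on c A"
  obtains p where "fun_code A f = Graph p" "range p = (\<lambda>x. (x, f x)) ` A"
proof -
  have "inj_on (\<lambda>z. c (fst z)) ((\<lambda>x. (x, f x)) ` A)"
    using assms(2) by (auto simp: inj_on_def)
  with assms(1) show thesis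
    using that unfolding fun_code_def by (elim graph_code_range[rotated]) auto
qed

lemma fun_code_eq_iff:
  fixes A B :: "'b hval set" and c d :: "'b hval \<Rightarrow> real"
  assumes "A \<noteq> {}" "inj_on c A" "B \<noteq> {}" "inj_on d B"
  shows "fun_code A f = fun_code B g \<longleftrightarrow> A = B \<and> (\<forall>x\<in>A. f x = g x)"
proof -
  obtain p where p: "fun_code A f = Graph p" "range p = (\<lambda>x. (x, f x)) ` A"
    using fun_code_range[OF assms(1,2)] .
  obtain q where q: "fun_code B g = Graph q" "range q = (\<lambda>x. (x, g x)) ` B"
    using fun_code_range[OF assms(3,4)] .
  show ?thesis
  proof
    assume "fun_code A f = fun_code B g"
    then have "(\<lambda>x. (x, f x)) ` A = (\<lambda>x. (x, g x)) ` B" using p q by simp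
    then have eq: "(x, y) \<in> (\<lambda>x. (x, f x)) ` A \<longleftrightarrow> (x, y) \<in> (\<lambda>x. (x, g x)) ` B" for x y
      by simp
    show "A = B \<and> (\<forall>x\<in>A. f x = g x)" using eq by blast
  next
    assume "A = B \<and> (\<forall>x\<in>A. f x = g x)"
    then show "fun_code A f = fun_code B g" by (simp add: fun_code_def cong: image_cong)
  qed
qed

lemma app_fun_code:
  fixes A :: "'b hval set" and c :: "'b hval \<Rightarrow> real"
  assumes "x \<in> A" "inj_on c A"
  shows "app (fun_code A f) x = f x"
proof -
  have "A \<noteq> {}" using assms(1) by blast
  then obtain p where "fun_code A f = Graph p" "range p = (\<lambda>x. (x, f x)) ` A"
    using fun_code_range assms(2) by metis
  then show ?thesis using assms(1) by auto
qed


section \<open>Scott topology and function spaces\<close>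

text \<open>A partially ordered set is given by its reflexive order relation, so that its carrier is the
  \<open>Field\<close> of the relation.\<close>

definition directed_in :: "'a rel \<Rightarrow> 'a set \<Rightarrow> bool" where
  "directed_in r A \<longleftrightarrow> A \<subseteq> Field r \<and> A \<noteq> {} \<and> (\<forall>x\<in>A. \<forall>y\<in>A. \<exists>z\<in>A. (x, z) \<in> r \<and> (y, z) \<in> r)"

definition is_lub_in :: "'a rel \<Rightarrow> 'a set \<Rightarrow> 'a \<Rightarrow> bool" where
  "is_lub_in r A x \<longleftrightarrow> x \<in> Field r \<and> (\<forall>a\<in>A. (a, x) \<in> r) \<and>
     (\<forall>y\<in>Field r. (\<forall>a\<in>A. (a, y) \<in> r) \<longrightarrow> (x, y) \<in> r)"

definition scott_open :: "'a rel \<Rightarrow> 'a set \<Rightarrow> bool" where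
  "scott_open r U \<longleftrightarrow> U \<subseteq> Field r \<and> (\<forall>x y. x \<in> U \<and> (x, y) \<in> r \<longrightarrow> y \<in> U) \<and>
     (\<forall>A x. directed_in r A \<and> is_lub_in r A x \<and> x \<in> U \<longrightarrow> A \<inter> U \<noteq> {})"

definition scott_topology :: "'a rel \<Rightarrow> 'a topology" where
  "scott_topology r = topology (scott_open r)"

lemma openin_scott_topology: "openin (scott_topology r) U \<longleftrightarrow> scott_open r U"
proof -
  have "scott_open r (U \<inter> V)" if U: "scott_open r U" and V: "scott_open r V" for U V
    unfolding scott_open_def
  proof (intro conjI allI impI)
    show "U \<inter> V \<subseteq> Field r" using U by (auto simp: scott_open_def)
    show "y \<in> U \<inter> V" if "x \<in> U \<inter> V \<and> (x, y) \<in> r" for x y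
      using that U V unfolding scott_open_def by blast
    fix A x assume A: "directed_in r A \<and> is_lub_in r A x \<and> x \<in> U \<inter> V"
    then obtain a b where ab: "a \<in> A" "a \<in> U" "b \<in> A" "b \<in> V"
      using U V unfolding scott_open_def by blast
    moreover obtain c where "c \<in> A" "(a, c) \<in> r" "(b, c) \<in> r"
      using A ab unfolding directed_in_def by blast
    ultimately show "A \<inter> (U \<inter> V) \<noteq> {}"
      using U V unfolding scott_open_def by blast
  qed
  moreover have "scott_open r (\<Union>\<K>)" if "\<forall>K\<in>\<K>. scott_open r K" for \<K>
    unfolding scott_open_def
  proof (intro conjI allI impI)
    show "\<Union>\<K> \<subseteq> Field r" using that unfolding scott_open_def by blast
    show "y \<in> \<Union>\<K>" if *: "x \<in> \<Union>\<K> \<and> (x, y) \<in> r" for x y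
      using * \<open>\<forall>K\<in>\<K>. scott_open r K\<close> unfolding scott_open_def by blast
    fix A x assume A: "directed_in r A \<and> is_lub_in r A x \<and> x \<in> \<Union>\<K>"
    then obtain K where "K \<in> \<K>" "x \<in> K" by blast
    then have "A \<inter> K \<noteq> {}" using A that unfolding scott_open_def by blast
    with \<open>K \<in> \<K>\<close> show "A \<inter> \<Union>\<K> \<noteq> {}" by blast
  qed
  ultimately have "istopology (scott_open r)"
    unfolding istopology_def by blast
  then show ?thesis by (simp add: scott_topology_def topology_inverse')
qed

definition fun_space :: "'b hval rel \<Rightarrow> 'b hval rel \<Rightarrow> 'b hval rel" where
  "fun_space r s = {(fun_code (Field r) f, fun_code (Field r) g) | f g.
     continuous_map (scott_topology r) (scott_topology s) f \<and>
     continuous_map (scott_topology r) (scott_topology s) g \<and>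
     (\<forall>x\<in>Field r. (f x, g x) \<in> s)}"

definition maximal_in :: "'a rel \<Rightarrow> 'a \<Rightarrow> bool" where
  "maximal_in r x \<longleftrightarrow> x \<in> Field r \<and> (\<forall>y. (x, y) \<in> r \<longrightarrow> y = x)"


section \<open>Hereditarily total objects\<close>

text \<open>Given the levels \<open>D\<close> of a hierarchy and the partial equivalence \<open>P\<close> at level 0, this is
  the partial equivalence at level \<open>k\<close>.\<close>

primrec tot_eq :: "(nat \<Rightarrow> 'b hval rel) \<Rightarrow> ('b hval \<Rightarrow> 'b hval \<Rightarrow> bool) \<Rightarrow>
    nat \<Rightarrow> 'b hval \<Rightarrow> 'b hval \<Rightarrow> bool" where
  "tot_eq D P 0 x y \<longleftrightarrow> P x y"
| "tot_eq D P (Suc k) f g \<longleftrightarrow> f \<in> Field (D (Suc k)) \<and> g \<in> Field (D (Suc k)) \<and>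
     (\<forall>a b. tot_eq D P k a b \<longrightarrow> P (app f a) (app g b))"

definition total :: "(nat \<Rightarrow> 'b hval \<Rightarrow> 'b hval \<Rightarrow> bool) \<Rightarrow> nat \<Rightarrow> 'b hval set" where
  "total Q k = {x. Q k x x}"

text \<open>The functional over the reals represented by a total object, where \<open>v\<close> gives the real
  represented at level 0. A functional at level \<open>Suc k\<close> is coded by its graph, the set of all pairs
  \<open>(\<rho>\<^sub>k y, \<rho>\<^sub>0 (f y))\<close>, in the type \<open>real hval\<close> shared by all hierarchies.\<close>

primrec rho :: "(nat \<Rightarrow> 'b hval \<Rightarrow> 'b hval \<Rightarrow> bool) \<Rightarrow> ('b hval \<Rightarrow> real) \<Rightarrow>
    nat \<Rightarrow> 'b hval \<Rightarrow> real hval" where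
  "rho Q v 0 x = Base (v x)"
| "rho Q v (Suc k) f = graph_code ((\<lambda>y. (rho Q v k y, Base (v (app f y)))) ` total Q k)"

fun Ct_real :: "(nat \<Rightarrow> 'b hval \<Rightarrow> 'b hval \<Rightarrow> bool) \<Rightarrow> ('b hval \<Rightarrow> real) \<Rightarrow>
    nat \<Rightarrow> real hval set" where
  "Ct_real Q v 0 = range Base"
| "Ct_real Q v (Suc k) = rho Q v (Suc k) ` total Q (Suc k)"


section \<open>The Kleene-Kreisel functionals\<close>

primrec N_dom :: "nat \<Rightarrow> nat option hval rel" where
  "N_dom 0 = {(Base x, Base y) | x y. x = None \<or> x = y}"
| "N_dom (Suc k) = fun_space (N_dom k) {(Base x, Base y) | x y. x = None \<or> x = y}"

definition eqN :: "nat \<Rightarrow> nat option hval \<Rightarrow> nat option hval \<Rightarrow> bool" where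
  "eqN = tot_eq N_dom (\<lambda>x y. \<exists>n. x = Base (Some n) \<and> y = Base (Some n))"

definition quotient_topology :: "'a topology \<Rightarrow> 'a rel \<Rightarrow> 'a set topology" where
  "quotient_topology X R =
     topology (\<lambda>V. V \<subseteq> topspace X // R \<and> openin X {x \<in> topspace X. R `` {x} \<in> V})"

lemma openin_quotient_topology:
  "openin (quotient_topology X R) V \<longleftrightarrow>
     V \<subseteq> topspace X // R \<and> openin X {x \<in> topspace X. R `` {x} \<in> V}"
proof -
  have 1: "{x \<in> topspace X. R `` {x} \<in> S \<inter> T} =
      {x \<in> topspace X. R `` {x} \<in> S} \<inter> {x \<in> topspace X. R `` {x} \<in> T}" for S T
    by blast
  have 2: "{x \<in> topspace X. R `` {x} \<in> \<Union>\<K>} = (\<Union>K\<in>\<K>. {x \<in> topspace X. R `` {x} \<in> K})" for \<K>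
    by blast
  have "istopology (\<lambda>V. V \<subseteq> topspace X // R \<and> openin X {x \<in> topspace X. R `` {x} \<in> V})"
    unfolding istopology_def 1 2 by (auto intro!: openin_Union)
  then show ?thesis by (simp add: quotient_topology_def topology_inverse')
qed

definition Ct_N :: "nat \<Rightarrow> nat option hval set topology" where
  "Ct_N k = quotient_topology (subtopology (scott_topology (N_dom k)) (total eqN k))
     {(x, y). eqN k x y}"


section \<open>The extensional hierarchy over the reals\<close>

definition E_compact :: "real set set" where
  "E_compact = insert UNIV {{p..q} | p q. p \<in> \<rat> \<and> q \<in> \<rat> \<and> p \<le> q}"

text \<open>Ideals with respect to reverse inclusion.\<close>

definition E_ideal :: "real set set \<Rightarrow> bool" where
  "E_ideal I \<longleftrightarrow> I \<subseteq> E_compact \<and> I \<noteq> {} \<and>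
     (\<forall>a\<in>E_compact. \<forall>b\<in>I. b \<subseteq> a \<longrightarrow> a \<in> I) \<and>
     (\<forall>a\<in>I. \<forall>b\<in>I. \<exists>c\<in>I. c \<subseteq> a \<and> c \<subseteq> b)"

definition E_base :: "real set set hval rel" where
  "E_base = {(Base I, Base J) | I J. E_ideal I \<and> E_ideal J \<and> I \<subseteq> J}"

primrec E_dom :: "nat \<Rightarrow> real set set hval rel" where
  "E_dom 0 = E_base"
| "E_dom (Suc k) = fun_space (E_dom k) E_base"

definition eqE :: "nat \<Rightarrow> real set set hval \<Rightarrow> real set set hval \<Rightarrow> bool" where
  "eqE = tot_eq E_dom (\<lambda>a b. a \<in> Field E_base \<and> b \<in> Field E_base \<and>
     (\<exists>x. \<Inter>(base_val a) = {x} \<and> \<Inter>(base_val b) = {x}))"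

definition Ct_E :: "nat \<Rightarrow> real hval set" where
  "Ct_E = Ct_real eqE (\<lambda>a. the_elem (\<Inter>(base_val a)))"


section \<open>The smoothened intensional hierarchy over the reals\<close>

text \<open>A finite or infinite sequence is a partial function on an initial segment of the naturals; its
  term with index 0 is the integer part, and extension of sequences is \<open>map_le\<close>.\<close>

definition S_seq :: "(nat \<Rightarrow> int option) \<Rightarrow> bool" where
  "S_seq s \<longleftrightarrow> (\<forall>n. s (Suc n) \<noteq> None \<longrightarrow> s n \<noteq> None \<and> the (s (Suc n)) \<in> {-1, 0, 1})"

definition S_base :: "(nat \<Rightarrow> int option) hval rel" where
  "S_base = {(Base s, Base t) | s t. S_seq s \<and> S_seq t \<and> s \<subseteq>\<^sub>m t}"

definition S_val :: "(nat \<Rightarrow> int option) hval \<Rightarrow> real" where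
  "S_val x = real_of_int (the (base_val x 0)) +
     (\<Sum>n. real_of_int (the (base_val x (Suc n))) / 2 ^ Suc n)"

definition S_sim_base :: "(nat \<Rightarrow> int option) hval \<Rightarrow> (nat \<Rightarrow> int option) hval \<Rightarrow> bool" where
  "S_sim_base x y \<longleftrightarrow> (\<exists>x' y'. (x, x') \<in> S_base \<and> maximal_in S_base x' \<and>
     (y, y') \<in> S_base \<and> maximal_in S_base y' \<and> S_val x' = S_val y')"

function S_dom :: "nat \<Rightarrow> (nat \<Rightarrow> int option) hval rel"
  and S_sim :: "nat \<Rightarrow> (nat \<Rightarrow> int option) hval \<Rightarrow> (nat \<Rightarrow> int option) hval \<Rightarrow> bool" where
  "S_dom 0 = S_base"
| "S_dom (Suc k) = {(f, g) \<in> fun_space (S_dom k) S_base.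
     \<forall>h\<in>{f, g}. \<forall>x y. S_sim k x y \<longrightarrow> S_sim_base (app h x) (app h y)}"
| "S_sim 0 x y = S_sim_base x y"
| "S_sim (Suc k) f g = (f \<in> Field (S_dom (Suc k)) \<and> g \<in> Field (S_dom (Suc k)) \<and>
     (\<forall>x y. S_sim k x y \<longrightarrow> S_sim_base (app f x) (app g y)))"
  by pat_completeness auto
termination
  by (relation "Wellfounded.measure (\<lambda>c. case c of Inl k \<Rightarrow> 2 * k | Inr (k, _) \<Rightarrow> 2 * k + 1)") auto

definition eqS :: "nat \<Rightarrow> (nat \<Rightarrow> int option) hval \<Rightarrow> (nat \<Rightarrow> int option) hval \<Rightarrow> bool" where
  "eqS = tot_eq S_dom (\<lambda>x y. maximal_in S_base x \<and> maximal_in S_base y \<and> S_sim_base x y)"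

definition Ct_S :: "nat \<Rightarrow> real hval set" where
  "Ct_S = Ct_real eqS S_val"


section \<open>The topology induced by the continuous real functions\<close>

text \<open>For an arbitrary space the preimages need not be closed under unions. They are for
  a hereditarily Lindelof space, see \<open>openin_R_topology\<close>. The spaces \<open>Ct_N k\<close> are such, as
  quotients of subspaces of second countable spaces.\<close>

definition R_topology :: "'a topology \<Rightarrow> 'a topology" where
  "R_topology T = topology (\<lambda>U. \<exists>f W. continuous_map T euclideanreal f \<and> open W \<and>
     U = {x \<in> topspace T. f x \<in> W})"

lemma openin_R_topology:
  assumes "hereditarily Lindelof_space T"
  shows "openin (R_topology T) U \<longleftrightarrow>
    (\<exists>f W. continuous_map T euclideanreal f \<and> open W \<and> U = {x \<in> topspace T. f x \<in> W})"
proof -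
  define P where "P = (\<lambda>U. \<exists>f W. continuous_map T euclideanreal f \<and> open W \<and>
    U = {x \<in> topspace T. f x \<in> W})"
  have P_cozero: "\<exists>g. continuous_map T euclideanreal g \<and> (\<forall>x. 0 \<le> g x \<and> g x \<le> 1) \<and>
      U = {x \<in> topspace T. g x \<noteq> 0}" if "P U" for U
  proof -
    from that obtain f W where f: "continuous_map T euclideanreal f" "open W"
      "U = {x \<in> topspace T. f x \<in> W}" unfolding P_def by blast
    define h where "h = (\<lambda>y::real. if W = UNIV then 1 else min 1 (infdist y (- W)))"
    have "continuous_on UNIV h" unfolding h_def by (cases "W = UNIV") (simp_all add: continuous_on_infdist continuous_on_min)
    then have "continuous_map T euclideanreal (h \<circ> f)"
      using f(1) by (auto intro: continuous_map_compose)
    moreover have "h y \<noteq> 0 \<longleftrightarrow> y \<in> W" for y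
    proof (cases "W = UNIV")
      case False
      then have "infdist y (- W) = 0 \<longleftrightarrow> y \<in> - W"
        using in_closed_iff_infdist_zero[of "- W" y] f(2) by (auto simp: closed_def)
      with False show ?thesis by (auto simp: h_def min_def)
    qed (simp add: h_def)
    moreover have "0 \<le> h y \<and> h y \<le> 1" for y by (auto simp: h_def infdist_nonneg)
    ultimately show ?thesis using f(3) by (intro exI[of _ "h \<circ> f"]) auto
  qed
  have cozero_P: "P {x \<in> topspace T. g x \<noteq> 0}" if "continuous_map T euclideanreal g" for g
    unfolding P_def using that by (intro exI[of _ g] exI[of _ "- {0}"]) auto
  have P_openin: "openin T U" if "P U" for U
    using that openin_continuous_map_preimage unfolding P_def by fastforce
  have "P (U \<inter> V)" if U: "P U" and V: "P V" for U V
  proof -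
    obtain f g where "continuous_map T euclideanreal f" "U = {x \<in> topspace T. f x \<noteq> 0}"
      "continuous_map T euclideanreal g" "V = {x \<in> topspace T. g x \<noteq> 0}"
      using P_cozero[OF U] P_cozero[OF V] by blast
    moreover from this have "P {x \<in> topspace T. f x * g x \<noteq> 0}"
      by (intro cozero_P continuous_map_real_mult)
    moreover have "{x \<in> topspace T. f x * g x \<noteq> 0} =
        {x \<in> topspace T. f x \<noteq> 0} \<inter> {x \<in> topspace T. g x \<noteq> 0}" by auto
    ultimately show ?thesis by simp
  qed
  moreover have "P (\<Union>\<K>)" if \<K>: "\<forall>K\<in>\<K>. P K" for \<K>
  proof -
    have "Lindelof_space (subtopology T (\<Union>\<K>))"
      using assms by (simp add: hereditarily)
    then obtain \<V> where \<V>: "countable \<V>" "\<V> \<subseteq> \<K>" "topspace T \<inter> \<Union>\<K> \<subseteq> \<Union>\<V>"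
      using \<K> P_openin unfolding Lindelof_space_subtopology by (metis inf_le2)
    have "\<Union>\<K> \<subseteq> topspace T"
      using \<K> P_openin openin_subset by blast
    with \<V> have eq: "\<Union>\<K> = \<Union>\<V>" by blast
    have P_empty: "P {}" using cozero_P[of "\<lambda>_. 0"] by simp
    define V where "V = from_nat_into (insert {} \<V>)"
    have rV: "range V = insert {} \<V>"
      unfolding V_def using \<V>(1) by (intro range_from_nat_into) auto
    have PV: "P (V i)" for i
    proof -
      have "V i \<in> insert {} \<V>" using rangeI[of V i] unfolding rV .
      then consider "V i = {}" | "V i \<in> \<K>" using \<V>(2) by (metis insertE subsetD)
      then show ?thesis using \<K> P_empty by cases simp_all
    qed
    have "\<forall>i. \<exists>g. continuous_map T euclideanreal g \<and> (\<forall>x. 0 \<le> g x \<and> g x \<le> 1) \<and>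
        V i = {x \<in> topspace T. g x \<noteq> 0}"
      using P_cozero[OF PV] by blast
    from choice[OF this] obtain g where g: "\<And>i. continuous_map T euclideanreal (g i)"
      "\<And>i x. 0 \<le> g i x \<and> g i x \<le> (1::real)" "\<And>i. V i = {x \<in> topspace T. g i x \<noteq> 0}"
      by blast
    define G where "G = (\<lambda>x. \<Sum>i. (1/2)^i * g i x)"
    have bd: "norm ((1/2)^i * g i x) \<le> (1/2)^i" for i x
      using g(2)[of i x] by (auto simp: abs_mult mult_le_cancel_left1)
    have geo: "summable (\<lambda>i. (1/2::real)^i)" by (rule summable_geometric) simp
    have summ: "summable (\<lambda>i. (1/2)^i * g i x)" for x
      by (rule summable_comparison_test'[OF geo, of 0]) (use bd in auto)
    have ul: "uniform_limit (topspace T) (\<lambda>n x. \<Sum>i<n. (1/2)^i * g i x) G sequentially"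
      unfolding G_def by (rule Weierstrass_m_test[OF _ geo]) (use bd in auto)
    have "continuous_map T Met_TC.mtopology G"
    proof (rule Met_TC.continuous_map_uniform_limit[where F = sequentially])
      show "\<forall>\<^sub>F n in sequentially. continuous_map T Met_TC.mtopology (\<lambda>x. \<Sum>i<n. (1/2)^i * g i x)"
        using g(1) by (auto intro!: always_eventually continuous_map_sum continuous_map_real_mult)
      show "\<forall>\<^sub>F n in sequentially. \<forall>x\<in>topspace T. G x \<in> UNIV \<and> dist (\<Sum>i<n. (1/2)^i * g i x) (G x) < e"
        if "e > 0" for e
        using ul that by (auto simp: uniform_limit_iff)
    qed simp
    then have "P {x \<in> topspace T. G x \<noteq> 0}" by (intro cozero_P) simp
    moreover have "G x \<noteq> 0 \<longleftrightarrow> (\<exists>i. g i x \<noteq> 0)" for x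
    proof -
      have "0 \<le> (1/2)^i * g i x" for i using g(2)[of i x] by simp
      then show ?thesis unfolding G_def using suminf_eq_zero_iff[OF summ[of x]] by simp
    qed
    then have "{x \<in> topspace T. G x \<noteq> 0} = (\<Union>i. V i)" unfolding g(3) by blast
    moreover have "(\<Union>i. V i) = \<Union>\<K>" using rV eq by simp
    ultimately show ?thesis by simp
  qed
  ultimately have "istopology P" unfolding istopology_def by blast
  then have "openin (topology P) U \<longleftrightarrow> P U" by (simp add: topology_inverse')
  then show ?thesis by (simp add: R_topology_def P_def)
qed

definition zero_dimensional :: "'a topology \<Rightarrow> bool" where
  "zero_dimensional X \<longleftrightarrow>
     (\<exists>\<B>. (\<forall>B\<in>\<B>. openin X B \<and> closedin X B) \<and> openin X = arbitrary union_of (\<lambda>B. B \<in> \<B>))"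

end

theory Submission
  imports Defs
begin

text \<open>Both hierarchies contain the Kleene-Kreisel functionals: a total \<open>x\<close> of type \<open>k + 1\<close> over the
  natural numbers is extended to real arguments \<open>y\<close> by rounding \<open>y\<close>, as far as its values at sampled
  arguments are close to natural numbers, to functionals over the natural numbers, and interpolating
  between the values of \<open>x\<close> at these. The interpolated value depends only on the functional \<open>y\<close>, so that
  by induction on the type both hierarchies represent the same real functional at \<open>x\<close>, provided they
  agree on the types below.

  In the extensional hierarchy the same interpolation extends every continuous \<open>f\<close> on \<open>Ct_N n\<close> to a
  functional of type \<open>n + 1\<close>. If the two hierarchies agree at type \<open>n + 1\<close>, they agree below, and this
  functional has a realizer in the intensional hierarchy, which sends representatives of elements of
  \<open>Ct_N n\<close> continuously to total digit sequences for the values of \<open>f\<close>. Two representatives of the same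
  element have a total lower bound, and total digit sequences are maximal. So the digit sequence depends
  only on the element, and the sets where its first digits are prescribed are clopen.\<close>

section \<open>Domains as limits of finite deflations\<close>

text \<open>The obstacle is that an emitted digit can never be revised, while a realizer sees its
  argument only through finite approximations. An interval for an interpolated value can simply be
  shrunk, so extensionally arbitrary enclosures of the values of \<open>f\<close> will do.
  Intensionally, a digit may be emitted only if further knowledge of the values being interpolated
  would lead to the same digit. The construction below achieves this when each value is unknown or a
  natural number: enough for the embeddings, whereas the realizer for a real-valued \<open>f\<close>
  comes from the assumed equality. The embeddings must also respect the consistency relation of the
  smoothened hierarchy, so roundings of consistent arguments have to be bounded above. Closeness to
  natural numbers is tested at finitely many total arguments per stage, with a strictness growing
  with the stage; hence the interpolation is a finite sum unless the argument is exactly natural at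
  all samples. The constants leave margins: weights vanish from 1/8 on, rounding works below 1/4,
  and truncated digit sequences err by at most 1/16.\<close>

lemma scott_open_field: "scott_open r U \<Longrightarrow> x \<in> U \<Longrightarrow> x \<in> Field r"
  unfolding scott_open_def by blast

lemma scott_open_up: "scott_open r U \<Longrightarrow> x \<in> U \<Longrightarrow> (x, y) \<in> r \<Longrightarrow> y \<in> U"
  unfolding scott_open_def by blast

lemma scott_open_lub:
  "scott_open r U \<Longrightarrow> directed_in r A \<Longrightarrow> is_lub_in r A x \<Longrightarrow> x \<in> U \<Longrightarrow> A \<inter> U \<noteq> {}"
  unfolding scott_open_def by blast

text \<open>Bounded-complete omega-algebraic domains carry this structure, with \<open>p i x\<close>
  the join of those among the first \<open>i\<close> compact elements that lie below
  \<open>x\<close>. \<open>p_att\<close> combines continuity of \<open>p i\<close> with the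
  finiteness of its range: the value at a least upper bound is attained inside the directed set.
  With maps in place of compact elements, function spaces are handled by composition.\<close>

locale sfp =
  fixes r :: "'a rel" and p :: "nat \<Rightarrow> 'a \<Rightarrow> 'a"
  assumes ord_refl: "x \<in> Field r \<Longrightarrow> (x, x) \<in> r"
    and ord_trans: "(x, y) \<in> r \<Longrightarrow> (y, z) \<in> r \<Longrightarrow> (x, z) \<in> r"
    and ord_antisym: "(x, y) \<in> r \<Longrightarrow> (y, x) \<in> r \<Longrightarrow> x = y"
    and nonempty: "Field r \<noteq> {}"
    and has_lub: "directed_in r A \<Longrightarrow> \<exists>x. is_lub_in r A x"
    and p_le: "x \<in> Field r \<Longrightarrow> (p i x, x) \<in> r"
    and p_mono: "(x, y) \<in> r \<Longrightarrow> (p i x, p i y) \<in> r"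
    and p_chain: "x \<in> Field r \<Longrightarrow> i \<le> j \<Longrightarrow> (p i x, p j x) \<in> r"
    and p_fin: "finite (p i ` Field r)"
    and p_lub: "x \<in> Field r \<Longrightarrow> y \<in> Field r \<Longrightarrow> (\<And>i. (p i x, y) \<in> r) \<Longrightarrow> (x, y) \<in> r"
    and p_att: "directed_in r A \<Longrightarrow> is_lub_in r A x \<Longrightarrow> \<exists>a\<in>A. p i x = p i a"
begin

lemma p_field: "x \<in> Field r \<Longrightarrow> p i x \<in> Field r"
  using p_le by (meson FieldI1)

lemma directed_p: "x \<in> Field r \<Longrightarrow> directed_in r (range (\<lambda>i. p i x))"
  unfolding directed_in_def
proof (intro conjI ballI)
  assume x: "x \<in> Field r"
  then show "range (\<lambda>i. p i x) \<subseteq> Field r" using p_field by auto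
  fix a b assume "a \<in> range (\<lambda>i. p i x)" "b \<in> range (\<lambda>i. p i x)"
  then obtain i j where "a = p i x" "b = p j x" by auto
  then show "\<exists>z\<in>range (\<lambda>i. p i x). (a, z) \<in> r \<and> (b, z) \<in> r"
    using p_chain[OF x, of i "max i j"] p_chain[OF x, of j "max i j"] by auto
qed auto

lemma lub_p: "x \<in> Field r \<Longrightarrow> is_lub_in r (range (\<lambda>i. p i x)) x"
  unfolding is_lub_in_def using p_le p_lub by auto

lemma lub_unique: "is_lub_in r A x \<Longrightarrow> is_lub_in r A y \<Longrightarrow> x = y"
  unfolding is_lub_in_def using ord_antisym by blast

text \<open>The chain of all \<open>p j x\<close> has least upper bound \<open>x\<close>, so
  \<open>p_att\<close> gives one such \<open>j\<close>; monotonicity and antisymmetry then admit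
  every larger index.\<close>

lemma p_p_att: "x \<in> Field r \<Longrightarrow> \<exists>j\<ge>n. p i x = p i (p j x)"
proof -
  assume x: "x \<in> Field r"
  obtain j where j: "p i x = p i (p j x)"
    using p_att[OF directed_p[OF x] lub_p[OF x]] by auto
  have "(p i (p j x), p i (p (max n j) x)) \<in> r" "(p i (p (max n j) x), p i x) \<in> r"
    using x by (auto intro!: p_mono p_chain p_le)
  then have "p i x = p i (p (max n j) x)" using j ord_antisym by metis
  then show ?thesis by (intro exI[of _ "max n j"]) auto
qed

end

lemma finite_directed_bound:
  assumes A: "directed_in r A" and tr: "\<And>x y z. (x, y) \<in> r \<Longrightarrow> (y, z) \<in> r \<Longrightarrow> (x, z) \<in> r"
    and "finite F" "F \<subseteq> A"
  shows "\<exists>z\<in>A. \<forall>x\<in>F. (x, z) \<in> r"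
  using assms(3,4)
proof (induction F rule: finite_induct)
  case empty
  then show ?case using A by (auto simp: directed_in_def)
next
  case (insert x F)
  then obtain z where z: "z \<in> A" "\<forall>x\<in>F. (x, z) \<in> r" by auto
  then obtain w where "w \<in> A" "(x, w) \<in> r" "(z, w) \<in> r"
    using A insert.prems unfolding directed_in_def by (meson insert_subset)
  then show ?case using z(2) tr by (intro bexI[of _ w]) auto
qed

text \<open>Expansions in base 3 with digits 0 and 1: beyond the first place where two sets differ,
  all later digits together weigh at most half of that place.\<close>

lemma nat_set_inj_real: "\<exists>g :: nat set \<Rightarrow> real. inj g"
proof -
  define h :: "nat set \<Rightarrow> nat \<Rightarrow> real" where "h S n = (if n \<in> S then (1/3) ^ n else 0)" for S n
  have geo: "summable (\<lambda>n. (1/3::real) ^ n)" by (rule summable_geometric) simp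
  have sm: "summable (h S)" for S
    by (rule summable_comparison_test'[OF geo, of 0]) (auto simp: h_def)
  have lt: "suminf (h S) < suminf (h T)"
    if n: "n \<in> T" "n \<notin> S" and below: "\<forall>m<n. m \<in> S \<longleftrightarrow> m \<in> T" for S T n
  proof -
    have "suminf (h S) = (\<Sum>i. h S (i + Suc n)) + (\<Sum>i<Suc n. h S i)"
      using suminf_split_initial_segment[OF sm] .
    also have "(\<Sum>i<Suc n. h S i) = (\<Sum>i<n. h T i)"
      using n below by (auto simp: h_def intro!: sum.cong)
    also have "(\<Sum>i. h S (i + Suc n)) \<le> (\<Sum>i. (1/3) ^ (i + Suc n))"
      by (intro suminf_le summable_ignore_initial_segment sm geo) (simp add: h_def)
    also have "(\<Sum>i. (1/3::real) ^ (i + Suc n)) = (1/3) ^ n / 2"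
      using suminf_mult[OF geo, of "(1/3) ^ Suc n"] suminf_geometric[of "1/3::real"]
      by (simp add: power_add mult.commute)
    finally have "suminf (h S) \<le> (1/3) ^ n / 2 + (\<Sum>i<n. h T i)" by simp
    also have "\<dots> < (1/3) ^ n + (\<Sum>i<n. h T i)" by simp
    also have "\<dots> = (\<Sum>i<Suc n. h T i)" using n by (simp add: h_def)
    also have "\<dots> \<le> suminf (h T)"
      by (intro sum_le_suminf sm) (auto simp: h_def)
    finally show ?thesis .
  qed
  have "inj (\<lambda>S. suminf (h S))"
  proof (rule injI, rule ccontr)
    fix S T assume eq: "suminf (h S) = suminf (h T)" and "S \<noteq> T"
    then have "\<exists>n. (n \<in> S) \<noteq> (n \<in> T)" by blast
    then obtain n where n: "(n \<in> S) \<noteq> (n \<in> T)" "\<forall>m<n. (m \<in> S) = (m \<in> T)"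
      using exists_least_iff[of "\<lambda>n. (n \<in> S) \<noteq> (n \<in> T)"] by blast
    then show False using lt[of n T S] lt[of n S T] eq by (cases "n \<in> S") auto
  qed
  then show ?thesis by blast
qed

section \<open>Cardinality and countable bases of domains\<close>

context sfp
begin

lemma countable_p_range: "countable (\<Union>i. p i ` Field r)"
  using p_fin by (auto intro: countable_finite)

text \<open>An element is the least upper bound of its approximations, which lie in a countable set,
  so a set of naturals codes it. This injection makes the codes of functions faithful.\<close>

lemma inj_real: "\<exists>c :: 'a \<Rightarrow> real. inj_on c (Field r)"
proof -
  define C where "C = (\<Union>i. p i ` Field r)"
  define d where "d x = to_nat_on C ` {p i x | i. True}" for x
  have "inj_on d (Field r)"
  proof (rule inj_onI)
    fix x y assume x: "x \<in> Field r" and y: "y \<in> Field r" and eq: "d x = d y"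
    have sub: "{p i z | i. True} \<subseteq> C" if "z \<in> Field r" for z
      using that by (auto simp: C_def)
    have "inj_on (to_nat_on C) C" unfolding C_def by (rule inj_on_to_nat_on[OF countable_p_range])
    then have "{p i x | i. True} = {p i y | i. True}"
      using eq sub[OF x] sub[OF y] unfolding d_def by (metis inj_on_image_eq_iff)
    then have "range (\<lambda>i. p i x) = range (\<lambda>i. p i y)" by (simp add: full_SetCompr_eq)
    then show "x = y" using lub_p[OF x] lub_p[OF y] lub_unique by simp
  qed
  moreover obtain g :: "nat set \<Rightarrow> real" where "inj g" using nat_set_inj_real by blast
  ultimately have "inj_on (g \<circ> d) (Field r)"
    by (simp add: comp_inj_on inj_on_subset)
  then show ?thesis by blast
qed

text \<open>Here \<open>c\<close> is arbitrary: openness comes from \<open>p_att\<close>, which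
  finds \<open>p i x\<close> already inside a directed set. For \<open>c\<close> in the ranges of
  the \<open>p i\<close>, these sets form a countable base.\<close>

lemma scott_open_above_p:
  assumes "c \<in> Field r"
  shows "scott_open r {y \<in> Field r. (c, p i y) \<in> r}"
  unfolding scott_open_def
proof (intro conjI allI impI)
  fix x y assume "x \<in> {y \<in> Field r. (c, p i y) \<in> r} \<and> (x, y) \<in> r"
  then have "(c, p i x) \<in> r" "(p i x, p i y) \<in> r" "y \<in> Field r"
    using p_mono by (auto intro: FieldI2)
  then show "y \<in> {y \<in> Field r. (c, p i y) \<in> r}"
    by (auto intro: ord_trans)
next
  fix A x
  assume A: "directed_in r A \<and> is_lub_in r A x \<and> x \<in> {y \<in> Field r. (c, p i y) \<in> r}"
  then obtain a where a: "a \<in> A" "p i x = p i a" using p_att by metis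
  then have "a \<in> {y \<in> Field r. (c, p i y) \<in> r}"
    using A by (auto simp: directed_in_def)
  with a show "A \<inter> {y \<in> Field r. (c, p i y) \<in> r} \<noteq> {}" by blast
qed auto

lemma topspace_scott [simp]: "topspace (scott_topology r) = Field r"
proof -
  have "scott_open r (Field r)"
    unfolding scott_open_def directed_in_def by (fastforce intro: FieldI2)
  then show ?thesis
    unfolding topspace_def openin_scott_topology
    by (intro antisym Union_upper Union_least) (simp_all add: scott_open_def)
qed

lemma scott_open_p:
  assumes "scott_open r U" "x \<in> U"
  shows "\<exists>i. p i x \<in> U"
proof -
  have x: "x \<in> Field r" using assms scott_open_field by metis
  show ?thesis
    using scott_open_lub[OF assms(1) directed_p[OF x] lub_p[OF x] assms(2)] by auto
qed

lemma second_countable_scott: "second_countable (scott_topology r)"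
  unfolding second_countable_def openin_scott_topology
proof (intro exI conjI)
  define C where "C = (\<Union>i. p i ` Field r)"
  define \<B> where "\<B> = (\<lambda>(c, i). {y \<in> Field r. (c, p i y) \<in> r}) ` (C \<times> UNIV)"
  show "countable \<B>" using countable_p_range by (auto simp: \<B>_def C_def)
  have "C \<subseteq> Field r" using p_field by (auto simp: C_def)
  then show "\<forall>V\<in>\<B>. scott_open r V"
    by (auto simp: \<B>_def intro!: scott_open_above_p)
  show "\<forall>U x. scott_open r U \<and> x \<in> U \<longrightarrow> (\<exists>V\<in>\<B>. x \<in> V \<and> V \<subseteq> U)"
  proof (intro allI impI)
    fix U x assume U: "scott_open r U \<and> x \<in> U"
    then have x: "x \<in> Field r" using scott_open_field by metis
    obtain i where i: "p i x \<in> U" using scott_open_p[of U x] U by blast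
    let ?V = "{y \<in> Field r. (p i x, p i y) \<in> r}"
    have "?V \<in> \<B>"
      unfolding \<B>_def C_def using x by (intro image_eqI[of _ _ "(p i x, i)"]) auto
    moreover have "x \<in> ?V" using x ord_refl[OF p_field[OF x]] by simp
    moreover have "?V \<subseteq> U"
    proof
      fix y assume "y \<in> ?V"
      then have "(p i x, p i y) \<in> r" "(p i y, y) \<in> r" using p_le by auto
      then have "(p i x, y) \<in> r" by (rule ord_trans)
      then show "y \<in> U" using scott_open_up[OF conjunct1[OF U] i] by simp
    qed
    ultimately show "\<exists>V\<in>\<B>. x \<in> V \<and> V \<subseteq> U" by (intro bexI[of _ ?V]) simp_all
  qed
qed

end

text \<open>Scott continuity in epsilon-delta form: each approximation of \<open>f x\<close> is
  reached at some approximation of \<open>x\<close>. Later verifications can thus avoid directed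
  sets.\<close>

definition cnt :: "'a rel \<Rightarrow> (nat \<Rightarrow> 'a \<Rightarrow> 'a) \<Rightarrow> 'b rel \<Rightarrow> (nat \<Rightarrow> 'b \<Rightarrow> 'b) \<Rightarrow> ('a \<Rightarrow> 'b) \<Rightarrow> bool" where
  "cnt r p s q f \<longleftrightarrow> (\<forall>x y. (x, y) \<in> r \<longrightarrow> (f x, f y) \<in> s) \<and>
     (\<forall>x\<in>Field r. \<forall>i. \<exists>j. (q i (f x), f (p j x)) \<in> s)"

lemma cnt_mono: "cnt r p s q f \<Longrightarrow> (x, y) \<in> r \<Longrightarrow> (f x, f y) \<in> s"
  by (auto simp: cnt_def)

lemma cnt_approx: "cnt r p s q f \<Longrightarrow> x \<in> Field r \<Longrightarrow> \<exists>j. (q i (f x), f (p j x)) \<in> s"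
  by (auto simp: cnt_def)

lemma cnt_field: "cnt r p s q f \<Longrightarrow> sfp r p \<Longrightarrow> x \<in> Field r \<Longrightarrow> f x \<in> Field s"
  using cnt_mono sfp.ord_refl by (metis FieldI1)

lemma directed_image:
  assumes A: "directed_in r A" and mono: "\<And>x y. (x, y) \<in> r \<Longrightarrow> (f x, f y) \<in> s"
    and fl: "\<And>x. x \<in> Field r \<Longrightarrow> f x \<in> Field s"
  shows "directed_in s (f ` A)"
  unfolding directed_in_def
proof (intro conjI ballI)
  show "f ` A \<subseteq> Field s" "f ` A \<noteq> {}" using A fl by (auto simp: directed_in_def)
  fix u v assume "u \<in> f ` A" "v \<in> f ` A"
  then obtain x y where xy: "x \<in> A" "u = f x" "y \<in> A" "v = f y" by blast
  then obtain z where "z \<in> A" "(x, z) \<in> r" "(y, z) \<in> r"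
    using A unfolding directed_in_def by meson
  then show "\<exists>z\<in>f ` A. (u, z) \<in> s \<and> (v, z) \<in> s" using xy mono by blast
qed

text \<open>An approximation of \<open>f x\<close> lies below some \<open>f (p j x)\<close>, and
  \<open>p j x\<close> equals \<open>p j a\<close> for a member \<open>a\<close> of the directed
  set, so it lies below \<open>f a\<close>.\<close>

lemma cnt_lub:
  assumes f: "cnt r p s q f" and r: "sfp r p" and s: "sfp s q"
    and A: "directed_in r A" "is_lub_in r A x"
  shows "is_lub_in s (f ` A) (f x)"
  unfolding is_lub_in_def
proof (intro conjI ballI impI)
  have x: "x \<in> Field r" using A by (auto simp: is_lub_in_def)
  then show "f x \<in> Field s" using cnt_field f r by metis
  show "(b, f x) \<in> s" if "b \<in> f ` A" for b
    using that A cnt_mono[OF f] by (auto simp: is_lub_in_def)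
  fix z assume z: "z \<in> Field s" "\<forall>b\<in>f ` A. (b, z) \<in> s"
  show "(f x, z) \<in> s"
  proof (rule sfp.p_lub[OF s])
    fix i
    obtain j where j: "(q i (f x), f (p j x)) \<in> s" using cnt_approx[OF f x] by blast
    obtain a where a: "a \<in> A" "p j x = p j a" using sfp.p_att[OF r A] by blast
    have "a \<in> Field r" using a A by (auto simp: directed_in_def)
    then have "(f (p j a), f a) \<in> s" using sfp.p_le[OF r] cnt_mono[OF f] by blast
    then show "(q i (f x), z) \<in> s" using j a z sfp.ord_trans[OF s] by (metis imageI)
  qed (use x z cnt_field f r in metis)+
qed

text \<open>Continuity with equality instead of order: \<open>f x\<close> is the least upper bound
  of the images of the approximations of \<open>x\<close>, so \<open>p_att\<close> of the target
  applies.\<close>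

lemma cnt_att:
  assumes f: "cnt r p s q f" and r: "sfp r p" and s: "sfp s q" and x: "x \<in> Field r"
  shows "\<exists>j\<ge>n. q i (f x) = q i (f (p j x))"
proof -
  have fl: "f x \<in> Field s" if "x \<in> Field r" for x using that cnt_field f r by metis
  have "directed_in s (f ` range (\<lambda>j. p j x))"
    by (rule directed_image[OF sfp.directed_p[OF r x]]) (use cnt_mono f fl in auto)
  moreover have "is_lub_in s (f ` range (\<lambda>j. p j x)) (f x)"
    using cnt_lub[OF f r s sfp.directed_p[OF r x] sfp.lub_p[OF r x]] .
  ultimately obtain j where j: "q i (f x) = q i (f (p j x))"
    using sfp.p_att[OF s] by blast
  have "(q i (f (p j x)), q i (f (p (max n j) x))) \<in> s" "(q i (f (p (max n j) x)), q i (f x)) \<in> s"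
    using sfp.p_chain[OF r x, of j "max n j"] sfp.p_le[OF r x] cnt_mono[OF f] sfp.p_mono[OF s]
    by auto
  then have "q i (f x) = q i (f (p (max n j) x))" using j sfp.ord_antisym[OF s] by metis
  then show ?thesis by (intro exI[of _ "max n j"]) auto
qed

lemma cnt_iff_continuous_map:
  assumes r: "sfp r p" and s: "sfp s q"
  shows "continuous_map (scott_topology r) (scott_topology s) f \<longleftrightarrow> cnt r p s q f"
proof
  assume f: "continuous_map (scott_topology r) (scott_topology s) f"
  have fl: "f x \<in> Field s" if "x \<in> Field r" for x
    using that f continuous_map_image_subset_topspace[OF f] r s by (auto simp: sfp.topspace_scott)
  have pre: "scott_open r {x \<in> Field r. f x \<in> U}" if "scott_open s U" for U
    using openin_continuous_map_preimage[OF f, of U] that r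
    by (simp add: openin_scott_topology sfp.topspace_scott)
  \<comment> \<open>Complements of principal lower sets are open and detect the order, which forces
    a continuous map to be monotone.\<close>
  have notbelow: "scott_open s {z \<in> Field s. (z, w) \<notin> s}" for w
    unfolding scott_open_def
  proof (intro conjI allI impI)
    fix x y assume "x \<in> {z \<in> Field s. (z, w) \<notin> s} \<and> (x, y) \<in> s"
    then show "y \<in> {z \<in> Field s. (z, w) \<notin> s}"
      using sfp.ord_trans[OF s] by (blast intro: FieldI2)
  next
    fix A x assume A: "directed_in s A \<and> is_lub_in s A x \<and> x \<in> {z \<in> Field s. (z, w) \<notin> s}"
    show "A \<inter> {z \<in> Field s. (z, w) \<notin> s} \<noteq> {}"
    proof
      assume "A \<inter> {z \<in> Field s. (z, w) \<notin> s} = {}"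
      then have "\<forall>a\<in>A. (a, w) \<in> s" using A by (auto simp: directed_in_def)
      moreover then have "w \<in> Field s" using A unfolding directed_in_def by (blast intro: FieldI2)
      ultimately show False using A by (auto simp: is_lub_in_def)
    qed
  qed auto
  have mono: "(f x, f y) \<in> s" if "(x, y) \<in> r" for x y
  proof (rule ccontr)
    assume "(f x, f y) \<notin> s"
    then have "x \<in> {x \<in> Field r. f x \<in> {z \<in> Field s. (z, f y) \<notin> s}}"
      using that fl by (auto intro: FieldI1)
    then have "y \<in> {x \<in> Field r. f x \<in> {z \<in> Field s. (z, f y) \<notin> s}}"
      using pre[OF notbelow[of "f y"]] that unfolding scott_open_def by blast
    then show False using sfp.ord_refl[OF s] by auto
  qed
  show "cnt r p s q f"
    unfolding cnt_def
  proof (intro conjI allI impI ballI mono)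
    fix x i assume x: "x \<in> Field r"
    have c: "q i (f x) \<in> Field s" using sfp.p_field[OF s] fl x by blast
    have "scott_open r {y \<in> Field r. f y \<in> {y \<in> Field s. (q i (f x), q i y) \<in> s}}"
      by (intro pre sfp.scott_open_above_p[OF s] c)
    moreover have "x \<in> {y \<in> Field r. f y \<in> {y \<in> Field s. (q i (f x), q i y) \<in> s}}"
      using x fl c sfp.ord_refl[OF s] by auto
    ultimately obtain j where "(q i (f x), q i (f (p j x))) \<in> s" "f (p j x) \<in> Field s"
      using sfp.scott_open_p[OF r] by blast
    then show "\<exists>j. (q i (f x), f (p j x)) \<in> s"
      using sfp.p_le[OF s] sfp.ord_trans[OF s] by blast
  qed
next
  assume f: "cnt r p s q f"
  show "continuous_map (scott_topology r) (scott_topology s) f"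
    unfolding continuous_map_def openin_scott_topology sfp.topspace_scott[OF r] sfp.topspace_scott[OF s]
  proof (intro conjI allI impI)
    show "f \<in> Field r \<rightarrow> Field s" using cnt_field[OF f r] by blast
    fix U assume U: "scott_open s U"
    show "scott_open r {x \<in> Field r. f x \<in> U}"
      unfolding scott_open_def
    proof (intro conjI allI impI)
      fix x y assume "x \<in> {x \<in> Field r. f x \<in> U} \<and> (x, y) \<in> r"
      then show "y \<in> {x \<in> Field r. f x \<in> U}"
        using scott_open_up[OF U] cnt_mono[OF f] by (auto intro: FieldI2)
    next
      fix A x assume A: "directed_in r A \<and> is_lub_in r A x \<and> x \<in> {x \<in> Field r. f x \<in> U}"
      have "directed_in s (f ` A)"
        by (rule directed_image[of r]) (use A cnt_mono[OF f] cnt_field[OF f r] in auto)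
      then have "f ` A \<inter> U \<noteq> {}"
        using scott_open_lub[OF U _ cnt_lub[OF f r s]] A by auto
      then show "A \<inter> {x \<in> Field r. f x \<in> U} \<noteq> {}"
        using A by (auto simp: directed_in_def)
    qed auto
  qed
qed

lemma cnt_compose:
  assumes f: "cnt r p s q f" and g: "cnt s q t o' g" and r: "sfp r p" and s: "sfp s q" and t: "sfp t o'"
  shows "cnt r p t o' (\<lambda>x. g (f x))"
  unfolding cnt_def
proof (intro conjI allI impI ballI)
  show "(g (f x), g (f y)) \<in> t" if "(x, y) \<in> r" for x y
    using that cnt_mono f g by metis
  fix x i assume x: "x \<in> Field r"
  then obtain j where j: "(o' i (g (f x)), g (q j (f x))) \<in> t"
    using cnt_approx[OF g] cnt_field[OF f r] by blast
  obtain k where "(q j (f x), f (p k x)) \<in> s" using cnt_approx[OF f x] by blast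
  then show "\<exists>j. (o' i (g (f x)), g (f (p j x))) \<in> t"
    using j cnt_mono[OF g] sfp.ord_trans[OF t] by blast
qed

lemma cnt_const: "sfp s q \<Longrightarrow> c \<in> Field s \<Longrightarrow> cnt r p s q (\<lambda>_. c)"
  unfolding cnt_def by (auto intro: sfp.ord_refl sfp.p_le)

lemma cnt_p: "sfp r p \<Longrightarrow> cnt r p r p (p i)"
  unfolding cnt_def
proof (intro conjI allI impI ballI)
  fix x j assume r: "sfp r p" and x: "x \<in> Field r"
  obtain k where "p i x = p i (p k x)" using sfp.p_p_att[OF r x] by blast
  then show "\<exists>k. (p j (p i x), p i (p k x)) \<in> r"
    using sfp.p_le[OF r] sfp.p_field[OF r x] by metis
qed (simp add: sfp.p_mono)

lemma cnt_id: "sfp r p \<Longrightarrow> cnt r p r p (\<lambda>x. x)"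
  unfolding cnt_def by (auto intro: sfp.ord_refl sfp.p_field)

section \<open>Function spaces\<close>

lemma app_code: "sfp r p \<Longrightarrow> x \<in> Field r \<Longrightarrow> app (fun_code (Field r) f) x = f x"
  using sfp.inj_real app_fun_code by metis

lemma code_eq_iff:
  "sfp r p \<Longrightarrow> fun_code (Field r) f = fun_code (Field r) g \<longleftrightarrow> (\<forall>x\<in>Field r. f x = g x)"
  using sfp.inj_real[of r p] sfp.nonempty[of r p] by (metis fun_code_eq_iff)

lemma cnt_cong:
  assumes r: "sfp r p" and eq: "\<And>x. x \<in> Field r \<Longrightarrow> f x = g x"
  shows "cnt r p s q f \<longleftrightarrow> cnt r p s q g"
proof -
  have "(x, y) \<in> r \<Longrightarrow> f x = g x \<and> f y = g y" for x y
    using eq by (auto intro: FieldI1 FieldI2)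
  then show ?thesis
    using eq sfp.p_field[OF r] unfolding cnt_def by (metis (no_types, lifting))
qed

text \<open>The set \<open>T\<close> is \<open>UNIV\<close> for the Kleene-Kreisel and the
  extensional domains and the set of smooth functions for the smoothened ones, so one development
  covers all three.\<close>

definition fs :: "'b hval rel \<Rightarrow> 'b hval rel \<Rightarrow> 'b hval set \<Rightarrow> 'b hval rel" where
  "fs r s T = {(f, g) \<in> fun_space r s. f \<in> T \<and> g \<in> T}"

lemma fs_UNIV [simp]: "fs r s UNIV = fun_space r s"
  by (auto simp: fs_def)

text \<open>The usual deflation of a function space: truncate the argument, apply, truncate the
  value.\<close>

definition fs_p :: "'b hval rel \<Rightarrow> (nat \<Rightarrow> 'b hval \<Rightarrow> 'b hval) \<Rightarrow> (nat \<Rightarrow> 'b hval \<Rightarrow> 'b hval) \<Rightarrow>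
    nat \<Rightarrow> 'b hval \<Rightarrow> 'b hval" where
  "fs_p r p q i f = fun_code (Field r) (\<lambda>x. q i (app f (p i x)))"

locale sfp_pair = r: sfp r p + s: sfp s q
  for r :: "'b hval rel" and p and s :: "'b hval rel" and q
begin

abbreviation code :: "('b hval \<Rightarrow> 'b hval) \<Rightarrow> 'b hval" where
  "code \<equiv> fun_code (Field r)"

lemma app_code': "x \<in> Field r \<Longrightarrow> app (code f) x = f x"
  using app_code r.sfp_axioms by metis

lemma fun_space_iff:
  "(F, G) \<in> fun_space r s \<longleftrightarrow> (\<exists>f g. F = code f \<and> G = code g \<and>
     cnt r p s q f \<and> cnt r p s q g \<and> (\<forall>x\<in>Field r. (f x, g x) \<in> s))"
  unfolding fun_space_def cnt_iff_continuous_map[OF r.sfp_axioms s.sfp_axioms] by blast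

lemma cnt_app_code: "cnt r p s q (app (code f)) \<longleftrightarrow> cnt r p s q f"
  by (rule cnt_cong[OF r.sfp_axioms]) (rule app_code')

lemma code_app_code: "code (app (code f)) = code f"
  using code_eq_iff[OF r.sfp_axioms] app_code' by blast

lemma code_field: "cnt r p s q f \<Longrightarrow> code f \<in> Field (fun_space r s)"
proof -
  assume f: "cnt r p s q f"
  have "(f x, f x) \<in> s" if "x \<in> Field r" for x
    using cnt_mono[OF f r.ord_refl[OF that]] .
  then have "(code f, code f) \<in> fun_space r s" using f fun_space_iff by blast
  then show ?thesis by (rule FieldI1)
qed

lemma field_fun_space_iff:
  "F \<in> Field (fun_space r s) \<longleftrightarrow> F = code (app F) \<and> cnt r p s q (app F)"
proof
  assume "F \<in> Field (fun_space r s)"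
  then obtain f where "F = code f" "cnt r p s q f"
    unfolding Field_def Domain_iff Range_iff Un_iff fun_space_iff by blast
  then show "F = code (app F) \<and> cnt r p s q (app F)"
    by (simp add: code_app_code cnt_app_code)
next
  assume "F = code (app F) \<and> cnt r p s q (app F)"
  then show "F \<in> Field (fun_space r s)" using code_field by metis
qed

lemma fun_space_rel:
  "(F, G) \<in> fun_space r s \<longleftrightarrow> F \<in> Field (fun_space r s) \<and> G \<in> Field (fun_space r s) \<and>
     (\<forall>x\<in>Field r. (app F x, app G x) \<in> s)"
proof
  assume FG: "(F, G) \<in> fun_space r s"
  then obtain f g where "F = code f" "G = code g" "\<forall>x\<in>Field r. (f x, g x) \<in> s"
    using fun_space_iff by blast
  then show "F \<in> Field (fun_space r s) \<and> G \<in> Field (fun_space r s) \<and>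
     (\<forall>x\<in>Field r. (app F x, app G x) \<in> s)"
    using FG by (auto simp: app_code' intro: FieldI1 FieldI2)
next
  assume "F \<in> Field (fun_space r s) \<and> G \<in> Field (fun_space r s) \<and>
     (\<forall>x\<in>Field r. (app F x, app G x) \<in> s)"
  then show "(F, G) \<in> fun_space r s"
    unfolding fun_space_iff field_fun_space_iff by blast
qed

lemma fs_p_app: "x \<in> Field r \<Longrightarrow> app (fs_p r p q i F) x = q i (app F (p i x))"
  by (simp add: fs_p_def app_code')

lemma cnt_fs_p:
  assumes "cnt r p s q f"
  shows "cnt r p s q (\<lambda>x. q i (f (p i x)))"
proof (rule cnt_compose[OF _ cnt_p[OF s.sfp_axioms] r.sfp_axioms s.sfp_axioms s.sfp_axioms])
  show "cnt r p s q (\<lambda>x. f (p i x))"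
    by (rule cnt_compose[OF cnt_p[OF r.sfp_axioms] assms r.sfp_axioms r.sfp_axioms s.sfp_axioms])
qed

lemma fs_p_le:
  assumes "F \<in> Field (fun_space r s)"
  shows "(fs_p r p q i F, F) \<in> fun_space r s"
proof -
  have F: "cnt r p s q (app F)" using assms field_fun_space_iff by blast
  have "(q i (app F (p i x)), app F x) \<in> s" if x: "x \<in> Field r" for x
  proof (rule s.ord_trans)
    show "(q i (app F (p i x)), app F (p i x)) \<in> s"
      using cnt_field[OF F r.sfp_axioms r.p_field[OF x]] by (rule s.p_le)
    show "(app F (p i x), app F x) \<in> s" using cnt_mono[OF F r.p_le[OF x]] .
  qed
  then show ?thesis
    unfolding fun_space_rel using assms cnt_fs_p[OF F]
    by (simp add: fs_p_app) (simp add: fs_p_def code_field)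
qed

end

text \<open>Closure downwards keeps the truncations of a function in \<open>T\<close>;
  \<open>T_lim\<close> says that membership is decided by them. Together they make \<open>T\<close>
  closed under directed least upper bounds.\<close>

locale fun_domain = sfp_pair r p s q
  for r :: "'b hval rel" and p and s :: "'b hval rel" and q +
  fixes T :: "'b hval set"
  assumes T_nonempty: "Field (fun_space r s) \<inter> T \<noteq> {}"
    and T_down: "(G, F) \<in> fun_space r s \<Longrightarrow> F \<in> T \<Longrightarrow> G \<in> T"
    and T_lim: "F \<in> Field (fun_space r s) \<Longrightarrow> (\<And>i. fs_p r p q i F \<in> T) \<Longrightarrow> F \<in> T"
begin

lemma field_fs: "F \<in> Field (fs r s T) \<longleftrightarrow> F \<in> Field (fun_space r s) \<and> F \<in> T"
proof
  assume "F \<in> Field (fs r s T)"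
  then show "F \<in> Field (fun_space r s) \<and> F \<in> T"
    unfolding fs_def Field_def by auto
next
  assume F: "F \<in> Field (fun_space r s) \<and> F \<in> T"
  then have c: "cnt r p s q (app F)" using field_fun_space_iff by blast
  have "(app F x, app F x) \<in> s" if "x \<in> Field r" for x
    using cnt_mono[OF c r.ord_refl[OF that]] .
  then have "(F, F) \<in> fs r s T" using F by (simp add: fs_def fun_space_rel)
  then show "F \<in> Field (fs r s T)" by (rule FieldI1)
qed

lemma fs_rel:
  "(F, G) \<in> fs r s T \<longleftrightarrow> F \<in> Field (fs r s T) \<and> G \<in> Field (fs r s T) \<and>
     (\<forall>x\<in>Field r. (app F x, app G x) \<in> s)"
  unfolding field_fs by (auto simp: fs_def fun_space_rel)

lemma field_cnt: "F \<in> Field (fs r s T) \<Longrightarrow> cnt r p s q (app F)"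
  using field_fs field_fun_space_iff by blast

lemma field_code: "F \<in> Field (fs r s T) \<Longrightarrow> code (app F) = F"
  using field_fs field_fun_space_iff by metis

lemma ext_eq:
  assumes "F \<in> Field (fs r s T)" "G \<in> Field (fs r s T)" "\<And>x. x \<in> Field r \<Longrightarrow> app F x = app G x"
  shows "F = G"
  using assms field_code code_eq_iff[OF r.sfp_axioms] by metis

lemma fs_p_field: "F \<in> Field (fs r s T) \<Longrightarrow> fs_p r p q i F \<in> Field (fs r s T)"
  using fs_p_le T_down by (metis FieldI1 field_fs)

lemma app_field: "F \<in> Field (fs r s T) \<Longrightarrow> x \<in> Field r \<Longrightarrow> app F x \<in> Field s"
  using field_cnt cnt_field r.sfp_axioms by metis

lemma directed_app:
  assumes "directed_in (fs r s T) A" "x \<in> Field r"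
  shows "directed_in s ((\<lambda>F. app F x) ` A)"
proof (rule directed_image[OF assms(1)])
  show "(app F x, app G x) \<in> s" if "(F, G) \<in> fs r s T" for F G
    using that assms(2) unfolding fs_rel by blast
qed (rule app_field[OF _ assms(2)])

lemma fs_trans: "(F, G) \<in> fs r s T \<Longrightarrow> (G, H) \<in> fs r s T \<Longrightarrow> (F, H) \<in> fs r s T"
  unfolding fs_rel using s.ord_trans by metis

lemma fs_antisym: "(F, G) \<in> fs r s T \<Longrightarrow> (G, F) \<in> fs r s T \<Longrightarrow> F = G"
  using ext_eq[of F G] s.ord_antisym unfolding fs_rel by metis

text \<open>The pointwise least upper bound is the right one. It stays in \<open>T\<close> because
  each of its truncations is also the truncation of a single member of \<open>A\<close>.\<close>

lemma lub_exists:
  assumes A: "directed_in (fs r s T) A"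
  shows "\<exists>F. is_lub_in (fs r s T) A F \<and>
    (\<forall>x\<in>Field r. is_lub_in s ((\<lambda>G. app G x) ` A) (app F x))"
proof -
  define h where "h x = (SOME y. is_lub_in s ((\<lambda>G. app G x) ` A) y)" for x
  have h: "is_lub_in s ((\<lambda>G. app G x) ` A) (h x)" if "x \<in> Field r" for x
    unfolding h_def using s.has_lub[OF directed_app[OF A that]] by (rule someI_ex)
  have Af: "G \<in> Field (fs r s T)" if "G \<in> A" for G
    using A that by (auto simp: directed_in_def)
  have hf: "h x \<in> Field s" and ub: "\<And>G. G \<in> A \<Longrightarrow> (app G x, h x) \<in> s"
    and least: "\<And>z. z \<in> Field s \<Longrightarrow> (\<And>G. G \<in> A \<Longrightarrow> (app G x, z) \<in> s) \<Longrightarrow> (h x, z) \<in> s"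
    if "x \<in> Field r" for x
    using h[OF that] by (auto simp: is_lub_in_def)
  have att: "\<exists>G\<in>A. q i (h x) = q i (app G x)" if "x \<in> Field r" for i x
    using s.p_att[OF directed_app[OF A that] h[OF that]] by auto
  have cnt_h: "cnt r p s q h"
    unfolding cnt_def
  proof (intro conjI allI impI ballI)
    fix x y assume xy: "(x, y) \<in> r"
    then have x: "x \<in> Field r" and y: "y \<in> Field r" by (auto intro: FieldI1 FieldI2)
    show "(h x, h y) \<in> s"
    proof (rule least[OF x hf[OF y]])
      fix G assume G: "G \<in> A"
      have "(app G x, app G y) \<in> s" using cnt_mono[OF field_cnt[OF Af[OF G]] xy] .
      then show "(app G x, h y) \<in> s" using ub[OF y G] by (rule s.ord_trans)
    qed
  next
    fix x i assume x: "x \<in> Field r"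
    obtain G where G: "G \<in> A" "q i (h x) = q i (app G x)" using att[OF x] by blast
    obtain j where "(q i (app G x), app G (p j x)) \<in> s"
      using cnt_approx[OF field_cnt[OF Af[OF G(1)]] x] by blast
    then have "(q i (app G x), h (p j x)) \<in> s"
      using ub[OF r.p_field[OF x] G(1)] by (rule s.ord_trans)
    then show "\<exists>j. (q i (h x), h (p j x)) \<in> s" using G by auto
  qed
  have H: "code h \<in> Field (fun_space r s)" using code_field[OF cnt_h] .
  have "code h \<in> T"
  proof (rule T_lim[OF H])
    fix i
    \<comment> \<open>Only the finitely many points in the range of \<open>p i\<close> matter; the
      members of \<open>A\<close> attaining the truncated values there have a common upper bound in
      \<open>A\<close>.\<close>
    have "\<exists>G\<in>A. q i (h c) = q i (app G c)" if "c \<in> p i ` Field r" for c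
      using that att r.p_field by blast
    then obtain g where g: "\<And>c. c \<in> p i ` Field r \<Longrightarrow> g c \<in> A \<and> q i (h c) = q i (app (g c) c)"
      by metis
    have "\<exists>G\<in>A. \<forall>H\<in>g ` p i ` Field r. (H, G) \<in> fs r s T"
      by (rule finite_directed_bound[OF A fs_trans]) (use r.p_fin g in auto)
    then obtain G where G: "G \<in> A" "\<And>c. c \<in> p i ` Field r \<Longrightarrow> (g c, G) \<in> fs r s T"
      by auto
    have "fs_p r p q i (code h) = fs_p r p q i G"
      unfolding fs_p_def code_eq_iff[OF r.sfp_axioms]
    proof
      fix x assume x: "x \<in> Field r"
      let ?c = "p i x"
      have c: "?c \<in> Field r" "?c \<in> p i ` Field r" using x r.p_field by auto
      have "(app (g ?c) ?c, app G ?c) \<in> s" using G(2)[OF c(2)] c(1) fs_rel by blast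
      then have "(q i (h ?c), q i (app G ?c)) \<in> s"
        using s.p_mono g[OF c(2)] by metis
      moreover have "(q i (app G ?c), q i (h ?c)) \<in> s"
        using ub[OF c(1) G(1)] s.p_mono by blast
      ultimately show "q i (app (code h) ?c) = q i (app G ?c)"
        using s.ord_antisym app_code'[OF c(1)] by metis
    qed
    then show "fs_p r p q i (code h) \<in> T"
      using fs_p_field[OF Af[OF G(1)]] field_fs by metis
  qed
  then have Hf: "code h \<in> Field (fs r s T)" using H field_fs by blast
  have "is_lub_in (fs r s T) A (code h)"
    unfolding is_lub_in_def
  proof (intro conjI ballI impI Hf)
    show "(G, code h) \<in> fs r s T" if "G \<in> A" for G
      unfolding fs_rel using Af[OF that] Hf ub[OF _ that] by (simp add: app_code')
    fix F assume F: "F \<in> Field (fs r s T)" "\<forall>G\<in>A. (G, F) \<in> fs r s T"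
    show "(code h, F) \<in> fs r s T"
      unfolding fs_rel
    proof (intro conjI ballI Hf F(1))
      fix x assume x: "x \<in> Field r"
      have "(h x, app F x) \<in> s"
        by (rule least[OF x app_field[OF F(1) x]]) (use F(2) x fs_rel in blast)
      then show "(app (code h) x, app F x) \<in> s" using x by (simp add: app_code')
    qed
  qed
  then show ?thesis using h by (intro exI[of _ "code h"]) (simp add: app_code')
qed

lemma lub_pointwise:
  assumes A: "directed_in (fs r s T) A" and F: "is_lub_in (fs r s T) A F" and x: "x \<in> Field r"
  shows "is_lub_in s ((\<lambda>G. app G x) ` A) (app F x)"
proof -
  obtain H where H: "is_lub_in (fs r s T) A H"
    "is_lub_in s ((\<lambda>G. app G x) ` A) (app H x)"
    using lub_exists[OF A] x by blast
  have "F = H" using F H(1) fs_antisym unfolding is_lub_in_def by meson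
  then show ?thesis using H(2) by simp
qed

lemma cnt_eval:
  assumes x: "x \<in> Field r"
  shows "cnt (fs r s T) (fs_p r p q) s q (\<lambda>F. app F x)"
  unfolding cnt_def
proof (intro conjI allI impI ballI)
  show "(app F x, app G x) \<in> s" if "(F, G) \<in> fs r s T" for F G
    using that x unfolding fs_rel by blast
  fix F i assume F: "F \<in> Field (fs r s T)"
  \<comment> \<open>One index has to truncate both argument and value; \<open>j \<ge> i\<close>
    ensures that \<open>q j\<close> loses no more than \<open>q i\<close>.\<close>
  obtain j where j: "j \<ge> i" "q i (app F x) = q i (app F (p j x))"
    using cnt_att[OF field_cnt[OF F] r.sfp_axioms s.sfp_axioms x] by blast
  have "(q i (app F (p j x)), q j (app F (p j x))) \<in> s"
    using s.p_chain[OF app_field[OF F r.p_field[OF x]] j(1)] .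
  then have "(q i (app F x), app (fs_p r p q j F) x) \<in> s"
    using j(2) fs_p_app[OF x] by simp
  then show "\<exists>j. (q i (app F x), app (fs_p r p q j F) x) \<in> s" by blast
qed

text \<open>Currying: continuity in each variable separately suffices, because a truncation inspects
  the function at finitely many points and the largest of their moduli serves for all.\<close>

lemma cnt_codeI:
  assumes r': "sfp r' p'" and fl: "\<And>x. x \<in> Field r' \<Longrightarrow> code (f x) \<in> Field (fs r s T)"
    and g: "\<And>z. z \<in> Field r \<Longrightarrow> cnt r' p' s q (\<lambda>x. f x z)"
  shows "cnt r' p' (fs r s T) (fs_p r p q) (\<lambda>x. code (f x))"
  unfolding cnt_def
proof (intro conjI allI impI ballI)
  fix x y assume xy: "(x, y) \<in> r'"
  then have x: "x \<in> Field r'" and y: "y \<in> Field r'" by (auto intro: FieldI1 FieldI2)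
  show "(code (f x), code (f y)) \<in> fs r s T"
    unfolding fs_rel using fl[OF x] fl[OF y] cnt_mono[OF g xy] by (simp add: app_code')
next
  fix x i assume x: "x \<in> Field r'"
  define C where "C = p i ` Field r"
  have C: "finite C" "\<And>c. c \<in> C \<Longrightarrow> c \<in> Field r"
    unfolding C_def using r.p_fin r.p_field by auto
  have "\<exists>j. (q i (f x c), f (p' j x) c) \<in> s" if "c \<in> C" for c
    using cnt_approx[OF g[OF C(2)[OF that]] x] .
  then obtain J where J: "\<And>c. c \<in> C \<Longrightarrow> (q i (f x c), f (p' (J c) x) c) \<in> s"
    by metis
  define j where "j = Max (J ` C)"
  have le: "(q i (f x c), f (p' j x) c) \<in> s" if c: "c \<in> C" for c
  proof (rule s.ord_trans[OF J[OF c]])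
    have "J c \<le> j" using c C(1) by (simp add: j_def)
    then show "(f (p' (J c) x) c, f (p' j x) c) \<in> s"
      by (rule cnt_mono[OF g[OF C(2)[OF c]] sfp.p_chain[OF r' x]])
  qed
  have px: "p' j x \<in> Field r'" using sfp.p_field[OF r' x] .
  have "(fs_p r p q i (code (f x)), code (f (p' j x))) \<in> fs r s T"
    unfolding fs_rel
  proof (intro conjI ballI fs_p_field fl x px)
    fix z assume z: "z \<in> Field r"
    have "(app (code (f (p' j x))) (p i z), app (code (f (p' j x))) z) \<in> s"
      using cnt_mono[OF field_cnt[OF fl[OF px]] r.p_le[OF z]] .
    then have "(f (p' j x) (p i z), f (p' j x) z) \<in> s"
      by (simp add: app_code' z r.p_field[OF z])
    moreover have "(q i (f x (p i z)), f (p' j x) (p i z)) \<in> s"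
      by (rule le) (simp add: C_def z)
    ultimately have "(q i (f x (p i z)), f (p' j x) z) \<in> s"
      by (meson s.ord_trans)
    then show "(app (fs_p r p q i (code (f x))) z, app (code (f (p' j x))) z) \<in> s"
      by (simp add: fs_p_app app_code' z r.p_field[OF z])
  qed
  then show "\<exists>j. (fs_p r p q i (code (f x)), code (f (p' j x))) \<in> fs r s T" by blast
qed

lemma sfp_fs: "sfp (fs r s T) (fs_p r p q)"
proof
  fix F assume F: "F \<in> Field (fs r s T)"
  then show "(F, F) \<in> fs r s T" using fs_rel app_field s.ord_refl by blast
  fix i
  show "(fs_p r p q i F, F) \<in> fs r s T"
    using F fs_p_field[OF F] fs_p_le[of F i] unfolding fs_rel field_fs[of F] fun_space_rel by blast
  show "(fs_p r p q i F, fs_p r p q j F) \<in> fs r s T" if "i \<le> j" for j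
    unfolding fs_rel
  proof (intro conjI ballI fs_p_field F)
    fix x assume x: "x \<in> Field r"
    have "(app F (p i x), app F (p j x)) \<in> s"
      using cnt_mono[OF field_cnt[OF F] r.p_chain[OF x that]] .
    then have "(q i (app F (p i x)), q i (app F (p j x))) \<in> s" by (rule s.p_mono)
    moreover have "(q i (app F (p j x)), q j (app F (p j x))) \<in> s"
      using s.p_chain[OF app_field[OF F r.p_field[OF x]] that] .
    ultimately show "(app (fs_p r p q i F) x, app (fs_p r p q j F) x) \<in> s"
      unfolding fs_p_app[OF x] by (rule s.ord_trans)
  qed
next
  show "Field (fs r s T) \<noteq> {}" using T_nonempty field_fs by blast
next
  fix i F G assume "(F, G) \<in> fs r s T"
  then show "(fs_p r p q i F, fs_p r p q i G) \<in> fs r s T"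
    using fs_p_field r.p_field s.p_mono unfolding fs_rel by (simp add: fs_p_app)
next
  fix i
  define X where "X = p i ` Field r"
  define Y where "Y = q i ` Field s"
  have fin: "finite (PiE X (\<lambda>_. Y))"
    unfolding X_def Y_def by (intro finite_PiE r.p_fin s.p_fin)
  \<comment> \<open>A truncated function is determined by a table from the finite range of
    \<open>p i\<close> to the finite range of \<open>q i\<close>.\<close>
  have "fs_p r p q i F \<in> (\<lambda>g. code (\<lambda>x. g (p i x))) ` PiE X (\<lambda>_. Y)" if F: "F \<in> Field (fs r s T)" for F
  proof
    let ?g = "restrict (\<lambda>c. q i (app F c)) X"
    show "fs_p r p q i F = code (\<lambda>x. ?g (p i x))"
      unfolding fs_p_def code_eq_iff[OF r.sfp_axioms] by (simp add: X_def)
    show "?g \<in> PiE X (\<lambda>_. Y)"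
      using app_field[OF F] r.p_field by (auto simp: X_def Y_def)
  qed
  then have "fs_p r p q i ` Field (fs r s T) \<subseteq> (\<lambda>g. code (\<lambda>x. g (p i x))) ` PiE X (\<lambda>_. Y)"
    by blast
  then show "finite (fs_p r p q i ` Field (fs r s T))" using fin finite_surj by blast
next
  fix F G assume F: "F \<in> Field (fs r s T)" and G: "G \<in> Field (fs r s T)"
    and le: "\<And>i. (fs_p r p q i F, G) \<in> fs r s T"
  show "(F, G) \<in> fs r s T"
    unfolding fs_rel
  proof (intro conjI ballI F G)
    fix x assume x: "x \<in> Field r"
    show "(app F x, app G x) \<in> s"
    proof (rule s.p_lub[OF app_field[OF F x] app_field[OF G x]])
      fix i
      obtain j where j: "j \<ge> i" "q i (app F x) = q i (app F (p j x))"
        using cnt_att[OF field_cnt[OF F] r.sfp_axioms s.sfp_axioms x] by blast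
      have "(q i (app F (p j x)), q j (app F (p j x))) \<in> s"
        using s.p_chain[OF app_field[OF F r.p_field[OF x]] j(1)] .
      moreover have "(q j (app F (p j x)), app G x) \<in> s"
        using le[of j] x fs_rel fs_p_app[OF x] by metis
      ultimately show "(q i (app F x), app G x) \<in> s"
        unfolding j(2) by (rule s.ord_trans)
    qed
  qed
next
  fix A F i assume A: "directed_in (fs r s T) A" and F: "is_lub_in (fs r s T) A F"
  have "\<exists>G\<in>A. q i (app F c) = q i (app G c)" if "c \<in> p i ` Field r" for c
  proof -
    have c: "c \<in> Field r" using that r.p_field by blast
    show ?thesis
      using s.p_att[OF directed_app[OF A c] lub_pointwise[OF A F c]] by auto
  qed
  then obtain g where g: "\<And>c. c \<in> p i ` Field r \<Longrightarrow> g c \<in> A \<and> q i (app F c) = q i (app (g c) c)"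
    by metis
  have "\<exists>G\<in>A. \<forall>H\<in>g ` p i ` Field r. (H, G) \<in> fs r s T"
    by (rule finite_directed_bound[OF A fs_trans]) (use r.p_fin g in auto)
  then obtain G where G: "G \<in> A" "\<And>c. c \<in> p i ` Field r \<Longrightarrow> (g c, G) \<in> fs r s T"
    by auto
  have "fs_p r p q i F = fs_p r p q i G"
    unfolding fs_p_def code_eq_iff[OF r.sfp_axioms]
  proof
    fix x assume x: "x \<in> Field r"
    have c: "p i x \<in> Field r" "p i x \<in> p i ` Field r" using x r.p_field by auto
    have "(app (g (p i x)) (p i x), app G (p i x)) \<in> s" using G(2)[OF c(2)] c(1) fs_rel by blast
    then have "(q i (app F (p i x)), q i (app G (p i x))) \<in> s"
      using s.p_mono g[OF c(2)] by metis
    moreover have "(G, F) \<in> fs r s T" using F G(1) by (simp add: is_lub_in_def)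
    then have "(q i (app G (p i x)), q i (app F (p i x))) \<in> s"
      using c(1) fs_rel s.p_mono by blast
    ultimately show "q i (app F (p i x)) = q i (app G (p i x))" by (rule s.ord_antisym)
  qed
  then show "\<exists>G\<in>A. fs_p r p q i F = fs_p r p q i G" using G(1) by blast
next
  show "(F, H) \<in> fs r s T" if "(F, G) \<in> fs r s T" "(G, H) \<in> fs r s T" for F G H
    using fs_trans that .
  show "F = G" if "(F, G) \<in> fs r s T" "(G, F) \<in> fs r s T" for F G
    using fs_antisym that .
  show "\<exists>F. is_lub_in (fs r s T) A F" if "directed_in (fs r s T) A" for A
    using lub_exists[OF that] by blast
qed

end

lemma fun_domain_UNIV:
  assumes "sfp r p" "sfp s q"
  shows "fun_domain r p s q UNIV"
proof -
  interpret sfp_pair r p s q using assms by (simp add: sfp_pair_def)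
  obtain c where "c \<in> Field s" using s.nonempty by blast
  then have "code (\<lambda>_. c) \<in> Field (fun_space r s)"
    by (intro code_field cnt_const s.sfp_axioms)
  then show ?thesis by unfold_locales auto
qed

section \<open>Levels of a hierarchy and their partial equivalences\<close>

primrec lev_p :: "(nat \<Rightarrow> 'b hval rel) \<Rightarrow> (nat \<Rightarrow> 'b hval \<Rightarrow> 'b hval) \<Rightarrow>
    nat \<Rightarrow> nat \<Rightarrow> 'b hval \<Rightarrow> 'b hval" where
  "lev_p D q 0 = q"
| "lev_p D q (Suc k) = fs_p (D k) (lev_p D q k) q"

lemma tot_eq_sym:
  assumes "\<And>x y. P x y \<Longrightarrow> P y x"
  shows "tot_eq D P k x y \<Longrightarrow> tot_eq D P k y x"
proof (induction k arbitrary: x y)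
  case (Suc k)
  then show ?case using assms by (simp (no_asm_use)) blast
qed (use assms in auto)

lemma tot_eq_trans:
  assumes sym: "\<And>x y. P x y \<Longrightarrow> P y x" and tr: "\<And>x y z. P x y \<Longrightarrow> P y z \<Longrightarrow> P x z"
  shows "tot_eq D P k x y \<Longrightarrow> tot_eq D P k y z \<Longrightarrow> tot_eq D P k x z"
proof (induction k arbitrary: x y z)
  case (Suc k)
  have "P (app x a) (app z b)" if ab: "tot_eq D P k a b" for a b
  proof (rule tr)
    show "P (app x a) (app y b)" using Suc.prems(1) ab by simp
    \<comment> \<open>The middle function has to be compared with \<open>z\<close> at
      \<open>b\<close> itself; symmetry and the induction hypothesis make \<open>b\<close>
      total.\<close>
    have "tot_eq D P k b b"
      using Suc.IH[OF tot_eq_sym[OF sym] _, OF _ ab ab] by blast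
    then show "P (app y b) (app z b)" using Suc.prems(2) by simp
  qed
  then show ?case using Suc.prems by simp
qed (use tr in auto)

section \<open>The domains of the Kleene-Kreisel functionals\<close>

definition flatN :: "nat option hval rel" where
  "flatN = {(Base x, Base y) | x y. x = None \<or> x = y}"

abbreviation "Bot \<equiv> Base (None :: nat option)"
abbreviation "Num m \<equiv> Base (Some (m :: nat))"

definition flat_p :: "nat \<Rightarrow> nat option hval \<Rightarrow> nat option hval" where
  "flat_p i x = (case base_val x of None \<Rightarrow> Bot | Some m \<Rightarrow> if m < i then Num m else Bot)"

lemma Field_flatN: "x \<in> Field flatN \<longleftrightarrow> x = Bot \<or> (\<exists>m. x = Num m)"
  unfolding flatN_def Field_def by (cases x) auto

lemma flatN_iff: "(x, y) \<in> flatN \<longleftrightarrow> x \<in> Field flatN \<and> y \<in> Field flatN \<and> (x = Bot \<or> x = y)"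
  unfolding Field_flatN by (auto simp: flatN_def)

lemma flat_p_simps [simp]: "flat_p i Bot = Bot" "flat_p i (Num m) = (if m < i then Num m else Bot)"
  by (simp_all add: flat_p_def)

lemma flat_p_NumD: "x \<in> Field flatN \<Longrightarrow> flat_p i x = Num m \<Longrightarrow> x = Num m"
  by (auto simp: Field_flatN split: if_splits)

lemma sfp_flatN: "sfp flatN flat_p"
proof
  show "Field flatN \<noteq> {}" using Field_flatN by blast
next
  fix i :: nat
  have "flat_p i ` Field flatN \<subseteq> insert Bot (Num ` {..<i})"
    by (auto simp: Field_flatN)
  then show "finite (flat_p i ` Field flatN)" by (rule finite_subset) simp
next
  fix x y assume x: "x \<in> Field flatN" and y: "y \<in> Field flatN" and le: "\<And>i. (flat_p i x, y) \<in> flatN"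
  show "(x, y) \<in> flatN"
  proof (cases "x = Bot")
    case False
    then obtain m where "x = Num m" using x Field_flatN by blast
    then show ?thesis using le[of "Suc m"] by simp
  qed (use y in \<open>simp add: flatN_iff Field_flatN\<close>)
next
  fix A assume A: "directed_in flatN A"
  show "\<exists>x. is_lub_in flatN A x"
  proof (cases "A \<subseteq> {Bot}")
    case True
    then have "is_lub_in flatN A Bot"
      using A by (auto simp: is_lub_in_def flatN_iff Field_flatN)
    then show ?thesis ..
  next
    case False
    then obtain m where m: "Num m \<in> A" using A Field_flatN unfolding directed_in_def by blast
    have "x = Bot \<or> x = Num m" if "x \<in> A" for x
      using A m that unfolding directed_in_def flatN_iff by blast
    then have "is_lub_in flatN A (Num m)"
      using m unfolding is_lub_in_def flatN_iff by (auto simp: Field_flatN)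
    then show ?thesis ..
  qed
next
  fix A x and i :: nat assume A: "directed_in flatN A" and x: "is_lub_in flatN A x"
  have ne: "A \<noteq> {}" using A by (auto simp: directed_in_def)
  have le: "\<And>a. a \<in> A \<Longrightarrow> a = Bot \<or> a = x" using x by (auto simp: is_lub_in_def flatN_iff)
  show "\<exists>a\<in>A. flat_p i x = flat_p i a"
  proof (cases "x \<in> A")
    case False
    then have "\<forall>a\<in>A. a = Bot" using le by auto
    then have "(x, Bot) \<in> flatN" using x by (auto simp: is_lub_in_def Field_flatN flatN_iff)
    then have "x = Bot" by (simp add: flatN_iff)
    then show ?thesis using le ne by blast
  qed auto
qed (auto simp: flatN_iff Field_flatN)

lemma cnt_flatI:
  assumes "sfp r p" and fl: "\<And>x. x \<in> Field r \<Longrightarrow> f x \<in> Field flatN"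
    and mono: "\<And>x y m. (x, y) \<in> r \<Longrightarrow> f x = Num m \<Longrightarrow> f y = Num m"
    and app: "\<And>x m. x \<in> Field r \<Longrightarrow> f x = Num m \<Longrightarrow> \<exists>j. f (p j x) = Num m"
  shows "cnt r p flatN flat_p f"
  unfolding cnt_def
proof (intro conjI allI impI ballI)
  fix x y assume xy: "(x, y) \<in> r"
  then have "f x \<in> Field flatN" "f y \<in> Field flatN" using fl by (auto intro: FieldI1 FieldI2)
  then show "(f x, f y) \<in> flatN" using mono[OF xy] by (auto simp: flatN_iff Field_flatN)
next
  fix x i assume x: "x \<in> Field r"
  show "\<exists>j. (flat_p i (f x), f (p j x)) \<in> flatN"
  proof (cases "f x = Bot")
    case True
    then show ?thesis using fl[OF sfp.p_field[OF assms(1) x]] by (simp add: flatN_iff Field_flatN)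
  next
    case False
    then obtain m where m: "f x = Num m" using fl[OF x] by (auto simp: Field_flatN)
    then obtain j where "f (p j x) = Num m" using app x by blast
    then show ?thesis using m by (intro exI[of _ j]) (simp add: flatN_iff Field_flatN)
  qed
qed

lemma cnt_flatD:
  assumes f: "cnt r p flatN flat_p f" and r: "sfp r p" and x: "x \<in> Field r" "f x = Num m"
  shows "\<exists>j\<ge>n. f (p j x) = Num m"
proof -
  \<comment> \<open>\<open>flat_p (Suc m)\<close> is the first deflation that keeps the number
    \<open>m\<close>, so equal deflated values force equal values.\<close>
  obtain j where "j \<ge> n" "flat_p (Suc m) (f x) = flat_p (Suc m) (f (p j x))"
    using cnt_att[OF f r sfp_flatN x(1)] by blast
  moreover have "f (p j x) \<in> Field flatN"
    using cnt_field[OF f r sfp.p_field[OF r x(1)]] .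
  ultimately have "j \<ge> n \<and> f (p j x) = Num m"
    using x(2) flat_p_NumD[of "f (p j x)" "Suc m" m] by simp
  then show ?thesis by blast
qed

lemma cnt_flat_mono: "cnt r p flatN flat_p f \<Longrightarrow> (x, y) \<in> r \<Longrightarrow> f x = Num m \<Longrightarrow> f y = Num m"
  by (drule cnt_mono, assumption) (auto simp: flatN_iff)

abbreviation "N_p \<equiv> lev_p N_dom flat_p"

lemma N_dom_0: "N_dom 0 = flatN"
  by (simp add: flatN_def)

lemma N_dom_Suc: "N_dom (Suc k) = fs (N_dom k) flatN UNIV"
  by (simp add: flatN_def)

declare N_dom.simps [simp del]

lemma sfp_N: "sfp (N_dom k) (N_p k)"
proof (induction k)
  case 0
  then show ?case by (simp add: N_dom_0 sfp_flatN)
next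
  case (Suc k)
  interpret fun_domain "N_dom k" "N_p k" flatN flat_p UNIV
    by (rule fun_domain_UNIV[OF Suc sfp_flatN])
  show ?case using sfp_fs by (simp add: N_dom_Suc)
qed

interpretation N: sfp "N_dom k" "N_p k" for k
  by (rule sfp_N)

interpretation NF: fun_domain "N_dom k" "N_p k" flatN flat_p UNIV for k
  by (rule fun_domain_UNIV[OF sfp_N sfp_flatN])

lemma N_field_cnt: "f \<in> Field (N_dom (Suc k)) \<Longrightarrow> cnt (N_dom k) (N_p k) flatN flat_p (app f)"
  using NF.field_cnt by (simp add: N_dom_Suc)

lemma N_code_field: "cnt (N_dom k) (N_p k) flatN flat_p f \<Longrightarrow> fun_code (Field (N_dom k)) f \<in> Field (N_dom (Suc k))"
  using NF.code_field by (simp add: N_dom_Suc)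

lemma N_rel:
  "(f, g) \<in> N_dom (Suc k) \<longleftrightarrow> f \<in> Field (N_dom (Suc k)) \<and> g \<in> Field (N_dom (Suc k)) \<and>
     (\<forall>x\<in>Field (N_dom k). (app f x, app g x) \<in> flatN)"
  using NF.fs_rel by (simp only: N_dom_Suc)

lemma N_app_code [simp]: "x \<in> Field (N_dom k) \<Longrightarrow> app (fun_code (Field (N_dom k)) f) x = f x"
  by (rule NF.app_code')

lemma N_app_field: "f \<in> Field (N_dom (Suc k)) \<Longrightarrow> x \<in> Field (N_dom k) \<Longrightarrow> app f x \<in> Field flatN"
  using NF.app_field by (simp only: N_dom_Suc)

lemma N_app_mono: "(f, g) \<in> N_dom (Suc k) \<Longrightarrow> (x, y) \<in> N_dom k \<Longrightarrow> app f x = Num m \<Longrightarrow> app g y = Num m"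
  using cnt_flat_mono[OF N_field_cnt] unfolding N_rel by (metis FieldI2 flatN_iff hval.inject(1) option.distinct(1))

lemma N_p_app: "x \<in> Field (N_dom k) \<Longrightarrow> app (N_p (Suc k) i f) x = flat_p i (app f (N_p k i x))"
  using NF.fs_p_app by simp

subsection \<open>Total objects\<close>

lemma eqN_0: "eqN 0 x y \<longleftrightarrow> (\<exists>m. x = Num m \<and> y = Num m)"
  by (simp add: eqN_def)

lemma eqN_Suc: "eqN (Suc k) f g \<longleftrightarrow> f \<in> Field (N_dom (Suc k)) \<and> g \<in> Field (N_dom (Suc k)) \<and>
     (\<forall>a b. eqN k a b \<longrightarrow> (\<exists>m. app f a = Num m \<and> app g b = Num m))"
  by (simp add: eqN_def)

lemma eqN_sym: "eqN k x y \<Longrightarrow> eqN k y x"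
  unfolding eqN_def by (rule tot_eq_sym) auto

lemma eqN_trans: "eqN k x y \<Longrightarrow> eqN k y z \<Longrightarrow> eqN k x z"
  unfolding eqN_def by (rule tot_eq_trans) auto

lemma eqN_refl1: "eqN k x y \<Longrightarrow> eqN k x x" and eqN_refl2: "eqN k x y \<Longrightarrow> eqN k y y"
  using eqN_sym eqN_trans by metis+

lemma eqN_field: "eqN k x y \<Longrightarrow> x \<in> Field (N_dom k)" "eqN k x y \<Longrightarrow> y \<in> Field (N_dom k)"
  by (cases k; auto simp: eqN_0 eqN_Suc N_dom_0 Field_flatN)+

lemma eqN_extI:
  assumes f: "eqN (Suc k) f f" and g: "eqN (Suc k) g g" and eq: "\<And>z. eqN k z z \<Longrightarrow> app f z = app g z"
  shows "eqN (Suc k) f g"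
proof -
  have "\<exists>m. app f a = Num m \<and> app g b = Num m" if ab: "eqN k a b" for a b
    using f g eq[OF eqN_refl2[OF ab]] ab unfolding eqN_Suc by (metis hval.inject(1) option.inject)
  then show ?thesis using f g unfolding eqN_Suc by blast
qed

text \<open>The pointwise meet, undefined where \<open>x\<close> and \<open>y\<close> differ, stays
  total since equivalent objects take the same number at every total argument.\<close>

lemma eqN_lower:
  assumes xy: "eqN k x y"
  shows "\<exists>z. eqN k z z \<and> (z, x) \<in> N_dom k \<and> (z, y) \<in> N_dom k"
proof (cases k)
  case 0
  then show ?thesis using xy N.ord_refl[of x 0] by (auto simp: eqN_0 N_dom_0 flatN_iff Field_flatN)
next
  case (Suc l)
  note fl = eqN_field[OF xy, unfolded Suc]
  note cx = N_field_cnt[OF fl(1)] and cy = N_field_cnt[OF fl(2)]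
  define h where "h a = (if app x a = app y a then app x a else Bot)" for a
  have hN: "h a = Num m \<longleftrightarrow> app x a = Num m \<and> app y a = Num m" for a m by (auto simp: h_def)
  have "cnt (N_dom l) (N_p l) flatN flat_p h"
  proof (rule cnt_flatI[OF sfp_N])
    show "h a \<in> Field flatN" if "a \<in> Field (N_dom l)" for a
      using N_app_field[OF fl(1) that] Field_flatN[of Bot] unfolding h_def by metis
    show "h b = Num m" if "(a, b) \<in> N_dom l" "h a = Num m" for a b m
      using that cnt_flat_mono[OF cx that(1)] cnt_flat_mono[OF cy that(1)] by (simp add: hN)
    show "\<exists>j. h (N_p l j a) = Num m" if a: "a \<in> Field (N_dom l)" and m: "h a = Num m" for a m
    proof -
      obtain i where i: "app x (N_p l i a) = Num m"
        using cnt_flatD[OF cx sfp_N a] m hN by blast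
      obtain j where j: "j \<ge> i" "app y (N_p l j a) = Num m"
        using cnt_flatD[OF cy sfp_N a] m hN by blast
      have "app x (N_p l j a) = Num m"
        using cnt_flat_mono[OF cx N.p_chain[OF a j(1)] i] .
      then show ?thesis using j hN by blast
    qed
  qed
  then have hf: "fun_code (Field (N_dom l)) h \<in> Field (N_dom (Suc l))" by (rule N_code_field)
  have le: "(fun_code (Field (N_dom l)) h, w) \<in> N_dom (Suc l)" if w: "w = x \<or> w = y" for w
    unfolding N_rel
  proof (intro conjI ballI hf)
    show wf: "w \<in> Field (N_dom (Suc l))" using w fl by blast
    fix a assume a: "a \<in> Field (N_dom l)"
    show "(app (fun_code (Field (N_dom l)) h) a, app w a) \<in> flatN"
      using w N_app_field[OF fl(1) a] N_app_field[OF fl(2) a]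
      by (auto simp: a flatN_iff Field_flatN h_def)
  qed
  have "\<exists>m. app (fun_code (Field (N_dom l)) h) a = Num m \<and> app (fun_code (Field (N_dom l)) h) b = Num m"
    if ab: "eqN l a b" for a b
  proof -
    obtain m where m: "app x a = Num m" "app y b = Num m"
      using xy ab by (auto simp: Suc eqN_Suc)
    \<comment> \<open>Comparing \<open>x\<close> and \<open>y\<close> also at \<open>b\<close> alone
      and at \<open>a\<close> alone shows that all four values coincide.\<close>
    obtain m' where "app x b = Num m'" "app y b = Num m'"
      using xy eqN_refl2[OF ab] by (fastforce simp: Suc eqN_Suc)
    moreover obtain m'' where "app x a = Num m''" "app y a = Num m''"
      using xy eqN_refl1[OF ab] by (fastforce simp: Suc eqN_Suc)
    ultimately show ?thesis using m eqN_field[OF ab] by (simp add: h_def)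
  qed
  then have "eqN (Suc l) (fun_code (Field (N_dom l)) h) (fun_code (Field (N_dom l)) h)"
    using hf by (simp add: eqN_Suc)
  then show ?thesis using le Suc by blast
qed

subsection \<open>Total approximations\<close>

primrec N_zero :: "nat \<Rightarrow> nat option hval" where
  "N_zero 0 = Num 0"
| "N_zero (Suc k) = fun_code (Field (N_dom k)) (\<lambda>_. Num 0)"

lemma eqN_zero: "eqN k (N_zero k) (N_zero k)"
proof (cases k)
  case (Suc l)
  have c: "cnt (N_dom l) (N_p l) flatN flat_p (\<lambda>_. Num 0)"
    by (rule cnt_const[OF sfp_flatN]) (simp add: Field_flatN)
  have "app (fun_code (Field (N_dom l)) (\<lambda>_. Num 0)) a = Num 0" if "eqN l a b \<or> eqN l b a" for a b
    using that eqN_field by (metis N_app_code)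
  then show ?thesis using N_code_field[OF c] unfolding Suc eqN_Suc N_zero.simps by blast
qed (simp add: eqN_0)

text \<open>Numbers from \<open>i\<close> on become 0 rather than undefined as in
  \<open>flat_p\<close>: totality survives, while only finitely many numbers remain.\<close>

definition flat_tau :: "nat \<Rightarrow> nat option hval \<Rightarrow> nat option hval" where
  "flat_tau i x = (case base_val x of None \<Rightarrow> Bot | Some m \<Rightarrow> Num (if m < i then m else 0))"

lemma flat_tau_simps [simp]: "flat_tau i Bot = Bot" "flat_tau i (Num m) = Num (if m < i then m else 0)"
  by (simp_all add: flat_tau_def)

lemma cnt_flat_tau: "cnt flatN flat_p flatN flat_p (flat_tau i)"
  by (rule cnt_flatI[OF sfp_flatN])
    (auto simp: Field_flatN flatN_iff intro: exI[of _ "Suc _"])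

primrec tau :: "nat \<Rightarrow> nat \<Rightarrow> nat option hval \<Rightarrow> nat option hval" where
  "tau 0 i = flat_tau i"
| "tau (Suc k) i = (\<lambda>f. fun_code (Field (N_dom k)) (\<lambda>z. flat_tau i (app f (tau k i z))))"

lemma N_cntI:
  assumes "sfp r p" and "\<And>x. x \<in> Field r \<Longrightarrow> cnt (N_dom k) (N_p k) flatN flat_p (f x)"
    and "\<And>z. z \<in> Field (N_dom k) \<Longrightarrow> cnt r p flatN flat_p (\<lambda>x. f x z)"
  shows "cnt r p (N_dom (Suc k)) (N_p (Suc k)) (\<lambda>x. fun_code (Field (N_dom k)) (f x))"
  using NF.cnt_codeI[of r p k f] assms N_code_field by (simp add: N_dom_Suc)

lemma cnt_app_at:
  "z \<in> Field (N_dom k) \<Longrightarrow> cnt (N_dom (Suc k)) (N_p (Suc k)) flatN flat_p (\<lambda>f. app f z)"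
  using NF.cnt_eval by (simp add: N_dom_Suc)

lemma cnt_tau: "cnt (N_dom k) (N_p k) (N_dom k) (N_p k) (tau k i)"
proof (induction k)
  case 0
  then show ?case by (simp add: N_dom_0 cnt_flat_tau)
next
  case (Suc k)
  have tf: "tau k i z \<in> Field (N_dom k)" if "z \<in> Field (N_dom k)" for z
    using cnt_field[OF Suc sfp_N that] .
  show ?case
    unfolding tau.simps
  proof (rule N_cntI[OF sfp_N])
    fix f assume f: "f \<in> Field (N_dom (Suc k))"
    show "cnt (N_dom k) (N_p k) flatN flat_p (\<lambda>z. flat_tau i (app f (tau k i z)))"
      by (intro cnt_compose[OF _ cnt_flat_tau] cnt_compose[OF Suc N_field_cnt[OF f]] sfp_N sfp_flatN)
  next
    fix z assume "z \<in> Field (N_dom k)"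
    then show "cnt (N_dom (Suc k)) (N_p (Suc k)) flatN flat_p (\<lambda>f. flat_tau i (app f (tau k i z)))"
      by (intro cnt_compose[OF _ cnt_flat_tau] cnt_app_at tf sfp_N sfp_flatN)
  qed
qed

lemma tau_field: "z \<in> Field (N_dom k) \<Longrightarrow> tau k i z \<in> Field (N_dom k)"
  using cnt_field[OF cnt_tau sfp_N] .

lemma tau_app: "z \<in> Field (N_dom k) \<Longrightarrow> app (tau (Suc k) i f) z = flat_tau i (app f (tau k i z))"
  by simp

lemma eqN_tau: "eqN k x y \<Longrightarrow> eqN k (tau k i x) (tau k i y)"
proof (induction k arbitrary: x y)
  case 0
  then show ?case by (auto simp: eqN_0)
next
  case (Suc k)
  have "\<exists>m. app (tau (Suc k) i x) a = Num m \<and> app (tau (Suc k) i y) b = Num m" if ab: "eqN k a b" for a b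
  proof -
    obtain m where "app x (tau k i a) = Num m" "app y (tau k i b) = Num m"
      using Suc.prems Suc.IH[OF ab] by (auto simp: eqN_Suc)
    then show ?thesis using eqN_field[OF ab] by (simp add: tau_app del: tau.simps)
  qed
  then show ?case using tau_field eqN_field[OF Suc.prems] unfolding eqN_Suc by blast
qed

text \<open>Replacing undefined values by 0 only adds information, so \<open>tau\<close> lies above
  the deflation. Through this, continuity statements about \<open>N_p\<close> carry over to total
  truncations.\<close>

lemma p_le_tau:
  "n \<le> i \<Longrightarrow> z \<in> Field (N_dom k) \<Longrightarrow> (N_p k n z, tau k i z) \<in> N_dom k"
proof (induction k arbitrary: z)
  case 0
  then show ?case by (auto simp: N_dom_0 flatN_iff Field_flatN)
next
  case (Suc k)
  show ?case
    unfolding N_rel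
  proof (intro conjI ballI N.p_field tau_field Suc.prems(2))
    fix x assume x: "x \<in> Field (N_dom k)"
    have "app z (tau k i x) = Num m" if "app z (N_p k n x) = Num m" for m
      using cnt_flat_mono[OF N_field_cnt[OF Suc.prems(2)] Suc.IH[OF Suc.prems(1) x] that] .
    moreover have "app z (N_p k n x) \<in> Field flatN" "app z (tau k i x) \<in> Field flatN"
      using N_app_field[OF Suc.prems(2)] N.p_field[OF x] tau_field[OF x] by auto
    ultimately show "(app (N_p (Suc k) n z) x, app (tau (Suc k) i z) x) \<in> flatN"
      unfolding N_p_app[OF x] tau_app[OF x]
      using Suc.prems(1) by (auto simp: Field_flatN flatN_iff)
  qed
qed

text \<open>By induction, the truncation of \<open>f\<close> is determined up to equivalence by the
  truncated values of \<open>f\<close> at finitely many truncated arguments.\<close>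

lemma tau_finite:
  "\<exists>X. finite X \<and> (\<forall>a\<in>X. eqN k a a) \<and> (\<forall>z. eqN k z z \<longrightarrow> (\<exists>a\<in>X. eqN k (tau k i z) a))"
proof (induction k)
  case 0
  show ?case
    by (intro exI[of _ "insert (Num 0) (Num ` {..<i})"]) (auto simp: eqN_0)
next
  case (Suc k)
  then obtain X where X: "finite X" "\<And>a. a \<in> X \<Longrightarrow> eqN k a a"
    "\<And>z. eqN k z z \<Longrightarrow> \<exists>a\<in>X. eqN k (tau k i z) a" by blast
  define Y where "Y = insert (Num 0) (Num ` {..<i})"
  define G where "G f = restrict (\<lambda>a. flat_tau i (app f a)) X" for f
  define Z where "Z = {f. eqN (Suc k) f f}"
  have "G ` Z \<subseteq> PiE X (\<lambda>_. Y)"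
  proof (intro image_subsetI)
    fix f assume "f \<in> Z"
    then have "\<exists>m. app f a = Num m" if "a \<in> X" for a
      using X(2)[OF that] unfolding Z_def eqN_Suc by blast
    then show "G f \<in> PiE X (\<lambda>_. Y)" by (fastforce simp: G_def Y_def)
  qed
  then have fin: "finite (G ` Z)"
    by (rule finite_subset) (simp add: X(1) Y_def finite_PiE)
  \<comment> \<open>One total functional is chosen for each of the finitely many tables; its
    truncation represents all functionals with that table.\<close>
  define h where "h g = (SOME f. f \<in> Z \<and> G f = g)" for g
  have h: "h g \<in> Z \<and> G (h g) = g" if "g \<in> G ` Z" for g
    unfolding h_def using that by (intro someI_ex[of "\<lambda>f. f \<in> Z \<and> G f = g"]) blast
  show ?case
  proof (intro exI[of _ "tau (Suc k) i ` h ` G ` Z"] conjI ballI allI impI)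
    show "finite (tau (Suc k) i ` h ` G ` Z)" by (rule finite_imageI[OF finite_imageI[OF fin]])
    show "eqN (Suc k) a a" if "a \<in> tau (Suc k) i ` h ` G ` Z" for a
      using that h eqN_tau by (auto simp: Z_def simp del: tau.simps)
    fix f assume f: "eqN (Suc k) f f"
    define f' where "f' = h (G f)"
    have "f \<in> Z" using f by (simp add: Z_def)
    then have f': "eqN (Suc k) f' f'" "G f' = G f" using h[of "G f"] by (auto simp: Z_def f'_def)
    have "eqN (Suc k) (tau (Suc k) i f) (tau (Suc k) i f')"
    proof (rule eqN_extI[OF eqN_tau[OF f] eqN_tau[OF f'(1)]])
      fix z assume z: "eqN k z z"
      then obtain a where a: "a \<in> X" "eqN k (tau k i z) a" using X(3) by blast
      have "app f (tau k i z) = app f a" "app f' (tau k i z) = app f' a"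
        using f f'(1) a(2) unfolding eqN_Suc by metis+
      moreover have "flat_tau i (app f' a) = flat_tau i (app f a)"
        using fun_cong[OF f'(2), of a] a(1) by (simp add: G_def)
      ultimately show "app (tau (Suc k) i f) z = app (tau (Suc k) i f') z"
        using tau_app[OF eqN_field(1)[OF z]] by metis
    qed
    then show "\<exists>a\<in>tau (Suc k) i ` h ` G ` Z. eqN (Suc k) (tau (Suc k) i f) a"
      using \<open>f \<in> Z\<close> by (auto simp: f'_def simp del: tau.simps)
  qed
qed

subsection \<open>Density of the total objects\<close>

text \<open>At level 0 the second argument of \<open>nval\<close> is a dummy.\<close>

primrec nval :: "nat \<Rightarrow> nat option hval \<Rightarrow> nat option hval \<Rightarrow> nat option hval" where
  "nval 0 x z = x"
| "nval (Suc k) x z = app x z"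

lemma nval_cnt: "z \<in> Field (N_dom (k - 1)) \<Longrightarrow> cnt (N_dom k) (N_p k) flatN flat_p (\<lambda>x. nval k x z)"
  by (cases k) (simp_all add: cnt_app_at cnt_id[OF sfp_flatN] N_dom_0 del: lev_p.simps(2))

lemma nval_total: "eqN k x y \<Longrightarrow> eqN (k - 1) z z \<Longrightarrow> \<exists>m. nval k x z = Num m \<and> nval k y z = Num m"
  by (cases k) (auto simp: eqN_0 eqN_Suc)

text \<open>Without conflicting values the pointwise join exists. Contrapositively, unbounded pairs
  are separated by two distinct numbers at some argument, which is how density uses it.\<close>

lemma nval_consistent:
  assumes x: "x \<in> Field (N_dom k)" and y: "y \<in> Field (N_dom k)"
    and con: "\<And>z m m'. z \<in> Field (N_dom (k - 1)) \<Longrightarrow> nval k x z = Num m \<Longrightarrow> nval k y z = Num m' \<Longrightarrow> m = m'"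
  shows "\<exists>h. (x, h) \<in> N_dom k \<and> (y, h) \<in> N_dom k"
proof (cases k)
  case 0
  obtain z where "z \<in> Field (N_dom 0)" using N.nonempty by blast
  then show ?thesis
    using x y con[of z] by (fastforce simp: 0 N_dom_0 flatN_iff Field_flatN)
next
  case (Suc l)
  note cx = N_field_cnt[OF x[unfolded Suc]] and cy = N_field_cnt[OF y[unfolded Suc]]
  have fl: "app x z \<in> Field flatN" "app y z \<in> Field flatN" if "z \<in> Field (N_dom l)" for z
    using N_app_field that x y Suc by auto
  define h where "h z = (if app x z = Bot then app y z else app x z)" for z
  have hN: "h z = Num m \<longleftrightarrow> app x z = Num m \<or> app y z = Num m" if "z \<in> Field (N_dom l)" for z m
    using fl[OF that] con[of z] that by (auto simp: h_def Suc Field_flatN)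
  have "cnt (N_dom l) (N_p l) flatN flat_p h"
  proof (rule cnt_flatI[OF sfp_N])
    show "h a \<in> Field flatN" if "a \<in> Field (N_dom l)" for a
      using fl[OF that] by (simp add: h_def)
    show "h b = Num m" if "(a, b) \<in> N_dom l" "h a = Num m" for a b m
      using that(2) cnt_flat_mono[OF cx that(1)] cnt_flat_mono[OF cy that(1)]
        hN[OF FieldI1[OF that(1)]] hN[OF FieldI2[OF that(1)]] by blast
    show "\<exists>j. h (N_p l j a) = Num m" if a: "a \<in> Field (N_dom l)" and m: "h a = Num m" for a m
      using m cnt_flatD[OF cx sfp_N a] cnt_flatD[OF cy sfp_N a] hN[OF a] hN[OF N.p_field[OF a]]
      by blast
  qed
  then have hf: "fun_code (Field (N_dom l)) h \<in> Field (N_dom (Suc l))" by (rule N_code_field)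
  have "(app w z, h z) \<in> flatN" if w: "w = x \<or> w = y" and z: "z \<in> Field (N_dom l)" for w z
  proof -
    have "h z \<in> Field flatN" using fl[OF z] by (simp add: h_def)
    moreover have "app w z \<in> Field flatN" using fl[OF z] w by auto
    moreover have "app w z = h z" if "app w z = Num m" for m
      using hN[OF z, of m] that w by auto
    ultimately show ?thesis by (auto simp: flatN_iff Field_flatN)
  qed
  then show ?thesis
    using x y hf by (intro exI[of _ "fun_code (Field (N_dom l)) h"]) (simp add: Suc N_rel)
qed

text \<open>The density theorem for one more type. A finite table of values of \<open>x\<close> is
  extended to a total functional that decides which entry applies by finitely many tests. Arguments
  with different prescribed values are inconsistent, hence differ at some point one level below,
  which density at that level replaces by a total point.\<close>

lemma N_dense_step:
  assumes below: "k > 0 \<Longrightarrow> (\<And>x n. x \<in> Field (N_dom (k - 1)) \<Longrightarrow>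
      \<exists>t. eqN (k - 1) t t \<and> (N_p (k - 1) n x, t) \<in> N_dom (k - 1))"
    and x: "x \<in> Field (N_dom (Suc k))"
  shows "\<exists>t. eqN (Suc k) t t \<and> (N_p (Suc k) n x, t) \<in> N_dom (Suc k)"
proof -
  define C where "C = N_p k n ` Field (N_dom k)"
  have C: "finite C" "\<And>c. c \<in> C \<Longrightarrow> c \<in> Field (N_dom k)"
    unfolding C_def using N.p_fin N.p_field by auto
  define v where "v c = flat_p n (app x c)" for c
  define conf where "conf c c' \<longleftrightarrow> (\<exists>a b. v c = Num a \<and> v c' = Num b \<and> a \<noteq> b)" for c c'
  have "\<exists>t. eqN (k - 1) t t \<and> (\<exists>a b. nval k c t = Num a \<and> nval k c' t = Num b \<and> a \<noteq> b)"
    if c: "c \<in> C" "c' \<in> C" and cf: "conf c c'" for c c'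
  proof -
    obtain a b where ab: "app x c = Num a" "app x c' = Num b" "a \<noteq> b"
      using cf flat_p_NumD N_app_field[OF x] C(2) c unfolding conf_def v_def by metis
    \<comment> \<open>A common upper bound would have to be mapped by \<open>x\<close> to both
      numbers.\<close>
    have "\<not> (\<exists>h. (c, h) \<in> N_dom k \<and> (c', h) \<in> N_dom k)"
      using cnt_flat_mono[OF N_field_cnt[OF x] _ ab(1)] cnt_flat_mono[OF N_field_cnt[OF x] _ ab(2)] ab(3)
      by fastforce
    then obtain z a' b' where z: "z \<in> Field (N_dom (k - 1))" "nval k c z = Num a'"
      "nval k c' z = Num b'" "a' \<noteq> b'"
      using nval_consistent[OF C(2)[OF c(1)] C(2)[OF c(2)]] by blast
    show ?thesis
    proof (cases k)
      case 0
      then show ?thesis using z eqN_zero[of 0] by auto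
    next
      case (Suc l)
      have zf: "z \<in> Field (N_dom l)" using z(1) Suc by simp
      note cc = N_field_cnt[OF C(2)[OF c(1), unfolded Suc]] N_field_cnt[OF C(2)[OF c(2), unfolded Suc]]
      obtain i where i: "app c (N_p l i z) = Num a'"
        using cnt_flatD[OF cc(1) sfp_N zf] z(2) Suc by auto
      obtain j where j: "j \<ge> i" "app c' (N_p l j z) = Num b'"
        using cnt_flatD[OF cc(2) sfp_N zf] z(3) Suc by auto
      \<comment> \<open>At the approximation \<open>N_p l j z\<close> both numbers are already
        attained, so they persist at any total object above it.\<close>
      obtain t where t: "eqN l t t" "(N_p l j z, t) \<in> N_dom l" using below[of z j] Suc zf by auto
      have "app c t = Num a'"
        using cnt_flat_mono[OF cc(1) t(2) cnt_flat_mono[OF cc(1) N.p_chain[OF zf j(1)] i]] .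
      moreover have "app c' t = Num b'" using cnt_flat_mono[OF cc(2) t(2) j(2)] .
      ultimately show ?thesis using t(1) z(4) Suc by auto
    qed
  qed
  then obtain t where t: "\<And>c c'. c \<in> C \<Longrightarrow> c' \<in> C \<Longrightarrow> conf c c' \<Longrightarrow> eqN (k - 1) (t c c') (t c c') \<and>
      (\<exists>a b. nval k c (t c c') = Num a \<and> nval k c' (t c c') = Num b \<and> a \<noteq> b)"
    by metis
  define S where "S = {t c c' | c c'. c \<in> C \<and> c' \<in> C \<and> conf c c'}"
  have "S \<subseteq> (\<lambda>(c, c'). t c c') ` (C \<times> C)" by (auto simp: S_def)
  then have finS: "finite S" using C(1) by (meson finite_SigmaI finite_imageI finite_subset)
  have S: "eqN (k - 1) u u" "u \<in> Field (N_dom (k - 1))" if "u \<in> S" for u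
    using that t unfolding S_def by (blast intro: eqN_field)+
  \<comment> \<open>The separating point is chosen for ordered pairs; demanding agreement at both
    orders lets two passing candidates be compared at the same point.\<close>
  define pass where "pass z c \<longleftrightarrow> c \<in> C \<and> (\<exists>a. v c = Num a) \<and>
    (\<forall>c'\<in>C. conf c c' \<longrightarrow> nval k z (t c c') = nval k c (t c c') \<and> nval k z (t c' c) = nval k c (t c' c))"
    for z c
  have conf_sym: "conf c c' \<Longrightarrow> conf c' c" for c c' unfolding conf_def by blast
  have pass_unique: "v c = v c'" if "pass z c" "pass z c'" for z c c'
  proof (rule ccontr)
    assume "v c \<noteq> v c'"
    then have cf: "conf c c'" using that unfolding pass_def conf_def by auto
    then have "nval k z (t c c') = nval k c (t c c')" "nval k z (t c c') = nval k c' (t c c')"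
      using that conf_sym[OF cf] unfolding pass_def by blast+
    then show False using t[of c c'] cf that unfolding pass_def by auto
  qed
  \<comment> \<open>The default 0 is given only after every test has been answered, since a later
    answer might still let some \<open>c\<close> pass; this keeps \<open>g\<close> monotone.\<close>
  define g where "g z = (if \<exists>c. pass z c then v (SOME c. pass z c)
    else if \<forall>u\<in>S. \<exists>m. nval k z u = Num m then Num 0 else Bot)" for z
  have g_pass: "g z = v c" if "pass z c" for z c
    using someI[of "pass z", OF that] pass_unique[OF that] that by (auto simp: g_def)
  have v_field: "v c \<in> Field flatN" if "c \<in> C" for c
    using N_app_field[OF x C(2)[OF that]] by (auto simp: v_def Field_flatN)
  have g_field: "g z \<in> Field flatN" for z
  proof (cases "\<exists>c. pass z c")
    case True
    then show ?thesis using g_pass v_field unfolding pass_def by metis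
  qed (auto simp: g_def Field_flatN)
  have nval_field: "nval k z u \<in> Field flatN" if "z \<in> Field (N_dom k)" "u \<in> S" for z u
    using cnt_field[OF nval_cnt[OF S(2)[OF that(2)]] sfp_N that(1)] .
  have nval_mono: "nval k z' u = Num m" if "(z, z') \<in> N_dom k" "u \<in> S" "nval k z u = Num m" for z z' u m
    using cnt_flat_mono[OF nval_cnt[OF S(2)[OF that(2)]] that(1,3)] .
  have pass_num: "\<exists>m. nval k c (t c c') = Num m" "\<exists>m. nval k c (t c' c) = Num m" "t c c' \<in> S" "t c' c \<in> S"
    if "c \<in> C" "c' \<in> C" "conf c c'" for c c'
    using t[of c c'] t[of c' c] that conf_sym[OF that(3)] by (auto simp: S_def)
  have pass_mono: "pass z' c" if zz: "(z, z') \<in> N_dom k" and ps: "pass z c" for z z' c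
    unfolding pass_def
  proof (intro conjI ballI impI)
    show cC: "c \<in> C" and "\<exists>a. v c = Num a" using ps by (auto simp: pass_def)
    fix c' assume c': "c' \<in> C" "conf c c'"
    note pn = pass_num[OF cC c']
    show "nval k z' (t c c') = nval k c (t c c')"
      using pn(1) ps c' nval_mono[OF zz pn(3)] unfolding pass_def by metis
    show "nval k z' (t c' c) = nval k c (t c' c)"
      using pn(2) ps c' nval_mono[OF zz pn(4)] unfolding pass_def by metis
  qed
  have g_cong: "g z = g z'" if "\<And>u. u \<in> S \<Longrightarrow> nval k z u = nval k z' u" for z z'
  proof -
    have "pass z c \<longleftrightarrow> pass z' c" for c
      unfolding pass_def using that pass_num(3,4) by (metis (full_types))
    then have "pass z = pass z'" by blast
    then show ?thesis unfolding g_def using that by auto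
  qed
  have "cnt (N_dom k) (N_p k) flatN flat_p g"
  proof (rule cnt_flatI[OF sfp_N g_field])
    fix z z' m assume zz: "(z, z') \<in> N_dom k" and m: "g z = Num m"
    show "g z' = Num m"
    proof (cases "\<exists>c. pass z c")
      case True
      then show ?thesis using g_pass pass_mono[OF zz] m by metis
    next
      case False
      then have all: "\<forall>u\<in>S. \<exists>m. nval k z u = Num m" using m by (auto simp: g_def split: if_splits)
      have "nval k z u = nval k z' u" if "u \<in> S" for u
        using all that nval_mono[OF zz that] by force
      then show ?thesis using g_cong m by metis
    qed
  next
    fix z m assume z: "z \<in> Field (N_dom k)" and m: "g z = Num m"
    \<comment> \<open>Each of the finitely many tests eventually has the same outcome on the
      approximations as on \<open>z\<close>, and \<open>g\<close> depends only on these
      outcomes.\<close>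
    have "\<exists>i. \<forall>j\<ge>i. nval k (N_p k j z) u = nval k z u" if u: "u \<in> S" for u
    proof (cases "nval k z u = Bot")
      case True
      have "nval k (N_p k j z) u = Bot" for j
        using nval_field[OF N.p_field[OF z] u] nval_mono[OF N.p_le[OF z] u] True
        by (fastforce simp: Field_flatN)
      then show ?thesis using True by simp
    next
      case False
      then obtain m where m: "nval k z u = Num m" using nval_field[OF z u] by (auto simp: Field_flatN)
      then obtain i where "nval k (N_p k i z) u = Num m"
        using cnt_flatD[OF nval_cnt[OF S(2)[OF u]] sfp_N z] by blast
      then show ?thesis using nval_mono[OF N.p_chain[OF z] u] m by auto
    qed
    then obtain I where I: "\<And>u j. u \<in> S \<Longrightarrow> j \<ge> I u \<Longrightarrow> nval k (N_p k j z) u = nval k z u" by metis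
    have "nval k (N_p k (Max (I ` S)) z) u = nval k z u" if "u \<in> S" for u
      by (rule I[OF that]) (use that finS in simp)
    then show "\<exists>j. g (N_p k j z) = Num m" using g_cong m by metis
  qed
  then have gf: "fun_code (Field (N_dom k)) g \<in> Field (N_dom (Suc k))" by (rule N_code_field)
  have "\<exists>m. g a = Num m \<and> g b = Num m" if ab: "eqN k a b" for a b
  proof -
    have nv: "\<exists>m. nval k a u = Num m \<and> nval k b u = Num m" if "u \<in> S" for u
      using nval_total[OF ab S(1)[OF that]] .
    have "\<exists>m. g a = Num m"
    proof (cases "\<exists>c. pass a c")
      case True
      then show ?thesis using g_pass unfolding pass_def by metis
    next
      case False
      then show ?thesis using nv by (auto simp: g_def)
    qed
    moreover have "g a = g b" by (rule g_cong) (use nv in force)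
    ultimately show ?thesis by auto
  qed
  then have "eqN (Suc k) (fun_code (Field (N_dom k)) g) (fun_code (Field (N_dom k)) g)"
    using gf eqN_field unfolding eqN_Suc by (metis N_app_code)
  moreover have "(N_p (Suc k) n x, fun_code (Field (N_dom k)) g) \<in> N_dom (Suc k)"
    unfolding N_rel
  proof (intro conjI ballI gf N.p_field x)
    fix z assume z: "z \<in> Field (N_dom k)"
    define c where "c = N_p k n z"
    have cC: "c \<in> C" using z by (simp add: C_def c_def)
    \<comment> \<open>As \<open>z\<close> lies above \<open>c\<close>, it inherits the answers of
      \<open>c\<close> at all relevant tests.\<close>
    have "g z = v c" if "v c \<noteq> Bot"
    proof (rule g_pass)
      have "\<exists>a. v c = Num a" using v_field[OF cC] that by (auto simp: Field_flatN)
      then show "pass z c"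
        unfolding pass_def using cC pass_num[OF cC] nval_mono[OF N.p_le[OF z, of n, folded c_def]] by metis
    qed
    then show "(app (N_p (Suc k) n x) z, app (fun_code (Field (N_dom k)) g) z) \<in> flatN"
      unfolding N_p_app[OF z] N_app_code[OF z]
      using v_field[OF cC] g_field[of z] by (auto simp: flatN_iff Field_flatN v_def c_def)
  qed
  ultimately show ?thesis by blast
qed

text \<open>Strong induction, since the step for type \<open>k + 1\<close> uses density at type
  \<open>k - 1\<close>.\<close>

lemma N_dense: "x \<in> Field (N_dom k) \<Longrightarrow> \<exists>t. eqN k t t \<and> (N_p k n x, t) \<in> N_dom k"
proof (induction k arbitrary: x n rule: less_induct)
  case (less k)
  show ?case
  proof (cases k)
    case 0
    then have "x = Bot \<or> (\<exists>m. x = Num m)" using less.prems by (simp add: N_dom_0 Field_flatN)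
    then show ?thesis
    proof
      assume "x = Bot"
      then have "eqN k (Num 0) (Num 0) \<and> (N_p k n x, Num 0) \<in> N_dom k"
        unfolding 0 by (simp add: eqN_0 N_dom_0 flatN_iff Field_flatN)
      then show ?thesis by blast
    next
      assume "\<exists>m. x = Num m"
      then have "eqN k x x \<and> (N_p k n x, x) \<in> N_dom k"
        unfolding 0 by (auto simp: eqN_0 N_dom_0 flatN_iff Field_flatN)
      then show ?thesis by blast
    qed
  next
    case (Suc l)
    show ?thesis
      unfolding Suc by (rule N_dense_step) (use less Suc in auto)
  qed
qed

section \<open>Interpolation between approximations\<close>

definition nat_dist :: "real \<Rightarrow> real" where
  "nat_dist x = infdist x (range real)"

lemma nat_dist_nonneg: "nat_dist x \<ge> 0"
  by (simp add: nat_dist_def infdist_nonneg)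

lemma nat_dist_lipschitz: "nat_dist x \<le> nat_dist y + \<bar>x - y\<bar>"
  using infdist_triangle[of x "range real" y] by (simp add: nat_dist_def dist_real_def)

lemma nat_dist_nat [simp]: "nat_dist (real m) = 0"
  by (simp add: nat_dist_def)

lemma nat_dist_lessE:
  assumes "nat_dist x < e"
  obtains m where "\<bar>x - real m\<bar> < e"
proof -
  have "(INF a\<in>range real. dist x a) < e" using assms by (simp add: nat_dist_def infdist_def)
  then obtain a where "a \<in> range real" "dist x a < e"
    by (subst (asm) cInf_less_iff) (auto intro: bdd_belowI2[of _ 0])
  then show thesis using that by (auto simp: dist_real_def)
qed

text \<open>It is 1 up to 1/16, 0 from 1/8 on and linear in between.\<close>

definition clamp :: "real \<Rightarrow> real" where
  "clamp x = max 0 (min 1 (2 - 16 * x))"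

locale index_sets =
  fixes A :: "nat \<Rightarrow> 'i set"
  assumes A_finite: "finite (A j)" and A_nonempty: "A j \<noteq> {}" and A_mono: "i \<le> j \<Longrightarrow> A i \<subseteq> A j"
begin

definition delta :: "('i \<Rightarrow> real) \<Rightarrow> nat \<Rightarrow> real" where
  "delta r j = Max ((\<lambda>a. nat_dist (r a)) ` A j)"

text \<open>The factor \<open>real j + 1\<close> makes the weights vanish eventually as soon as one
  \<open>delta\<close> is positive. Only functions with exact natural values at all samples escape
  the finite sum.\<close>

definition wt :: "('i \<Rightarrow> real) \<Rightarrow> nat \<Rightarrow> real" where
  "wt r j = clamp ((real j + 1) * delta r j)"

text \<open>The sum is a weighted mean of the values \<open>v i\<close>, where \<open>v i\<close> counts only as long as \<open>r\<close> is close
  to natural numbers on \<open>A (i - 1)\<close>. The infimum is the upper limit of \<open>v\<close>; it is only used when \<open>r\<close>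
  takes natural values on every \<open>A j\<close>.\<close>

definition interp :: "('i \<Rightarrow> real) \<Rightarrow> (nat \<Rightarrow> real) \<Rightarrow> real" where
  "interp r v = (if \<exists>j. wt r j = 0
     then v 0 + (\<Sum>j<(LEAST j. wt r j = 0). wt r j * (v (Suc j) - v j))
     else Inf {b. \<exists>n. \<forall>i\<ge>n. v i \<le> b})"

lemma delta_ge: "a \<in> A j \<Longrightarrow> nat_dist (r a) \<le> delta r j"
  unfolding delta_def using A_finite by (intro Max_ge) auto

lemma delta_le_iff: "delta r j \<le> x \<longleftrightarrow> (\<forall>a\<in>A j. nat_dist (r a) \<le> x)"
  unfolding delta_def using A_finite A_nonempty by (subst Max_le_iff) auto

lemma delta_nonneg: "delta r j \<ge> 0"
  using delta_ge nat_dist_nonneg A_nonempty order_trans by (metis ex_in_conv)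

lemma delta_mono: "i \<le> j \<Longrightarrow> delta r i \<le> delta r j"
  using A_mono[of i j] delta_ge[of _ j r] unfolding delta_le_iff by blast

lemma delta_lipschitz:
  assumes "\<And>a. a \<in> A j \<Longrightarrow> \<bar>r a - r' a\<bar> \<le> e"
  shows "delta r j \<le> delta r' j + e"
  unfolding delta_le_iff
proof
  fix a assume "a \<in> A j"
  then show "nat_dist (r a) \<le> delta r' j + e"
    using assms[of a] delta_ge[of a j r'] nat_dist_lipschitz[of "r a" "r' a"] by linarith
qed

lemma delta_cong: "(\<And>a. a \<in> A j \<Longrightarrow> r a = r' a) \<Longrightarrow> delta r j = delta r' j"
  unfolding delta_def by (intro arg_cong[where f = Max] image_cong) auto

lemma wt_bounds: "0 \<le> wt r j" "wt r j \<le> 1"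
  by (auto simp: wt_def clamp_def)

lemma wt_antimono: "i \<le> j \<Longrightarrow> wt r j \<le> wt r i"
proof -
  assume ij: "i \<le> j"
  have "(real i + 1) * delta r i \<le> (real j + 1) * delta r j"
    using ij delta_mono[OF ij] delta_nonneg by (intro mult_mono) auto
  then show ?thesis unfolding wt_def clamp_def by linarith
qed

lemma wt_zero_mono: "wt r i = 0 \<Longrightarrow> i \<le> j \<Longrightarrow> wt r j = 0"
  using wt_antimono[of i j r] wt_bounds[of r j] by simp

lemma wt_posD: "wt r j \<noteq> 0 \<Longrightarrow> delta r j < 1 / 8"
proof -
  assume "wt r j \<noteq> 0"
  then have "16 * ((real j + 1) * delta r j) < 2" unfolding wt_def clamp_def by linarith
  moreover have "delta r j \<le> (real j + 1) * delta r j"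
    using mult_right_mono[OF _ delta_nonneg[of r j], of 1 "real j + 1"] by simp
  ultimately show ?thesis by linarith
qed

lemma wt_one: "(real j + 1) * delta r j \<le> 1 / 16 \<Longrightarrow> wt r j = 1"
  unfolding wt_def clamp_def by linarith

lemma wt_zero: "(real j + 1) * delta r j \<ge> 1 / 8 \<Longrightarrow> wt r j = 0"
  unfolding wt_def clamp_def by linarith

lemma wt_cong: "(\<And>a. a \<in> A j \<Longrightarrow> r a = r' a) \<Longrightarrow> wt r j = wt r' j"
  unfolding wt_def using delta_cong[of j r r'] by simp

text \<open>The Archimedean property gives the least \<open>L\<close>. The strict inequality at
  \<open>L\<close> survives small perturbations of \<open>r\<close>; the bound 1/8 below
  \<open>L\<close> keeps every earlier stage in the range where rounding works.\<close>

lemma integral_or_wt_zero: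
  obtains "\<And>j. delta r j = 0" | L where "1 / 8 < (real L + 1) * delta r L"
    "\<And>j. j < L \<Longrightarrow> (real j + 1) * delta r j \<le> 1 / 8"
proof (cases "\<forall>j. delta r j = 0")
  case False
  then obtain i where i: "delta r i > 0" using delta_nonneg by (metis less_eq_real_def)
  obtain n :: nat where n: "1 / 8 < real n * delta r i"
    using reals_Archimedean3[OF i] by blast
  have "real n * delta r i \<le> (real (max i n) + 1) * delta r (max i n)"
    using delta_mono[of i "max i n" r] i by (intro mult_mono) auto
  then have ex: "\<exists>L. 1 / 8 < (real L + 1) * delta r L" using n by (intro exI[of _ "max i n"]) simp
  define L where "L = (LEAST L. 1 / 8 < (real L + 1) * delta r L)"
  have "1 / 8 < (real L + 1) * delta r L" unfolding L_def using ex by (rule LeastI_ex)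
  moreover have "(real j + 1) * delta r j \<le> 1 / 8" if "j < L" for j
    using not_less_Least[of j "\<lambda>L. 1 / 8 < (real L + 1) * delta r L"] that
    unfolding L_def by linarith
  ultimately show thesis using that(2) by blast
qed (use that(1) in blast)

lemma interp_upto:
  assumes "wt r L = 0"
  shows "interp r v = v 0 + (\<Sum>j<L. wt r j * (v (Suc j) - v j))"
proof -
  define K where "K = (LEAST j. wt r j = 0)"
  have K: "wt r K = 0" "K \<le> L"
    using assms LeastI[of "\<lambda>j. wt r j = 0" L] Least_le[of "\<lambda>j. wt r j = 0" L] by (auto simp: K_def)
  have "(\<Sum>j<K. wt r j * (v (Suc j) - v j)) = (\<Sum>j<L. wt r j * (v (Suc j) - v j))"
    using K wt_zero_mono[OF K(1)] by (intro sum.mono_neutral_left) auto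
  then show ?thesis using assms unfolding interp_def K_def[symmetric] by auto
qed

lemma interp_integral:
  assumes "\<And>j. delta r j = 0"
  shows "interp r v = Inf {b. \<exists>n. \<forall>i\<ge>n. v i \<le> b}"
  using wt_one[of _ r] assms by (simp add: interp_def)

text \<open>The value \<open>v i\<close> can enter only while some weight before \<open>i\<close>
  survives, and then every earlier \<open>delta\<close> is at most 1/8. In the integral case the
  hypothesis covers all \<open>i\<close>.\<close>

lemma interp_cong:
  assumes "\<And>i. (\<And>j. j < i \<Longrightarrow> delta r j < 1 / 4) \<Longrightarrow> v i = v' i"
  shows "interp r v = interp r v'"
proof (rule integral_or_wt_zero[of r])
  assume "\<And>j. delta r j = 0"
  then have "v = v'" using assms by (intro ext) simp
  then show ?thesis by simp
next
  fix L assume "1 / 8 < (real L + 1) * delta r L" and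
    small: "\<And>j. j < L \<Longrightarrow> (real j + 1) * delta r j \<le> 1 / 8"
  then have L: "wt r L = 0" using wt_zero[of L r] by simp
  have "v i = v' i" if "i \<le> L" for i
  proof (rule assms)
    fix j assume "j < i"
    have "delta r j \<le> (real j + 1) * delta r j"
      using mult_right_mono[OF _ delta_nonneg[of r j], of 1 "real j + 1"] by simp
    then show "delta r j < 1 / 4" using small[of j] \<open>j < i\<close> that by simp
  qed
  then show ?thesis unfolding interp_upto[OF L] by auto
qed

lemma interp_cong_r:
  assumes "\<And>a j. a \<in> A j \<Longrightarrow> r a = r' a"
  shows "interp r v = interp r' v"
proof -
  have "wt r = wt r'" using wt_cong[of _ r r'] assms by blast
  then show ?thesis by (simp add: interp_def)
qed

text \<open>While the weights are 1 the sum telescopes to \<open>v N\<close>; afterwards decreasing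
  weights make it a convex combination of later values. Without a vanishing weight, the upper limit
  obeys the same bound.\<close>

lemma interp_enclosed:
  assumes one: "\<And>j. j < N \<Longrightarrow> wt r j = 1" and v: "\<And>i. i \<ge> N \<Longrightarrow> \<bar>v i - u\<bar> \<le> e"
  shows "\<bar>interp r v - u\<bar> \<le> e"
proof (cases "\<exists>j. wt r j = 0")
  case True
  then obtain L where L: "wt r L = 0" by blast
  then have "N \<le> L" using one by (metis leI zero_neq_one)
  have "e \<ge> 0" using v[of N] by simp
  define S where "S n = v 0 + (\<Sum>j<n. wt r j * (v (Suc j) - v j))" for n
  have pre: "S n = v n" if "n \<le> N" for n
    using that by (induction n) (auto simp: S_def one)
  \<comment> \<open>The weight still carried by \<open>v n\<close> in the partial sum. For
    \<open>N = 0\<close> the expression \<open>n - 1\<close> would read \<open>wt r 0\<close> at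
    \<open>N\<close>, hence the separate value 1.\<close>
  define w where "w n = (if n = N then 1 else wt r (n - 1))" for n
  have "\<bar>S n - u - w n * (v n - u)\<bar> \<le> (1 - w n) * e" if "n \<ge> N" for n
    using that
  proof (induction n rule: dec_induct)
    case base
    then show ?case using pre by (simp add: w_def)
  next
    case (step n)
    have w': "w (Suc n) = wt r n" using step by (simp add: w_def)
    have le: "0 \<le> w n - wt r n" using wt_antimono[of "n - 1" n r] wt_bounds[of r n] by (auto simp: w_def)
    have "S (Suc n) - u - wt r n * (v (Suc n) - u) = (S n - u - w n * (v n - u)) + (w n - wt r n) * (v n - u)"
      by (simp add: S_def algebra_simps)
    also have "\<bar>\<dots>\<bar> \<le> (1 - w n) * e + (w n - wt r n) * e"
      using step.IH mult_left_mono[OF v[of n] le] step le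
      by (intro order_trans[OF abs_triangle_ineq] add_mono) (auto simp: abs_mult)
    finally show ?case by (simp add: w' algebra_simps)
  qed
  \<comment> \<open>At \<open>Suc L\<close> the remaining weight is \<open>wt r L\<close>, which is
    zero, so the bound becomes plain \<open>e\<close>.\<close>
  from this[OF le_SucI[OF \<open>N \<le> L\<close>]] \<open>N \<le> L\<close> L
  have "\<bar>S (Suc L) - u\<bar> \<le> e" by (simp add: w_def)
  then show ?thesis
    using interp_upto[OF L] L by (simp add: S_def)
next
  case False
  then have eq: "interp r v = Inf {b. \<exists>n. \<forall>i\<ge>n. v i \<le> b}" by (simp add: interp_def)
  have up: "u + e \<in> {b. \<exists>n. \<forall>i\<ge>n. v i \<le> b}"
  proof -
    have "v i \<le> u + e" if "i \<ge> N" for i using v[OF that] by linarith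
    then show ?thesis by blast
  qed
  have low: "u - e \<le> b" if "b \<in> {b. \<exists>n. \<forall>i\<ge>n. v i \<le> b}" for b
  proof -
    from that obtain n where "\<forall>i\<ge>n. v i \<le> b" by auto
    then have "v (max n N) \<le> b" by simp
    then show ?thesis using v[of "max n N"] by simp
  qed
  have "interp r v \<le> u + e" unfolding eq using up low by (intro cInf_lower bdd_belowI) auto
  moreover have "u - e \<le> interp r v" unfolding eq using up low by (intro cInf_greatest) blast+
  ultimately show ?thesis by (simp add: abs_le_iff)
qed

section \<open>Sets of possible interpolated values\<close>

definition vals :: "('i \<Rightarrow> real set) \<Rightarrow> (nat \<Rightarrow> real set) \<Rightarrow> real set" where
  "vals R J = {interp r v | r v. (\<forall>a\<in>\<Union>(range A). r a \<in> R a) \<and> (\<forall>i. v i \<in> J i)}"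

lemma vals_mono:
  "(\<And>a. a \<in> \<Union>(range A) \<Longrightarrow> R a \<subseteq> R' a) \<Longrightarrow> (\<And>i. J i \<subseteq> J' i) \<Longrightarrow> vals R J \<subseteq> vals R' J'"
  unfolding vals_def by (clarsimp simp: subset_iff) metis

lemma vals_nonempty:
  assumes "\<And>a. a \<in> \<Union>(range A) \<Longrightarrow> R a \<noteq> {}" "\<And>i. J i \<noteq> {}"
  shows "vals R J \<noteq> {}"
proof -
  have "\<exists>r. \<forall>a\<in>\<Union>(range A). r a \<in> R a" using assms(1) by (intro bchoice) blast
  moreover have "\<exists>v. \<forall>i. v i \<in> J i" using assms(2) by (intro choice) blast
  ultimately show ?thesis unfolding vals_def by blast
qed

text \<open>If \<open>r\<close> is integral, more and more leading weights become 1 and only the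
  values near their limit remain. Otherwise a weight vanishes near \<open>r\<close>, and the
  interpolation is a continuous expression in finitely many enclosed quantities.\<close>

lemma vals_shrink:
  fixes R :: "nat \<Rightarrow> 'i \<Rightarrow> real set" and J :: "nat \<Rightarrow> nat \<Rightarrow> real set"
  assumes R_anti: "\<And>m n a. m \<le> n \<Longrightarrow> a \<in> \<Union>(range A) \<Longrightarrow> R n a \<subseteq> R m a"
    and J_anti: "\<And>m n i. m \<le> n \<Longrightarrow> J n i \<subseteq> J m i"
    and R_conv: "\<And>a e. a \<in> \<Union>(range A) \<Longrightarrow> e > 0 \<Longrightarrow> \<exists>m. R m a \<subseteq> {r a - e..r a + e}"
    and J_int: "(\<And>j. delta r j = 0) \<Longrightarrow> \<exists>u. \<forall>e>0. \<exists>m N. \<forall>i\<ge>N. J m i \<subseteq> {u - e..u + e}"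
    and J_conv: "\<And>i. (\<And>j. j < i \<Longrightarrow> delta r j < 1 / 4) \<Longrightarrow> \<exists>u. \<forall>e>0. \<exists>m. J m i \<subseteq> {u - e..u + e}"
  shows "\<exists>w. \<forall>e>0. \<exists>m. vals (R m) (J m) \<subseteq> {w - e..w + e}"
proof -
  define Box where "Box m = {(r, v). (\<forall>a\<in>\<Union>(range A). r a \<in> R m a) \<and> (\<forall>i. v i \<in> J m i)}" for m
  \<comment> \<open>The filter generated by the boxes of compatible data turns shrinking enclosures
    into ordinary limits.\<close>
  define \<F> where "\<F> = (INF m. principal (Box m))"
  have Box_anti: "Box n \<subseteq> Box m" if "m \<le> n" for m n
    unfolding Box_def using R_anti[OF that] J_anti[OF that] by blast
  have ev: "eventually P \<F> \<longleftrightarrow> (\<exists>m. \<forall>x\<in>Box m. P x)" for P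
    unfolding \<F>_def
  proof (subst eventually_INF_base)
    show "\<exists>x\<in>UNIV. principal (Box x) \<le> inf (principal (Box m)) (principal (Box n))" for m n
      using Box_anti[of m "max m n"] Box_anti[of n "max m n"] by (intro bexI[of _ "max m n"]) auto
  qed (auto simp: eventually_principal)
  have r_tendsto: "((\<lambda>x. fst x a) \<longlongrightarrow> r a) \<F>" if a: "a \<in> \<Union>(range A)" for a
  proof (rule tendstoI)
    fix e :: real assume "e > 0"
    then obtain m where "R m a \<subseteq> {r a - e / 2..r a + e / 2}" using R_conv[OF a, of "e / 2"] by auto
    then have "dist (fst x a) (r a) < e" if "x \<in> Box m" for x
      using that a \<open>e > 0\<close> by (fastforce simp: Box_def dist_real_def abs_le_iff)
    then show "\<forall>\<^sub>F x in \<F>. dist (fst x a) (r a) < e" unfolding ev by blast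
  qed
  have delta_tendsto: "((\<lambda>x. delta (fst x) j) \<longlongrightarrow> delta r j) \<F>" for j
  proof (rule tendstoI)
    fix e :: real assume "e > 0"
    have "\<forall>\<^sub>F x in \<F>. dist (fst x a) (r a) < e / 2" if "a \<in> A j" for a
      by (rule tendstoD[OF r_tendsto]) (use that \<open>e > 0\<close> in auto)
    then have "\<forall>\<^sub>F x in \<F>. \<forall>a\<in>A j. dist (fst x a) (r a) < e / 2"
      by (intro eventually_ball_finite A_finite) auto
    then show "\<forall>\<^sub>F x in \<F>. dist (delta (fst x) j) (delta r j) < e"
    proof eventually_elim
      case (elim x)
      then have "delta (fst x) j \<le> delta r j + e / 2" "delta r j \<le> delta (fst x) j + e / 2"
        by (intro delta_lipschitz; simp add: dist_real_def abs_minus_commute less_imp_le)+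
      then show ?case using \<open>e > 0\<close> by (simp add: dist_real_def abs_less_iff)
    qed
  qed
  have key: "\<exists>m. vals (R m) (J m) \<subseteq> {w - e..w + e}"
    if "\<forall>\<^sub>F x in \<F>. \<bar>interp (fst x) (snd x) - w\<bar> \<le> e" for w e
    using that unfolding ev vals_def Box_def by (fastforce simp: abs_le_iff)
  show ?thesis
  proof (rule integral_or_wt_zero[of r])
    assume int: "\<And>j. delta r j = 0"
    then obtain u where u: "\<And>e. e > 0 \<Longrightarrow> \<exists>m N. \<forall>i\<ge>N. J m i \<subseteq> {u - e..u + e}"
      using J_int by blast
    have "\<exists>m. vals (R m) (J m) \<subseteq> {u - e..u + e}" if e: "e > 0" for e
    proof (rule key)
      obtain m N where mN: "\<And>i. i \<ge> N \<Longrightarrow> J m i \<subseteq> {u - e..u + e}" using u[OF e] by blast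
      have "\<forall>\<^sub>F x in \<F>. wt (fst x) j = 1" for j
      proof -
        have "\<forall>\<^sub>F x in \<F>. delta (fst x) j < 1 / (16 * (real j + 1))"
          by (rule order_tendstoD(2)[OF delta_tendsto]) (simp add: int)
        then show ?thesis
          by eventually_elim (rule wt_one, simp add: field_simps)
      qed
      then have "\<forall>\<^sub>F x in \<F>. \<forall>j\<in>{..<N}. wt (fst x) j = 1"
        by (intro eventually_ball_finite) auto
      moreover have "\<forall>\<^sub>F x in \<F>. \<forall>i\<ge>N. snd x i \<in> {u - e..u + e}"
        unfolding ev using mN by (intro exI[of _ m]) (force simp: Box_def)
      ultimately show "\<forall>\<^sub>F x in \<F>. \<bar>interp (fst x) (snd x) - u\<bar> \<le> e"
      proof eventually_elim
        case (elim x)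
        show ?case
          by (rule interp_enclosed[of N]) (use elim in \<open>auto simp: abs_le_iff algebra_simps\<close>)
      qed
    qed
    then show ?thesis by blast
  next
    fix L assume L: "1 / 8 < (real L + 1) * delta r L"
      and small: "\<And>j. j < L \<Longrightarrow> (real j + 1) * delta r j \<le> 1 / 8"
    have "\<exists>u. \<forall>e>0. \<exists>m. J m i \<subseteq> {u - e..u + e}" if "i \<le> L" for i
    proof (rule J_conv)
      fix j assume "j < i"
      have "delta r j \<le> (real j + 1) * delta r j"
        using mult_right_mono[OF _ delta_nonneg[of r j], of 1 "real j + 1"] by simp
      then show "delta r j < 1 / 4" using small[of j] \<open>j < i\<close> that by simp
    qed
    then obtain u where u: "\<And>i e. i \<le> L \<Longrightarrow> e > 0 \<Longrightarrow> \<exists>m. J m i \<subseteq> {u i - e..u i + e}"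
      by metis
    have v_tendsto: "((\<lambda>x. snd x i) \<longlongrightarrow> u i) \<F>" if i: "i \<le> L" for i
    proof (rule tendstoI)
      fix e :: real assume "e > 0"
      then obtain m where "J m i \<subseteq> {u i - e / 2..u i + e / 2}" using u[OF i, of "e / 2"] by auto
      then have "dist (snd x i) (u i) < e" if "x \<in> Box m" for x
        using that \<open>e > 0\<close> by (fastforce simp: Box_def dist_real_def abs_le_iff)
      then show "\<forall>\<^sub>F x in \<F>. dist (snd x i) (u i) < e" unfolding ev by blast
    qed
    have wt_tendsto: "((\<lambda>x. wt (fst x) j) \<longlongrightarrow> wt r j) \<F>" for j
      unfolding wt_def clamp_def by (intro tendsto_intros delta_tendsto)
    define w where "w = u 0 + (\<Sum>j<L. wt r j * (u (Suc j) - u j))"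
    have "((\<lambda>x. snd x 0 + (\<Sum>j<L. wt (fst x) j * (snd x (Suc j) - snd x j))) \<longlongrightarrow> w) \<F>"
      unfolding w_def by (intro tendsto_intros wt_tendsto v_tendsto) auto
    moreover have "\<forall>\<^sub>F x in \<F>. snd x 0 + (\<Sum>j<L. wt (fst x) j * (snd x (Suc j) - snd x j)) =
        interp (fst x) (snd x)"
    proof -
      \<comment> \<open>Strictness matters: the weight at \<open>L\<close> then vanishes throughout
        a box around \<open>r\<close>.\<close>
      have "1 / (8 * (real L + 1)) < delta r L" using L by (simp add: field_simps)
      then have "\<forall>\<^sub>F x in \<F>. 1 / (8 * (real L + 1)) < delta (fst x) L"
        by (rule order_tendstoD(1)[OF delta_tendsto])
      then show ?thesis
      proof eventually_elim
        case (elim x)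
        then have "wt (fst x) L = 0" by (intro wt_zero) (simp add: field_simps)
        then show ?case by (simp add: interp_upto)
      qed
    qed
    ultimately have lim: "((\<lambda>x. interp (fst x) (snd x)) \<longlongrightarrow> w) \<F>"
      by (rule Lim_transform_eventually)
    have "\<exists>m. vals (R m) (J m) \<subseteq> {w - e..w + e}" if "e > 0" for e
    proof (rule key)
      show "\<forall>\<^sub>F x in \<F>. \<bar>interp (fst x) (snd x) - w\<bar> \<le> e"
        using tendstoD[OF lim that] by eventually_elim (simp add: dist_real_def)
    qed
    then show ?thesis by blast
  qed
qed

end

section \<open>Continuous regularization\<close>

text \<open>The maps \<open>h m\<close> need only be jointly monotone: evaluating them at deflations
  of finite range makes the supremum Scott continuous.\<close>

definition reg :: "'b rel \<Rightarrow> (nat \<Rightarrow> 'a \<Rightarrow> 'a) \<Rightarrow> (nat \<Rightarrow> 'a \<Rightarrow> 'b) \<Rightarrow> 'a \<Rightarrow> 'b" where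
  "reg s p h y = (THE x. is_lub_in s (range (\<lambda>m. h m (p m y))) x)"

locale regularization = r: sfp r p + s: sfp s q
  for r :: "'a rel" and p and s :: "'b rel" and q +
  fixes h :: "nat \<Rightarrow> 'a \<Rightarrow> 'b"
  assumes h_mono: "m \<le> n \<Longrightarrow> (x, y) \<in> r \<Longrightarrow> (h m x, h n y) \<in> s"
begin

lemma chain:
  assumes "y \<in> Field r" "m \<le> n"
  shows "(h m (p m y), h n (p n y)) \<in> s"
  using h_mono[OF assms(2) r.p_chain[OF assms]] .

lemma directed_chain:
  assumes y: "y \<in> Field r"
  shows "directed_in s (range (\<lambda>m. h m (p m y)))"
  unfolding directed_in_def
proof (intro conjI ballI)
  have "h m (p m y) \<in> Field s" for m using FieldI1[OF chain[OF y order_refl]] .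
  then show "range (\<lambda>m. h m (p m y)) \<subseteq> Field s" by blast
  fix u v assume "u \<in> range (\<lambda>m. h m (p m y))" "v \<in> range (\<lambda>m. h m (p m y))"
  then obtain m n where "u = h m (p m y)" "v = h n (p n y)" by blast
  then show "\<exists>w\<in>range (\<lambda>m. h m (p m y)). (u, w) \<in> s \<and> (v, w) \<in> s"
    using chain[OF y, of m "max m n"] chain[OF y, of n "max m n"] by auto
qed auto

lemma reg_lub:
  assumes y: "y \<in> Field r"
  shows "is_lub_in s (range (\<lambda>m. h m (p m y))) (reg s p h y)"
proof -
  obtain x where x: "is_lub_in s (range (\<lambda>m. h m (p m y))) x"
    using s.has_lub[OF directed_chain[OF y]] by blast
  show ?thesis
    unfolding reg_def by (rule theI[of _ x]) (use x s.lub_unique in auto)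
qed

lemma reg_ge: "y \<in> Field r \<Longrightarrow> (h m (p m y), reg s p h y) \<in> s"
  using reg_lub[of y] unfolding is_lub_in_def by blast

lemma reg_field: "y \<in> Field r \<Longrightarrow> reg s p h y \<in> Field s"
  using reg_lub[of y] unfolding is_lub_in_def by blast

lemma reg_att:
  assumes y: "y \<in> Field r"
  shows "\<exists>m. q i (reg s p h y) = q i (h m (p m y))"
  using s.p_att[OF directed_chain[OF y] reg_lub[OF y]] by auto

lemma cnt_reg: "cnt r p s q (reg s p h)"
  unfolding cnt_def
proof (intro conjI allI impI ballI)
  fix x y assume xy: "(x, y) \<in> r"
  then have x: "x \<in> Field r" and y: "y \<in> Field r" by (auto intro: FieldI1 FieldI2)
  have "(h m (p m x), reg s p h y) \<in> s" for m
    using h_mono[OF order_refl r.p_mono[OF xy]] reg_ge[OF y] by (rule s.ord_trans)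
  then show "(reg s p h x, reg s p h y) \<in> s"
    using reg_lub[OF x] reg_field[OF y] unfolding is_lub_in_def by blast
next
  fix x i assume x: "x \<in> Field r"
  obtain m where m: "q i (reg s p h x) = q i (h m (p m x))" using reg_att[OF x] by blast
  \<comment> \<open>The \<open>m\<close>-th term reads only \<open>p m x\<close>, so it is unchanged
    when \<open>x\<close> is replaced by a suitable approximation.\<close>
  obtain j where j: "p m x = p m (p j x)" using r.p_p_att[OF x] by blast
  have "(q i (h m (p m x)), h m (p m x)) \<in> s"
    using s.p_le FieldI1[OF chain[OF x order_refl]] by blast
  moreover have "(h m (p m x), reg s p h (p j x)) \<in> s"
    using reg_ge[OF r.p_field[OF x], of m j] j by simp
  ultimately have "(q i (reg s p h x), reg s p h (p j x)) \<in> s"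
    unfolding m by (rule s.ord_trans)
  then show "\<exists>j. (q i (reg s p h x), reg s p h (p j x)) \<in> s" ..
qed

end

section \<open>Type structures over the reals\<close>

text \<open>For the smoothened hierarchy this is its consistency relation, see
  \<open>S_sim_rsim\<close>. It is formed for every type structure, so that the embeddings are shown
  to respect it only once.\<close>

primrec rsim :: "(nat \<Rightarrow> 'b hval rel) \<Rightarrow> ('b hval \<Rightarrow> real set) \<Rightarrow>
    nat \<Rightarrow> 'b hval \<Rightarrow> 'b hval \<Rightarrow> bool" where
  "rsim D I 0 x y \<longleftrightarrow> x \<in> Field (D 0) \<and> y \<in> Field (D 0) \<and> I x \<inter> I y \<noteq> {}"
| "rsim D I (Suc k) f g \<longleftrightarrow> f \<in> Field (D (Suc k)) \<and> g \<in> Field (D (Suc k)) \<and>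
     (\<forall>x y. rsim D I k x y \<longrightarrow> I (app f x) \<inter> I (app g y) \<noteq> {})"

definition same_real :: "'b hval rel \<Rightarrow> ('b hval \<Rightarrow> real set) \<Rightarrow> 'b hval \<Rightarrow> 'b hval \<Rightarrow> bool" where
  "same_real B I x y \<longleftrightarrow> x \<in> Field B \<and> y \<in> Field B \<and> (\<exists>v. I x = {v} \<and> I y = {v})"

text \<open>A finite set of total objects of level \<open>l\<close> that represents the values of
  \<open>tau l 0, \<dots>, tau l j\<close>.\<close>

definition samples :: "nat \<Rightarrow> nat \<Rightarrow> nat option hval set" where
  "samples l j = insert (N_zero l) (\<Union>i\<le>j. SOME X. finite X \<and> (\<forall>a\<in>X. eqN l a a) \<and>
     (\<forall>z. eqN l z z \<longrightarrow> (\<exists>a\<in>X. eqN l (tau l i z) a)))"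

lemma
  shows samples_total: "a \<in> samples l j \<Longrightarrow> eqN l a a"
    and samples_finite: "finite (samples l j)"
    and samples_tau: "eqN l z z \<Longrightarrow> i \<le> j \<Longrightarrow> \<exists>a\<in>samples l j. eqN l (tau l i z) a"
proof -
  define X where "X i = (SOME X. finite X \<and> (\<forall>a\<in>X. eqN l a a) \<and>
     (\<forall>z. eqN l z z \<longrightarrow> (\<exists>a\<in>X. eqN l (tau l i z) a)))" for i
  have X: "finite (X i) \<and> (\<forall>a\<in>X i. eqN l a a) \<and>
     (\<forall>z. eqN l z z \<longrightarrow> (\<exists>a\<in>X i. eqN l (tau l i z) a))" for i
    unfolding X_def using tau_finite[of l i] by (rule someI_ex)
  have eq: "samples l j = insert (N_zero l) (\<Union>i\<le>j. X i)" for j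
    unfolding samples_def X_def ..
  show "a \<in> samples l j \<Longrightarrow> eqN l a a" using X eqN_zero by (auto simp: eq)
  show "finite (samples l j)" using X by (simp add: eq)
  show "eqN l z z \<Longrightarrow> i \<le> j \<Longrightarrow> \<exists>a\<in>samples l j. eqN l (tau l i z) a"
    using X[of i] by (auto simp: eq)
qed

interpretation smp: index_sets "samples l" for l
proof
  show "samples l j \<noteq> {}" "i \<le> j \<Longrightarrow> samples l i \<subseteq> samples l j" for i j
    unfolding samples_def by auto
qed (rule samples_finite)

text \<open>The object \<open>b\<close> rounds the real-valued functional \<open>Y\<close> with arguments truncated by \<open>tau\<close>.\<close>

definition approximates :: "nat \<Rightarrow> (nat option hval \<Rightarrow> real) \<Rightarrow> nat \<Rightarrow> nat option hval \<Rightarrow> bool" where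
  "approximates k Y i b \<longleftrightarrow> eqN k b b \<and> (i = 0 \<longrightarrow> b = N_zero k) \<and>
     (\<forall>j z. i = Suc j \<longrightarrow> eqN (k - 1) z z \<longrightarrow>
        (\<exists>m. nval k b z = Num m \<and> \<bar>Y (tau (k - 1) j z) - real m\<bar> < 1 / 4))"

lemma eqN_nvalI:
  assumes x: "x \<in> Field (N_dom k)" and y: "y \<in> Field (N_dom k)"
    and num: "\<And>z z'. eqN (k - 1) z z' \<Longrightarrow> \<exists>m. nval k x z = Num m \<and> nval k y z' = Num m"
  shows "eqN k x y"
proof (cases k)
  case 0
  then show ?thesis using num[of "Num 0" "Num 0"] by (auto simp: eqN_0)
next
  case (Suc l)
  then show ?thesis using assms by (auto simp: eqN_Suc)
qed

text \<open>Two naturals within 1/4 of the same real are equal, so an approximant depends only on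
  the values of the functional at total arguments.\<close>

lemma approximates_unique:
  assumes b: "approximates k Y i b" and b': "approximates k Y' i b'"
    and Y: "\<And>z. eqN (k - 1) z z \<Longrightarrow> Y z = Y' z"
  shows "eqN k b b'"
proof (cases i)
  case 0
  then show ?thesis using b b' eqN_zero by (simp add: approximates_def)
next
  case (Suc j)
  have tb: "eqN k b b" and tb': "eqN k b' b'" using b b' by (auto simp: approximates_def)
  show ?thesis
  proof (rule eqN_nvalI)
    show "b \<in> Field (N_dom k)" "b' \<in> Field (N_dom k)" using tb tb' eqN_field by auto
    fix z z' assume zz: "eqN (k - 1) z z'"
    have z: "eqN (k - 1) z z" using zz eqN_refl1 by blast
    obtain m where m: "nval k b z = Num m" "\<bar>Y (tau (k - 1) j z) - real m\<bar> < 1 / 4"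
      using b z Suc unfolding approximates_def by blast
    obtain m' where m': "nval k b' z = Num m'" "\<bar>Y' (tau (k - 1) j z) - real m'\<bar> < 1 / 4"
      using b' z Suc unfolding approximates_def by blast
    have "\<bar>real m - real m'\<bar> < 1" using m(2) m'(2) Y[OF eqN_tau[OF z], of j] by linarith
    then have "m = m'" by linarith
    moreover have "nval k b' z' = nval k b' z"
      using tb' zz by (cases k) (auto simp: eqN_Suc, metis)
    ultimately show "\<exists>m. nval k b z = Num m \<and> nval k b' z' = Num m" using m(1) m'(1) by simp
  qed
qed

text \<open>A specification of the value that mentions neither hierarchy: both realizers satisfy it,
  and uniqueness makes them agree.\<close>

definition interpolates :: "nat \<Rightarrow> (nat option hval \<Rightarrow> real) \<Rightarrow> (nat option hval \<Rightarrow> real) \<Rightarrow> real \<Rightarrow> bool" where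
  "interpolates k c Y w \<longleftrightarrow> (\<exists>v. w = smp.interp (k - 1) Y v \<and>
     (\<forall>i. (\<forall>j<i. smp.delta (k - 1) Y j < 1 / 4) \<longrightarrow> (\<exists>b. approximates k Y i b \<and> v i = c b)))"

lemma interpolates_unique:
  assumes w: "interpolates k c Y w" and w': "interpolates k c' Y' w'"
    and Y: "\<And>z. eqN (k - 1) z z \<Longrightarrow> Y z = Y' z"
    and c: "\<And>b b'. eqN k b b' \<Longrightarrow> c b = c' b'"
  shows "w = w'"
proof -
  obtain v where v: "w = smp.interp (k - 1) Y v"
    "\<And>i. (\<And>j. j < i \<Longrightarrow> smp.delta (k - 1) Y j < 1 / 4) \<Longrightarrow> \<exists>b. approximates k Y i b \<and> v i = c b"
    using w unfolding interpolates_def by auto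
  obtain v' where v': "w' = smp.interp (k - 1) Y' v'"
    "\<And>i. (\<And>j. j < i \<Longrightarrow> smp.delta (k - 1) Y' j < 1 / 4) \<Longrightarrow> \<exists>b. approximates k Y' i b \<and> v' i = c' b"
    using w' unfolding interpolates_def by auto
  have d: "smp.delta (k - 1) Y j = smp.delta (k - 1) Y' j" for j
    by (rule smp.delta_cong) (use Y samples_total in blast)
  have "smp.interp (k - 1) Y v = smp.interp (k - 1) Y v'"
  proof (rule smp.interp_cong)
    fix i assume small: "\<And>j. j < i \<Longrightarrow> smp.delta (k - 1) Y j < 1 / 4"
    obtain b where b: "approximates k Y i b" "v i = c b" using v(2)[OF small] by blast
    obtain b' where b': "approximates k Y' i b'" "v' i = c' b'" using v'(2) small d by metis
    show "v i = v' i" using b(2) b'(2) c[OF approximates_unique[OF b(1) b'(1) Y]] by simp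
  qed
  also have "\<dots> = smp.interp (k - 1) Y' v'"
    by (rule smp.interp_cong_r) (use Y samples_total in blast)
  finally show ?thesis using v(1) v'(1) by simp
qed

definition num_set :: "nat option hval \<Rightarrow> real set" where
  "num_set x = (case base_val x of None \<Rightarrow> UNIV | Some m \<Rightarrow> {real m})"

lemma num_set_simps [simp]: "num_set Bot = UNIV" "num_set (Num m) = {real m}"
  by (simp_all add: num_set_def)

lemma num_set_anti: "(x, y) \<in> flatN \<Longrightarrow> num_set y \<subseteq> num_set x"
  by (auto simp: flatN_iff)

definition num_family :: "nat \<Rightarrow> nat option hval \<Rightarrow> nat \<Rightarrow> nat option hval \<Rightarrow> real set" where
  "num_family k x m b = num_set (app (N_p (Suc k) m x) b)"

definition num_val :: "nat option hval \<Rightarrow> nat option hval \<Rightarrow> real" where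
  "num_val x b = the_elem (num_set (app x b))"

text \<open>The first clause is convergence to \<open>c\<close>, already along deflations of a total
  object; the second keeps the true value in every enclosure offered at an approximation. Numerical
  functionals and arbitrary continuous functions both enter \<open>extension\<close> through this
  condition.\<close>

definition encloses :: "nat \<Rightarrow> (nat \<Rightarrow> nat option hval \<Rightarrow> real set) \<Rightarrow> (nat option hval \<Rightarrow> real) \<Rightarrow> bool" where
  "encloses k jj c \<longleftrightarrow>
     (\<forall>b e. eqN k b b \<longrightarrow> e > 0 \<longrightarrow> (\<exists>m n. jj m (N_p k n b) \<subseteq> {c b - e..c b + e})) \<and>
     (\<forall>b b' m. eqN k b b \<longrightarrow> (b', b) \<in> N_dom k \<longrightarrow> c b \<in> jj m b')"

lemma encloses_num_family:
  assumes x: "eqN (Suc k) x x"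
  shows "encloses k (num_family k x) (num_val x)"
  unfolding encloses_def
proof (intro conjI allI impI)
  have xf: "x \<in> Field (N_dom (Suc k))" using eqN_field x by blast
  fix b assume b: "eqN k b b"
  then have bf: "b \<in> Field (N_dom k)" using eqN_field by blast
  obtain u where u: "app x b = Num u" using x b unfolding eqN_Suc by blast
  {
    fix e :: real assume "e > 0"
    obtain n where n: "app x (N_p k n b) = Num u"
      using cnt_flatD[OF N_field_cnt[OF xf] sfp_N bf u] by blast
    obtain m where "app (N_p (Suc k) m x) (N_p k n b) = Num u"
      using cnt_flatD[OF cnt_app_at[OF N.p_field[OF bf]] sfp_N xf n] by blast
    then have "num_family k x m (N_p k n b) = {num_val x b}"
      unfolding num_family_def num_val_def u by simp
    then show "\<exists>m n. num_family k x m (N_p k n b) \<subseteq> {num_val x b - e..num_val x b + e}"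
      using \<open>e > 0\<close> by (intro exI[of _ m] exI[of _ n]) simp
  }
  fix b' m assume b': "(b', b) \<in> N_dom k"
  have "app (N_p (Suc k) m x) b' \<in> Field flatN"
    using N_app_field[OF N.p_field[OF xf] FieldI1[OF b']] .
  then have "app (N_p (Suc k) m x) b' = Bot \<or> app (N_p (Suc k) m x) b' = Num u"
    using N_app_mono[OF N.p_le[OF xf] b'] u unfolding Field_flatN by fastforce
  then show "num_val x b \<in> num_family k x m b'"
    unfolding num_family_def num_val_def u by auto
qed

text \<open>An element \<open>x\<close> of the base domain \<open>B\<close> stands for the set \<open>I x\<close> of reals, \<open>emb\<close> embeds the flat
  natural numbers, and \<open>out A s J\<close> encloses all values \<open>index_sets.interp A r v\<close> where \<open>r\<close> is enclosed
  by \<open>s\<close> and \<open>v\<close> by \<open>J\<close>. The enclosures \<open>J i\<close> are restricted by \<open>okJ\<close>: digit sequences of interpolated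
  values can be given only if each \<open>J i\<close> is unknown or a single natural number.\<close>

locale real_types =
  fixes B :: "'b hval rel" and q :: "nat \<Rightarrow> 'b hval \<Rightarrow> 'b hval" and I :: "'b hval \<Rightarrow> real set"
    and D :: "nat \<Rightarrow> 'b hval rel" and T :: "nat \<Rightarrow> 'b hval set"
    and emb :: "nat option hval \<Rightarrow> 'b hval" and okJ :: "real set \<Rightarrow> bool"
    and out :: "(nat \<Rightarrow> nat option hval set) \<Rightarrow> (nat option hval \<Rightarrow> 'b hval) \<Rightarrow> (nat \<Rightarrow> real set) \<Rightarrow> 'b hval"
  assumes sfp_B: "sfp B q"
    and D_0: "D 0 = B"
    and D_Suc: "D (Suc k) = fs (D k) B (T k)"
    and D_domain: "fun_domain (D k) (lev_p D q k) B q (T k)"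
    and I_nonempty: "x \<in> Field B \<Longrightarrow> I x \<noteq> {}"
    and I_anti: "(x, y) \<in> B \<Longrightarrow> I y \<subseteq> I x"
    and I_open: "x \<in> Field B \<Longrightarrow> I x \<subseteq> {l<..<h} \<Longrightarrow> \<exists>i. I (q i x) \<subseteq> {l<..<h}"
    and I_lim: "x \<in> Field B \<Longrightarrow> (\<And>i. w \<in> I (q i x)) \<Longrightarrow> w \<in> I x"
    and T_smooth: "F \<in> Field (fun_space (D k) B) \<Longrightarrow>
      (\<And>x y. rsim D I k x y \<Longrightarrow> I (app F x) \<inter> I (app F y) \<noteq> {}) \<Longrightarrow> F \<in> T k"
    and cnt_emb: "cnt flatN flat_p B q emb"
    and emb_Num: "I (emb (Num m)) = {real m}"
    and okJ_UNIV: "okJ UNIV" and okJ_nat: "okJ {real m}" and okJ_nonempty: "okJ X \<Longrightarrow> X \<noteq> {}"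
    and out_mono: "index_sets A \<Longrightarrow> (\<And>a. a \<in> \<Union>(range A) \<Longrightarrow> (s a, s' a) \<in> B) \<Longrightarrow>
      (\<And>i. J' i \<subseteq> J i) \<Longrightarrow> (\<And>i. okJ (J i)) \<Longrightarrow> (\<And>i. okJ (J' i)) \<Longrightarrow> (out A s J, out A s' J') \<in> B"
    and out_sound: "index_sets A \<Longrightarrow> (\<And>a. a \<in> \<Union>(range A) \<Longrightarrow> s a \<in> Field B) \<Longrightarrow>
      (\<And>i. okJ (J i)) \<Longrightarrow> index_sets.vals A (\<lambda>a. I (s a)) J \<subseteq> I (out A s J)"
    and out_conv: "index_sets A \<Longrightarrow>
      (\<And>(m::nat) n a. m \<le> n \<Longrightarrow> a \<in> \<Union>(range A) \<Longrightarrow> (ss m a, ss n a) \<in> B) \<Longrightarrow>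
      (\<And>m n i. m \<le> n \<Longrightarrow> JJ n i \<subseteq> JJ m i) \<Longrightarrow> (\<And>m i. okJ (JJ m i)) \<Longrightarrow>
      (\<And>a e. a \<in> \<Union>(range A) \<Longrightarrow> e > 0 \<Longrightarrow> \<exists>m. I (ss m a) \<subseteq> {\<rho> a - e..\<rho> a + e}) \<Longrightarrow>
      ((\<And>j. index_sets.delta A \<rho> j = 0) \<Longrightarrow> \<exists>u. \<forall>e>0. \<exists>m N. \<forall>i\<ge>N. JJ m i \<subseteq> {u - e..u + e}) \<Longrightarrow>
      (\<And>i. (\<And>j. j < i \<Longrightarrow> index_sets.delta A \<rho> j < 1 / 4) \<Longrightarrow> \<exists>u. \<forall>e>0. \<exists>m. JJ m i \<subseteq> {u - e..u + e}) \<Longrightarrow>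
      e > 0 \<Longrightarrow> \<exists>m c. I (out A (ss m) (JJ m)) \<subseteq> {c - e..c + e}"
begin

abbreviation "D_p \<equiv> lev_p D q"
abbreviation "sim \<equiv> rsim D I"
definition "eqD = tot_eq D (same_real B I)"

interpretation B: sfp B q by (rule sfp_B)

lemma sfp_D: "sfp (D k) (D_p k)"
  using D_domain[of k] by (simp add: fun_domain_def sfp_pair_def)

interpretation D: sfp "D k" "D_p k" for k by (rule sfp_D)
interpretation DF: fun_domain "D k" "D_p k" B q "T k" for k by (rule D_domain)

lemma D_field_cnt: "f \<in> Field (D (Suc k)) \<Longrightarrow> cnt (D k) (D_p k) B q (app f)"
  using DF.field_cnt by (simp only: D_Suc)

lemma D_app_field: "f \<in> Field (D (Suc k)) \<Longrightarrow> x \<in> Field (D k) \<Longrightarrow> app f x \<in> Field B"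
  using DF.app_field by (simp only: D_Suc)

lemma D_app_code [simp]: "x \<in> Field (D k) \<Longrightarrow> app (fun_code (Field (D k)) f) x = f x"
  by (rule DF.app_code')

lemma cnt_D_eval:
  "x \<in> Field (D k) \<Longrightarrow> cnt (D (Suc k)) (D_p (Suc k)) B q (\<lambda>f. app f x)"
  using DF.cnt_eval by (simp add: D_Suc)

lemma eqD_0: "eqD 0 x y \<longleftrightarrow> same_real B I x y"
  by (simp add: eqD_def)

lemma eqD_Suc: "eqD (Suc k) f g \<longleftrightarrow> f \<in> Field (D (Suc k)) \<and> g \<in> Field (D (Suc k)) \<and>
     (\<forall>a b. eqD k a b \<longrightarrow> same_real B I (app f a) (app g b))"
  by (simp add: eqD_def)

lemma eqD_field: "eqD k x y \<Longrightarrow> x \<in> Field (D k)" "eqD k x y \<Longrightarrow> y \<in> Field (D k)"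
  by (cases k; auto simp: eqD_0 eqD_Suc same_real_def D_0)+

lemma eqD_sym: "eqD k x y \<Longrightarrow> eqD k y x"
  unfolding eqD_def by (rule tot_eq_sym) (auto simp: same_real_def)

lemma eqD_trans: "eqD k x y \<Longrightarrow> eqD k y z \<Longrightarrow> eqD k x z"
  unfolding eqD_def by (rule tot_eq_trans) (auto simp: same_real_def)

lemma eqD_refl1: "eqD k x y \<Longrightarrow> eqD k x x" and eqD_refl2: "eqD k x y \<Longrightarrow> eqD k y y"
  using eqD_sym eqD_trans by metis+

subsection \<open>Rounding\<close>

text \<open>The intervals of radius 1/4 are open, so rounding happens at a finite approximation, and
  disjoint, so elements sharing a real cannot be rounded differently.\<close>

definition rnd :: "'b hval \<Rightarrow> nat option hval" where
  "rnd x = (if \<exists>m. I x \<subseteq> {real m - 1/4<..<real m + 1/4}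
     then Num (SOME m. I x \<subseteq> {real m - 1/4<..<real m + 1/4}) else Bot)"

lemma rnd_iff:
  assumes "x \<in> Field B"
  shows "rnd x = Num m \<longleftrightarrow> I x \<subseteq> {real m - 1/4<..<real m + 1/4}"
proof -
  have unique: "m = m'" if "I x \<subseteq> {real m - 1/4<..<real m + 1/4}"
    "I x \<subseteq> {real m' - 1/4<..<real m' + 1/4}" for m m'
  proof -
    obtain v where "v \<in> I x" using I_nonempty[OF assms] by blast
    then have "v \<in> {real m - 1/4<..<real m + 1/4}" "v \<in> {real m' - 1/4<..<real m' + 1/4}"
      using that by blast+
    then have "\<bar>real m - real m'\<bar> < 1" by (simp add: abs_less_iff)
    then show ?thesis by linarith
  qed
  show ?thesis
  proof (cases "\<exists>m. I x \<subseteq> {real m - 1/4<..<real m + 1/4}")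
    case True
    then show ?thesis
      using someI_ex[OF True] unique unfolding rnd_def by (metis (lifting) hval.inject(1) option.inject)
  qed (simp add: rnd_def)
qed

lemma rnd_field: "rnd x \<in> Field flatN"
  by (simp add: rnd_def Field_flatN)

lemma cnt_rnd: "cnt B q flatN flat_p rnd"
proof (rule cnt_flatI[OF sfp_B rnd_field])
  show "rnd y = Num m" if "(x, y) \<in> B" "rnd x = Num m" for x y m
    using that I_anti[OF that(1)] rnd_iff[OF FieldI1[OF that(1)]] rnd_iff[OF FieldI2[OF that(1)]]
    by blast
  show "\<exists>j. rnd (q j x) = Num m" if "x \<in> Field B" "rnd x = Num m" for x m
    using I_open[OF that(1)] that rnd_iff B.p_field by blast
qed

lemma rnd_consistent:
  assumes "x \<in> Field B" "y \<in> Field B" "I x \<inter> I y \<noteq> {}" "rnd x = Num m" "rnd y = Num m'"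
  shows "m = m'"
proof -
  obtain v where "v \<in> I x" "v \<in> I y" using assms(3) by blast
  then have "v \<in> {real m - 1/4<..<real m + 1/4}" "v \<in> {real m' - 1/4<..<real m' + 1/4}"
    using assms(4,5) rnd_iff[OF assms(1)] rnd_iff[OF assms(2)] by blast+
  then have "\<bar>real m - real m'\<bar> < 1" by (simp add: abs_less_iff)
  then show ?thesis by linarith
qed

subsection \<open>Probing and rounding functionals\<close>

text \<open>Throughout, \<open>g\<close> embeds level \<open>k - 1\<close> of the Kleene-Kreisel domains into \<open>D (k - 1)\<close>;
  it is irrelevant if \<open>k = 0\<close>.\<close>

primrec probe :: "nat \<Rightarrow> (nat option hval \<Rightarrow> 'b hval) \<Rightarrow> nat option hval \<Rightarrow> 'b hval \<Rightarrow> 'b hval" where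
  "probe 0 g a y = y"
| "probe (Suc l) g a y = app y (g a)"

text \<open>The map \<open>t\<close> is a truncation \<open>tau (k - 1) j\<close> at stage
  \<open>Suc j\<close>, and the identity for the limit of the stages.\<close>

primrec beta_suc :: "nat \<Rightarrow> (nat option hval \<Rightarrow> 'b hval) \<Rightarrow> (nat option hval \<Rightarrow> nat option hval) \<Rightarrow>
    'b hval \<Rightarrow> nat option hval" where
  "beta_suc 0 g t y = rnd y"
| "beta_suc (Suc l) g t y = fun_code (Field (N_dom l)) (\<lambda>z. rnd (app y (g (t z))))"

text \<open>Stage 0 is constant because \<open>v 0\<close> enters the interpolation unconditionally,
  whereas stage \<open>Suc j\<close> counts only if the samples up to \<open>j\<close> are close to
  natural numbers.\<close>

primrec beta :: "nat \<Rightarrow> (nat option hval \<Rightarrow> 'b hval) \<Rightarrow> nat \<Rightarrow> 'b hval \<Rightarrow> nat option hval" where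
  "beta k g 0 y = N_zero k"
| "beta k g (Suc j) y = beta_suc k g (tau (k - 1) j) y"

definition pval :: "nat \<Rightarrow> (nat option hval \<Rightarrow> 'b hval) \<Rightarrow> 'b hval \<Rightarrow> nat option hval \<Rightarrow> real" where
  "pval k g y a = the_elem (I (probe k g a y))"

text \<open>The consistency clause covers partial \<open>a\<close> too; it makes the probes of
  consistent functionals consistent.\<close>

definition good_emb :: "nat \<Rightarrow> (nat option hval \<Rightarrow> 'b hval) \<Rightarrow> bool" where
  "good_emb l g \<longleftrightarrow> cnt (N_dom l) (N_p l) (D l) (D_p l) g \<and>
     (\<forall>a\<in>Field (N_dom l). sim l (g a) (g a)) \<and> (\<forall>a b. eqN l a b \<longrightarrow> eqD l (g a) (g b))"

lemma nval_beta_suc: "z \<in> Field (N_dom (k - 1)) \<Longrightarrow> nval k (beta_suc k g t y) z = rnd (probe k g (t z) y)"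
  by (cases k) auto

context
  fixes k :: nat and g :: "nat option hval \<Rightarrow> 'b hval"
  assumes g: "k > 0 \<Longrightarrow> good_emb (k - 1) g"
begin

lemma g_cnt: "k = Suc l \<Longrightarrow> cnt (N_dom l) (N_p l) (D l) (D_p l) g"
  using g by (simp add: good_emb_def)

lemma g_field: "k = Suc l \<Longrightarrow> a \<in> Field (N_dom l) \<Longrightarrow> g a \<in> Field (D l)"
  using cnt_field[OF g_cnt sfp_N] .

lemma cnt_probe:
  assumes "a \<in> Field (N_dom (k - 1))"
  shows "cnt (D k) (D_p k) B q (probe k g a)"
proof (cases k)
  case 0
  then have "probe k g a = (\<lambda>y. y)" by (intro ext) simp
  then show ?thesis by (simp add: 0 D_0 cnt_id[OF sfp_B])
next
  case (Suc l)
  have "probe (Suc l) g a = (\<lambda>y. app y (g a))" by (intro ext) simp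
  then show ?thesis using cnt_D_eval[OF g_field[OF Suc, of a]] assms Suc by simp
qed

lemma probe_field: "a \<in> Field (N_dom (k - 1)) \<Longrightarrow> y \<in> Field (D k) \<Longrightarrow> probe k g a y \<in> Field B"
  using cnt_field[OF cnt_probe sfp_D] .

lemma probe_same:
  assumes "eqD k y y'" "eqN (k - 1) a a'"
  shows "same_real B I (probe k g a y) (probe k g a' y')"
proof (cases k)
  case 0
  then show ?thesis using assms by (simp add: eqD_0)
next
  case (Suc l)
  then have "eqD l (g a) (g a')" using g assms by (simp add: good_emb_def)
  then show ?thesis using assms(1) unfolding Suc eqD_Suc probe.simps by blast
qed

lemma I_probe:
  assumes "eqD k y y" "eqN (k - 1) a a"
  shows "I (probe k g a y) = {pval k g y a}"
proof -
  obtain v where "I (probe k g a y) = {v}"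
    using probe_same[OF assms] unfolding same_real_def by blast
  then show ?thesis by (simp add: pval_def)
qed

lemma pval_cong:
  assumes "eqD k y y'" "eqN (k - 1) a a'"
  shows "pval k g y a = pval k g y' a'"
proof -
  obtain v where "I (probe k g a y) = {v}" "I (probe k g a' y') = {v}"
    using probe_same[OF assms] unfolding same_real_def by blast
  then show ?thesis by (simp add: pval_def)
qed

lemma probe_sim:
  assumes "sim k y y'" "a \<in> Field (N_dom (k - 1))"
  shows "I (probe k g a y) \<inter> I (probe k g a y') \<noteq> {}"
proof (cases k)
  case 0
  then show ?thesis using assms by simp
next
  case (Suc l)
  then have "sim l (g a) (g a)" using g assms by (simp add: good_emb_def)
  then show ?thesis using assms(1) unfolding Suc rsim.simps probe.simps by blast
qed

lemma cnt_beta_suc: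
  assumes t: "cnt (N_dom (k - 1)) (N_p (k - 1)) (N_dom (k - 1)) (N_p (k - 1)) t"
  shows "cnt (D k) (D_p k) (N_dom k) (N_p k) (beta_suc k g t)"
proof (cases k)
  case 0
  then have "beta_suc k g t = rnd" by (intro ext) simp
  then show ?thesis by (simp add: 0 D_0 N_dom_0 cnt_rnd)
next
  case (Suc l)
  have t': "cnt (N_dom l) (N_p l) (N_dom l) (N_p l) t" using t Suc by simp
  have "cnt (D (Suc l)) (D_p (Suc l)) (N_dom (Suc l)) (N_p (Suc l))
    (\<lambda>y. fun_code (Field (N_dom l)) (\<lambda>z. rnd (app y (g (t z)))))"
  proof (rule N_cntI[OF sfp_D])
    fix y assume y: "y \<in> Field (D (Suc l))"
    show "cnt (N_dom l) (N_p l) flatN flat_p (\<lambda>z. rnd (app y (g (t z))))"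
      by (intro cnt_compose[OF _ cnt_rnd] cnt_compose[OF _ D_field_cnt[OF y]]
          cnt_compose[OF t' g_cnt[OF Suc]] sfp_N sfp_D sfp_B sfp_flatN)
  next
    fix z assume "z \<in> Field (N_dom l)"
    then have "g (t z) \<in> Field (D l)" using g_field[OF Suc] cnt_field[OF t' sfp_N] by blast
    then show "cnt (D (Suc l)) (D_p (Suc l)) flatN flat_p (\<lambda>y. rnd (app y (g (t z))))"
      by (intro cnt_compose[OF _ cnt_rnd] cnt_D_eval sfp_D sfp_B sfp_flatN)
  qed
  moreover have "beta_suc (Suc l) g t = (\<lambda>y. fun_code (Field (N_dom l)) (\<lambda>z. rnd (app y (g (t z)))))"
    by (intro ext) simp
  ultimately show ?thesis by (simp add: Suc)
qed

lemma cnt_beta: "cnt (D k) (D_p k) (N_dom k) (N_p k) (beta k g i)"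
proof (cases i)
  case 0
  then have "beta k g i = (\<lambda>_. N_zero k)" by (intro ext) simp
  then show ?thesis using cnt_const[OF sfp_N eqN_field(1)[OF eqN_zero]] by simp
next
  case (Suc j)
  then have "beta k g i = beta_suc k g (tau (k - 1) j)" by (intro ext) simp
  then show ?thesis using cnt_beta_suc[OF cnt_tau] by simp
qed

lemma beta_field: "y \<in> Field (D k) \<Longrightarrow> beta k g i y \<in> Field (N_dom k)"
  using cnt_field[OF cnt_beta sfp_D] .

text \<open>Consistent objects have probes sharing a real, so their roundings never conflict and
  possess a join. This carries the consistency of arguments over to the number functionals.\<close>

lemma beta_sim:
  assumes sim: "sim k y y'"
  shows "\<exists>h. (beta k g i y, h) \<in> N_dom k \<and> (beta k g i y', h) \<in> N_dom k"
proof (cases i)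
  case 0
  then show ?thesis using N.ord_refl[OF eqN_field(1)[OF eqN_zero]] by auto
next
  case (Suc j)
  have y: "y \<in> Field (D k)" "y' \<in> Field (D k)" using sim by (cases k; simp)+
  show ?thesis
  proof (rule nval_consistent[OF beta_field[OF y(1)] beta_field[OF y(2)]])
    fix z m m' assume z: "z \<in> Field (N_dom (k - 1))"
      and m: "nval k (beta k g i y) z = Num m" "nval k (beta k g i y') z = Num m'"
    have t: "tau (k - 1) j z \<in> Field (N_dom (k - 1))" using tau_field[OF z] .
    show "m = m'"
      by (rule rnd_consistent[OF probe_field[OF t y(1)] probe_field[OF t y(2)] probe_sim[OF sim t]])
        (use m Suc z in \<open>simp_all add: nval_beta_suc\<close>)
  qed
qed

lemma beta_suc_total:
  assumes y: "eqD k y y"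
    and t: "cnt (N_dom (k - 1)) (N_p (k - 1)) (N_dom (k - 1)) (N_p (k - 1)) t"
      "\<And>z z'. eqN (k - 1) z z' \<Longrightarrow> eqN (k - 1) (t z) (t z')"
    and small: "\<And>z. eqN (k - 1) z z \<Longrightarrow> nat_dist (pval k g y (t z)) < 1 / 4"
  shows "eqN k (beta_suc k g t y) (beta_suc k g t y)"
    and "eqN (k - 1) z z \<Longrightarrow>
      \<exists>m. nval k (beta_suc k g t y) z = Num m \<and> \<bar>pval k g y (t z) - real m\<bar> < 1 / 4"
proof -
  have yf: "y \<in> Field (D k)" using eqD_field y by blast
  have num: "\<exists>m. nval k (beta_suc k g t y) z = Num m \<and> nval k (beta_suc k g t y) z' = Num m \<and>
      \<bar>pval k g y (t z) - real m\<bar> < 1 / 4"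
    if zz: "eqN (k - 1) z z'" for z z'
  proof -
    have z: "eqN (k - 1) z z" "eqN (k - 1) z' z'" using zz eqN_refl1 eqN_refl2 by blast+
    obtain m where m: "\<bar>pval k g y (t z) - real m\<bar> < 1 / 4"
      using small[OF z(1)] by (rule nat_dist_lessE)
    have I1: "I (probe k g (t z) y) = {pval k g y (t z)}" using I_probe[OF y t(2)[OF z(1)]] .
    have I2: "I (probe k g (t z') y) = {pval k g y (t z)}"
      using I_probe[OF y t(2)[OF z(2)]] pval_cong[OF y t(2)[OF zz]] by simp
    have f: "probe k g (t z) y \<in> Field B" "probe k g (t z') y \<in> Field B"
      using probe_field[OF _ yf] eqN_field t(2)[OF zz] by blast+
    have zf: "z \<in> Field (N_dom (k - 1))" "z' \<in> Field (N_dom (k - 1))" using eqN_field zz by auto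
    show ?thesis
      unfolding nval_beta_suc[OF zf(1)] nval_beta_suc[OF zf(2)] rnd_iff[OF f(1)] rnd_iff[OF f(2)] I1 I2
      using m abs_less_iff[of "pval k g y (t z) - real m" "1 / 4"]
      by (intro exI[of _ m]) (simp add: algebra_simps)
  qed
  have "beta_suc k g t y \<in> Field (N_dom k)" using cnt_field[OF cnt_beta_suc[OF t(1)] sfp_D yf] .
  then show "eqN k (beta_suc k g t y) (beta_suc k g t y)"
    using num by (intro eqN_nvalI) blast+
  show "eqN (k - 1) z z \<Longrightarrow>
      \<exists>m. nval k (beta_suc k g t y) z = Num m \<and> \<bar>pval k g y (t z) - real m\<bar> < 1 / 4"
    using num by blast
qed

text \<open>Closeness at all truncated arguments reduces to the finitely many samples, as each
  truncation is equivalent to one of them.\<close>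

lemma beta_approximates:
  assumes y: "eqD k y y" and small: "\<And>j. j < i \<Longrightarrow> smp.delta (k - 1) (pval k g y) j < 1 / 4"
  shows "approximates k (pval k g y) i (beta k g i y)"
proof (cases i)
  case 0
  then show ?thesis by (simp add: approximates_def eqN_zero)
next
  case (Suc j)
  have small': "nat_dist (pval k g y (tau (k - 1) j z)) < 1 / 4" if z: "eqN (k - 1) z z" for z
  proof -
    obtain a where a: "a \<in> samples (k - 1) j" "eqN (k - 1) (tau (k - 1) j z) a"
      using samples_tau[OF z order_refl] by blast
    then have "pval k g y (tau (k - 1) j z) = pval k g y a" using pval_cong[OF y] by blast
    then show ?thesis using smp.delta_ge[OF a(1), of "pval k g y"] small[of j] Suc by simp
  qed
  show ?thesis
    using beta_suc_total[OF y cnt_tau eqN_tau small'] Suc by (simp add: approximates_def)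
qed

text \<open>If the samples are exactly natural, rounding without truncation is total as well: the
  value at \<open>z\<close> is a limit of values at truncations of \<open>z\<close>. The truncated
  stages converge to this rounding.\<close>

lemma beta_limit:
  assumes y: "eqD k y y" and int: "\<And>j. smp.delta (k - 1) (pval k g y) j = 0"
  shows "\<exists>b. eqN k b b \<and> (\<forall>n. \<exists>m N. \<forall>i\<ge>N. (N_p k n b, beta k g i (D_p k m y)) \<in> N_dom k)"
proof -
  have yf: "y \<in> Field (D k)" using eqD_field y by blast
  define b where "b = beta_suc k g (\<lambda>z. z) y"
  have cnt_b: "cnt (D k) (D_p k) (N_dom k) (N_p k) (beta_suc k g (\<lambda>z. z))"
    by (rule cnt_beta_suc[OF cnt_id[OF sfp_N]])
  have "eqN k b b"
    unfolding b_def
  proof (rule beta_suc_total(1)[OF y cnt_id[OF sfp_N]])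
    fix z assume z: "eqN (k - 1) z z"
    have zf: "z \<in> Field (N_dom (k - 1))" using eqN_field z by blast
    define v where "v = pval k g y z"
    have Iv: "I (probe k g z y) = {v}" using I_probe[OF y z] by (simp add: v_def)
    have "cnt (N_dom (k - 1)) (N_p (k - 1)) B q (\<lambda>a. probe k g a y)"
    proof (cases k)
      case 0
      then show ?thesis using yf by (simp add: D_0 cnt_const[OF sfp_B])
    next
      case (Suc l)
      then show ?thesis
        using cnt_compose[OF g_cnt[OF Suc] D_field_cnt] yf by (simp add: sfp_N sfp_D sfp_B)
    qed
    note cp = this
    \<comment> \<open>Radius 1/8 places the value at \<open>z\<close> within 1/4 of a sampled value,
      whose distance to the naturals is 0.\<close>
    obtain i where i: "I (q i (probe k g z y)) \<subseteq> {v - 1/8<..<v + 1/8}"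
      using I_open[OF probe_field[OF zf yf], of "v - 1/8" "v + 1/8"] Iv by auto
    obtain n where n: "(q i (probe k g z y), probe k g (N_p (k - 1) n z) y) \<in> B"
      using cnt_approx[OF cp zf] by blast
    have "(N_p (k - 1) n z, tau (k - 1) n z) \<in> N_dom (k - 1)" using p_le_tau[OF order_refl zf] .
    then have "(q i (probe k g z y), probe k g (tau (k - 1) n z) y) \<in> B"
      using cnt_mono[OF cp] n B.ord_trans by blast
    then have sub: "I (probe k g (tau (k - 1) n z) y) \<subseteq> {v - 1/8<..<v + 1/8}"
      using i I_anti by blast
    obtain a where a: "a \<in> samples (k - 1) n" "eqN (k - 1) (tau (k - 1) n z) a"
      using samples_tau[OF z order_refl] by blast
    have "pval k g y (tau (k - 1) n z) = pval k g y a" using pval_cong[OF y a(2)] .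
    moreover have "pval k g y (tau (k - 1) n z) \<in> {v - 1/8<..<v + 1/8}"
      using sub I_probe[OF y eqN_tau[OF z]] by simp
    moreover have "nat_dist (pval k g y a) \<le> 0"
      using smp.delta_ge[OF a(1), of "pval k g y"] int by simp
    ultimately show "nat_dist (pval k g y z) < 1 / 4"
      using nat_dist_lipschitz[of v "pval k g y a"] by (auto simp: v_def abs_le_iff)
  qed simp
  moreover have "\<exists>m N. \<forall>i\<ge>N. (N_p k n b, beta k g i (D_p k m y)) \<in> N_dom k" for n
  proof -
    obtain m where m: "N_p k n b = N_p k n (beta_suc k g (\<lambda>z. z) (D_p k m y))"
      using cnt_att[OF cnt_b sfp_D sfp_N yf] unfolding b_def by blast
    have ym: "D_p k m y \<in> Field (D k)" using D.p_field[OF yf] .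
    \<comment> \<open>Stage \<open>Suc j\<close> truncates arguments by \<open>tau\<close> with
      index \<open>j\<close>, which lies above the \<open>n\<close>-th deflation from
      \<open>j = n\<close> on.\<close>
    have "(N_p k n b, beta k g i (D_p k m y)) \<in> N_dom k" if i: "i \<ge> Suc n" for i
    proof -
      obtain j where j: "i = Suc j" "n \<le> j" using i by (cases i) auto
      show ?thesis
      proof (cases k)
        case 0
        have "beta k g i (D_p k m y) = beta_suc k g (\<lambda>z. z) (D_p k m y)" using j 0 by simp
        then show ?thesis unfolding m using N.p_le cnt_field[OF cnt_b sfp_D ym] by simp
      next
        case (Suc l)
        let ?y = "D_p k m y"
        have yl: "?y \<in> Field (D (Suc l))" using ym Suc by simp
        show ?thesis
          unfolding m unfolding Suc N_rel
        proof (intro conjI ballI)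
          show "N_p (Suc l) n (beta_suc (Suc l) g (\<lambda>z. z) (D_p (Suc l) m y)) \<in> Field (N_dom (Suc l))"
            using N.p_field[OF cnt_field[OF cnt_b sfp_D ym]] Suc by metis
          show "beta (Suc l) g i (D_p (Suc l) m y) \<in> Field (N_dom (Suc l))"
            using beta_field[OF ym] Suc by metis
          fix z assume z: "z \<in> Field (N_dom l)"
          have "(N_p l n z, tau l j z) \<in> N_dom l" using p_le_tau[OF j(2) z] .
          then have "(rnd (app ?y (g (N_p l n z))), rnd (app ?y (g (tau l j z)))) \<in> flatN"
            using cnt_mono[OF cnt_rnd] cnt_mono[OF D_field_cnt[OF yl]] cnt_mono[OF g_cnt[OF Suc]] by blast
          moreover have "(flat_p n (rnd (app ?y (g (N_p l n z)))), rnd (app ?y (g (N_p l n z)))) \<in> flatN"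
            using sfp.p_le[OF sfp_flatN rnd_field] .
          ultimately have "(flat_p n (rnd (app ?y (g (N_p l n z)))), rnd (app ?y (g (tau l j z)))) \<in> flatN"
            by (meson sfp.ord_trans[OF sfp_flatN])
          then show "(app (N_p (Suc l) n (beta_suc (Suc l) g (\<lambda>z. z) (D_p (Suc l) m y))) z,
              app (beta (Suc l) g i (D_p (Suc l) m y)) z) \<in> flatN"
            unfolding N_p_app[OF z] using j(1) z N.p_field[OF z] Suc by simp
        qed
      qed
    qed
    then show ?thesis by blast
  qed
  ultimately show ?thesis by blast
qed

end

subsection \<open>The embeddings of the Kleene-Kreisel functionals\<close>

definition family :: "nat \<Rightarrow> (nat \<Rightarrow> nat option hval \<Rightarrow> real set) \<Rightarrow> bool" where
  "family k jj \<longleftrightarrow> (\<forall>m. \<forall>b\<in>Field (N_dom k). okJ (jj m b)) \<and>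
     (\<forall>m n b b'. m \<le> n \<longrightarrow> (b, b') \<in> N_dom k \<longrightarrow> jj n b' \<subseteq> jj m b)"

definition stage :: "nat \<Rightarrow> (nat option hval \<Rightarrow> 'b hval) \<Rightarrow> (nat \<Rightarrow> nat option hval \<Rightarrow> real set) \<Rightarrow>
    nat \<Rightarrow> 'b hval \<Rightarrow> 'b hval" where
  "stage k g jj m y = out (samples (k - 1)) (\<lambda>a. probe k g a y) (\<lambda>i. jj m (beta k g i y))"

text \<open>The stages are only known to be monotone in \<open>m\<close> and \<open>y\<close>;
  regularization supplies continuity.\<close>

definition extension :: "nat \<Rightarrow> (nat option hval \<Rightarrow> 'b hval) \<Rightarrow> (nat \<Rightarrow> nat option hval \<Rightarrow> real set) \<Rightarrow>
    'b hval \<Rightarrow> 'b hval" where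
  "extension k g jj = reg B (D_p k) (stage k g jj)"

lemma family_num:
  assumes x: "x \<in> Field (N_dom (Suc k))"
  shows "family k (num_family k x)"
  unfolding family_def
proof (intro conjI allI impI ballI)
  show "okJ (num_family k x m b)" if "b \<in> Field (N_dom k)" for m :: nat and b
  proof -
    have "app (N_p (Suc k) m x) b = Bot \<or> (\<exists>u. app (N_p (Suc k) m x) b = Num u)"
      using N_app_field[OF N.p_field[OF x] that] by (simp only: Field_flatN)
    then show ?thesis unfolding num_family_def using okJ_UNIV okJ_nat by (metis num_set_simps)
  qed
  fix m n :: nat and b b' assume mn: "m \<le> n" and b: "(b, b') \<in> N_dom k"
  have "(app (N_p (Suc k) m x) b, app (N_p (Suc k) n x) b) \<in> flatN"
    using N.p_chain[OF x mn] FieldI1[OF b] unfolding N_rel by blast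
  moreover have "(app (N_p (Suc k) n x) b, app (N_p (Suc k) n x) b') \<in> flatN"
    using cnt_mono[OF N_field_cnt[OF N.p_field[OF x]] b] .
  ultimately have "(app (N_p (Suc k) m x) b, app (N_p (Suc k) n x) b') \<in> flatN"
    by (rule sfp.ord_trans[OF sfp_flatN])
  then show "num_family k x n b' \<subseteq> num_family k x m b"
    unfolding num_family_def by (rule num_set_anti)
qed

context
  fixes k :: nat and g :: "nat option hval \<Rightarrow> 'b hval"
  assumes g: "k > 0 \<Longrightarrow> good_emb (k - 1) g"
begin

lemma sample_field: "a \<in> \<Union>(range (samples (k - 1))) \<Longrightarrow> a \<in> Field (N_dom (k - 1))"
  using samples_total eqN_field by blast

lemma regularization_stage:
  assumes jj: "family k jj"
  shows "regularization (D k) (D_p k) B q (stage k g jj)"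
proof (intro regularization.intro regularization_axioms.intro sfp_D sfp_B)
  fix m n :: nat and x y assume mn: "m \<le> n" and xy: "(x, y) \<in> D k"
  have x: "x \<in> Field (D k)" and y: "y \<in> Field (D k)" using xy by (auto intro: FieldI1 FieldI2)
  show "(stage k g jj m x, stage k g jj n y) \<in> B"
    unfolding stage_def
  proof (rule out_mono[OF smp.index_sets_axioms])
    show "(probe k g a x, probe k g a y) \<in> B" if "a \<in> \<Union>(range (samples (k - 1)))" for a
      using cnt_mono[OF cnt_probe[OF g sample_field[OF that]] xy] .
    show "jj n (beta k g i y) \<subseteq> jj m (beta k g i x)" for i
      using jj mn cnt_mono[OF cnt_beta[OF g] xy] unfolding family_def by blast
    show "okJ (jj m (beta k g i x))" "okJ (jj n (beta k g i y))" for i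
      using jj beta_field[OF g x] beta_field[OF g y] unfolding family_def by blast+
  qed
qed

lemma cnt_extension: "family k jj \<Longrightarrow> cnt (D k) (D_p k) B q (extension k g jj)"
  unfolding extension_def by (rule regularization.cnt_reg[OF regularization_stage])

lemma stage_sound:
  assumes jj: "family k jj" and y: "y \<in> Field (D k)"
    and "\<And>a. a \<in> \<Union>(range (samples (k - 1))) \<Longrightarrow> \<rho> a \<in> I (probe k g a y)"
    and "\<And>i. v i \<in> jj m (beta k g i y)"
  shows "smp.interp (k - 1) \<rho> v \<in> I (stage k g jj m y)"
proof -
  have "smp.interp (k - 1) \<rho> v \<in> smp.vals (k - 1) (\<lambda>a. I (probe k g a y)) (\<lambda>i. jj m (beta k g i y))"
    unfolding smp.vals_def using assms(3,4) by blast
  also have "\<dots> \<subseteq> I (stage k g jj m y)"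
    unfolding stage_def
  proof (rule out_sound[OF smp.index_sets_axioms])
    show "probe k g a y \<in> Field B" if "a \<in> \<Union>(range (samples (k - 1)))" for a
      using probe_field[OF g sample_field[OF that] y] .
    show "okJ (jj m (beta k g i y))" for i
      using jj beta_field[OF g y] unfolding family_def by blast
  qed
  finally show ?thesis .
qed

lemma probe_approx:
  assumes y: "y \<in> Field (D k)" and a: "a \<in> Field (N_dom (k - 1))" and v: "I (probe k g a y) = {v}" and "e > 0"
  shows "\<exists>m. I (probe k g a (D_p k m y)) \<subseteq> {v - e..v + e}"
proof -
  obtain i where i: "I (q i (probe k g a y)) \<subseteq> {v - e<..<v + e}"
    using I_open[OF probe_field[OF g a y], of "v - e" "v + e"] v \<open>e > 0\<close> by auto
  obtain m where "(q i (probe k g a y), probe k g a (D_p k m y)) \<in> B"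
    using cnt_approx[OF cnt_probe[OF g a] y] by blast
  then have "I (probe k g a (D_p k m y)) \<subseteq> {v - e<..<v + e}" using i I_anti by blast
  then show ?thesis using greaterThanLessThan_subseteq_atLeastAtMost_iff[of "v - e" "v + e"] \<open>e > 0\<close>
    by (metis order_refl order_trans)
qed

text \<open>The outputs of the stages become arbitrarily small, and one interpolated value lies in
  all of them. Hence it is the only real represented.\<close>

lemma extension_value:
  assumes jj: "family k jj" and c: "encloses k jj c" and y: "eqD k y y"
  shows "\<exists>w. I (extension k g jj y) = {w} \<and> interpolates k c (pval k g y) w"
proof -
  interpret R: regularization "D k" "D_p k" B q "stage k g jj" by (rule regularization_stage[OF jj])
  have yf: "y \<in> Field (D k)" using eqD_field y by blast
  define ss where "ss m a = probe k g a (D_p k m y)" for m a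
  define JJ where "JJ m i = jj m (beta k g i (D_p k m y))" for m i
  have beta_chain: "(beta k g i (D_p k m y), beta k g i (D_p k n y)) \<in> N_dom k" if "m \<le> n" for i m n
    using cnt_mono[OF cnt_beta[OF g] D.p_chain[OF yf that]] .
  have JJ_sub: "JJ n i \<subseteq> jj m b" if "(b, beta k g i (D_p k n' y)) \<in> N_dom k" "n \<ge> m" "n \<ge> n'" for m n n' b i
  proof -
    have "(b, beta k g i (D_p k n y)) \<in> N_dom k"
      using that(1) beta_chain[OF that(3)] N.ord_trans by meson
    then show ?thesis using jj that(2) unfolding JJ_def family_def by blast
  qed
  have conv: "\<exists>m u. I (out (samples (k - 1)) (ss m) (JJ m)) \<subseteq> {u - e..u + e}" if "e > 0" for e
  proof (rule out_conv[OF smp.index_sets_axioms _ _ _ _ _ _ that])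
    show "(ss m a, ss n a) \<in> B" if "m \<le> n" "a \<in> \<Union>(range (samples (k - 1)))" for m n a
      unfolding ss_def
      using cnt_mono[OF cnt_probe[OF g sample_field[OF that(2)]] D.p_chain[OF yf that(1)]] .
    show "JJ n i \<subseteq> JJ m i" if "m \<le> n" for m n i
      using jj that beta_chain[OF that] unfolding JJ_def family_def by blast
    show "okJ (JJ m i)" for m i
      using jj beta_field[OF g D.p_field[OF yf]] unfolding JJ_def family_def by blast
    show "\<exists>m. I (ss m a) \<subseteq> {pval k g y a - e..pval k g y a + e}"
      if "a \<in> \<Union>(range (samples (k - 1)))" "e > 0" for a e
      unfolding ss_def
      using probe_approx[OF yf sample_field[OF that(1)] I_probe[OF g y] that(2)] samples_total that(1)
      by blast
    \<comment> \<open>In the integral case the stages converge to a total limit \<open>b\<close>, so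
      the enclosures converge to \<open>c b\<close> uniformly in the late stages.\<close>
    show "\<exists>u. \<forall>e>0. \<exists>m N. \<forall>i\<ge>N. JJ m i \<subseteq> {u - e..u + e}"
      if int: "\<And>j. smp.delta (k - 1) (pval k g y) j = 0"
    proof -
      obtain b where b: "eqN k b b"
        "\<And>n. \<exists>m N. \<forall>i\<ge>N. (N_p k n b, beta k g i (D_p k m y)) \<in> N_dom k"
        using beta_limit[OF g y int] by blast
      have "\<exists>m N. \<forall>i\<ge>N. JJ m i \<subseteq> {c b - e..c b + e}" if "e > 0" for e
      proof -
        obtain m n where mn: "jj m (N_p k n b) \<subseteq> {c b - e..c b + e}"
          using c b(1) \<open>e > 0\<close> unfolding encloses_def by blast
        obtain m' N where N: "\<And>i. i \<ge> N \<Longrightarrow> (N_p k n b, beta k g i (D_p k m' y)) \<in> N_dom k"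
          using b(2) by blast
        have "JJ (max m m') i \<subseteq> jj m (N_p k n b)" if "i \<ge> N" for i
          by (rule JJ_sub[OF N[OF that]]) auto
        then show ?thesis using mn by (meson order_trans)
      qed
      then show ?thesis by blast
    qed
    show "\<exists>u. \<forall>e>0. \<exists>m. JJ m i \<subseteq> {u - e..u + e}"
      if small: "\<And>j. j < i \<Longrightarrow> smp.delta (k - 1) (pval k g y) j < 1 / 4" for i
    proof -
      have b: "eqN k (beta k g i y) (beta k g i y)"
        using beta_approximates[OF g y small] by (simp add: approximates_def)
      have "\<exists>m. JJ m i \<subseteq> {c (beta k g i y) - e..c (beta k g i y) + e}" if "e > 0" for e
      proof -
        obtain m n where mn: "jj m (N_p k n (beta k g i y)) \<subseteq> {c (beta k g i y) - e..c (beta k g i y) + e}"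
          using c b \<open>e > 0\<close> unfolding encloses_def by blast
        obtain m' where "(N_p k n (beta k g i y), beta k g i (D_p k m' y)) \<in> N_dom k"
          using cnt_approx[OF cnt_beta[OF g] yf] by blast
        then have "JJ (max m m') i \<subseteq> jj m (N_p k n (beta k g i y))" by (rule JJ_sub) auto
        then show ?thesis using mn by (meson order_trans)
      qed
      then show ?thesis by blast
    qed
  qed
  \<comment> \<open>The default 0 stands at stages whose rounding is not total; no such stage
    influences the interpolation.\<close>
  define v where "v i = (if eqN k (beta k g i y) (beta k g i y) then c (beta k g i y) else 0)" for i
  define W where "W = smp.interp (k - 1) (pval k g y) v"
  have v_small: "approximates k (pval k g y) i (beta k g i y) \<and> v i = c (beta k g i y)"
    if "\<And>j. j < i \<Longrightarrow> smp.delta (k - 1) (pval k g y) j < 1 / 4" for i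
    using beta_approximates[OF g y that] by (simp add: approximates_def v_def)
  have W_in: "W \<in> I (stage k g jj m (D_p k m y))" for m
  proof -
    have ym: "D_p k m y \<in> Field (D k)" using D.p_field[OF yf] .
    \<comment> \<open>At non-total stages any element of the enclosure is taken instead of the
      default, which leaves the interpolated value unchanged.\<close>
    have "\<exists>x. x \<in> JJ m i \<and> (eqN k (beta k g i y) (beta k g i y) \<longrightarrow> x = v i)" for i
    proof (cases "eqN k (beta k g i y) (beta k g i y)")
      case True
      have "(beta k g i (D_p k m y), beta k g i y) \<in> N_dom k"
        using cnt_mono[OF cnt_beta[OF g] D.p_le[OF yf]] .
      then show ?thesis using c True unfolding encloses_def JJ_def v_def by auto
    next
      case False
      have "okJ (JJ m i)" using jj beta_field[OF g ym] unfolding JJ_def family_def by blast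
      then show ?thesis using okJ_nonempty False by blast
    qed
    then obtain v' where v': "\<And>i. v' i \<in> JJ m i"
      "\<And>i. eqN k (beta k g i y) (beta k g i y) \<Longrightarrow> v' i = v i" by metis
    have "smp.interp (k - 1) (pval k g y) v' = W"
      unfolding W_def using v'(2) v_small by (intro smp.interp_cong) (auto simp: approximates_def)
    moreover have "smp.interp (k - 1) (pval k g y) v' \<in> I (stage k g jj m (D_p k m y))"
    proof (rule stage_sound[OF jj ym])
      fix a assume a: "a \<in> \<Union>(range (samples (k - 1)))"
      have "I (probe k g a y) \<subseteq> I (probe k g a (D_p k m y))"
        using cnt_mono[OF cnt_probe[OF g sample_field[OF a]] D.p_le[OF yf]] by (rule I_anti)
      then show "pval k g y a \<in> I (probe k g a (D_p k m y))"
        using I_probe[OF g y] samples_total a by blast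
    qed (use v'(1) in \<open>simp add: JJ_def\<close>)
    ultimately show ?thesis by simp
  qed
  have sub: "I (extension k g jj y) \<subseteq> I (stage k g jj m (D_p k m y))" for m
    unfolding extension_def by (rule I_anti[OF R.reg_ge[OF yf]])
  have "x = W" if x: "x \<in> I (extension k g jj y)" for x
  proof (rule ccontr)
    assume "x \<noteq> W"
    then have "\<bar>x - W\<bar> / 3 > 0" by simp
    then obtain m u where "I (stage k g jj m (D_p k m y)) \<subseteq> {u - \<bar>x - W\<bar> / 3..u + \<bar>x - W\<bar> / 3}"
      using conv unfolding stage_def ss_def JJ_def by blast
    then have "x \<in> {u - \<bar>x - W\<bar> / 3..u + \<bar>x - W\<bar> / 3}" "W \<in> {u - \<bar>x - W\<bar> / 3..u + \<bar>x - W\<bar> / 3}"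
      using sub W_in x by blast+
    then have "\<bar>x - W\<bar> \<le> 2 * (\<bar>x - W\<bar> / 3)" unfolding atLeastAtMost_iff by linarith
    then show False using \<open>x \<noteq> W\<close> by simp
  qed
  moreover have "I (extension k g jj y) \<noteq> {}"
    using I_nonempty R.reg_field[OF yf] unfolding extension_def by blast
  ultimately have "I (extension k g jj y) = {W}" by blast
  moreover have "interpolates k c (pval k g y) W"
    unfolding interpolates_def W_def using v_small by blast
  ultimately show ?thesis by blast
qed

text \<open>Reals shared by the probes, and values shared by the roundings, are chosen once for both
  arguments. The interpolated value built from them lies in both outputs.\<close>

lemma extension_sim:
  assumes x: "x \<in> Field (N_dom (Suc k))" and sim: "sim k y y'"
  shows "I (extension k g (num_family k x) y) \<inter> I (extension k g (num_family k x) y') \<noteq> {}"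
proof -
  note jj = family_num[OF x]
  have yf: "y \<in> Field (D k)" "y' \<in> Field (D k)" using sim by (cases k; simp)+
  have "\<exists>t. t \<in> I (probe k g a y) \<inter> I (probe k g a y')" if "a \<in> \<Union>(range (samples (k - 1)))" for a
    using probe_sim[OF g sim sample_field[OF that]] by blast
  then obtain \<rho> where \<rho>: "\<And>a. a \<in> \<Union>(range (samples (k - 1))) \<Longrightarrow> \<rho> a \<in> I (probe k g a y) \<inter> I (probe k g a y')"
    by metis
  have "\<exists>t. t \<in> num_set (app x (beta k g i y)) \<inter> num_set (app x (beta k g i y'))" for i
  proof -
    obtain h where h: "(beta k g i y, h) \<in> N_dom k" "(beta k g i y', h) \<in> N_dom k"
      using beta_sim[OF g sim] by blast
    have "num_set (app x h) \<subseteq> num_set (app x (beta k g i y)) \<inter> num_set (app x (beta k g i y'))"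
      using num_set_anti cnt_mono[OF N_field_cnt[OF x]] h by blast
    moreover have "num_set (app x h) \<noteq> {}"
      using N_app_field[OF x FieldI2[OF h(1)]] by (auto simp: Field_flatN)
    ultimately show ?thesis by blast
  qed
  then obtain v where v: "\<And>i. v i \<in> num_set (app x (beta k g i y)) \<inter> num_set (app x (beta k g i y'))"
    by metis
  have "smp.interp (k - 1) \<rho> v \<in> I (extension k g (num_family k x) z)" if z: "z = y \<or> z = y'" for z
  proof -
    interpret R: regularization "D k" "D_p k" B q "stage k g (num_family k x)"
      by (rule regularization_stage[OF jj])
    have zf: "z \<in> Field (D k)" using z yf by blast
    have W: "smp.interp (k - 1) \<rho> v \<in> I (stage k g (num_family k x) m (D_p k m z))" for m
    proof (rule stage_sound[OF jj D.p_field[OF zf]])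
      fix a assume a: "a \<in> \<Union>(range (samples (k - 1)))"
      have "I (probe k g a z) \<subseteq> I (probe k g a (D_p k m z))"
        using cnt_mono[OF cnt_probe[OF g sample_field[OF a]] D.p_le[OF zf]] by (rule I_anti)
      then show "\<rho> a \<in> I (probe k g a (D_p k m z))" using \<rho>[OF a] z by blast
    next
      fix i
      have le: "(beta k g i (D_p k m z), beta k g i z) \<in> N_dom k"
        using cnt_mono[OF cnt_beta[OF g] D.p_le[OF zf]] .
      have "(app (N_p (Suc k) m x) (beta k g i (D_p k m z)), app x (beta k g i (D_p k m z))) \<in> flatN"
        using N.p_le[OF x] FieldI1[OF le] unfolding N_rel by blast
      moreover have "(app x (beta k g i (D_p k m z)), app x (beta k g i z)) \<in> flatN"
        using cnt_mono[OF N_field_cnt[OF x] le] .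
      ultimately have "(app (N_p (Suc k) m x) (beta k g i (D_p k m z)), app x (beta k g i z)) \<in> flatN"
        by (rule sfp.ord_trans[OF sfp_flatN])
      then show "v i \<in> num_family k x m (beta k g i (D_p k m z))"
        using num_set_anti v[of i] z unfolding num_family_def by blast
    qed
    show ?thesis
      unfolding extension_def
    proof (rule I_lim[OF R.reg_field[OF zf]])
      fix i
      obtain m where m: "q i (reg B (D_p k) (stage k g (num_family k x)) z) =
          q i (stage k g (num_family k x) m (D_p k m z))"
        using R.reg_att[OF zf] by blast
      have "stage k g (num_family k x) m (D_p k m z) \<in> Field B"
        using R.reg_ge[OF zf] by (rule FieldI1)
      then have "I (stage k g (num_family k x) m (D_p k m z)) \<subseteq> I (q i (stage k g (num_family k x) m (D_p k m z)))"
        using B.p_le I_anti by blast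
      then show "smp.interp (k - 1) \<rho> v \<in> I (q i (reg B (D_p k) (stage k g (num_family k x)) z))"
        unfolding m using W by blast
    qed
  qed
  then show ?thesis by blast
qed

lemma extension_field:
  assumes x: "x \<in> Field (N_dom (Suc k))"
  shows "fun_code (Field (D k)) (extension k g (num_family k x)) \<in> Field (D (Suc k))"
proof -
  let ?F = "fun_code (Field (D k)) (extension k g (num_family k x))"
  have F: "?F \<in> Field (fun_space (D k) B)"
    by (rule DF.code_field[OF cnt_extension[OF family_num[OF x]]])
  moreover have "?F \<in> T k"
  proof (rule T_smooth[OF F])
    fix y y' assume sim: "sim k y y'"
    then have "y \<in> Field (D k)" "y' \<in> Field (D k)" by (cases k; simp)+
    then show "I (app ?F y) \<inter> I (app ?F y') \<noteq> {}" using extension_sim[OF x sim] by simp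
  qed
  ultimately show ?thesis using DF.field_fs by (simp only: D_Suc)
qed

text \<open>Continuity in the number functional at a fixed argument, the other half needed for
  currying.\<close>

lemma cnt_extension_family:
  assumes y: "y \<in> Field (D k)"
  shows "cnt (N_dom (Suc k)) (N_p (Suc k)) B q (\<lambda>x. extension k g (num_family k x) y)"
  unfolding cnt_def
proof (intro conjI allI impI ballI)
  fix x x' assume xx: "(x, x') \<in> N_dom (Suc k)"
  have x: "x \<in> Field (N_dom (Suc k))" and x': "x' \<in> Field (N_dom (Suc k))"
    using xx by (auto intro: FieldI1 FieldI2)
  interpret R: regularization "D k" "D_p k" B q "stage k g (num_family k x)"
    by (rule regularization_stage[OF family_num[OF x]])
  interpret R': regularization "D k" "D_p k" B q "stage k g (num_family k x')"
    by (rule regularization_stage[OF family_num[OF x']])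
  have "(stage k g (num_family k x) m (D_p k m y), extension k g (num_family k x') y) \<in> B" for m
  proof -
    have ym: "D_p k m y \<in> Field (D k)" using D.p_field[OF y] .
    have "(stage k g (num_family k x) m (D_p k m y), stage k g (num_family k x') m (D_p k m y)) \<in> B"
      unfolding stage_def
    proof (rule out_mono[OF smp.index_sets_axioms])
      show "(probe k g a (D_p k m y), probe k g a (D_p k m y)) \<in> B"
        if "a \<in> \<Union>(range (samples (k - 1)))" for a
        using B.ord_refl[OF probe_field[OF g sample_field[OF that] ym]] .
      show "num_family k x' m (beta k g i (D_p k m y)) \<subseteq> num_family k x m (beta k g i (D_p k m y))" for i
        unfolding num_family_def
        by (rule num_set_anti) (use N.p_mono[OF xx, of m] beta_field[OF g ym] in \<open>unfold N_rel, blast\<close>)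
      show "okJ (num_family k x m (beta k g i (D_p k m y)))" "okJ (num_family k x' m (beta k g i (D_p k m y)))" for i
        using family_num[OF x] family_num[OF x'] beta_field[OF g ym] unfolding family_def by blast+
    qed
    then show ?thesis using R'.reg_ge[OF y] unfolding extension_def by (rule B.ord_trans)
  qed
  then show "(extension k g (num_family k x) y, extension k g (num_family k x') y) \<in> B"
    using R.reg_lub[OF y] R'.reg_field[OF y] unfolding extension_def is_lub_in_def by blast
next
  fix x i assume x: "x \<in> Field (N_dom (Suc k))"
  interpret R: regularization "D k" "D_p k" B q "stage k g (num_family k x)"
    by (rule regularization_stage[OF family_num[OF x]])
  obtain m where m: "q i (extension k g (num_family k x) y) = q i (stage k g (num_family k x) m (D_p k m y))"
    using R.reg_att[OF y] unfolding extension_def by blast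
  \<comment> \<open>The \<open>m\<close>-th stage uses only \<open>N_p (Suc k) m x\<close>, so it is
    the same for some approximation of \<open>x\<close>.\<close>
  obtain j where j: "N_p (Suc k) m x = N_p (Suc k) m (N_p (Suc k) j x)" using N.p_p_att[OF x] by blast
  interpret R': regularization "D k" "D_p k" B q "stage k g (num_family k (N_p (Suc k) j x))"
    by (rule regularization_stage[OF family_num[OF N.p_field[OF x]]])
  have "num_family k x m = num_family k (N_p (Suc k) j x) m"
    using j unfolding num_family_def by metis
  then have eq: "stage k g (num_family k x) m (D_p k m y) = stage k g (num_family k (N_p (Suc k) j x)) m (D_p k m y)"
    by (simp add: stage_def)
  have "(q i (stage k g (num_family k x) m (D_p k m y)), stage k g (num_family k x) m (D_p k m y)) \<in> B"
    by (rule B.p_le[OF FieldI1[OF R.reg_ge[OF y]]])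
  moreover have "(stage k g (num_family k x) m (D_p k m y), extension k g (num_family k (N_p (Suc k) j x)) y) \<in> B"
    unfolding eq extension_def by (rule R'.reg_ge[OF y])
  ultimately have "(q i (extension k g (num_family k x) y), extension k g (num_family k (N_p (Suc k) j x)) y) \<in> B"
    unfolding m by (rule B.ord_trans)
  then show "\<exists>j. (q i (extension k g (num_family k x) y), extension k g (num_family k (N_p (Suc k) j x)) y) \<in> B" ..
qed

end

text \<open>Arguments of type \<open>k\<close> are probed through the embedding of type
  \<open>k - 1\<close>, two types below the functional being embedded. For \<open>k = 0\<close> the
  embedding passed on is a dummy.\<close>

fun pi :: "nat \<Rightarrow> nat option hval \<Rightarrow> 'b hval" where
  "pi 0 x = emb x"
| "pi (Suc k) x = fun_code (Field (D k)) (extension k (pi (k - 1)) (num_family k x))"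

lemma good_pi_step:
  assumes g: "k > 0 \<Longrightarrow> good_emb (k - 1) (pi (k - 1))"
  shows "good_emb (Suc k) (pi (Suc k))"
  unfolding good_emb_def
proof (intro conjI ballI allI impI)
  let ?g = "pi (k - 1)"
  have eq: "pi (Suc k) = (\<lambda>x. fun_code (Field (D k)) (extension k ?g (num_family k x)))"
    by (intro ext) simp
  have field: "pi (Suc k) x \<in> Field (D (Suc k))" if "x \<in> Field (N_dom (Suc k))" for x
    using extension_field[OF g that] by simp
  have app: "app (pi (Suc k) x) y = extension k ?g (num_family k x) y" if "y \<in> Field (D k)" for x y
    using that by simp
  have "cnt (N_dom (Suc k)) (N_p (Suc k)) (fs (D k) B (T k)) (fs_p (D k) (D_p k) q) (pi (Suc k))"
    unfolding eq
  proof (rule DF.cnt_codeI[OF sfp_N])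
    show "fun_code (Field (D k)) (extension k ?g (num_family k x)) \<in> Field (fs (D k) B (T k))"
      if "x \<in> Field (N_dom (Suc k))" for x
      using extension_field[OF g that] by (simp add: D_Suc)
  qed (rule cnt_extension_family[OF g])
  then show "cnt (N_dom (Suc k)) (N_p (Suc k)) (D (Suc k)) (D_p (Suc k)) (pi (Suc k))"
    by (simp add: D_Suc)
  show "sim (Suc k) (pi (Suc k) x) (pi (Suc k) x)" if x: "x \<in> Field (N_dom (Suc k))" for x
    unfolding rsim.simps(2)
  proof (intro conjI allI impI field x)
    fix y y' assume sim: "sim k y y'"
    then have "y \<in> Field (D k)" "y' \<in> Field (D k)" by (cases k; simp)+
    then show "I (app (pi (Suc k) x) y) \<inter> I (app (pi (Suc k) x) y') \<noteq> {}"
      using extension_sim[OF g x sim] by (simp add: app del: pi.simps)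
  qed
  fix x x' assume xx: "eqN (Suc k) x x'"
  show "eqD (Suc k) (pi (Suc k) x) (pi (Suc k) x')"
    unfolding eqD_Suc
  proof (intro conjI allI impI field)
    show x: "x \<in> Field (N_dom (Suc k))" "x' \<in> Field (N_dom (Suc k))" using eqN_field xx by auto
    fix y y' assume yy: "eqD k y y'"
    have y: "y \<in> Field (D k)" "y' \<in> Field (D k)" using eqD_field yy by auto
    obtain w where w: "I (extension k ?g (num_family k x) y) = {w}" "interpolates k (num_val x) (pval k ?g y) w"
      using extension_value[OF g family_num[OF x(1)] encloses_num_family[OF eqN_refl1[OF xx]] eqD_refl1[OF yy]]
      by blast
    obtain w' where w': "I (extension k ?g (num_family k x') y') = {w'}" "interpolates k (num_val x') (pval k ?g y') w'"
      using extension_value[OF g family_num[OF x(2)] encloses_num_family[OF eqN_refl2[OF xx]] eqD_refl2[OF yy]]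
      by blast
    have "w = w'"
    proof (rule interpolates_unique[OF w(2) w'(2)])
      show "pval k ?g y z = pval k ?g y' z" if "eqN (k - 1) z z" for z
        using pval_cong[OF g yy that] .
      show "num_val x b = num_val x' b'" if bb: "eqN k b b'" for b b'
      proof -
        have "app x b = app x' b'" using xx bb unfolding eqN_Suc by metis
        then show ?thesis by (simp add: num_val_def)
      qed
    qed
    then show "same_real B I (app (pi (Suc k) x) y) (app (pi (Suc k) x') y')"
      unfolding same_real_def app[OF y(1)] app[OF y(2)]
      using w(1) w'(1) cnt_field[OF cnt_extension[OF g family_num] sfp_D] x y by blast
  qed
qed

lemma good_pi: "good_emb k (pi k)"
proof (induction k rule: less_induct)
  case (less k)
  show ?case
  proof (cases k)
    case 0
    have eq: "pi 0 = emb" by (intro ext) simp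
    have fl: "emb a \<in> Field B" if "a \<in> Field flatN" for a
      using cnt_field[OF cnt_emb sfp_flatN that] .
    show ?thesis
      unfolding 0 good_emb_def eq
    proof (intro conjI ballI allI impI)
      show "cnt (N_dom 0) (N_p 0) (D 0) (D_p 0) emb" using cnt_emb by (simp add: N_dom_0 D_0)
      show "sim 0 (emb a) (emb a)" if "a \<in> Field (N_dom 0)" for a
        using fl that I_nonempty by (simp add: N_dom_0 D_0)
      show "eqD 0 (emb a) (emb b)" if "eqN 0 a b" for a b
        using that fl[of a] emb_Num by (auto simp: eqN_0 eqD_0 same_real_def Field_flatN)
    qed
  next
    case (Suc l)
    show ?thesis
      unfolding Suc by (rule good_pi_step) (use less Suc in auto)
  qed
qed

lemma cnt_pi: "cnt (N_dom k) (N_p k) (D k) (D_p k) (pi k)"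
  using good_pi by (simp add: good_emb_def)

lemma pi_eq: "eqN k a b \<Longrightarrow> eqD k (pi k a) (pi k b)"
  using good_pi by (simp add: good_emb_def)

lemma extension_value_pi:
  assumes "family k jj" "encloses k jj c" "eqD k y y"
  shows "\<exists>w. I (extension k (pi (k - 1)) jj y) = {w} \<and> interpolates k c (pval k (pi (k - 1)) y) w"
  using extension_value[OF good_pi assms] .

lemma pi_value:
  assumes x: "eqN (Suc k) x x" and y: "eqD k y y"
  shows "\<exists>w. I (app (pi (Suc k) x) y) = {w} \<and> interpolates k (num_val x) (pval k (pi (k - 1)) y) w"
proof -
  have "x \<in> Field (N_dom (Suc k))" "y \<in> Field (D k)" using eqN_field x eqD_field y by auto
  then show ?thesis
    using extension_value_pi[OF family_num encloses_num_family[OF x] y] by simp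
qed

end

section \<open>The extensional hierarchy\<close>

definition E_val :: "real set set hval \<Rightarrow> real set" where
  "E_val x = \<Inter>(base_val x)"

definition E_up :: "real set \<Rightarrow> real set set" where
  "E_up c = {K \<in> E_compact. c \<subseteq> K}"

definition E_enum :: "nat \<Rightarrow> real set" where
  "E_enum = from_nat_into E_compact"

text \<open>Only the first \<open>i\<close> rational intervals are consulted; the intersection of
  those in the ideal generates the truncated ideal.\<close>

definition E_p :: "nat \<Rightarrow> real set set hval \<Rightarrow> real set set hval" where
  "E_p i x = Base (E_up (\<Inter>k\<in>{k. k < i \<and> E_enum k \<in> base_val x}. E_enum k))"

lemma E_compactE:
  assumes "K \<in> E_compact"
  obtains "K = UNIV" | p q where "K = {p..q}" "p \<in> \<rat>" "q \<in> \<rat>" "p \<le> q"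
  using assms unfolding E_compact_def by blast

lemma E_compact_nonempty: "K \<in> E_compact \<Longrightarrow> K \<noteq> {}"
  by (erule E_compactE) auto

lemma E_compact_closed: "K \<in> E_compact \<Longrightarrow> closed K"
  by (erule E_compactE) auto

lemma UNIV_E_compact: "UNIV \<in> E_compact"
  by (simp add: E_compact_def)

lemma E_compact_Int:
  assumes "K \<in> E_compact" "L \<in> E_compact" "K \<inter> L \<noteq> {}"
  shows "K \<inter> L \<in> E_compact"
  using assms(1)
proof (cases rule: E_compactE)
  case K: (2 p q)
  show ?thesis
    using assms(2)
  proof (cases rule: E_compactE)
    case L: (2 p' q')
    have "max p p' \<in> \<rat>" "min q q' \<in> \<rat>" using K L by (auto simp: max_def min_def)
    moreover have "K \<inter> L = {max p p'..min q q'}" using K L by auto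
    moreover from this have "max p p' \<le> min q q'" using assms(3) by auto
    ultimately show ?thesis unfolding E_compact_def by blast
  qed (use assms in simp)
qed (use assms in simp)

lemma countable_E_compact: "countable E_compact"
proof -
  have "{{p..q} | p q. p \<in> \<rat> \<and> q \<in> \<rat> \<and> p \<le> q} \<subseteq> (\<lambda>(p, q). {p..q::real}) ` (\<rat> \<times> \<rat>)"
    by auto
  then have "countable {{p..q} | p q. p \<in> \<rat> \<and> q \<in> \<rat> \<and> p \<le> (q::real)}"
    by (rule countable_subset) (simp add: countable_rat)
  then show ?thesis by (simp add: E_compact_def)
qed

lemma range_E_enum: "range E_enum = E_compact"
  unfolding E_enum_def using UNIV_E_compact countable_E_compact by (intro range_from_nat_into) auto

lemma E_idealD:
  assumes "E_ideal J"
  shows "J \<subseteq> E_compact" "J \<noteq> {}" "b \<in> J \<Longrightarrow> a \<in> E_compact \<Longrightarrow> b \<subseteq> a \<Longrightarrow> a \<in> J"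
    "a \<in> J \<Longrightarrow> b \<in> J \<Longrightarrow> \<exists>c\<in>J. c \<subseteq> a \<and> c \<subseteq> b"
proof -
  note * = assms[unfolded E_ideal_def]
  show "J \<subseteq> E_compact" "J \<noteq> {}" using * by simp_all
  show "b \<in> J \<Longrightarrow> a \<in> E_compact \<Longrightarrow> b \<subseteq> a \<Longrightarrow> a \<in> J"
    using *[THEN conjunct2, THEN conjunct2, THEN conjunct1] by metis
  show "a \<in> J \<Longrightarrow> b \<in> J \<Longrightarrow> \<exists>c\<in>J. c \<subseteq> a \<and> c \<subseteq> b"
    using *[THEN conjunct2, THEN conjunct2, THEN conjunct2] by metis
qed

lemma E_ideal_Int:
  assumes J: "E_ideal J" and a: "a \<in> J" and b: "b \<in> J"
  shows "a \<inter> b \<in> J"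
proof -
  obtain c where c: "c \<in> J" "c \<subseteq> a" "c \<subseteq> b" using E_idealD(4)[OF J a b] by blast
  have "c \<noteq> {}" using c(1) E_idealD(1)[OF J] E_compact_nonempty by blast
  then have "a \<inter> b \<in> E_compact"
    using a b c E_idealD(1)[OF J] by (intro E_compact_Int) auto
  then show ?thesis using E_idealD(3)[OF J c(1)] c by blast
qed

lemma E_ideal_UNIV: "E_ideal J \<Longrightarrow> UNIV \<in> J"
  using E_idealD(2,3) UNIV_E_compact by blast

lemma E_ideal_INT:
  assumes J: "E_ideal J" and "finite F" "F \<subseteq> J"
  shows "\<Inter>F \<in> J"
  using assms(2,3)
proof (induction F rule: finite_induct)
  case empty
  then show ?case using E_ideal_UNIV[OF J] by simp
next
  case (insert a F)
  then show ?case using E_ideal_Int[OF J] by simp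
qed

lemma E_ideal_up:
  assumes "c \<noteq> {}"
  shows "E_ideal (E_up c)"
  unfolding E_ideal_def
proof (intro conjI ballI impI)
  show "E_up c \<subseteq> E_compact" "E_up c \<noteq> {}" using UNIV_E_compact by (auto simp: E_up_def)
  show "a \<in> E_up c" if "a \<in> E_compact" "b \<in> E_up c" "b \<subseteq> a" for a b
    using that unfolding E_up_def by blast
  show "\<exists>d\<in>E_up c. d \<subseteq> a \<and> d \<subseteq> b" if "a \<in> E_up c" "b \<in> E_up c" for a b
  proof (intro bexI[of _ "a \<inter> b"] conjI)
    have "a \<inter> b \<noteq> {}" using that assms unfolding E_up_def by blast
    then show "a \<inter> b \<in> E_up c" using that E_compact_Int unfolding E_up_def by blast
  qed auto
qed

lemma Field_E_base: "x \<in> Field E_base \<longleftrightarrow> (\<exists>J. x = Base J \<and> E_ideal J)"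
  unfolding E_base_def Field_def by blast

lemma E_base_iff:
  "(x, y) \<in> E_base \<longleftrightarrow> x \<in> Field E_base \<and> y \<in> Field E_base \<and> base_val x \<subseteq> base_val y"
proof
  assume "x \<in> Field E_base \<and> y \<in> Field E_base \<and> base_val x \<subseteq> base_val y"
  then show "(x, y) \<in> E_base" unfolding Field_E_base by (auto simp: E_base_def)
next
  assume xy: "(x, y) \<in> E_base"
  then have "x \<in> Field E_base" "y \<in> Field E_base" by (auto intro: FieldI1 FieldI2)
  then show "x \<in> Field E_base \<and> y \<in> Field E_base \<and> base_val x \<subseteq> base_val y"
    using xy by (auto simp: E_base_def)
qed

lemma E_field_ideal: "x \<in> Field E_base \<Longrightarrow> E_ideal (base_val x)"
  by (auto simp: Field_E_base)

lemma E_up_field: "c \<noteq> {} \<Longrightarrow> Base (E_up c) \<in> Field E_base"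
  using E_ideal_up by (auto simp: Field_E_base)

lemma E_p_core: 
  assumes "x \<in> Field E_base"
  shows "(\<Inter>k\<in>{k. k < i \<and> E_enum k \<in> base_val x}. E_enum k) \<in> base_val x"
  using E_ideal_INT[OF E_field_ideal[OF assms], of "E_enum ` {k. k < i \<and> E_enum k \<in> base_val x}"]
  by auto

lemma E_p_field:
  assumes "x \<in> Field E_base"
  shows "E_p i x \<in> Field E_base"
  unfolding E_p_def
  using E_p_core[OF assms, of i] E_idealD(1)[OF E_field_ideal[OF assms]] E_compact_nonempty
  by (intro E_up_field) blast

lemma E_enum_in_E_p:
  assumes "x \<in> Field E_base" "E_enum k \<in> base_val x" "k < i"
  shows "E_enum k \<in> base_val (E_p i x)"
  using assms range_E_enum by (auto simp: E_p_def E_up_def)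

lemma E_directed_Union:
  assumes A: "directed_in E_base A"
  shows "E_ideal (\<Union>(base_val ` A))"
  unfolding E_ideal_def
proof (intro conjI ballI impI)
  have Af: "x \<in> Field E_base" if "x \<in> A" for x using A that by (auto simp: directed_in_def)
  have id: "E_ideal (base_val x)" if "x \<in> A" for x using E_field_ideal[OF Af[OF that]] .
  show "\<Union>(base_val ` A) \<subseteq> E_compact" using E_idealD(1)[OF id] by blast
  obtain x where "x \<in> A" using A by (auto simp: directed_in_def)
  then show "\<Union>(base_val ` A) \<noteq> {}" using E_idealD(2)[OF id] by blast
  show "a \<in> \<Union>(base_val ` A)" if "a \<in> E_compact" "b \<in> \<Union>(base_val ` A)" "b \<subseteq> a" for a b
    using that E_idealD(3)[OF id] by blast
  fix a b assume "a \<in> \<Union>(base_val ` A)" "b \<in> \<Union>(base_val ` A)"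
  then obtain x y where xy: "x \<in> A" "a \<in> base_val x" "y \<in> A" "b \<in> base_val y" by blast
  then obtain z where z: "z \<in> A" "(x, z) \<in> E_base" "(y, z) \<in> E_base"
    using A unfolding directed_in_def by meson
  then have ab: "a \<in> base_val z" "b \<in> base_val z" using xy unfolding E_base_iff by blast+
  obtain c where "c \<in> base_val z" "c \<subseteq> a" "c \<subseteq> b" using E_idealD(4)[OF id[OF z(1)] ab] by auto
  then show "\<exists>c\<in>\<Union>(base_val ` A). c \<subseteq> a \<and> c \<subseteq> b" using z(1) by blast
qed

lemma E_lub_Union:
  assumes A: "directed_in E_base A"
  shows "is_lub_in E_base A (Base (\<Union>(base_val ` A)))"
proof -
  have Af: "x \<in> Field E_base" if "x \<in> A" for x using A that by (auto simp: directed_in_def)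
  have f: "Base (\<Union>(base_val ` A)) \<in> Field E_base"
    using E_directed_Union[OF A] by (simp add: Field_E_base)
  show ?thesis
    unfolding is_lub_in_def
  proof (intro conjI ballI impI f)
    show "(a, Base (\<Union>(base_val ` A))) \<in> E_base" if "a \<in> A" for a
      using that Af f unfolding E_base_iff by auto
    show "(Base (\<Union>(base_val ` A)), y) \<in> E_base" if "y \<in> Field E_base" "\<forall>a\<in>A. (a, y) \<in> E_base" for y
      using that f unfolding E_base_iff by auto
  qed
qed

lemma sfp_E_base: "sfp E_base E_p"
proof
  show "Field E_base \<noteq> {}" using E_up_field[of UNIV] by auto
next
  show "x = y" if "(x, y) \<in> E_base" "(y, x) \<in> E_base" for x y
    using that unfolding E_base_iff Field_E_base by auto
next
  show "\<exists>x. is_lub_in E_base A x" if "directed_in E_base A" for A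
    using E_lub_Union[OF that] ..
next
  fix x i assume x: "x \<in> Field E_base"
  show "(E_p i x, x) \<in> E_base"
    unfolding E_base_iff
  proof (intro conjI x E_p_field)
    show "base_val (E_p i x) \<subseteq> base_val x"
      unfolding E_p_def E_up_def
      using E_idealD(3)[OF E_field_ideal[OF x] E_p_core[OF x, of i]] by auto
  qed
  fix j assume "i \<le> j"
  then show "(E_p i x, E_p j x) \<in> E_base"
    unfolding E_base_iff using x E_p_field by (auto simp: E_p_def E_up_def)
next
  fix x y i assume xy: "(x, y) \<in> E_base"
  then have "(\<Inter>k\<in>{k. k < i \<and> E_enum k \<in> base_val y}. E_enum k) \<subseteq>
      (\<Inter>k\<in>{k. k < i \<and> E_enum k \<in> base_val x}. E_enum k)"
    unfolding E_base_iff by blast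
  then have "base_val (E_p i x) \<subseteq> base_val (E_p i y)"
    unfolding E_p_def E_up_def by auto
  then show "(E_p i x, E_p i y) \<in> E_base"
    using xy E_p_field unfolding E_base_iff by blast
next
  fix i
  have "E_p i ` Field E_base \<subseteq> (\<lambda>S. Base (E_up (\<Inter>k\<in>S. E_enum k))) ` Pow {..<i}"
    unfolding E_p_def by blast
  then show "finite (E_p i ` Field E_base)" by (rule finite_subset) simp
next
  fix x y assume x: "x \<in> Field E_base" and y: "y \<in> Field E_base" and le: "\<And>i. (E_p i x, y) \<in> E_base"
  have "K \<in> base_val y" if K: "K \<in> base_val x" for K
  proof -
    have "K \<in> range E_enum" using K E_idealD(1)[OF E_field_ideal[OF x]] range_E_enum by blast
    then obtain k where k: "K = E_enum k" by blast
    then have "K \<in> base_val (E_p (Suc k) x)" using E_enum_in_E_p[OF x, of k "Suc k"] K by simp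
    then show ?thesis using le unfolding E_base_iff by blast
  qed
  then show "(x, y) \<in> E_base" using x y unfolding E_base_iff by blast
next
  fix A x i assume A: "directed_in E_base A" and x: "is_lub_in E_base A x"
  have "(x, Base (\<Union>(base_val ` A))) \<in> E_base" "(Base (\<Union>(base_val ` A)), x) \<in> E_base"
    using x E_lub_Union[OF A] unfolding is_lub_in_def by blast+
  then have eq: "base_val x = \<Union>(base_val ` A)" unfolding E_base_iff by simp
  define S where "S = {k. k < i \<and> E_enum k \<in> base_val x}"
  have "\<exists>a\<in>A. E_enum k \<in> base_val a" if "k \<in> S" for k
    using that by (simp add: S_def eq)
  then obtain a where a: "\<And>k. k \<in> S \<Longrightarrow> a k \<in> A \<and> E_enum k \<in> base_val (a k)" by metis
  have tr: "(x, z) \<in> E_base" if "(x, y) \<in> E_base" "(y, z) \<in> E_base" for x y z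
    using that unfolding E_base_iff by blast
  have "\<exists>b\<in>A. \<forall>c\<in>a ` S. (c, b) \<in> E_base"
    by (rule finite_directed_bound[OF A tr]) (use a in \<open>auto simp: S_def\<close>)
  then obtain b where b: "b \<in> A" "\<And>k. k \<in> S \<Longrightarrow> (a k, b) \<in> E_base" by blast
  have "S = {k. k < i \<and> E_enum k \<in> base_val b}"
  proof (intro equalityI subsetI CollectI conjI)
    fix k assume k: "k \<in> S"
    then show "k < i" by (simp add: S_def)
    show "E_enum k \<in> base_val b" using a[OF k] b(2)[OF k] unfolding E_base_iff by blast
  next
    fix k assume "k \<in> {k. k < i \<and> E_enum k \<in> base_val b}"
    then show "k \<in> S" using b(1) by (auto simp: S_def eq)
  qed
  then have "E_p i x = E_p i b" by (simp add: E_p_def S_def)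
  then show "\<exists>a\<in>A. E_p i x = E_p i a" using b(1) by blast
qed (auto simp: E_base_iff)

text \<open>The complements of the members, together with \<open>U\<close>, cover a bounded member;
  a finite subcover and closure under intersections give the member sought.\<close>

lemma E_ideal_compactness:
  assumes J: "E_ideal J" and U: "open U" "\<Inter>J \<subseteq> U"
  shows "\<exists>K\<in>J. K \<subseteq> U"
\<comment> \<open>Only a member other than \<open>UNIV\<close> is compact. Without one the
  intersection is the whole line, and \<open>UNIV\<close> itself is the required member.\<close>
proof (cases "J = {UNIV}")
  case True
  then show ?thesis using U by auto
next
  case False
  then obtain K0 where K0: "K0 \<in> J" "K0 \<noteq> UNIV" using E_ideal_UNIV[OF J] by blast
  have JE: "J \<subseteq> E_compact" using E_idealD(1)[OF J] .
  have "compact K0" using K0 JE by (elim E_compactE[of K0, OF subsetD]) auto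
  define \<C> where "\<C> = insert U (uminus ` J)"
  have "K0 \<subseteq> \<Union>\<C>" using U(2) by (auto simp: \<C>_def)
  moreover have "\<And>C. C \<in> \<C> \<Longrightarrow> open C"
    using U(1) JE E_compact_closed by (auto simp: \<C>_def open_Compl)
  ultimately obtain \<D> where \<D>: "\<D> \<subseteq> \<C>" "finite \<D>" "K0 \<subseteq> \<Union>\<D>"
    using \<open>compact K0\<close> by (meson compactE)
  have "\<D> - {U} \<subseteq> uminus ` J" using \<D>(1) by (auto simp: \<C>_def)
  then obtain F where F: "F \<subseteq> J" "finite F" "\<D> - {U} = uminus ` F"
    using \<D>(2) by (meson finite_Diff finite_subset_image)
  have "K0 \<inter> \<Inter>F \<in> J" using E_ideal_Int[OF J K0(1) E_ideal_INT[OF J F(2,1)]] .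
  moreover have "K0 \<inter> \<Inter>F \<subseteq> U"
  proof
    fix x assume x: "x \<in> K0 \<inter> \<Inter>F"
    then obtain C where C: "C \<in> \<D>" "x \<in> C" using \<D>(3) by blast
    show "x \<in> U"
    proof (rule ccontr)
      assume "x \<notin> U"
      then have "C \<in> uminus ` F" using C F(3) by blast
      then show False using C(2) x by blast
    qed
  qed
  ultimately show ?thesis by blast
qed

text \<open>The factor 2 pays for moving real endpoints outwards to rational ones.\<close>

lemma E_val_up_subset:
  assumes "c \<subseteq> {w - e..w + e}" "e > 0"
  shows "E_val (Base (E_up c)) \<subseteq> {w - 2 * e..w + 2 * e}"
proof -
  obtain p where p: "p \<in> \<rat>" "w - 2 * e < p" "p < w - e"
    using Rats_dense_in_real[of "w - 2 * e" "w - e"] assms(2) by auto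
  obtain r where r: "r \<in> \<rat>" "w + e < r" "r < w + 2 * e"
    using Rats_dense_in_real[of "w + e" "w + 2 * e"] assms(2) by auto
  have "c \<subseteq> {p..r}" using assms(1) p(3) r(2) by force
  moreover have "{p..r} \<in> E_compact" using p r assms(2) unfolding E_compact_def by force
  ultimately have "{p..r} \<in> E_up c" by (simp add: E_up_def)
  then have "E_val (Base (E_up c)) \<subseteq> {p..r}" by (auto simp: E_val_def)
  also have "\<dots> \<subseteq> {w - 2 * e..w + 2 * e}" using p r by auto
  finally show ?thesis .
qed

lemma E_val_up_sup: "c \<subseteq> E_val (Base (E_up c))"
  by (auto simp: E_val_def E_up_def)

lemma E_val_single: "E_val (Base (E_up {w})) = {w}"
proof
  show "{w} \<subseteq> E_val (Base (E_up {w}))" by (rule E_val_up_sup)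
  show "E_val (Base (E_up {w})) \<subseteq> {w}"
  proof
    fix x assume x: "x \<in> E_val (Base (E_up {w}))"
    show "x \<in> {w}"
    proof (rule ccontr)
      assume "x \<notin> {w}"
      then have e: "\<bar>x - w\<bar> / 3 > 0" by simp
      have "E_val (Base (E_up {w})) \<subseteq> {w - 2 * (\<bar>x - w\<bar> / 3)..w + 2 * (\<bar>x - w\<bar> / 3)}"
        using e by (intro E_val_up_subset) auto
      then have "\<bar>x - w\<bar> \<le> 2 * (\<bar>x - w\<bar> / 3)" using x unfolding subset_iff atLeastAtMost_iff
        by (meson abs_diff_le_iff)
      then show False using e by simp
    qed
  qed
qed

lemma cnt_from_flat:
  assumes s: "sfp s q" and f: "\<And>m. (f Bot, f (Num m)) \<in> s"
  shows "cnt flatN flat_p s q f"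
  unfolding cnt_def
proof (intro conjI allI impI ballI)
  have fl: "f x \<in> Field s" if "x \<in> Field flatN" for x
    using f that by (auto simp: Field_flatN intro: FieldI1 FieldI2)
  show "(f x, f y) \<in> s" if "(x, y) \<in> flatN" for x y
    using that f sfp.ord_refl[OF s fl] unfolding flatN_iff Field_flatN by auto
  fix x i assume x: "x \<in> Field flatN"
  have "\<exists>j. flat_p j x = x" using x by (auto simp: Field_flatN intro: exI[of _ "Suc _"])
  then obtain j where "flat_p j x = x" ..
  then show "\<exists>j. (q i (f x), f (flat_p j x)) \<in> s"
    using sfp.p_le[OF s fl[OF x]] by metis
qed

definition E_emb :: "nat option hval \<Rightarrow> real set set hval" where
  "E_emb x = Base (E_up (num_set x))"

text \<open>The ideal of all rational intervals containing every possible value. No choice is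
  involved, so monotonicity holds for arbitrary nonempty \<open>J\<close>.\<close>

definition E_out :: "(nat \<Rightarrow> 'i set) \<Rightarrow> ('i \<Rightarrow> real set set hval) \<Rightarrow> (nat \<Rightarrow> real set) \<Rightarrow> real set set hval" where
  "E_out A s J = Base (E_up (index_sets.vals A (\<lambda>a. E_val (s a)) J))"

lemma sfp_E: "sfp (E_dom k) (lev_p E_dom E_p k)"
proof (induction k)
  case 0
  then show ?case by (simp add: sfp_E_base)
next
  case (Suc k)
  interpret fun_domain "E_dom k" "lev_p E_dom E_p k" E_base E_p UNIV
    by (rule fun_domain_UNIV[OF Suc sfp_E_base])
  show ?case using sfp_fs by simp
qed

lemma E_val_nonempty:
  assumes "x \<in> Field E_base"
  shows "E_val x \<noteq> {}"
proof
  assume "E_val x = {}"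
  then obtain K where "K \<in> base_val x" "K \<subseteq> {}"
    using E_ideal_compactness[OF E_field_ideal[OF assms], of "{}"] by (auto simp: E_val_def)
  then show False using E_idealD(1)[OF E_field_ideal[OF assms]] E_compact_nonempty by blast
qed

lemma E_base_anti: "(x, y) \<in> E_base \<Longrightarrow> E_val y \<subseteq> E_val x"
  unfolding E_base_iff E_val_def by blast

interpretation E: real_types E_base E_p E_val E_dom "\<lambda>_. UNIV" E_emb "\<lambda>X. X \<noteq> {}" E_out
proof (rule real_types.intro)
  fix k
  show "E_dom 0 = E_base" "E_dom (Suc k) = fs (E_dom k) E_base UNIV" by simp_all
  show "fun_domain (E_dom k) (lev_p E_dom E_p k) E_base E_p UNIV"
    by (rule fun_domain_UNIV[OF sfp_E sfp_E_base])
next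
  fix x :: "real set set hval" and l h :: real assume x: "x \<in> Field E_base"
  show "\<exists>i. E_val (E_p i x) \<subseteq> {l<..<h}" if "E_val x \<subseteq> {l<..<h}"
  proof -
    obtain K where K: "K \<in> base_val x" "K \<subseteq> {l<..<h}"
      using E_ideal_compactness[OF E_field_ideal[OF x], of "{l<..<h}"] \<open>E_val x \<subseteq> {l<..<h}\<close>
      by (auto simp: E_val_def)
    then have "K \<in> range E_enum" using E_idealD(1)[OF E_field_ideal[OF x]] range_E_enum by blast
    then obtain k where k: "K = E_enum k" by blast
    then have "K \<in> base_val (E_p (Suc k) x)" using E_enum_in_E_p[OF x, of k "Suc k"] K by simp
    then have "E_val (E_p (Suc k) x) \<subseteq> K" unfolding E_val_def by blast
    then show ?thesis using K(2) by blast
  qed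
  show "w \<in> E_val x" if "\<And>i. w \<in> E_val (E_p i x)" for w
    unfolding E_val_def
  proof
    fix K assume K: "K \<in> base_val x"
    then have "K \<in> range E_enum" using E_idealD(1)[OF E_field_ideal[OF x]] range_E_enum by blast
    then obtain k where k: "K = E_enum k" by blast
    then have "K \<in> base_val (E_p (Suc k) x)" using E_enum_in_E_p[OF x, of k "Suc k"] K by simp
    then show "w \<in> K" using that[of "Suc k"] unfolding E_val_def by blast
  qed
next
  show "cnt flatN flat_p E_base E_p E_emb"
  proof (rule cnt_from_flat[OF sfp_E_base])
    fix m
    show "(E_emb Bot, E_emb (Num m)) \<in> E_base"
      unfolding E_base_iff E_emb_def using E_up_field[of UNIV] E_up_field[of "{real m}"]
      by (auto simp: E_up_def)
  qed
next
  show "E_val (E_emb (Num m)) = {real m}" for m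
    by (simp add: E_emb_def E_val_single)
next
  fix A :: "nat \<Rightarrow> nat option hval set" and s s' :: "nat option hval \<Rightarrow> real set set hval"
    and J J' :: "nat \<Rightarrow> real set"
  assume A: "index_sets A" and s: "\<And>a. a \<in> \<Union>(range A) \<Longrightarrow> (s a, s' a) \<in> E_base"
    and J: "\<And>i. J' i \<subseteq> J i" "\<And>i. J i \<noteq> {}" "\<And>i. J' i \<noteq> {}"
  interpret index_sets A by (rule A)
  have "vals (\<lambda>a. E_val (s a)) J \<noteq> {}" "vals (\<lambda>a. E_val (s' a)) J' \<noteq> {}"
    by (rule vals_nonempty; use J(2,3) E_val_nonempty[OF FieldI1[OF s]] E_val_nonempty[OF FieldI2[OF s]] in blast)+
  moreover have "vals (\<lambda>a. E_val (s' a)) J' \<subseteq> vals (\<lambda>a. E_val (s a)) J"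
    by (rule vals_mono) (use s E_base_anti J(1) in blast)+
  ultimately show "(E_out A s J, E_out A s' J') \<in> E_base"
    unfolding E_base_iff E_out_def using E_up_field by (auto simp: E_up_def)
next
  show "index_sets.vals A (\<lambda>a. E_val (s a)) J \<subseteq> E_val (E_out A s J)"
    if "index_sets A" for A :: "nat \<Rightarrow> nat option hval set" and s J
    unfolding E_out_def by (rule E_val_up_sup)
next
  fix A :: "nat \<Rightarrow> nat option hval set" and ss :: "nat \<Rightarrow> nat option hval \<Rightarrow> real set set hval"
    and JJ :: "nat \<Rightarrow> nat \<Rightarrow> real set" and \<rho> :: "nat option hval \<Rightarrow> real" and e :: real
  assume A: "index_sets A"
    and mono: "\<And>m n a. m \<le> n \<Longrightarrow> a \<in> \<Union>(range A) \<Longrightarrow> (ss m a, ss n a) \<in> E_base"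
    and J: "\<And>m n i. m \<le> n \<Longrightarrow> JJ n i \<subseteq> JJ m i"
    and conv: "\<And>a e. a \<in> \<Union>(range A) \<Longrightarrow> e > 0 \<Longrightarrow> \<exists>m. E_val (ss m a) \<subseteq> {\<rho> a - e..\<rho> a + e}"
    and J_int: "(\<And>j. index_sets.delta A \<rho> j = 0) \<Longrightarrow> \<exists>u. \<forall>e>0. \<exists>m N. \<forall>i\<ge>N. JJ m i \<subseteq> {u - e..u + e}"
    and J_conv: "\<And>i. (\<And>j. j < i \<Longrightarrow> index_sets.delta A \<rho> j < 1 / 4) \<Longrightarrow>
      \<exists>u. \<forall>e>0. \<exists>m. JJ m i \<subseteq> {u - e..u + e}"
    and e: "e > 0"
  interpret index_sets A by (rule A)
  have "\<exists>w. \<forall>e>0. \<exists>m. vals (\<lambda>a. E_val (ss m a)) (JJ m) \<subseteq> {w - e..w + e}"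
  proof (rule vals_shrink)
    show "E_val (ss n a) \<subseteq> E_val (ss m a)" if "m \<le> n" "a \<in> \<Union>(range A)" for m n a
      using E_base_anti[OF mono[OF that]] .
  qed (fact J conv J_int J_conv)+
  then obtain w m where "vals (\<lambda>a. E_val (ss m a)) (JJ m) \<subseteq> {w - e / 2..w + e / 2}"
    using e by (meson half_gt_zero)
  then have "E_val (E_out A (ss m) (JJ m)) \<subseteq> {w - 2 * (e / 2)..w + 2 * (e / 2)}"
    unfolding E_out_def using e by (intro E_val_up_subset) auto
  then show "\<exists>m c. E_val (E_out A (ss m) (JJ m)) \<subseteq> {c - e..c + e}" by auto
qed (simp_all add: sfp_E_base E_val_nonempty E_base_anti)

lemma eqE_eq: "eqE = E.eqD"
proof -
  have "(\<lambda>a b. a \<in> Field E_base \<and> b \<in> Field E_base \<and>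
     (\<exists>x. \<Inter>(base_val a) = {x} \<and> \<Inter>(base_val b) = {x})) = same_real E_base E_val"
    by (simp add: same_real_def E_val_def fun_eq_iff)
  then show ?thesis unfolding eqE_def E.eqD_def by simp
qed

section \<open>Signed digit sequences\<close>

definition part_val :: "(nat \<Rightarrow> int option) \<Rightarrow> nat \<Rightarrow> real" where
  "part_val s n = real_of_int (the (s 0)) + (\<Sum>i<n. real_of_int (the (s (Suc i))) / 2 ^ Suc i)"

text \<open>These are exactly the values of the total extensions of \<open>s\<close>, see
  \<open>S_val_in_seq_val\<close> and \<open>seq_val_extension\<close>; the empty sequence gives the
  whole line.\<close>

definition seq_val :: "(nat \<Rightarrow> int option) \<Rightarrow> real set" where
  "seq_val s = {w. \<forall>n. s n \<noteq> None \<longrightarrow> \<bar>w - part_val s n\<bar> \<le> 1 / 2 ^ n}"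

definition S_ival :: "(nat \<Rightarrow> int option) hval \<Rightarrow> real set" where
  "S_ival x = seq_val (base_val x)"

definition total_seq :: "(nat \<Rightarrow> int option) \<Rightarrow> bool" where
  "total_seq s \<longleftrightarrow> (\<forall>n. s n \<noteq> None)"

lemma S_seqD: "S_seq s \<Longrightarrow> s (Suc n) \<noteq> None \<Longrightarrow> s n \<noteq> None"
  "S_seq s \<Longrightarrow> s (Suc n) \<noteq> None \<Longrightarrow> the (s (Suc n)) \<in> {-1, 0, 1}"
  unfolding S_seq_def by blast+

lemma S_seq_down: "S_seq s \<Longrightarrow> s n \<noteq> None \<Longrightarrow> m \<le> n \<Longrightarrow> s m \<noteq> None"
proof (induction n arbitrary: m)
  case (Suc n)
  then show ?case using S_seqD(1)[of s n] by (cases "m = Suc n") auto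
qed simp

lemma digit_abs: "S_seq s \<Longrightarrow> s (Suc n) \<noteq> None \<Longrightarrow> \<bar>real_of_int (the (s (Suc n)))\<bar> \<le> 1"
  using S_seqD(2)[of s n] by auto

lemma part_val_Suc: "part_val s (Suc n) = part_val s n + real_of_int (the (s (Suc n))) / 2 ^ Suc n"
  by (simp add: part_val_def)

lemma part_val_cong: "(\<And>i. i \<le> n \<Longrightarrow> s i = t i) \<Longrightarrow> part_val s n = part_val t n"
  unfolding part_val_def by (intro arg_cong2[where f = "(+)"] sum.cong) auto

lemma part_val_mono: "s \<subseteq>\<^sub>m t \<Longrightarrow> S_seq s \<Longrightarrow> s n \<noteq> None \<Longrightarrow> part_val s n = part_val t n"
  by (rule part_val_cong) (metis S_seq_down domIff map_le_def)

lemma seq_val_mono: "s \<subseteq>\<^sub>m t \<Longrightarrow> S_seq s \<Longrightarrow> seq_val t \<subseteq> seq_val s"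
  unfolding seq_val_def using part_val_mono by (fastforce simp: map_le_def dom_def)

lemma seq_val_closed: "closed (seq_val s)"
proof -
  have "seq_val s = (\<Inter>n\<in>{n. s n \<noteq> None}. {part_val s n - 1 / 2 ^ n..part_val s n + 1 / 2 ^ n})"
    by (auto simp: seq_val_def abs_le_iff algebra_simps)
  then show ?thesis by auto
qed

lemma seq_val_subset:
  "s n \<noteq> None \<Longrightarrow> seq_val s \<subseteq> {part_val s n - 1 / 2 ^ n..part_val s n + 1 / 2 ^ n}"
  by (auto simp: seq_val_def abs_le_iff algebra_simps)

lemma nested_step:
  assumes "S_seq s" "s (Suc n) \<noteq> None" "\<bar>w - part_val s (Suc n)\<bar> \<le> 1 / 2 ^ Suc n"
  shows "\<bar>w - part_val s n\<bar> \<le> 1 / 2 ^ n"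
proof -
  have "\<bar>real_of_int (the (s (Suc n))) / 2 ^ Suc n\<bar> \<le> 1 / 2 ^ Suc n"
    using digit_abs[OF assms(1,2)] by (simp add: divide_right_mono)
  then have "\<bar>w - part_val s n\<bar> \<le> 1 / 2 ^ Suc n + 1 / 2 ^ Suc n"
    using assms(3) unfolding part_val_Suc by linarith
  then show ?thesis by simp
qed

lemma nested:
  assumes "S_seq s" "s n \<noteq> None" "\<bar>w - part_val s n\<bar> \<le> 1 / 2 ^ n" "m \<le> n"
  shows "\<bar>w - part_val s m\<bar> \<le> 1 / 2 ^ m"
  using assms(4,2,3)
proof (induction n rule: dec_induct)
  case (step n)
  then show ?case using nested_step[OF assms(1)] S_seqD(1)[OF assms(1)] by blast
qed simp

text \<open>The intervals are nested, since a digit shifts the centre by at most the new radius.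
  Hence only the last condition counts.\<close>

lemma seq_val_last:
  assumes "S_seq s" "s n \<noteq> None" "s (Suc n) = None"
  shows "seq_val s = {part_val s n - 1 / 2 ^ n..part_val s n + 1 / 2 ^ n}"
proof (intro equalityI seq_val_subset assms(2) subsetI)
  fix w assume "w \<in> {part_val s n - 1 / 2 ^ n..part_val s n + 1 / 2 ^ n}"
  then have w: "\<bar>w - part_val s n\<bar> \<le> 1 / 2 ^ n" by (auto simp: abs_le_iff)
  have "m \<le> n" if "s m \<noteq> None" for m
    using S_seq_down[OF assms(1) that, of "Suc n"] assms(3) by (meson not_less_eq_eq)
  then show "w \<in> seq_val s" using nested[OF assms(1,2) w] by (auto simp: seq_val_def)
qed

lemma seq_cases:
  assumes "S_seq s"
  obtains "total_seq s" | "s = Map.empty" | n where "s n \<noteq> None" "s (Suc n) = None"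
proof (cases "total_seq s")
  case False
  then obtain m where m: "s m = None" "\<forall>k<m. s k \<noteq> None"
    using exists_least_iff[of "\<lambda>n. s n = None"] by (auto simp: total_seq_def)
  show thesis
  proof (cases m)
    case 0
    then have "s k = None" for k using m(1) S_seq_down[OF assms] by (metis le0)
    then show thesis using that(2) by blast
  next
    case (Suc n)
    then show thesis using that(3)[of n] m by simp
  qed
qed (use that in blast)

definition zero_ext :: "(nat \<Rightarrow> int option) \<Rightarrow> nat \<Rightarrow> int option" where
  "zero_ext s n = (if s n = None then Some 0 else s n)"

lemma zero_ext:
  assumes "S_seq s"
  shows "S_seq (zero_ext s)" "total_seq (zero_ext s)" "s \<subseteq>\<^sub>m zero_ext s"
  using S_seqD(2)[OF assms] by (auto simp: S_seq_def total_seq_def zero_ext_def map_le_def)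

lemma S_val_in_seq_val:
  assumes s: "S_seq s" "total_seq s"
  shows "S_val (Base s) \<in> seq_val s"
proof -
  define d where "d n = real_of_int (the (s (Suc n))) / 2 ^ Suc n" for n
  have d: "\<bar>d n\<bar> \<le> (1 / 2) ^ Suc n" for n
    using digit_abs[OF s(1), of n] s(2) by (simp add: d_def total_seq_def abs_mult power_divide field_simps)
  have geo: "summable (\<lambda>n. (1 / 2::real) ^ Suc n)"
    using summable_mult[OF summable_geometric[of "1 / 2 :: real"], of "1 / 2"] by simp
  have sd: "summable (\<lambda>n. \<bar>d n\<bar>)"
    by (rule summable_comparison_test'[OF geo, of 0]) (use d in simp)
  then have sm: "summable d" by (rule summable_rabs_cancel)
  have "\<bar>S_val (Base s) - part_val s n\<bar> \<le> 1 / 2 ^ n" for n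
  proof -
    have "S_val (Base s) - part_val s n = suminf d - (\<Sum>i<n. d i)"
      unfolding S_val_def part_val_def d_def[abs_def] by simp
    also have "\<dots> = (\<Sum>i. d (i + n))"
      using suminf_split_initial_segment[OF sm, of n] by simp
    finally have eq: "S_val (Base s) - part_val s n = (\<Sum>i. d (i + n))" .
    have "\<bar>\<Sum>i. d (i + n)\<bar> \<le> (\<Sum>i. \<bar>d (i + n)\<bar>)"
      by (rule summable_rabs) (rule summable_ignore_initial_segment[OF sd])
    also have "\<dots> \<le> (\<Sum>i. (1 / 2) ^ Suc (i + n))"
      by (intro suminf_le d summable_ignore_initial_segment[OF sd]
          summable_ignore_initial_segment[OF geo, of n])
    also have "\<dots> = (1 / 2) ^ Suc n * (\<Sum>i. (1 / 2) ^ i)"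
      by (subst suminf_mult[symmetric]) (simp_all add: power_add mult_ac summable_geometric)
    also have "\<dots> = 1 / 2 ^ n"
      using suminf_geometric[of "1 / 2 :: real"] by (simp add: power_divide)
    finally show ?thesis using eq by simp
  qed
  then show ?thesis by (simp add: seq_val_def)
qed

lemma seq_val_nonempty: "S_seq s \<Longrightarrow> seq_val s \<noteq> {}"
  using S_val_in_seq_val[of "zero_ext s"] zero_ext[of s] seq_val_mono[of s "zero_ext s"] by blast

lemma small_power:
  assumes "(e::real) > 0"
  obtains n :: nat where "1 / 2 ^ n < e"
  using real_arch_pow_inv[OF assms, of "1 / 2"] that by (auto simp: power_one_over)

lemma seq_val_total:
  assumes s: "S_seq s" "total_seq s"
  shows "seq_val s = {S_val (Base s)}"
proof -
  have "w = S_val (Base s)" if w: "w \<in> seq_val s" for w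
  proof (rule ccontr)
    assume "w \<noteq> S_val (Base s)"
    then have "\<bar>w - S_val (Base s)\<bar> / 2 > 0" by simp
    then obtain n where n: "1 / 2 ^ n < \<bar>w - S_val (Base s)\<bar> / 2" by (rule small_power)
    have "\<bar>w - part_val s n\<bar> \<le> 1 / 2 ^ n" "\<bar>S_val (Base s) - part_val s n\<bar> \<le> 1 / 2 ^ n"
      using w S_val_in_seq_val[OF s] s(2) by (auto simp: seq_val_def total_seq_def)
    then have "\<bar>(w - part_val s n) - (S_val (Base s) - part_val s n)\<bar> \<le> 1 / 2 ^ n + 1 / 2 ^ n"
      by (intro order_trans[OF abs_triangle_ineq4 add_mono])
    then show False using n by simp
  qed
  then show ?thesis using S_val_in_seq_val[OF s] by blast
qed

definition next_digit :: "real \<Rightarrow> real \<Rightarrow> nat \<Rightarrow> int" where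
  "next_digit w v n = (if w - v \<ge> 1 / 2 ^ Suc n then 1 else if w - v \<le> - (1 / 2 ^ Suc n) then -1 else 0)"

lemma next_digit:
  assumes "\<bar>w - v\<bar> \<le> 1 / 2 ^ n"
  shows "\<bar>w - (v + real_of_int (next_digit w v n) / 2 ^ Suc n)\<bar> \<le> 1 / 2 ^ Suc n"
proof -
  have "(1::real) / 2 ^ n = 2 * (1 / 2 ^ Suc n)" by simp
  then show ?thesis using assms unfolding next_digit_def by (auto simp: abs_le_iff)
qed

lemma seq_val_extension:
  assumes s: "S_seq s" and w: "w \<in> seq_val s"
  obtains t where "S_seq t" "total_seq t" "s \<subseteq>\<^sub>m t" "S_val (Base t) = w"
proof -
  define d0 where "d0 = (case s 0 of Some a \<Rightarrow> a | None \<Rightarrow> \<lfloor>w\<rfloor>)"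
  define d where "d n v = (case s (Suc n) of Some b \<Rightarrow> b | None \<Rightarrow> next_digit w v n)" for n v
  \<comment> \<open>The recursion carries the digit and the partial value reached; defined digits of
    \<open>s\<close> are kept, missing ones are steered towards \<open>w\<close>.\<close>
  define st where "st = rec_nat (d0, real_of_int d0)
    (\<lambda>n (a, v). (d n v, v + real_of_int (d n v) / 2 ^ Suc n))"
  define t where "t n = Some (fst (st n))" for n
  have st0: "st 0 = (d0, real_of_int d0)" by (simp add: st_def)
  have stS: "st (Suc n) = (d n (snd (st n)), snd (st n) + real_of_int (d n (snd (st n))) / 2 ^ Suc n)" for n
    by (simp add: st_def case_prod_unfold)
  have pt: "part_val t n = snd (st n)" for n
  proof (induction n)
    case 0
    then show ?case by (simp add: part_val_def t_def st0)
  next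
    case (Suc n)
    have "the (t (Suc n)) = d n (snd (st n))" by (simp add: t_def stS)
    then show ?case unfolding part_val_Suc Suc by (simp add: stS)
  qed
  have tot: "total_seq t" by (simp add: total_seq_def t_def)
  have "fst (st (Suc n)) \<in> {-1, 0, 1}" for n
    using S_seqD(2)[OF s, of n] by (auto simp: stS d_def next_digit_def split: option.splits)
  then have seq: "S_seq t" by (simp add: S_seq_def t_def)
  have le: "s \<subseteq>\<^sub>m t"
    unfolding map_le_def
  proof
    fix n assume n: "n \<in> dom s"
    show "s n = t n"
      using n by (cases n) (auto simp: t_def st0 stS d0_def d_def)
  qed
  have "\<bar>w - part_val t n\<bar> \<le> 1 / 2 ^ n" for n
  proof (induction n)
    case 0
    show ?case
    proof (cases "s 0")
      case None
      then have "part_val t 0 = real_of_int \<lfloor>w\<rfloor>" by (simp add: pt st0 d0_def)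
      then show ?thesis by (simp add: abs_le_iff) linarith
    next
      case (Some a)
      then show ?thesis using w part_val_mono[OF le s, of 0] by (auto simp: seq_val_def)
    qed
  next
    case (Suc n)
    show ?case
    proof (cases "s (Suc n)")
      case None
      then show ?thesis using next_digit[OF Suc] by (simp add: pt stS d_def del: power_Suc)
    next
      case (Some a)
      then show ?thesis using w part_val_mono[OF le s, of "Suc n"] by (auto simp: seq_val_def)
    qed
  qed
  then have "w \<in> seq_val t" by (simp add: seq_val_def)
  then have "S_val (Base t) = w" using seq_val_total[OF seq tot] by simp
  then show thesis using that seq tot le by blast
qed

subsection \<open>The domain of digit sequences\<close>

lemma S_base_iff': "(Base s, Base t) \<in> S_base \<longleftrightarrow> S_seq s \<and> S_seq t \<and> s \<subseteq>\<^sub>m t"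
  by (auto simp: S_base_def)

lemma Field_S_base: "x \<in> Field S_base \<longleftrightarrow> (\<exists>s. x = Base s \<and> S_seq s)"
  unfolding S_base_def Field_def by (auto intro: map_le_refl)

lemma S_base_iff:
  "(x, y) \<in> S_base \<longleftrightarrow> x \<in> Field S_base \<and> y \<in> Field S_base \<and> base_val x \<subseteq>\<^sub>m base_val y"
proof
  assume "x \<in> Field S_base \<and> y \<in> Field S_base \<and> base_val x \<subseteq>\<^sub>m base_val y"
  then show "(x, y) \<in> S_base" by (auto simp: Field_S_base S_base_iff')
next
  assume xy: "(x, y) \<in> S_base"
  then have "x \<in> Field S_base" "y \<in> Field S_base" by (auto intro: FieldI1 FieldI2)
  then show "x \<in> Field S_base \<and> y \<in> Field S_base \<and> base_val x \<subseteq>\<^sub>m base_val y"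
    using xy by (auto simp: S_base_def)
qed

lemma S_field_seq: "x \<in> Field S_base \<Longrightarrow> S_seq (base_val x)"
  by (auto simp: Field_S_base)

lemma S_ival_anti: "(x, y) \<in> S_base \<Longrightarrow> S_ival y \<subseteq> S_ival x"
  unfolding S_base_iff S_ival_def using seq_val_mono S_field_seq by blast

lemma S_ival_nonempty: "x \<in> Field S_base \<Longrightarrow> S_ival x \<noteq> {}"
  unfolding S_ival_def using seq_val_nonempty S_field_seq by blast

lemma S_base_antisym: "(x, y) \<in> S_base \<Longrightarrow> (y, x) \<in> S_base \<Longrightarrow> x = y"
  unfolding S_base_iff Field_S_base using map_le_antisym by (metis hval.sel)

lemma S_base_trans: "(x, y) \<in> S_base \<Longrightarrow> (y, z) \<in> S_base \<Longrightarrow> (x, z) \<in> S_base"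
  unfolding S_base_iff using map_le_trans by metis

lemma maximal_S_base: "maximal_in S_base x \<longleftrightarrow> x \<in> Field S_base \<and> total_seq (base_val x)"
proof
  assume x: "maximal_in S_base x"
  then have xf: "x \<in> Field S_base" by (simp add: maximal_in_def)
  note sq = S_field_seq[OF xf]
  have "(x, Base (zero_ext (base_val x))) \<in> S_base"
    using xf zero_ext[OF sq] by (auto simp: S_base_iff Field_S_base)
  then have "x = Base (zero_ext (base_val x))" using x by (metis maximal_in_def)
  then have "base_val x = zero_ext (base_val x)" by (metis hval.sel)
  then show "x \<in> Field S_base \<and> total_seq (base_val x)" using xf zero_ext(2)[OF sq] by simp
next
  assume x: "x \<in> Field S_base \<and> total_seq (base_val x)"
  have "y = x" if xy: "(x, y) \<in> S_base" for y
  proof (rule S_base_antisym[OF _ xy])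
    have "base_val x n = base_val y n" for n
      using xy x by (auto simp: S_base_iff map_le_def total_seq_def dom_def)
    then show "(y, x) \<in> S_base" using xy by (simp add: S_base_iff map_le_def)
  qed
  then show "maximal_in S_base x" using x by (simp add: maximal_in_def)
qed

lemma S_ival_maximal: "maximal_in S_base x \<Longrightarrow> S_ival x = {S_val x}"
  unfolding maximal_S_base Field_S_base S_ival_def using seq_val_total by auto

text \<open>Any real in the interval of a sequence is the value of a total extension, so consistency
  means that the intervals meet.\<close>

lemma S_sim_base_iff:
  "S_sim_base x y \<longleftrightarrow> x \<in> Field S_base \<and> y \<in> Field S_base \<and> S_ival x \<inter> S_ival y \<noteq> {}"
proof
  assume "S_sim_base x y"
  then obtain x' y' where xy: "(x, x') \<in> S_base" "maximal_in S_base x'"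
    "(y, y') \<in> S_base" "maximal_in S_base y'" "S_val x' = S_val y'"
    unfolding S_sim_base_def by blast
  have "S_ival x' \<subseteq> S_ival x" "S_ival y' \<subseteq> S_ival y"
    using xy(1,3) S_ival_anti by auto
  then show "x \<in> Field S_base \<and> y \<in> Field S_base \<and> S_ival x \<inter> S_ival y \<noteq> {}"
    using xy S_ival_maximal unfolding S_base_iff by force
next
  assume xy: "x \<in> Field S_base \<and> y \<in> Field S_base \<and> S_ival x \<inter> S_ival y \<noteq> {}"
  then obtain w where w: "w \<in> S_ival x" "w \<in> S_ival y" by blast
  have "\<exists>z'. (z, z') \<in> S_base \<and> maximal_in S_base z' \<and> S_val z' = w"
    if z: "z \<in> Field S_base" "w \<in> S_ival z" for z
  proof -
    obtain t where t: "S_seq t" "total_seq t" "base_val z \<subseteq>\<^sub>m t" "S_val (Base t) = w"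
      using seq_val_extension[OF S_field_seq[OF z(1)]] z(2) unfolding S_ival_def by blast
    then show ?thesis
      using z(1) by (intro exI[of _ "Base t"]) (auto simp: S_base_iff maximal_S_base Field_S_base)
  qed
  then show "S_sim_base x y" unfolding S_sim_base_def using xy w by metis
qed

text \<open>Bounding the integer part as well as the length keeps the range finite; a sequence with
  too large an integer part is cut to the empty one.\<close>

definition trunc_seq :: "nat \<Rightarrow> (nat \<Rightarrow> int option) \<Rightarrow> nat \<Rightarrow> int option" where
  "trunc_seq i s = (\<lambda>n. if n < i \<and> s 0 \<noteq> None \<and> \<bar>the (s 0)\<bar> \<le> int i then s n else None)"

definition S_p :: "nat \<Rightarrow> (nat \<Rightarrow> int option) hval \<Rightarrow> (nat \<Rightarrow> int option) hval" where
  "S_p i x = Base (trunc_seq i (base_val x))"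

lemma trunc_seq: "S_seq s \<Longrightarrow> S_seq (trunc_seq i s)" "trunc_seq i s \<subseteq>\<^sub>m s"
  by (auto simp: S_seq_def trunc_seq_def map_le_def dom_def split: if_splits)

lemma S_p_field: "x \<in> Field S_base \<Longrightarrow> S_p i x \<in> Field S_base"
  using trunc_seq by (auto simp: Field_S_base S_p_def)

lemma trunc_seq_eventually:
  assumes "S_seq s" "s n \<noteq> None"
  shows "\<exists>i. \<forall>k\<le>n. trunc_seq i s k = s k"
proof -
  have "s 0 \<noteq> None" using S_seq_down[OF assms] by simp
  then show ?thesis
    by (intro exI[of _ "max (Suc n) (nat \<bar>the (s 0)\<bar>)"]) (auto simp: trunc_seq_def)
qed

lemma S_directed_lub:
  assumes A: "directed_in S_base A"
  defines "u \<equiv> (\<lambda>n. if \<exists>a\<in>A. base_val a n \<noteq> None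
     then base_val (SOME a. a \<in> A \<and> base_val a n \<noteq> None) n else None)"
  shows "is_lub_in S_base A (Base u)" "u n \<noteq> None \<Longrightarrow> \<exists>a\<in>A. base_val a n = u n"
proof -
  have Af: "a \<in> Field S_base" if "a \<in> A" for a using A that by (auto simp: directed_in_def)
  have agree: "base_val a n = base_val b n"
    if ab: "a \<in> A" "b \<in> A" "base_val a n \<noteq> None" "base_val b n \<noteq> None" for a b n
  proof -
    obtain c where "(a, c) \<in> S_base" "(b, c) \<in> S_base"
      using A ab unfolding directed_in_def by meson
    then show ?thesis using ab unfolding S_base_iff map_le_def by (metis domIff)
  qed
  have u: "u n = base_val a n" if "a \<in> A" "base_val a n \<noteq> None" for a n
  proof -
    let ?b = "SOME a. a \<in> A \<and> base_val a n \<noteq> None"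
    have b: "?b \<in> A \<and> base_val ?b n \<noteq> None"
      by (rule someI[of "\<lambda>a. a \<in> A \<and> base_val a n \<noteq> None", OF conjI[OF that]])
    have "\<exists>a\<in>A. base_val a n \<noteq> None" using that by blast
    then have "u n = base_val ?b n" unfolding u_def by (rule if_P)
    also have "\<dots> = base_val a n" by (rule agree) (use b that in auto)
    finally show ?thesis .
  qed
  show uD: "\<exists>a\<in>A. base_val a n = u n" if "u n \<noteq> None" for n
  proof -
    have "\<exists>a\<in>A. base_val a n \<noteq> None"
      by (rule ccontr) (use that in \<open>simp add: u_def\<close>)
    then show ?thesis using u by metis
  qed
  have "S_seq u"
    unfolding S_seq_def
  proof (intro allI impI)
    fix n assume n: "u (Suc n) \<noteq> None"
    then obtain a where a: "a \<in> A" "base_val a (Suc n) = u (Suc n)" using uD by blast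
    then have "base_val a n \<noteq> None \<and> the (base_val a (Suc n)) \<in> {-1, 0, 1}"
      using S_field_seq[OF Af[OF a(1)]] n unfolding S_seq_def by metis
    then show "u n \<noteq> None \<and> the (u (Suc n)) \<in> {-1, 0, 1}" using a u by metis
  qed
  then have uf: "Base u \<in> Field S_base" by (auto simp: Field_S_base)
  show "is_lub_in S_base A (Base u)"
    unfolding is_lub_in_def
  proof (intro conjI ballI impI uf)
    show "(a, Base u) \<in> S_base" if "a \<in> A" for a
      using Af[OF that] uf u[OF that] by (auto simp: S_base_iff map_le_def dom_def)
    show "(Base u, y) \<in> S_base" if y: "y \<in> Field S_base" "\<forall>a\<in>A. (a, y) \<in> S_base" for y
      unfolding S_base_iff map_le_def
    proof (intro conjI ballI uf y(1))
      fix n assume "n \<in> dom (base_val (Base u))"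
      then have n: "u n \<noteq> None" by auto
      then obtain a where a: "a \<in> A" "base_val a n = u n" using uD by blast
      then have "base_val a n = base_val y n"
        using y(2) n unfolding S_base_iff map_le_def by (metis domIff)
      then show "base_val (Base u) n = base_val y n" using a by simp
    qed
  qed
qed

lemma sfp_S_base: "sfp S_base S_p"
proof
  show "Field S_base \<noteq> {}" using Field_S_base[of "Base Map.empty"] by (auto simp: S_seq_def)
next
  show "(x, x) \<in> S_base" if "x \<in> Field S_base" for x using that by (simp add: S_base_iff)
  show "(x, z) \<in> S_base" if "(x, y) \<in> S_base" "(y, z) \<in> S_base" for x y z
    using S_base_trans that .
  show "x = y" if "(x, y) \<in> S_base" "(y, x) \<in> S_base" for x y
    using S_base_antisym that .
  show "\<exists>x. is_lub_in S_base A x" if "directed_in S_base A" for A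
    using S_directed_lub(1)[OF that] ..
next
  fix x i assume x: "x \<in> Field S_base"
  show "(S_p i x, x) \<in> S_base"
    unfolding S_base_iff using x S_p_field trunc_seq(2) by (auto simp: S_p_def)
  fix j assume "i \<le> j"
  then show "(S_p i x, S_p j x) \<in> S_base"
    unfolding S_base_iff using x S_p_field
    by (auto simp: S_p_def map_le_def trunc_seq_def dom_def split: if_splits)
next
  fix x y i assume xy: "(x, y) \<in> S_base"
  then have eq: "base_val x n \<noteq> None \<Longrightarrow> base_val x n = base_val y n" for n
    by (auto simp: S_base_iff map_le_def dom_def)
  show "(S_p i x, S_p i y) \<in> S_base"
    using xy S_p_field eq[of 0] eq unfolding S_base_iff
    by (auto simp: S_p_def map_le_def trunc_seq_def dom_def split: if_splits)
next
  fix i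
  \<comment> \<open>The extra 1 admits the digits -1 and 1 even when \<open>i\<close> is 0.\<close>
  define Y :: "int set" where "Y = {- int i - 1..int i + 1}"
  define Z where "Z = (\<Union>X\<in>Pow {..<i}. {m :: nat \<Rightarrow> int option. dom m = X \<and> ran m \<subseteq> Y})"
  have "finite {m :: nat \<Rightarrow> int option. dom m = X \<and> ran m \<subseteq> Y}" if "X \<in> Pow {..<i}" for X
    using that by (intro finite_set_of_finite_maps) (auto intro: finite_subset simp: Y_def)
  then have "finite Z" unfolding Z_def by auto
  moreover have "trunc_seq i s \<in> Z" if s: "S_seq s" for s
  proof -
    have "b \<in> Y" if b: "trunc_seq i s n = Some b" for n b
      using b S_seqD(2)[OF s, of "n - 1"] by (cases n) (auto simp: trunc_seq_def Y_def split: if_splits)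
    moreover have "dom (trunc_seq i s) \<subseteq> {..<i}" by (auto simp: trunc_seq_def dom_def split: if_splits)
    ultimately show ?thesis by (auto simp: Z_def ran_def)
  qed
  then have "S_p i ` Field S_base \<subseteq> Base ` Z" by (auto simp: S_p_def Field_S_base)
  ultimately show "finite (S_p i ` Field S_base)" by (meson finite_imageI finite_subset)
next
  fix x y assume x: "x \<in> Field S_base" and y: "y \<in> Field S_base" and le: "\<And>i. (S_p i x, y) \<in> S_base"
  show "(x, y) \<in> S_base"
    unfolding S_base_iff map_le_def
  proof (intro conjI ballI x y)
    fix n assume "n \<in> dom (base_val x)"
    then have n: "base_val x n \<noteq> None" by auto
    obtain i where "trunc_seq i (base_val x) n = base_val x n"
      using trunc_seq_eventually[OF S_field_seq[OF x] n] by blast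
    then show "base_val x n = base_val y n"
      using le[of i] n unfolding S_base_iff map_le_def S_p_def by (metis domIff hval.sel)
  qed
next
  fix A x i assume A: "directed_in S_base A" and x: "is_lub_in S_base A x"
  obtain u where u: "is_lub_in S_base A (Base u)" "\<And>n. u n \<noteq> None \<Longrightarrow> \<exists>a\<in>A. base_val a n = u n"
    using S_directed_lub[OF A] by blast
  have "x = Base u"
    using x u(1) S_base_antisym unfolding is_lub_in_def by meson
  then have "base_val x n \<noteq> None \<Longrightarrow> \<exists>a\<in>A. base_val a n = base_val x n" for n
    using u(2) by simp
  then obtain a where a: "\<And>n. base_val x n \<noteq> None \<Longrightarrow> a n \<in> A \<and> base_val (a n) n = base_val x n"
    by metis
  define N where "N = {n. n < i \<and> base_val x n \<noteq> None}"
  have "\<exists>b\<in>A. \<forall>c\<in>a ` N. (c, b) \<in> S_base"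
    by (rule finite_directed_bound[OF A S_base_trans]) (use a in \<open>auto simp: N_def\<close>)
  then obtain b where b: "b \<in> A" "\<And>n. n \<in> N \<Longrightarrow> (a n, b) \<in> S_base" by blast
  have bx: "(b, x) \<in> S_base" using x b(1) by (simp add: is_lub_in_def)
  have "base_val x n = base_val b n" if "n < i" for n
  proof (cases "base_val x n")
    case None
    then show ?thesis using bx unfolding S_base_iff map_le_def by (metis domIff)
  next
    case (Some d)
    then have "(a n, b) \<in> S_base" "base_val (a n) n = Some d" using b(2)[of n] a[of n] that by (auto simp: N_def)
    then show ?thesis using Some unfolding S_base_iff map_le_def by (metis domIff option.distinct(1))
  qed
  then have "S_p i x = S_p i b"
    by (cases "i = 0") (auto simp: S_p_def trunc_seq_def fun_eq_iff)
  then show "\<exists>a\<in>A. S_p i x = S_p i a" using b(1) by blast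
qed

lemma S_ival_p:
  assumes "x \<in> Field S_base" "base_val x n \<noteq> None"
  shows "\<exists>i. S_ival (S_p i x) \<subseteq> {part_val (base_val x) n - 1 / 2 ^ n..part_val (base_val x) n + 1 / 2 ^ n}"
proof -
  obtain i where i: "\<And>k. k \<le> n \<Longrightarrow> trunc_seq i (base_val x) k = base_val x k"
    using trunc_seq_eventually[OF S_field_seq[OF assms(1)] assms(2)] by blast
  have "part_val (trunc_seq i (base_val x)) n = part_val (base_val x) n"
    by (rule part_val_cong) (rule i)
  then show ?thesis
    using seq_val_subset[of "trunc_seq i (base_val x)" n] i[of n] assms(2)
    by (auto simp: S_ival_def S_p_def)
qed

lemma S_ival_lim:
  assumes x: "x \<in> Field S_base" and w: "\<And>i. w \<in> S_ival (S_p i x)"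
  shows "w \<in> S_ival x"
proof -
  have "\<bar>w - part_val (base_val x) n\<bar> \<le> 1 / 2 ^ n" if "base_val x n \<noteq> None" for n
    using S_ival_p[OF x that] w by (force simp: abs_le_iff)
  then show ?thesis by (simp add: S_ival_def seq_val_def)
qed

lemma S_ival_open:
  assumes x: "x \<in> Field S_base" and sub: "S_ival x \<subseteq> {l<..<h}"
  shows "\<exists>i. S_ival (S_p i x) \<subseteq> {l<..<h}"
proof -
  note s = S_field_seq[OF x]
  have "\<exists>n. base_val x n \<noteq> None \<and>
      {part_val (base_val x) n - 1 / 2 ^ n..part_val (base_val x) n + 1 / 2 ^ n} \<subseteq> {l<..<h}"
    using s
  proof (cases rule: seq_cases)
    case 1
    define v where "v = S_val (Base (base_val x))"
    have v: "seq_val (base_val x) = {v}" using seq_val_total[OF s 1] by (simp add: v_def)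
    then have "l < v" "v < h" using sub by (auto simp: S_ival_def)
    then obtain n where n: "1 / 2 ^ n < min (v - l) (h - v) / 2" using small_power[of "min (v - l) (h - v) / 2"] by auto
    have bn: "base_val x n \<noteq> None" using 1 by (simp add: total_seq_def)
    have "\<bar>v - part_val (base_val x) n\<bar> \<le> 1 / 2 ^ n" using v bn by (auto simp: seq_val_def)
    then have "{part_val (base_val x) n - 1 / 2 ^ n..part_val (base_val x) n + 1 / 2 ^ n} \<subseteq> {l<..<h}"
      using n by (auto simp: abs_le_iff)
    then show ?thesis using bn by blast
  next
    case 2
    then have "S_ival x = UNIV" by (simp add: S_ival_def seq_val_def)
    then have "h + \<bar>l\<bar> + 1 < h" using sub by (metis UNIV_I greaterThanLessThan_iff subsetD)
    then have False by linarith
    then show ?thesis ..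
  next
    case (3 n)
    then show ?thesis using seq_val_last[OF s 3] sub unfolding S_ival_def by blast
  qed
  then obtain n where n: "base_val x n \<noteq> None"
    "{part_val (base_val x) n - 1 / 2 ^ n..part_val (base_val x) n + 1 / 2 ^ n} \<subseteq> {l<..<h}" by blast
  then show ?thesis using S_ival_p[OF x n(1)] by blast
qed

text \<open>Unless \<open>x\<close> is empty, the intersections of the approximating intervals form
  a decreasing sequence of sets that are eventually compact, so a common real exists.\<close>

lemma S_ival_meet:
  assumes x: "x \<in> Field S_base" and y: "y \<in> Field S_base"
    and meet: "\<And>n. S_ival (S_p n x) \<inter> S_ival (S_p n y) \<noteq> {}"
  shows "S_ival x \<inter> S_ival y \<noteq> {}"
proof (cases "base_val x 0 = None")
  case True
  then have "base_val x n = None" for n using S_seq_down[OF S_field_seq[OF x]] by (metis le0)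
  then show ?thesis using S_ival_nonempty[OF y] by (auto simp: S_ival_def seq_val_def)
next
  case False
  define C where "C n = S_ival (S_p n x) \<inter> S_ival (S_p n y)" for n
  have anti: "C n \<subseteq> C m" if "m \<le> n" for m n
    unfolding C_def
    using S_ival_anti[OF sfp.p_chain[OF sfp_S_base x that]] S_ival_anti[OF sfp.p_chain[OF sfp_S_base y that]]
    by blast
  obtain i where i: "S_ival (S_p i x) \<subseteq> {part_val (base_val x) 0 - 1 / 2 ^ 0..part_val (base_val x) 0 + 1 / 2 ^ 0}"
    using S_ival_p[OF x False] by blast
  have "closed (C n)" for n
    unfolding C_def S_ival_def by (intro closed_Int seq_val_closed)
  moreover have "bounded (C (i + n))" for n
  proof (rule bounded_subset[OF bounded_closed_interval])
    have "C (i + n) \<subseteq> S_ival (S_p i x)" using anti[of i "i + n"] by (auto simp: C_def)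
    then show "C (i + n) \<subseteq> {part_val (base_val x) 0 - 1 / 2 ^ 0..part_val (base_val x) 0 + 1 / 2 ^ 0}"
      using i by (rule order_trans)
  qed
  ultimately have "compact (C (i + n))" for n by (simp add: compact_eq_bounded_closed)
  then have "\<Inter>(range (\<lambda>n. C (i + n))) \<noteq> {}"
    using meet anti by (intro compact_nest[of "\<lambda>n. C (i + n)"]) (simp_all add: C_def[symmetric])
  then obtain w where "\<And>n. w \<in> C (i + n)" by auto
  then have "w \<in> C n" for n using anti[of n "i + n"] by auto
  then show ?thesis using S_ival_lim[OF x] S_ival_lim[OF y] unfolding C_def by blast
qed

subsection \<open>The smoothened domains\<close>

definition smooth :: "nat \<Rightarrow> (nat \<Rightarrow> int option) hval set" where
  "smooth k = {h. \<forall>x y. S_sim k x y \<longrightarrow> S_sim_base (app h x) (app h y)}"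

lemma S_dom_Suc: "S_dom (Suc k) = fs (S_dom k) S_base (smooth k)"
  by (auto simp: fs_def smooth_def)

lemma S_sim_field: "S_sim k x y \<Longrightarrow> x \<in> Field (S_dom k) \<and> y \<in> Field (S_dom k)"
  by (cases k) (auto simp: S_sim_base_iff)

text \<open>Less output means larger intervals, so smoothness passes to smaller functions. It passes
  to limits by the compactness in \<open>S_ival_meet\<close>.\<close>

lemma S_domain_step:
  assumes "sfp (S_dom k) (lev_p S_dom S_p k)"
  shows "fun_domain (S_dom k) (lev_p S_dom S_p k) S_base S_p (smooth k)"
proof -
  interpret sfp_pair "S_dom k" "lev_p S_dom S_p k" S_base S_p
    by (simp add: sfp_pair_def assms sfp_S_base)
  show ?thesis
  proof
    obtain c where c: "c \<in> Field S_base" using s.nonempty by blast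
    have "code (\<lambda>_. c) \<in> Field (fun_space (S_dom k) S_base)"
      by (intro code_field cnt_const s.sfp_axioms c)
    moreover have "code (\<lambda>_. c) \<in> smooth k"
      using c S_ival_nonempty[OF c] S_sim_field by (auto simp: smooth_def app_code' S_sim_base_iff)
    ultimately show "Field (fun_space (S_dom k) S_base) \<inter> smooth k \<noteq> {}" by blast
  next
    fix F G assume GF: "(G, F) \<in> fun_space (S_dom k) S_base" and F: "F \<in> smooth k"
    have "S_sim_base (app G x) (app G y)" if xy: "S_sim k x y" for x y
    proof -
      have "(app G x, app F x) \<in> S_base" "(app G y, app F y) \<in> S_base"
        using GF S_sim_field[OF xy] unfolding fun_space_rel by blast+
      moreover have "S_sim_base (app F x) (app F y)" using F xy by (simp add: smooth_def)
      ultimately show ?thesis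
        using S_ival_anti[of "app G x"] S_ival_anti[of "app G y"] unfolding S_sim_base_iff S_base_iff by blast
    qed
    then show "G \<in> smooth k" by (simp add: smooth_def)
  next
    fix F assume F: "F \<in> Field (fun_space (S_dom k) S_base)"
      and lim: "\<And>i. fs_p (S_dom k) (lev_p S_dom S_p k) S_p i F \<in> smooth k"
    let ?p = "lev_p S_dom S_p k"
    have c: "cnt (S_dom k) ?p S_base S_p (app F)" using F field_fun_space_iff by blast
    have app: "app F x \<in> Field S_base" if "x \<in> Field (S_dom k)" for x
      using cnt_field[OF c assms that] .
    have "S_sim_base (app F x) (app F y)" if xy: "S_sim k x y" for x y
    proof -
      have x: "x \<in> Field (S_dom k)" and y: "y \<in> Field (S_dom k)" using S_sim_field[OF xy] by auto
      then have xf: "app F x \<in> Field S_base" and yf: "app F y \<in> Field S_base"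
        using app by auto
      \<comment> \<open>The assumption speaks of truncations with one index for argument and value;
        these eventually dominate any fixed truncation of the value.\<close>
      have le: "\<exists>j. \<forall>i\<ge>j. (S_p n (app F z), S_p i (app F (?p i z))) \<in> S_base" if z: "z \<in> Field (S_dom k)" for n z
      proof -
        obtain j where j: "j \<ge> n" "S_p n (app F z) = S_p n (app F (?p j z))"
          using cnt_att[OF c assms sfp_S_base z] by blast
        have "(S_p n (app F (?p j z)), S_p i (app F (?p i z))) \<in> S_base" if i: "i \<ge> j" for i
        proof (rule s.ord_trans)
          show "(S_p n (app F (?p j z)), S_p n (app F (?p i z))) \<in> S_base"
            using s.p_mono[OF cnt_mono[OF c r.p_chain[OF z i]]] .
          show "(S_p n (app F (?p i z)), S_p i (app F (?p i z))) \<in> S_base"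
            using s.p_chain[OF app[OF r.p_field[OF z]]] i j(1) by simp
        qed
        then show ?thesis using j(2) by auto
      qed
      have "S_ival (S_p n (app F x)) \<inter> S_ival (S_p n (app F y)) \<noteq> {}" for n
      proof -
        obtain j where j: "\<And>i. i \<ge> j \<Longrightarrow> (S_p n (app F x), S_p i (app F (?p i x))) \<in> S_base"
          using le[OF x] by blast
        obtain j' where j': "\<And>i. i \<ge> j' \<Longrightarrow> (S_p n (app F y), S_p i (app F (?p i y))) \<in> S_base"
          using le[OF y] by blast
        let ?i = "max j j'"
        have "S_sim_base (S_p ?i (app F (?p ?i x))) (S_p ?i (app F (?p ?i y)))"
          using lim[of ?i] xy unfolding smooth_def mem_Collect_eq
          by (metis fs_p_app[OF x] fs_p_app[OF y])
        then show "S_ival (S_p n (app F x)) \<inter> S_ival (S_p n (app F y)) \<noteq> {}"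
          using S_ival_anti[OF j[of ?i]] S_ival_anti[OF j'[of ?i]] unfolding S_sim_base_iff by auto
      qed
      then show ?thesis
        using S_ival_meet[OF xf yf] xf yf by (simp add: S_sim_base_iff)
    qed
    then show "F \<in> smooth k" by (simp add: smooth_def)
  qed
qed

lemma sfp_S: "sfp (S_dom k) (lev_p S_dom S_p k)"
proof (induction k)
  case 0
  then show ?case by (simp add: sfp_S_base)
next
  case (Suc k)
  interpret fun_domain "S_dom k" "lev_p S_dom S_p k" S_base S_p "smooth k"
    by (rule S_domain_step[OF Suc])
  show ?case using sfp_fs by (simp add: S_dom_Suc del: S_dom.simps(2))
qed

lemma S_domain: "fun_domain (S_dom k) (lev_p S_dom S_p k) S_base S_p (smooth k)"
  by (rule S_domain_step[OF sfp_S])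

lemma S_sim_rsim: "S_sim k = rsim S_dom S_ival k"
proof (induction k)
  case 0
  then show ?case by (intro ext) (simp add: S_sim_base_iff)
next
  case (Suc k)
  interpret fun_domain "S_dom k" "lev_p S_dom S_p k" S_base S_p "smooth k" by (rule S_domain)
  have app: "app f x \<in> Field S_base" if "f \<in> Field (S_dom (Suc k))" "x \<in> Field (S_dom k)" for f x
    using app_field that by (simp add: S_dom_Suc del: S_dom.simps(2))
  have "S_sim (Suc k) f g \<longleftrightarrow> rsim S_dom S_ival (Suc k) f g" for f g
    unfolding S_sim.simps(2) rsim.simps(2) Suc[symmetric] S_sim_base_iff
    using app S_sim_field by blast
  then show ?case by blast
qed

subsection \<open>Greedy digits\<close>

definition list_seq :: "int list \<Rightarrow> nat \<Rightarrow> int option" where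
  "list_seq xs n = (if n < length xs then Some (xs ! n) else None)"

definition fits :: "real set \<Rightarrow> int list \<Rightarrow> int \<Rightarrow> bool" where
  "fits X xs d \<longleftrightarrow> (xs = [] \<or> d \<in> {-1, 0, 1}) \<and> X \<subseteq> seq_val (list_seq (xs @ [d]))"

text \<open>At most one digit is added per stage, and stage \<open>j\<close> reads only the sets
  before \<open>j\<close>. The digits are therefore unaffected by what becomes known later.\<close>

primrec greedy :: "(nat \<Rightarrow> real set) \<Rightarrow> nat \<Rightarrow> int list" where
  "greedy X 0 = []"
| "greedy X (Suc j) = (if \<exists>d. fits (X j) (greedy X j) d
     then greedy X j @ [SOME d. fits (X j) (greedy X j) d] else greedy X j)"

lemma greedy_Suc:
  obtains "greedy X (Suc j) = greedy X j" "\<And>d. \<not> fits (X j) (greedy X j) d"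
  | d where "greedy X (Suc j) = greedy X j @ [d]" "fits (X j) (greedy X j) d"
proof (cases "\<exists>d. fits (X j) (greedy X j) d")
  case True
  then show thesis using that(2)[of "SOME d. fits (X j) (greedy X j) d"] someI_ex[OF True] by simp
qed (use that(1) in simp)

lemma greedy_cong: "(\<And>i. i < j \<Longrightarrow> X i = Y i) \<Longrightarrow> greedy X j = greedy Y j"
  by (induction j) simp_all

lemma greedy_prefix: "i \<le> j \<Longrightarrow> list_seq (greedy X i) \<subseteq>\<^sub>m list_seq (greedy X j)"
proof (induction j rule: dec_induct)
  case (step j)
  have "list_seq (greedy X j) \<subseteq>\<^sub>m list_seq (greedy X (Suc j))"
    by (rule greedy_Suc[of X j])
      (auto simp: list_seq_def map_le_def nth_append dom_def simp del: greedy.simps split: if_splits)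
  with step.IH show ?case by (rule map_le_trans)
qed simp

lemma S_seq_greedy: "S_seq (list_seq (greedy X j))"
proof (induction j)
  case 0
  then show ?case by (simp add: S_seq_def list_seq_def)
next
  case (Suc j)
  show ?case
  proof (rule greedy_Suc[of X j])
    fix d assume d: "greedy X (Suc j) = greedy X j @ [d]" "fits (X j) (greedy X j) d"
    show ?thesis
      unfolding d(1) S_seq_def
    proof (intro allI impI)
      fix n assume n: "list_seq (greedy X j @ [d]) (Suc n) \<noteq> None"
      show "list_seq (greedy X j @ [d]) n \<noteq> None \<and> the (list_seq (greedy X j @ [d]) (Suc n)) \<in> {-1, 0, 1}"
      proof (cases "Suc n < length (greedy X j)")
        case True
        then have "the (list_seq (greedy X j) (Suc n)) \<in> {-1, 0, 1}"
          using S_seqD(2)[OF Suc, of n] by (simp add: list_seq_def)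
        then show ?thesis using True by (simp add: list_seq_def nth_append)
      next
        case False
        then have "Suc n = length (greedy X j)" using n by (auto simp: list_seq_def split: if_splits)
        then show ?thesis using d(2) unfolding fits_def by (auto simp: list_seq_def nth_append)
      qed
    qed
  qed (use Suc in simp)
qed

lemma greedy_sound: "(\<And>i. i < j \<Longrightarrow> W \<subseteq> X i) \<Longrightarrow> W \<subseteq> seq_val (list_seq (greedy X j))"
proof (induction j)
  case 0
  then show ?case by (simp add: seq_val_def list_seq_def)
next
  case (Suc j)
  show ?case
  proof (rule greedy_Suc[of X j])
    fix d assume "greedy X (Suc j) = greedy X j @ [d]" "fits (X j) (greedy X j) d"
    then show ?thesis using Suc.prems[of j] unfolding fits_def by auto
  qed (use Suc in simp)
qed

lemma seq_val_snoc:
  assumes s: "S_seq (list_seq (xs @ [d]))" and X: "X \<subseteq> seq_val (list_seq xs)"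
    and last: "X \<subseteq> {part_val (list_seq (xs @ [d])) (length xs) - 1 / 2 ^ length xs..
      part_val (list_seq (xs @ [d])) (length xs) + 1 / 2 ^ length xs}"
  shows "X \<subseteq> seq_val (list_seq (xs @ [d]))"
proof -
  have "seq_val (list_seq (xs @ [d])) = {part_val (list_seq (xs @ [d])) (length xs) - 1 / 2 ^ length xs..
      part_val (list_seq (xs @ [d])) (length xs) + 1 / 2 ^ length xs}"
    by (rule seq_val_last[OF s]) (auto simp: list_seq_def)
  then show ?thesis using last by simp
qed

text \<open>Redundancy of signed digits: neighbouring digit intervals overlap so much that a
  sufficiently small set lies inside one of them.\<close>

lemma fits_exists:
  assumes s: "S_seq (list_seq xs)" and X: "X \<subseteq> seq_val (list_seq xs)"
    and small: "X \<subseteq> {w - e..w + e}" "e \<le> 1 / 2 ^ Suc (length xs)" and w: "w \<in> X"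
  shows "\<exists>d. fits X xs d"
proof (cases xs)
  case Nil
  have seq: "S_seq (list_seq ([] @ [\<lfloor>w + 1/2\<rfloor>]))" by (simp add: S_seq_def list_seq_def)
  have "part_val (list_seq ([] @ [\<lfloor>w + 1/2\<rfloor>])) 0 = real_of_int \<lfloor>w + 1/2\<rfloor>"
    by (simp add: part_val_def list_seq_def)
  moreover have "X \<subseteq> {real_of_int \<lfloor>w + 1/2\<rfloor> - 1..real_of_int \<lfloor>w + 1/2\<rfloor> + 1}"
  proof
    fix x assume "x \<in> X"
    then have "x \<in> {w - e..w + e}" "e \<le> 1 / 2" using small Nil by auto
    then have "\<bar>x - w\<bar> \<le> 1 / 2" unfolding atLeastAtMost_iff by linarith
    moreover have "real_of_int \<lfloor>w + 1/2\<rfloor> \<le> w + 1/2" "w + 1/2 < real_of_int \<lfloor>w + 1/2\<rfloor> + 1"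
      using floor_correct[of "w + 1/2"] by auto
    ultimately show "x \<in> {real_of_int \<lfloor>w + 1/2\<rfloor> - 1..real_of_int \<lfloor>w + 1/2\<rfloor> + 1}"
      unfolding atLeastAtMost_iff by linarith
  qed
  ultimately have "X \<subseteq> seq_val (list_seq ([] @ [\<lfloor>w + 1/2\<rfloor>]))"
    using X Nil by (intro seq_val_snoc[OF seq]) auto
  then show ?thesis using Nil by (auto simp: fits_def)
next
  case (Cons x ys)
  define n where "n = length ys"
  have len: "length xs = Suc n" using Cons by (simp add: n_def)
  define v where "v = part_val (list_seq xs) n"
  have sv: "seq_val (list_seq xs) = {v - 1 / 2 ^ n..v + 1 / 2 ^ n}"
    unfolding v_def by (rule seq_val_last[OF s]) (auto simp: list_seq_def len)
  define h :: real where "h = 1 / 2 ^ Suc (Suc n)"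
  have h: "1 / 2 ^ n = 4 * h" "1 / 2 ^ Suc n = 2 * h" by (simp_all add: h_def)
  have Xw: "\<bar>x - w\<bar> \<le> h" "\<bar>x - v\<bar> \<le> 4 * h" if "x \<in> X" for x
    using that small X sv unfolding h[symmetric] h_def len by (force simp: abs_le_iff)+
  \<comment> \<open>The intervals for -1, 0, 1 are \<open>[v - 4h, v]\<close>,
    \<open>[v - 2h, v + 2h]\<close> and \<open>[v, v + 4h]\<close>; a set within \<open>h\<close> of
    \<open>w\<close> fits the one selected by comparing \<open>w - v\<close> with \<open>h\<close>
    and \<open>-h\<close>.\<close>
  define d :: int where "d = (if w - v > h then 1 else if w - v < - h then -1 else 0)"
  have seq: "S_seq (list_seq (xs @ [d]))"
    unfolding S_seq_def
  proof (intro allI impI)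
    fix m assume m: "list_seq (xs @ [d]) (Suc m) \<noteq> None"
    show "list_seq (xs @ [d]) m \<noteq> None \<and> the (list_seq (xs @ [d]) (Suc m)) \<in> {-1, 0, 1}"
    proof (cases "Suc m < length xs")
      case True
      then have "the (list_seq xs (Suc m)) \<in> {-1, 0, 1}"
        using S_seqD(2)[OF s, of m] by (simp add: list_seq_def)
      then show ?thesis using True by (simp add: list_seq_def nth_append)
    next
      case False
      then have "Suc m = length xs" using m by (auto simp: list_seq_def split: if_splits)
      then show ?thesis by (auto simp: list_seq_def nth_append d_def)
    qed
  qed
  have "part_val (list_seq (xs @ [d])) n = v"
    unfolding v_def by (rule part_val_cong) (auto simp: list_seq_def nth_append len)
  then have pv: "part_val (list_seq (xs @ [d])) (Suc n) = v + real_of_int d * (2 * h)"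
    unfolding part_val_Suc h(2)[symmetric] by (simp add: list_seq_def len nth_append)
  have "X \<subseteq> seq_val (list_seq (xs @ [d]))"
  proof (rule seq_val_snoc[OF seq X])
    show "X \<subseteq> {part_val (list_seq (xs @ [d])) (length xs) - 1 / 2 ^ length xs..
      part_val (list_seq (xs @ [d])) (length xs) + 1 / 2 ^ length xs}"
      unfolding len pv h(2)
    proof
      fix x assume x: "x \<in> X"
      show "x \<in> {v + real_of_int d * (2 * h) - 2 * h..v + real_of_int d * (2 * h) + 2 * h}"
        using Xw[OF x] Xw(2)[OF w] by (auto simp: d_def abs_le_iff)
    qed
  qed
  then show ?thesis unfolding fits_def d_def by (intro exI[of _ d]) (auto simp: d_def)
qed

lemma greedy_progress:
  assumes anti: "\<And>i j. i \<le> j \<Longrightarrow> X j \<subseteq> X i" and ne: "\<And>j. X j \<noteq> {}"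
    and conv: "\<And>e. e > 0 \<Longrightarrow> \<exists>j w. X j \<subseteq> {w - e..w + e}"
  shows "\<exists>j. length (greedy X j) \<ge> n"
proof (induction n)
  case (Suc n)
  then obtain i where i: "length (greedy X i) \<ge> n" by blast
  have mono: "length (greedy X i) \<le> length (greedy X j)" if "i \<le> j" for i j
    using that
  proof (induction j rule: dec_induct)
    case (step j)
    then show ?case by (cases rule: greedy_Suc[of X j]) (auto simp del: greedy.simps)
  qed simp
  \<comment> \<open>Half of what \<open>fits_exists\<close> tolerates, as recentring at a member of
    the set doubles the radius.\<close>
  define e :: real where "e = 1 / 2 ^ Suc n / 2"
  obtain j w where j: "X j \<subseteq> {w - e..w + e}" using conv[of e] by (auto simp: e_def)
  let ?m = "max i j"
  show ?case
  proof (cases "length (greedy X ?m) \<ge> Suc n")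
    case False
    then have len: "length (greedy X ?m) = n" using i mono[of i ?m] by simp
    obtain w' where w': "w' \<in> X ?m" using ne by blast
    have sub: "X ?m \<subseteq> {w - e..w + e}" using anti[of j ?m] j by auto
    have "X ?m \<subseteq> {w' - 2 * e..w' + 2 * e}"
    proof
      fix x assume "x \<in> X ?m"
      then have "x \<in> {w - e..w + e}" "w' \<in> {w - e..w + e}" using sub w' by blast+
      then show "x \<in> {w' - 2 * e..w' + 2 * e}" by simp
    qed
    moreover have "2 * e \<le> 1 / 2 ^ Suc (length (greedy X ?m))" unfolding len e_def by simp
    moreover have "X ?m \<subseteq> seq_val (list_seq (greedy X ?m))"
      by (rule greedy_sound) (use anti in simp)
    ultimately have ex: "\<exists>d. fits (X ?m) (greedy X ?m) d"
      using fits_exists[OF S_seq_greedy _ _ _ w'] by blast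
    have "length (greedy X (Suc ?m)) = Suc n"
      by (rule greedy_Suc[of X ?m]) (use ex len in \<open>auto simp del: greedy.simps\<close>)
    then show ?thesis by (metis order_refl)
  qed blast
qed simp

text \<open>The union of the finite sequences \<open>f j\<close> with \<open>P j\<close>.\<close>

definition glue :: "(nat \<Rightarrow> bool) \<Rightarrow> (nat \<Rightarrow> int list) \<Rightarrow> nat \<Rightarrow> int option" where
  "glue P f n = (if \<exists>j. P j \<and> n < length (f j) then Some (f (LEAST j. P j \<and> n < length (f j)) ! n) else None)"

lemma glue_some: "glue P f n \<noteq> None \<Longrightarrow> \<exists>j. P j \<and> list_seq (f j) n = glue P f n"
  unfolding glue_def using LeastI_ex[of "\<lambda>j. P j \<and> n < length (f j)"]
  by (auto simp: list_seq_def split: if_splits)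

locale gluing =
  fixes f :: "nat \<Rightarrow> int list"
  assumes prefix: "i \<le> j \<Longrightarrow> list_seq (f i) \<subseteq>\<^sub>m list_seq (f j)"
    and seq: "S_seq (list_seq (f j))"
begin

lemma agree:
  assumes "list_seq (f i) n \<noteq> None" "list_seq (f j) n \<noteq> None"
  shows "list_seq (f i) n = list_seq (f j) n"
proof (cases "i \<le> j")
  case True
  then show ?thesis using prefix[OF True] assms(1) unfolding map_le_def by (metis domIff)
next
  case False
  then have "j \<le> i" by simp
  then show ?thesis using prefix[of j i] assms(2) unfolding map_le_def by (metis domIff)
qed

lemma list_seq_le_glue:
  assumes "P j"
  shows "list_seq (f j) \<subseteq>\<^sub>m glue P f"
  unfolding map_le_def
proof
  fix n assume "n \<in> dom (list_seq (f j))"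
  then have n: "list_seq (f j) n \<noteq> None" by auto
  then have "\<exists>j. P j \<and> n < length (f j)" using assms by (auto simp: list_seq_def split: if_splits)
  then have "glue P f n \<noteq> None" by (simp add: glue_def)
  then show "list_seq (f j) n = glue P f n" using glue_some agree n by metis
qed

lemma S_seq_glue: "S_seq (glue P f)"
  unfolding S_seq_def
proof (intro allI impI)
  fix n assume n: "glue P f (Suc n) \<noteq> None"
  then obtain j where j: "P j" "list_seq (f j) (Suc n) = glue P f (Suc n)" using glue_some by metis
  then have *: "list_seq (f j) n \<noteq> None" "the (list_seq (f j) (Suc n)) \<in> {-1, 0, 1}"
    using S_seqD[OF seq] n by metis+
  then have "list_seq (f j) n = glue P f n"
    using list_seq_le_glue[where P = P, OF j(1)] unfolding map_le_def by (metis domIff)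
  then show "glue P f n \<noteq> None \<and> the (glue P f (Suc n)) \<in> {-1, 0, 1}" using * j(2) by metis
qed

lemma glue_sound:
  assumes "\<And>j. P j \<Longrightarrow> W \<subseteq> seq_val (list_seq (f j))"
  shows "W \<subseteq> seq_val (glue P f)"
proof -
  have "\<bar>w - part_val (glue P f) n\<bar> \<le> 1 / 2 ^ n" if w: "w \<in> W" and n: "glue P f n \<noteq> None" for w n
  proof -
    obtain j where j: "P j" "list_seq (f j) n = glue P f n" using glue_some[OF n] by blast
    have "part_val (list_seq (f j)) n = part_val (glue P f) n"
      using part_val_mono[OF list_seq_le_glue[where P = P, OF j(1)] seq] j(2) n by metis
    then show ?thesis using assms[OF j(1)] w j(2) n unfolding seq_val_def by force
  qed
  then show ?thesis by (auto simp: seq_val_def)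
qed

end

lemma glue_le:
  assumes f: "gluing f" and g: "gluing g"
    and P: "\<And>j. P j \<Longrightarrow> P' j" and eq: "\<And>j. P j \<Longrightarrow> f j = g j"
  shows "glue P f \<subseteq>\<^sub>m glue P' g"
  unfolding map_le_def
proof
  fix n assume "n \<in> dom (glue P f)"
  then have n: "glue P f n \<noteq> None" by auto
  then obtain j where j: "P j" "list_seq (f j) n = glue P f n" using glue_some by metis
  then show "glue P f n = glue P' g n"
    using gluing.list_seq_le_glue[OF g, of P' j] P[OF j(1)] eq[OF j(1)] n
    unfolding map_le_def by (metis domIff)
qed

lemma gluing_greedy: "gluing (\<lambda>j. greedy X (Suc j))"
  by (intro gluing.intro greedy_prefix S_seq_greedy) simp

subsection \<open>Digit sequences for interpolated values\<close>

definition seg :: "nat \<Rightarrow> (nat \<Rightarrow> int option) \<Rightarrow> nat \<Rightarrow> int option" where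
  "seg m s = (\<lambda>n. if n \<le> m then s n else None)"

lemma S_seq_seg: "S_seq s \<Longrightarrow> S_seq (seg m s)"
  by (auto simp: S_seq_def seg_def)

lemma seg_le: "seg m s \<subseteq>\<^sub>m s" "m \<le> n \<Longrightarrow> seg m s \<subseteq>\<^sub>m seg n s"
  by (auto simp: seg_def map_le_def dom_def split: if_splits)

lemma seg_eq:
  assumes "s \<subseteq>\<^sub>m t" "S_seq s" "s m \<noteq> None"
  shows "seg m s = seg m t"
proof
  fix n
  show "seg m s n = seg m t n"
    using S_seq_down[OF assms(2,3), of n] assms(1) by (auto simp: seg_def map_le_def dom_def)
qed

lemma seq_val_seg_subset:
  assumes "S_seq s" "s m \<noteq> None"
  shows "seq_val (seg m s) \<subseteq> {part_val s m - 1 / 2 ^ m..part_val s m + 1 / 2 ^ m}"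
proof -
  have "part_val (seg m s) m = part_val s m" by (rule part_val_cong) (simp add: seg_def)
  then show ?thesis using seq_val_subset[of "seg m s" m] assms(2) by (simp add: seg_def)
qed

definition nat_seq :: "nat \<Rightarrow> nat \<Rightarrow> int option" where
  "nat_seq w n = Some (if n = 0 then int w else 0)"

lemma S_seq_nat_seq: "S_seq (nat_seq w)"
  by (simp add: S_seq_def nat_seq_def)

lemma seq_val_nat_seq: "seq_val (nat_seq w) = {real w}"
proof -
  have "part_val (nat_seq w) n = real w" for n by (simp add: part_val_def nat_seq_def)
  then have "real w \<in> seq_val (nat_seq w)" by (simp add: seq_val_def)
  moreover have "total_seq (nat_seq w)" by (simp add: total_seq_def nat_seq_def)
  ultimately show ?thesis using seq_val_total[OF S_seq_nat_seq] by auto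
qed

definition nat_or_unknown :: "real set \<Rightarrow> bool" where
  "nat_or_unknown X \<longleftrightarrow> X = UNIV \<or> (\<exists>m::nat. X = {real m})"

context index_sets
begin

definition seqs :: "('i \<Rightarrow> nat \<Rightarrow> int option) \<Rightarrow> bool" where
  "seqs s \<longleftrightarrow> (\<forall>a\<in>\<Union>(range A). S_seq (s a))"

lemma seqsD: "seqs s \<Longrightarrow> a \<in> \<Union>(range A) \<Longrightarrow> S_seq (s a)"
  unfolding seqs_def by blast

text \<open>The five additional digits bound the spread of each box by 1/16 already for
  \<open>m = 0\<close>, which fits between the thresholds 1/8 and 1/4.\<close>

definition avail :: "('i \<Rightarrow> nat \<Rightarrow> int option) \<Rightarrow> nat \<Rightarrow> bool" where
  "avail s m \<longleftrightarrow> (\<forall>a\<in>A m. s a (m + 5) \<noteq> None)"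

text \<open>Only digits up to index \<open>m + 5\<close> are read, even if more are known, so an
  available box never changes when the sequences are extended.\<close>

definition box :: "('i \<Rightarrow> nat \<Rightarrow> int option) \<Rightarrow> nat \<Rightarrow> 'i \<Rightarrow> real set" where
  "box s m a = (if a \<in> A m then seq_val (seg (m + 5) (s a)) else UNIV)"

text \<open>\<open>L \<le> m\<close> keeps \<open>A L\<close> inside \<open>A m\<close>, where the
  box carries information.\<close>

definition resolved :: "('i \<Rightarrow> nat \<Rightarrow> int option) \<Rightarrow> nat \<Rightarrow> nat \<Rightarrow> bool" where
  "resolved s m L \<longleftrightarrow> L \<le> m \<and> (\<forall>r. (\<forall>a\<in>A m. r a \<in> box s m a) \<longrightarrow> wt r L = 0)"

text \<open>This holds at every available stage up to and including the first one that resolves;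
  later stages are excluded.\<close>

definition first_stage :: "('i \<Rightarrow> nat \<Rightarrow> int option) \<Rightarrow> nat \<Rightarrow> bool" where
  "first_stage s m \<longleftrightarrow> avail s m \<and> (\<forall>m'<m. \<nexists>L. resolved s m' L)"

definition level :: "('i \<Rightarrow> nat \<Rightarrow> int option) \<Rightarrow> nat \<Rightarrow> nat" where
  "level s m = (LEAST L. resolved s m L)"

definition stage_vals :: "('i \<Rightarrow> nat \<Rightarrow> int option) \<Rightarrow> (nat \<Rightarrow> real set) \<Rightarrow> nat \<Rightarrow> real set" where
  "stage_vals s J m = vals (box s m) J"

definition settled :: "('i \<Rightarrow> nat \<Rightarrow> int option) \<Rightarrow> (nat \<Rightarrow> real set) \<Rightarrow> nat \<Rightarrow> bool" where
  "settled s J w \<longleftrightarrow> (\<exists>m. first_stage s m \<and> stage_vals s J m = {real w})"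

text \<open>The least resolved level is used because below it \<open>delta\<close> is guaranteed to
  be small, so that the required values \<open>J i\<close> will indeed become known.\<close>

definition started :: "('i \<Rightarrow> nat \<Rightarrow> int option) \<Rightarrow> (nat \<Rightarrow> real set) \<Rightarrow> nat \<Rightarrow> bool" where
  "started s J m \<longleftrightarrow> first_stage s m \<and> (\<exists>L. resolved s m L) \<and> (\<forall>i\<le>level s m. \<exists>x. J i = {x})"

text \<open>Digits must not depend on how much of \<open>J\<close> is known. A value is therefore only read off before
  it is resolved that finitely many of the \<open>J i\<close> matter if it is a known natural number; otherwise
  digits are produced greedily, once these \<open>J i\<close> are known.\<close>

definition digits :: "('i \<Rightarrow> nat \<Rightarrow> int option) \<Rightarrow> (nat \<Rightarrow> real set) \<Rightarrow> nat \<Rightarrow> int option" where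
  "digits s J = (if \<exists>w. settled s J w then nat_seq (THE w. settled s J w)
     else if \<exists>m. started s J m
     then glue (\<lambda>j. avail s ((THE m. started s J m) + j))
       (\<lambda>j. greedy (\<lambda>j. stage_vals s J ((THE m. started s J m) + j)) (Suc j))
     else Map.empty)"

lemma avail_down:
  assumes s: "seqs s" and "avail s n" "m \<le> n"
  shows "avail s m"
  unfolding avail_def
proof
  fix a assume a: "a \<in> A m"
  then have "a \<in> A n" using A_mono[OF assms(3)] by blast
  then show "s a (m + 5) \<noteq> None"
    using assms(2,3) S_seq_down[of "s a" "n + 5" "m + 5"] seqsD[OF s, of a] by (auto simp: avail_def)
qed

lemma box_anti:
  assumes s: "seqs s" and "m \<le> n" and a: "a \<in> \<Union>(range A)"
  shows "box s n a \<subseteq> box s m a"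
  using A_mono[OF assms(2)] seq_val_mono[OF seg_le(2)[of "m + 5" "n + 5" "s a"] S_seq_seg[OF seqsD[OF s a]]] assms(2)
  by (auto simp: box_def)

lemma box_nonempty: "seqs s \<Longrightarrow> a \<in> \<Union>(range A) \<Longrightarrow> box s m a \<noteq> {}"
  using seq_val_nonempty[OF S_seq_seg[OF seqsD]] by (simp add: box_def)

lemma stage_vals_anti:
  assumes s: "seqs s" and "m \<le> n" "\<And>i. J' i \<subseteq> J i"
  shows "stage_vals s J' n \<subseteq> stage_vals s J m"
  unfolding stage_vals_def by (rule vals_mono[OF box_anti[OF s assms(2)] assms(3)])

lemma stage_vals_nonempty:
  "seqs s \<Longrightarrow> (\<And>i. J i \<noteq> {}) \<Longrightarrow> stage_vals s J m \<noteq> {}"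
  unfolding stage_vals_def by (rule vals_nonempty[OF box_nonempty])

lemma seq_val_box: "seqs s \<Longrightarrow> a \<in> \<Union>(range A) \<Longrightarrow> seq_val (s a) \<subseteq> box s m a"
  using seq_val_mono[OF seg_le(1) S_seq_seg[OF seqsD[of s a]]] by (simp add: box_def)

lemma stage_vals_sup:
  "seqs s \<Longrightarrow> vals (\<lambda>a. seq_val (s a)) J \<subseteq> stage_vals s J m"
  unfolding stage_vals_def by (rule vals_mono[OF seq_val_box order_refl])

lemma settled_unique:
  assumes s: "seqs s" and "settled s J w" "settled s J w'"
  shows "w = w'"
proof -
  obtain m m' where m: "stage_vals s J m = {real w}" "stage_vals s J m' = {real w'}"
    using assms(2,3) by (auto simp: settled_def)
  have "stage_vals s J (max m m') \<subseteq> {real w}" "stage_vals s J (max m m') \<subseteq> {real w'}"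
    using stage_vals_anti[OF s, where m = m and n = "max m m'" and J = J and J' = J] stage_vals_anti[OF s, where m = m' and n = "max m m'" and J = J and J' = J] m by auto
  moreover have "J i \<noteq> {}" for i
  proof
    assume "J i = {}"
    then have "stage_vals s J m = {}" unfolding stage_vals_def vals_def by fastforce
    then show False using m by simp
  qed
  then have "stage_vals s J (max m m') \<noteq> {}" using stage_vals_nonempty[OF s] by blast
  ultimately show ?thesis by auto
qed

lemma started_unique: "started s J m \<Longrightarrow> started s J m' \<Longrightarrow> m = m'"
  unfolding started_def first_stage_def by (cases m m' rule: linorder_cases) auto

lemma digits_settled:
  assumes "seqs s" "settled s J w"
  shows "digits s J = nat_seq w"
proof -
  have "(THE w. settled s J w) = w"
    by (rule the_equality, rule assms(2), rule settled_unique[OF assms(1) _ assms(2)])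
  then show ?thesis using assms(2) unfolding digits_def by auto
qed

lemma digits_started:
  assumes "\<nexists>w. settled s J w" "started s J m"
  shows "digits s J = glue (\<lambda>j. avail s (m + j)) (\<lambda>j. greedy (\<lambda>j. stage_vals s J (m + j)) (Suc j))"
proof -
  have "(THE m. started s J m) = m"
    by (rule the_equality, rule assms(2), rule started_unique[OF _ assms(2)])
  then show ?thesis using assms unfolding digits_def by auto
qed

lemma S_seq_digits: "S_seq (digits s J)"
  unfolding digits_def using S_seq_nat_seq gluing.S_seq_glue[OF gluing_greedy]
  by (auto simp: S_seq_def[of Map.empty])

lemma digits_sound:
  assumes s: "seqs s"
  shows "vals (\<lambda>a. seq_val (s a)) J \<subseteq> seq_val (digits s J)"
proof (cases "\<exists>w. settled s J w")
  case True
  then obtain w m where w: "settled s J w" "stage_vals s J m = {real w}" by (auto simp: settled_def)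
  then show ?thesis
    using stage_vals_sup[OF s, where J = J and m = m] by (simp add: digits_settled[OF s w(1)] seq_val_nat_seq)
next
  case False
  show ?thesis
  proof (cases "\<exists>m. started s J m")
    case True
    then obtain m where m: "started s J m" ..
    show ?thesis
      unfolding digits_started[OF False m]
      by (rule gluing.glue_sound[OF gluing_greedy greedy_sound]) (rule stage_vals_sup[OF s])
  next
    case no: False
    have "digits s J = Map.empty" unfolding digits_def if_not_P[OF False] if_not_P[OF no] ..
    then show ?thesis by (simp add: seq_val_def)
  qed
qed

text \<open>Once the weight at \<open>L\<close> vanishes, entries of \<open>v\<close> beyond
  \<open>L\<close> may be replaced freely.\<close>

lemma vals_determined:
  assumes R: "\<And>r. (\<And>a. a \<in> \<Union>(range A) \<Longrightarrow> r a \<in> R a) \<Longrightarrow> wt r L = 0"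
    and J: "\<And>i. i \<le> L \<Longrightarrow> \<exists>x. J i = {x} \<and> J' i = {x}" and ne: "\<And>i. J' i \<noteq> {}"
  shows "vals R J \<subseteq> vals R J'"
proof
  fix w assume "w \<in> vals R J"
  then obtain r v where rv: "w = interp r v" "\<And>a. a \<in> \<Union>(range A) \<Longrightarrow> r a \<in> R a" "\<And>i. v i \<in> J i"
    unfolding vals_def by blast
  have "\<exists>v'. \<forall>i. v' i \<in> J' i" using ne by (intro choice) blast
  then obtain v' where v': "\<And>i. v' i \<in> J' i" by blast
  define u where "u i = (if i \<le> L then v i else v' i)" for i
  have "wt r L = 0" using R rv(2) by blast
  then have "interp r v = interp r u" by (simp add: interp_upto u_def)
  moreover have "u i \<in> J' i" for i
    using v'[of i] rv(3)[of i] J[of i] by (auto simp: u_def)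
  ultimately show "w \<in> vals R J'" unfolding vals_def using rv(1,2) by blast
qed

lemma resolved_level: "\<exists>L. resolved s m L \<Longrightarrow> resolved s m (level s m)"
  unfolding level_def by (rule LeastI_ex)

lemma stage_vals_determined:
  assumes s: "seqs s" and L: "resolved s m L" and "m \<le> n"
    and "\<And>i. i \<le> L \<Longrightarrow> \<exists>x. J i = {x} \<and> J' i = {x}" and "\<And>i. J' i \<noteq> {}"
  shows "stage_vals s J n \<subseteq> stage_vals s J' n"
  unfolding stage_vals_def
proof (rule vals_determined[OF _ assms(4,5)])
  fix r assume r: "\<And>a. a \<in> \<Union>(range A) \<Longrightarrow> r a \<in> box s n a"
  have "r a \<in> box s m a" if "a \<in> A m" for a
    by (rule subsetD[OF box_anti[OF s assms(3)] r]) (use that in blast)+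
  then show "wt r L = 0" using L unfolding resolved_def by blast
qed

context
  fixes s s' :: "'i \<Rightarrow> nat \<Rightarrow> int option"
  assumes s: "seqs s" and s': "seqs s'"
    and le: "\<And>a. a \<in> \<Union>(range A) \<Longrightarrow> s a \<subseteq>\<^sub>m s' a"
begin

lemma avail_le: "avail s m \<Longrightarrow> avail s' m"
  unfolding avail_def using le by (fastforce simp: map_le_def dom_def)

lemma box_eq:
  assumes "avail s m"
  shows "box s m = box s' m"
proof
  fix a
  have "seg (m + 5) (s a) = seg (m + 5) (s' a)" if a: "a \<in> A m"
  proof (rule seg_eq)
    show "s a \<subseteq>\<^sub>m s' a" "S_seq (s a)" using le seqsD[OF s] a by auto
    show "s a (m + 5) \<noteq> None" using assms a unfolding avail_def by blast
  qed
  then show "box s m a = box s' m a" by (simp add: box_def)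
qed

lemma stage_vals_eq: "avail s m \<Longrightarrow> stage_vals s J m = stage_vals s' J m"
  using box_eq by (simp add: stage_vals_def)

lemma resolved_eq: "avail s m \<Longrightarrow> resolved s m L = resolved s' m L"
  using box_eq by (simp add: resolved_def)

lemma first_stage_le: "first_stage s m \<Longrightarrow> first_stage s' m"
  unfolding first_stage_def using avail_le avail_down[OF s] resolved_eq by (meson less_imp_le)

text \<open>A settled value stays settled. Once digits have started, the sets of possible values at
  available stages are final, so additional information cannot alter a digit.\<close>

lemma digits_mono:
  assumes J: "\<And>i. J' i \<subseteq> J i" and ne: "\<And>i. J' i \<noteq> {}"
  shows "digits s J \<subseteq>\<^sub>m digits s' J'"
proof (cases "\<exists>w. settled s J w")
  case True
  then obtain w m where w: "settled s J w" and m: "first_stage s m" "stage_vals s J m = {real w}"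
    by (auto simp: settled_def)
  have av: "avail s m" using m(1) by (simp add: first_stage_def)
  have "stage_vals s' J' m \<subseteq> {real w}"
    using stage_vals_anti[OF s order_refl, where J = J and J' = J' and m = m] J m(2) stage_vals_eq[OF av] by simp
  moreover have "stage_vals s' J' m \<noteq> {}" using stage_vals_nonempty[OF s' ne] .
  ultimately have "settled s' J' w" using first_stage_le[OF m(1)] by (auto simp: settled_def)
  then show ?thesis using digits_settled[OF s w] digits_settled[OF s'] by simp
next
  case unsettled: False
  show ?thesis
  proof (cases "\<exists>m. started s J m")
    case True
    then obtain m where m: "started s J m" ..
    then have fs: "first_stage s m" and L: "resolved s m (level s m)"
      and single: "\<And>i. i \<le> level s m \<Longrightarrow> \<exists>x. J i = {x}"
      using resolved_level by (auto simp: started_def)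
    have av: "avail s m" using fs by (simp add: first_stage_def)
    have JJ: "\<exists>x. J i = {x} \<and> J' i = {x}" if "i \<le> level s m" for i
      using single[OF that] J[of i] ne[of i] by auto
    have eq: "stage_vals s J n = stage_vals s' J' n" if n: "m \<le> n" "avail s n" for n
    proof -
      have "stage_vals s J n \<subseteq> stage_vals s J' n"
        using stage_vals_determined[OF s L n(1) JJ ne] .
      moreover have "stage_vals s J' n \<subseteq> stage_vals s J n"
        using stage_vals_anti[OF s order_refl J] .
      ultimately show ?thesis using stage_vals_eq[OF n(2)] by auto
    qed
    have lev: "level s' m = level s m" using resolved_eq[OF av] by (simp add: level_def)
    have st': "started s' J' m"
      unfolding started_def lev using first_stage_le[OF fs] L resolved_eq[OF av] JJ by blast
    have unsettled': "\<nexists>w. settled s' J' w"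
    proof
      assume "\<exists>w. settled s' J' w"
      then obtain w m' where w: "first_stage s' m'" "stage_vals s' J' m' = {real w}"
        by (auto simp: settled_def)
      \<comment> \<open>Settling is tested only up to the resolving stage \<open>m\<close>. A value
        settled there with more information would, since the sets at \<open>m\<close> are final,
        have been settled before.\<close>
      have "\<not> m < m'" using w(1) L resolved_eq[OF av] unfolding first_stage_def by blast
      then have "stage_vals s' J' m \<subseteq> {real w}"
        using stage_vals_anti[OF s', where m = m' and n = m and J = J' and J' = J'] w(2) by simp
      moreover have "stage_vals s' J' m \<noteq> {}" using stage_vals_nonempty[OF s' ne] .
      ultimately have "stage_vals s J m = {real w}" using eq[OF order_refl av] by auto
      then show False using unsettled fs by (auto simp: settled_def)
    qed
    show ?thesis
      unfolding digits_started[OF unsettled m] digits_started[OF unsettled' st']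
    proof (rule glue_le[OF gluing_greedy gluing_greedy])
      fix j assume j: "avail s (m + j)"
      show "avail s' (m + j)" using avail_le[OF j] .
      show "greedy (\<lambda>j. stage_vals s J (m + j)) (Suc j) = greedy (\<lambda>j. stage_vals s' J' (m + j)) (Suc j)"
      proof (rule greedy_cong)
        fix i assume "i < Suc j"
        then have "avail s (m + i)" using avail_down[OF s j, where m = "m + i"] by simp
        then show "stage_vals s J (m + i) = stage_vals s' J' (m + i)" by (intro eq) auto
      qed
    qed
  next
    case False
    have "digits s J = Map.empty" unfolding digits_def if_not_P[OF unsettled] if_not_P[OF False] ..
    then show ?thesis by simp
  qed
qed

end

end

section \<open>Convergence of the digit sequences\<close>

lemma power_margin: "k \<le> m \<Longrightarrow> 2 / 2 ^ (m + 5) \<le> (1::real) / 2 ^ k"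
proof -
  assume "k \<le> m"
  then have "(1::real) / 2 ^ m \<le> 1 / 2 ^ k" by (intro divide_left_mono power_increasing) auto
  moreover have "2 / 2 ^ (m + 5) \<le> (1::real) / 2 ^ m" by (simp add: power_add divide_simps)
  ultimately show ?thesis by linarith
qed

text \<open>Ending before index \<open>n\<close> leaves an interval of radius at least
  \<open>1 / 2 ^ n\<close>, or the whole line, which exceeds the given bound.\<close>

lemma seq_defined:
  assumes s: "S_seq s" and sub: "seq_val s \<subseteq> {c - e..c + e}" and e: "e < 1 / 2 ^ n"
  shows "s n \<noteq> None"
  using s
proof (cases rule: seq_cases)
  case 1
  then show ?thesis by (simp add: total_seq_def)
next
  case 2
  then have "c + \<bar>e\<bar> + 1 \<in> {c - e..c + e}" using sub by (auto simp: seq_val_def)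
  then show ?thesis by auto
next
  case (3 k)
  show ?thesis
  proof (cases "n \<le> k")
    case True
    then show ?thesis using S_seq_down[OF s 3(1)] by blast
  next
    case False
    then have "(1::real) / 2 ^ n \<le> 1 / 2 ^ k" by (intro divide_left_mono power_increasing) auto
    moreover have "part_val s k - 1 / 2 ^ k \<in> {c - e..c + e}" "part_val s k + 1 / 2 ^ k \<in> {c - e..c + e}"
      using sub[unfolded seq_val_last[OF s 3], THEN subsetD] by simp_all
    ultimately show ?thesis using e by auto
  qed
qed

context index_sets
begin

text \<open>If \<rho> is integral, nothing is ever resolved, but the possible values shrink to one
  natural number and the sequence settles. Otherwise a first stage resolves and the finitely many
  values it needs become known; unless the value settles, greedy digits keep coming as the possible
  values shrink.\<close>

lemma digits_conv:
  fixes ss :: "nat \<Rightarrow> 'i \<Rightarrow> nat \<Rightarrow> int option" and JJ :: "nat \<Rightarrow> nat \<Rightarrow> real set"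
  assumes s: "\<And>m. seqs (ss m)"
    and le: "\<And>m n a. m \<le> n \<Longrightarrow> a \<in> \<Union>(range A) \<Longrightarrow> ss m a \<subseteq>\<^sub>m ss n a"
    and JJ: "\<And>m n i. m \<le> n \<Longrightarrow> JJ n i \<subseteq> JJ m i" and ok: "\<And>m i. nat_or_unknown (JJ m i)"
    and conv: "\<And>a e. a \<in> \<Union>(range A) \<Longrightarrow> e > 0 \<Longrightarrow> \<exists>m. seq_val (ss m a) \<subseteq> {\<rho> a - e..\<rho> a + e}"
    and J_int: "(\<And>j. delta \<rho> j = 0) \<Longrightarrow> \<exists>u. \<forall>e>0. \<exists>m N. \<forall>i\<ge>N. JJ m i \<subseteq> {u - e..u + e}"
    and J_conv: "\<And>i. (\<And>j. j < i \<Longrightarrow> delta \<rho> j < 1 / 4) \<Longrightarrow> \<exists>u. \<forall>e>0. \<exists>m. JJ m i \<subseteq> {u - e..u + e}"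
    and e: "e > 0"
  shows "\<exists>m c. seq_val (digits (ss m) (JJ m)) \<subseteq> {c - e..c + e}"
proof -
  have ne: "JJ m i \<noteq> {}" for m i using ok[of m i] by (auto simp: nat_or_unknown_def)
  \<comment> \<open>The enclosures decrease to \<rho> and each is closed, so \<rho> itself belongs
    to all of them.\<close>
  have \<rho>: "\<rho> a \<in> seq_val (ss m a)" if a: "a \<in> \<Union>(range A)" for m a
  proof -
    have "\<exists>y\<in>seq_val (ss m a). dist y (\<rho> a) < d" if "d > 0" for d
    proof -
      obtain n where n: "seq_val (ss n a) \<subseteq> {\<rho> a - d / 2..\<rho> a + d / 2}"
        using conv[OF a, of "d / 2"] \<open>d > 0\<close> by auto
      obtain y where y: "y \<in> seq_val (ss (max m n) a)"
        using seq_val_nonempty[OF seqsD[OF s a]] by blast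
      have "y \<in> seq_val (ss m a)" "y \<in> seq_val (ss n a)"
        using y seq_val_mono[OF le[OF _ a] seqsD[OF s a], of m "max m n"]
          seq_val_mono[OF le[OF _ a] seqsD[OF s a], of n "max m n"] by auto
      then show ?thesis using n \<open>d > 0\<close> by (force simp: dist_real_def abs_less_iff)
    qed
    then show ?thesis using closed_approachable[OF seq_val_closed] by blast
  qed
  have "\<exists>M. avail (ss M) m" for m
  proof -
    have "\<exists>M. ss M a (m + 5) \<noteq> None" if a: "a \<in> A m" for a
    proof -
      have a': "a \<in> \<Union>(range A)" using a by blast
      obtain M where "seq_val (ss M a) \<subseteq> {\<rho> a - 1 / 2 ^ (m + 6)..\<rho> a + 1 / 2 ^ (m + 6)}"
        using conv[OF a', of "1 / 2 ^ (m + 6)"] by auto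
      moreover have "(1::real) / 2 ^ (m + 6) < 1 / 2 ^ (m + 5)"
        by (intro divide_strict_left_mono) (simp_all add: power_add)
      ultimately have "ss M a (m + 5) \<noteq> None" using seq_defined[OF seqsD[OF s a']] by blast
      then show ?thesis ..
    qed
    then obtain M where M: "\<And>a. a \<in> A m \<Longrightarrow> ss (M a) a (m + 5) \<noteq> None" by metis
    have "ss (Max (M ` A m)) a (m + 5) \<noteq> None" if a: "a \<in> A m" for a
    proof -
      have "M a \<le> Max (M ` A m)" using a A_finite by simp
      then have "ss (M a) a \<subseteq>\<^sub>m ss (Max (M ` A m)) a" using le a by blast
      then show ?thesis using M[OF a] unfolding map_le_def by (metis domIff)
    qed
    then show ?thesis unfolding avail_def by blast
  qed
  then obtain \<mu> where \<mu>: "\<And>m. avail (ss (\<mu> m)) m" by metis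
  have le': "ss m a \<subseteq>\<^sub>m ss n a" if "a \<in> \<Union>(range A)" "m \<le> n" for m n a using le that by blast
  have avail_up: "avail (ss n) k" if "avail (ss m) k" "m \<le> n" for m n k
    using avail_le[OF s s le'[OF _ that(2)] that(1)] .
  \<comment> \<open>The box at stage \<open>m\<close> is the same for every \<open>M\<close> at
    which it is available, so it can be fixed once and for all.\<close>
  define Bx where "Bx m = box (ss (\<mu> m)) m" for m
  have box_Bx: "box (ss M) m = Bx m" if "avail (ss M) m" for M m
  proof -
    have "box (ss M) m = box (ss (max M (\<mu> m))) m"
      by (rule box_eq[OF s s le' that]) auto
    also have "\<dots> = Bx m"
      unfolding Bx_def by (rule box_eq[OF s s le' \<mu>, symmetric]) auto
    finally show ?thesis .
  qed
  have \<rho>_Bx: "\<rho> a \<in> Bx m a" if "a \<in> \<Union>(range A)" for m a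
    unfolding Bx_def using seq_val_box[OF s that] \<rho>[OF that] by blast
  have Bx_anti: "Bx n a \<subseteq> Bx m a" if "m \<le> n" "a \<in> \<Union>(range A)" for m n a
  proof -
    have "avail (ss (\<mu> n)) m" using avail_down[OF s \<mu> that(1)] .
    then have "Bx m = box (ss (\<mu> n)) m" using box_Bx by simp
    then show ?thesis unfolding Bx_def using box_anti[OF s that(1,2), of "\<mu> n"] by simp
  qed
  have Bx_near: "\<bar>x - \<rho> a\<bar> \<le> 2 / 2 ^ (m + 5)" if a: "a \<in> A m" and x: "x \<in> Bx m a" for a x m
  proof -
    have a': "a \<in> \<Union>(range A)" using a by blast
    define v where "v = part_val (ss (\<mu> m) a) (m + 5)"
    have "Bx m a \<subseteq> {v - 1 / 2 ^ (m + 5)..v + 1 / 2 ^ (m + 5)}"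
      unfolding Bx_def box_def v_def
      using a \<mu>[of m] seq_val_seg_subset[OF seqsD[OF s a']] by (auto simp: avail_def)
    then have "x \<in> {v - 1 / 2 ^ (m + 5)..v + 1 / 2 ^ (m + 5)}" "\<rho> a \<in> {v - 1 / 2 ^ (m + 5)..v + 1 / 2 ^ (m + 5)}"
      using x \<rho>_Bx[OF a'] by blast+
    then have "\<bar>x - \<rho> a\<bar> \<le> 2 * (1 / 2 ^ (m + 5))" unfolding atLeastAtMost_iff by linarith
    then show ?thesis by simp
  qed
  have delta_near: "\<bar>delta r j - delta \<rho> j\<bar> \<le> 2 / 2 ^ (m + 5)"
    if r: "\<And>a. a \<in> A m \<Longrightarrow> r a \<in> Bx m a" and "j \<le> m" for r j m
  proof -
    have "\<bar>r a - \<rho> a\<bar> \<le> 2 / 2 ^ (m + 5)" if "a \<in> A j" for a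
      using Bx_near[of a m "r a"] r A_mono[OF \<open>j \<le> m\<close>] that by blast
    then have "delta r j \<le> delta \<rho> j + 2 / 2 ^ (m + 5)" "delta \<rho> j \<le> delta r j + 2 / 2 ^ (m + 5)"
      by (intro delta_lipschitz; simp add: abs_minus_commute)+
    then show ?thesis by (simp add: abs_le_iff)
  qed
  have single: "\<exists>k. JJ m i = {real k} \<and> \<bar>real k - u\<bar> \<le> d" if "JJ m i \<subseteq> {u - d..u + d}" for m i u d
  proof -
    have "JJ m i \<noteq> UNIV"
    proof
      assume "JJ m i = UNIV"
      then have "u + \<bar>d\<bar> + 1 \<in> {u - d..u + d}" using that by blast
      then show False by auto
    qed
    then obtain k where "JJ m i = {real k}" using ok[of m i] by (auto simp: nat_or_unknown_def)
    moreover have "real k \<in> {u - d..u + d}" using that calculation by blast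
    ultimately show ?thesis by (auto simp: abs_le_iff)
  qed
  have settled_done: "\<exists>m c. seq_val (digits (ss m) (JJ m)) \<subseteq> {c - e..c + e}"
    if "settled (ss M) (JJ M) w" for M w
    using digits_settled[OF s that] e seq_val_nat_seq[of w]
    by (intro exI[of _ M] exI[of _ "real w"]) auto
  show ?thesis
  proof (rule integral_or_wt_zero[of \<rho>])
    assume int: "\<And>j. delta \<rho> j = 0"
    \<comment> \<open>Natural numbers within 1/4 of the same \<open>u\<close> are equal, so all late
      values are one number \<open>k\<close>.\<close>
    then obtain u M N where MN: "\<And>i. i \<ge> N \<Longrightarrow> JJ M i \<subseteq> {u - 1/4..u + 1/4}"
      using J_int by (metis zero_less_divide_1_iff zero_less_numeral)
    obtain k where k: "JJ M N = {real k}" "\<bar>real k - u\<bar> \<le> 1/4" using single[OF MN[of N]] by auto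
    have JMk: "JJ M i = {real k}" if i: "i \<ge> N" for i
    proof -
      obtain k' where k': "JJ M i = {real k'}" "\<bar>real k' - u\<bar> \<le> 1/4" using single[OF MN[OF i]] by auto
      then have "\<bar>real k' - real k\<bar> < 1" using k(2) by linarith
      then have "k' = k" by linarith
      then show ?thesis using k' by simp
    qed
    \<comment> \<open>This accuracy yields \<open>(j + 1) * delta \<le> 1 / 16\<close> for all
      \<open>j < N\<close>, hence weight 1 for the first \<open>N\<close> stages.\<close>
    obtain m0 :: nat where m0: "1 / 2 ^ m0 < 1 / (16 * (real N + 1))"
      using small_power[of "1 / (16 * (real N + 1))"] by auto
    define m where "m = max m0 N"
    define M' where "M' = max M (\<mu> m)"
    have av: "avail (ss M') m" using avail_up[OF \<mu>] by (simp add: M'_def)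
    have box: "box (ss M') n = Bx n" if "n \<le> m" for n
      using box_Bx[OF avail_down[OF s av that]] .
    \<comment> \<open>The box contains \<rho>, all of whose weights are 1.\<close>
    have "\<not> resolved (ss M') n L" if "n < m" for n L
    proof
      assume "resolved (ss M') n L"
      moreover have "\<forall>a\<in>A n. \<rho> a \<in> box (ss M') n a" using \<rho>_Bx box[of n] that by auto
      ultimately have "wt \<rho> L = 0" unfolding resolved_def by blast
      then show False using wt_one[of L \<rho>] int by simp
    qed
    then have fs: "first_stage (ss M') m" using av by (simp add: first_stage_def)
    have "x = real k" if x: "x \<in> stage_vals (ss M') (JJ M') m" for x
    proof -
      obtain r v where rv: "x = interp r v" "\<And>a. a \<in> \<Union>(range A) \<Longrightarrow> r a \<in> Bx m a" "\<And>i. v i \<in> JJ M' i"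
        using x unfolding stage_vals_def vals_def box[OF order_refl] by blast
      have "\<bar>interp r v - real k\<bar> \<le> 0"
      proof (rule interp_enclosed[of N])
        fix j assume j: "j < N"
        have "\<bar>delta r j - delta \<rho> j\<bar> \<le> 2 / 2 ^ (m + 5)"
          by (rule delta_near) (use rv(2) j in \<open>auto simp: m_def\<close>)
        then have "delta r j \<le> 2 / 2 ^ (m + 5)" using int[of j] by simp
        also have "\<dots> \<le> 1 / 2 ^ m0" by (rule power_margin) (simp add: m_def)
        finally have d: "delta r j \<le> 1 / (16 * (real N + 1))" using m0 by simp
        have "(real j + 1) * delta r j \<le> (real N + 1) * (1 / (16 * (real N + 1)))"
          using j d delta_nonneg[of r j] by (intro mult_mono) auto
        also have "\<dots> = 1 / 16" by (simp add: field_simps)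
        finally show "wt r j = 1" by (rule wt_one)
      next
        fix i assume "i \<ge> N"
        then have "JJ M' i \<subseteq> {real k}" using JJ[of M M' i] JMk[of i] by (simp add: M'_def)
        then show "\<bar>v i - real k\<bar> \<le> 0" using rv(3)[of i] by auto
      qed
      then show ?thesis using rv(1) by simp
    qed
    moreover have "stage_vals (ss M') (JJ M') m \<noteq> {}" using stage_vals_nonempty[OF s ne] .
    ultimately have "stage_vals (ss M') (JJ M') m = {real k}" by blast
    then have "settled (ss M') (JJ M') k" using fs by (auto simp: settled_def)
    then show ?thesis by (rule settled_done)
  next
    fix L0 assume L0: "1 / 8 < (real L0 + 1) * delta \<rho> L0"
    define rs where "rs m L \<longleftrightarrow> L \<le> m \<and> (\<forall>r. (\<forall>a\<in>A m. r a \<in> Bx m a) \<longrightarrow> wt r L = 0)" for m L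
    have rs: "resolved (ss M) m L \<longleftrightarrow> rs m L" if "avail (ss M) m" for M m L
      using box_Bx[OF that] by (simp add: resolved_def rs_def)
    have "\<exists>m L. rs m L"
    proof -
      \<comment> \<open>The gap in the strict inequality at \<open>L0\<close>; boxes finer than it
        force the weight at \<open>L0\<close> to vanish.\<close>
      define g where "g = delta \<rho> L0 - 1 / (8 * (real L0 + 1))"
      have "g > 0" using L0 by (simp add: g_def field_simps)
      then obtain m0 :: nat where m0: "1 / 2 ^ m0 < g" by (rule small_power)
      define m where "m = max m0 L0"
      have "wt r L0 = 0" if r: "\<And>a. a \<in> A m \<Longrightarrow> r a \<in> Bx m a" for r
      proof (rule wt_zero)
        have "\<bar>delta r L0 - delta \<rho> L0\<bar> \<le> 2 / 2 ^ (m + 5)"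
          by (rule delta_near[OF r]) (auto simp: m_def)
        also have "\<dots> \<le> 1 / 2 ^ m0" by (rule power_margin) (simp add: m_def)
        finally have "delta \<rho> L0 - g \<le> delta r L0" using m0 by linarith
        then have "(real L0 + 1) * (delta \<rho> L0 - g) \<le> (real L0 + 1) * delta r L0"
          by (intro mult_left_mono) auto
        moreover have "(real L0 + 1) * (delta \<rho> L0 - g) = 1 / 8" by (simp add: g_def field_simps)
        ultimately show "1 / 8 \<le> (real L0 + 1) * delta r L0" by simp
      qed
      then have "rs m L0" by (simp add: rs_def m_def)
      then show ?thesis by blast
    qed
    then obtain m where m: "\<exists>L. rs m L" "\<forall>n<m. \<not> (\<exists>L. rs n L)"
      using exists_least_iff[of "\<lambda>m. \<exists>L. rs m L"] by blast
    define L where "L = (LEAST L. rs m L)"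
    have L: "rs m L" unfolding L_def using m(1) by (rule LeastI_ex)
    \<comment> \<open>By minimality of \<open>L\<close> some point of the box has nonzero weight at
      \<open>j\<close>, so its \<open>delta\<close> is below 1/8. The box adds at most 1/16, which
      stays below 1/4.\<close>
    have small: "delta \<rho> j < 1 / 4" if j: "j < L" for j
    proof -
      have "\<not> rs m j" using j not_less_Least unfolding L_def by blast
      moreover have "j \<le> m" using j L by (simp add: rs_def)
      ultimately obtain r where r: "\<And>a. a \<in> A m \<Longrightarrow> r a \<in> Bx m a" "wt r j \<noteq> 0" by (auto simp: rs_def)
      have "\<bar>delta r j - delta \<rho> j\<bar> \<le> 2 / 2 ^ (m + 5)" by (rule delta_near[OF r(1) \<open>j \<le> m\<close>])
      moreover have "(2::real) / 2 ^ (m + 5) \<le> 1 / 16"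
      proof -
        have "(1::real) \<le> 2 ^ m" by simp
        then show ?thesis by (simp add: power_add field_simps)
      qed
      ultimately show ?thesis using wt_posD[OF r(2)] by linarith
    qed
    have "\<exists>M x. JJ M i = {x}" if i: "i \<le> L" for i
    proof -
      have "\<exists>u. \<forall>e>0. \<exists>m. JJ m i \<subseteq> {u - e..u + e}" using i small by (intro J_conv) simp
      then obtain u M where "JJ M i \<subseteq> {u - 1..u + 1}" by (metis zero_less_one)
      then show ?thesis using single by blast
    qed
    then obtain \<nu> \<xi> where \<nu>: "\<And>i. i \<le> L \<Longrightarrow> JJ (\<nu> i) i = {\<xi> i}" by metis
    define M0 where "M0 = max (\<mu> m) (Max (\<nu> ` {..L}))"
    have JJ_single: "JJ M i = {\<xi> i}" if "M \<ge> M0" "i \<le> L" for M i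
    proof -
      have "\<nu> i \<le> M" using that Max_ge[of "\<nu> ` {..L}" "\<nu> i"] by (simp add: M0_def)
      then show ?thesis using JJ[of "\<nu> i" M i] \<nu>[OF that(2)] ne[of M i] by auto
    qed
    have av: "avail (ss M) m" if "M \<ge> M0" for M
      using avail_up[OF \<mu>[of m], of M] that by (simp add: M0_def)
    have fs: "first_stage (ss M) m" if M: "M \<ge> M0" for M
      unfolding first_stage_def using av[OF M] m(2) rs[OF avail_down[OF s av[OF M]]] by auto
    have lev: "level (ss M) m = L" if M: "M \<ge> M0" for M
    proof -
      have "resolved (ss M) m = rs m" by (intro ext rs av M)
      then show ?thesis by (simp add: level_def L_def)
    qed
    have st: "started (ss M) (JJ M) m" if M: "M \<ge> M0" for M
      unfolding started_def lev[OF M] using fs[OF M] rs[OF av[OF M]] m(1) JJ_single[OF M] by blast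
    show ?thesis
    proof (cases "\<exists>M w. M \<ge> M0 \<and> settled (ss M) (JJ M) w")
      case True
      then show ?thesis using settled_done by blast
    next
      case unsettled: False
      \<comment> \<open>From \<open>M0\<close> on, the needed values are known, so the sets no
        longer depend on \<open>M\<close>; \<open>max M0 n\<close> picks a version that also
        decreases in \<open>n\<close>.\<close>
      define W where "W n = vals (Bx n) (JJ (max M0 n))" for n
      have W_eq: "stage_vals (ss M) (JJ M) n = W n" if M: "M \<ge> M0" and n: "n \<ge> m" "avail (ss M) n" for M n
      proof -
        have wt0: "wt r L = 0" if "\<And>a. a \<in> \<Union>(range A) \<Longrightarrow> r a \<in> Bx n a" for r
        proof -
          have "r a \<in> Bx m a" if "a \<in> A m" for a
            by (rule subsetD[OF Bx_anti[OF n(1)] \<open>\<And>a. a \<in> \<Union>(range A) \<Longrightarrow> r a \<in> Bx n a\<close>])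
              (use that in blast)+
          then show ?thesis using L by (simp add: rs_def)
        qed
        have "vals (Bx n) (JJ M) = vals (Bx n) (JJ (max M0 n))"
          by (intro antisym vals_determined[OF wt0] ne) (use JJ_single M in auto)
        then show ?thesis using box_Bx[OF n(2)] by (simp add: stage_vals_def W_def)
      qed
      have W_anti: "W j \<subseteq> W i" if "i \<le> j" for i j
        unfolding W_def by (rule vals_mono) (use Bx_anti[OF that] JJ[of "max M0 i" "max M0 j"] that in auto)
      have W_ne: "W i \<noteq> {}" for i
        unfolding W_def using \<rho>_Bx ne by (intro vals_nonempty) blast+
      have "\<exists>w. \<forall>e>0. \<exists>n. vals (Bx n) (JJ n) \<subseteq> {w - e..w + e}"
      proof (rule vals_shrink[where r = \<rho>])
        show "\<exists>n. Bx n a \<subseteq> {\<rho> a - d..\<rho> a + d}" if a: "a \<in> \<Union>(range A)" and d: "d > 0" for a d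
        proof -
          obtain j where j: "a \<in> A j" using a by blast
          obtain n0 :: nat where n0: "1 / 2 ^ n0 < d" using small_power[OF d] .
          define n where "n = max n0 j"
          have "\<bar>x - \<rho> a\<bar> \<le> d" if x: "x \<in> Bx n a" for x
          proof -
            have "a \<in> A n" using j A_mono[of j n] by (auto simp: n_def)
            then have "\<bar>x - \<rho> a\<bar> \<le> 2 / 2 ^ (n + 5)" using Bx_near x by blast
            also have "\<dots> \<le> 1 / 2 ^ n0" by (rule power_margin) (simp add: n_def)
            finally show ?thesis using n0 by simp
          qed
          then show ?thesis by (intro exI[of _ n]) (force simp: abs_le_iff)
        qed
      qed (fact Bx_anti JJ J_int J_conv)+
      then obtain w where w: "\<And>e. e > 0 \<Longrightarrow> \<exists>n. vals (Bx n) (JJ n) \<subseteq> {w - e..w + e}" by blast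
      define X where "X j = W (m + j)" for j
      have X_conv: "\<exists>j w. X j \<subseteq> {w - d..w + d}" if d: "d > 0" for d
      proof -
        obtain n where n: "vals (Bx n) (JJ n) \<subseteq> {w - d..w + d}" using w[OF d] by blast
        have "X n \<subseteq> vals (Bx n) (JJ n)"
          unfolding X_def W_def
          by (rule vals_mono) (use Bx_anti[of n "m + n"] JJ[of n "max M0 (m + n)"] in auto)
        then show ?thesis using n by (intro exI[of _ n] exI[of _ w]) (rule order_trans)
      qed
      obtain n :: nat where n: "1 / 2 ^ n < e" using small_power[OF e] .
      \<comment> \<open>\<open>Suc n\<close> digits, so that the digit with index \<open>n\<close>
        is defined.\<close>
      obtain j where j: "length (greedy X j) \<ge> Suc n"
        using greedy_progress[of X "Suc n"] X_conv W_anti W_ne by (auto simp: X_def)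
      define M where "M = max M0 (\<mu> (m + j))"
      have M: "M \<ge> M0" and avM: "avail (ss M) (m + j)"
        using avail_up[OF \<mu>[of "m + j"]] by (auto simp: M_def)
      let ?d = "digits (ss M) (JJ M)"
      have eqd: "?d = glue (\<lambda>j. avail (ss M) (m + j)) (\<lambda>j. greedy (\<lambda>j. stage_vals (ss M) (JJ M) (m + j)) (Suc j))"
        using digits_started[OF _ st[OF M]] unsettled M by blast
      have "greedy (\<lambda>j. stage_vals (ss M) (JJ M) (m + j)) (Suc j) = greedy X (Suc j)"
        unfolding X_def
        by (rule greedy_cong, rule W_eq[OF M]) (use avail_down[OF s avM] in auto)
      then have "list_seq (greedy X (Suc j)) \<subseteq>\<^sub>m ?d"
        using gluing.list_seq_le_glue[OF gluing_greedy, where P = "\<lambda>j. avail (ss M) (m + j)" and j = j, OF avM]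
        unfolding eqd by metis
      then have "list_seq (greedy X j) \<subseteq>\<^sub>m ?d"
        using map_le_trans[OF greedy_prefix[of j "Suc j" X]] by simp
      moreover have "list_seq (greedy X j) n \<noteq> None" using j by (simp add: list_seq_def)
      ultimately have "?d n \<noteq> None" unfolding map_le_def by (metis domIff)
      then have "seq_val ?d \<subseteq> {part_val ?d n - 1 / 2 ^ n..part_val ?d n + 1 / 2 ^ n}"
        by (rule seq_val_subset)
      also have "\<dots> \<subseteq> {part_val ?d n - e..part_val ?d n + e}" using n by auto
      finally show ?thesis by blast
    qed
  qed
qed

end

section \<open>The smoothened hierarchy as a type structure\<close>

definition S_emb :: "nat option hval \<Rightarrow> (nat \<Rightarrow> int option) hval" where
  "S_emb x = Base (case base_val x of None \<Rightarrow> Map.empty | Some m \<Rightarrow> nat_seq m)"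

definition S_out :: "(nat \<Rightarrow> 'i set) \<Rightarrow> ('i \<Rightarrow> (nat \<Rightarrow> int option) hval) \<Rightarrow> (nat \<Rightarrow> real set) \<Rightarrow>
    (nat \<Rightarrow> int option) hval" where
  "S_out A s J = Base (index_sets.digits A (\<lambda>a. base_val (s a)) J)"

lemma nat_or_unknown_nonempty: "nat_or_unknown X \<Longrightarrow> X \<noteq> {}"
  by (auto simp: nat_or_unknown_def)

interpretation S: real_types S_base S_p S_ival S_dom smooth S_emb nat_or_unknown S_out
proof (rule real_types.intro)
  fix k
  show "S_dom 0 = S_base" by simp
  show "S_dom (Suc k) = fs (S_dom k) S_base (smooth k)" by (rule S_dom_Suc)
  show "fun_domain (S_dom k) (lev_p S_dom S_p k) S_base S_p (smooth k)" by (rule S_domain)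
  fix F assume F: "F \<in> Field (fun_space (S_dom k) S_base)"
    and sm: "\<And>x y. rsim S_dom S_ival k x y \<Longrightarrow> S_ival (app F x) \<inter> S_ival (app F y) \<noteq> {}"
  interpret sfp_pair "S_dom k" "lev_p S_dom S_p k" S_base S_p
    by (simp add: sfp_pair_def sfp_S sfp_S_base)
  have "app F x \<in> Field S_base" if "x \<in> Field (S_dom k)" for x
    using F field_fun_space_iff cnt_field[OF _ sfp_S that] by blast
  then show "F \<in> smooth k"
    using sm S_sim_field by (auto simp: smooth_def S_sim_base_iff S_sim_rsim)
next
  show "cnt flatN flat_p S_base S_p S_emb"
  proof (rule cnt_from_flat[OF sfp_S_base])
    show "(S_emb Bot, S_emb (Num m)) \<in> S_base" for m
      by (simp add: S_emb_def S_base_iff' S_seq_nat_seq) (simp add: S_seq_def)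
  qed
  show "S_ival (S_emb (Num m)) = {real m}" for m
    by (simp add: S_emb_def S_ival_def seq_val_nat_seq)
next
  fix A :: "nat \<Rightarrow> nat option hval set" and s s' :: "nat option hval \<Rightarrow> (nat \<Rightarrow> int option) hval"
    and J J' :: "nat \<Rightarrow> real set"
  assume A: "index_sets A" and s: "\<And>a. a \<in> \<Union>(range A) \<Longrightarrow> (s a, s' a) \<in> S_base"
    and J: "\<And>i. J' i \<subseteq> J i" "\<And>i. nat_or_unknown (J i)" "\<And>i. nat_or_unknown (J' i)"
  interpret index_sets A by (rule A)
  have "digits (\<lambda>a. base_val (s a)) J \<subseteq>\<^sub>m digits (\<lambda>a. base_val (s' a)) J'"
  proof (rule digits_mono[OF _ _ _ J(1) nat_or_unknown_nonempty[OF J(3)]])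
    show "seqs (\<lambda>a. base_val (s a))" "seqs (\<lambda>a. base_val (s' a))"
      using s S_field_seq unfolding seqs_def by (blast intro: FieldI1 FieldI2)+
    show "base_val (s a) \<subseteq>\<^sub>m base_val (s' a)" if "a \<in> \<Union>(range A)" for a
      using s[OF that] unfolding S_base_iff by blast
  qed
  then show "(S_out A s J, S_out A s' J') \<in> S_base"
    unfolding S_out_def S_base_iff' using S_seq_digits by blast
next
  fix A :: "nat \<Rightarrow> nat option hval set" and s :: "nat option hval \<Rightarrow> (nat \<Rightarrow> int option) hval"
    and J :: "nat \<Rightarrow> real set"
  assume A: "index_sets A" and s: "\<And>a. a \<in> \<Union>(range A) \<Longrightarrow> s a \<in> Field S_base"
  interpret index_sets A by (rule A)
  have "seqs (\<lambda>a. base_val (s a))" using s S_field_seq unfolding seqs_def by blast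
  then show "vals (\<lambda>a. S_ival (s a)) J \<subseteq> S_ival (S_out A s J)"
    unfolding S_ival_def S_out_def hval.sel by (rule digits_sound)
next
  fix A :: "nat \<Rightarrow> nat option hval set" and ss :: "nat \<Rightarrow> nat option hval \<Rightarrow> (nat \<Rightarrow> int option) hval"
    and JJ :: "nat \<Rightarrow> nat \<Rightarrow> real set" and \<rho> :: "nat option hval \<Rightarrow> real" and e :: real
  assume A: "index_sets A"
    and mono: "\<And>m n a. m \<le> n \<Longrightarrow> a \<in> \<Union>(range A) \<Longrightarrow> (ss m a, ss n a) \<in> S_base"
    and J: "\<And>m n i. m \<le> n \<Longrightarrow> JJ n i \<subseteq> JJ m i" "\<And>m i. nat_or_unknown (JJ m i)"
    and conv: "\<And>a e. a \<in> \<Union>(range A) \<Longrightarrow> e > 0 \<Longrightarrow> \<exists>m. S_ival (ss m a) \<subseteq> {\<rho> a - e..\<rho> a + e}"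
    and J_int: "(\<And>j. index_sets.delta A \<rho> j = 0) \<Longrightarrow> \<exists>u. \<forall>e>0. \<exists>m N. \<forall>i\<ge>N. JJ m i \<subseteq> {u - e..u + e}"
    and J_conv: "\<And>i. (\<And>j. j < i \<Longrightarrow> index_sets.delta A \<rho> j < 1 / 4) \<Longrightarrow>
      \<exists>u. \<forall>e>0. \<exists>m. JJ m i \<subseteq> {u - e..u + e}"
    and e: "e > 0"
  interpret index_sets A by (rule A)
  have "\<exists>m c. seq_val (digits (\<lambda>a. base_val (ss m a)) (JJ m)) \<subseteq> {c - e..c + e}"
  proof (rule digits_conv[where \<rho> = \<rho>])
    show "seqs (\<lambda>a. base_val (ss m a))" for m
      using mono[OF order_refl] S_field_seq unfolding seqs_def by (blast intro: FieldI1)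
    show "base_val (ss m a) \<subseteq>\<^sub>m base_val (ss n a)" if "m \<le> n" "a \<in> \<Union>(range A)" for m n a
      using mono[OF that] unfolding S_base_iff by blast
    show "\<exists>m. seq_val (base_val (ss m a)) \<subseteq> {\<rho> a - e..\<rho> a + e}"
      if "a \<in> \<Union>(range A)" "e > 0" for a e
      using conv[OF that] by (simp add: S_ival_def)
    show "JJ n i \<subseteq> JJ m i" if "m \<le> n" for m n i using J(1)[OF that] .
    show "nat_or_unknown (JJ m i)" for m i by (rule J(2))
  qed (fact J_int J_conv e)+
  then show "\<exists>m c. S_ival (S_out A (ss m) (JJ m)) \<subseteq> {c - e..c + e}"
    by (simp add: S_ival_def S_out_def)
qed (use sfp_S_base S_ival_nonempty S_ival_anti S_ival_open S_ival_lim nat_or_unknown_nonempty in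
    \<open>auto simp: nat_or_unknown_def\<close>)

lemma maximal_iff_single: "maximal_in S_base x \<longleftrightarrow> x \<in> Field S_base \<and> (\<exists>v. S_ival x = {v})"
proof
  assume x: "x \<in> Field S_base \<and> (\<exists>v. S_ival x = {v})"
  then obtain v where v: "seq_val (base_val x) = {v}" by (auto simp: S_ival_def)
  have s: "S_seq (base_val x)" using x S_field_seq by blast
  have "total_seq (base_val x)"
    using s
  proof (cases rule: seq_cases)
    case 2
    then have "v + 1 \<in> seq_val (base_val x)" by (simp add: seq_val_def)
    then show ?thesis using v by simp
  next
    case (3 n)
    have "part_val (base_val x) n - 1 / 2 ^ n \<in> seq_val (base_val x)"
      "part_val (base_val x) n + 1 / 2 ^ n \<in> seq_val (base_val x)"
      unfolding seq_val_last[OF s 3] by simp_all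
    then have "part_val (base_val x) n - 1 / 2 ^ n = part_val (base_val x) n + 1 / 2 ^ n"
      unfolding v by simp
    then show ?thesis by simp
  qed
  then show "maximal_in S_base x" using x maximal_S_base by blast
qed (use S_ival_maximal maximal_S_base in blast)

lemma eqS_eq: "eqS = S.eqD"
proof -
  have "maximal_in S_base x \<and> maximal_in S_base y \<and> S_sim_base x y \<longleftrightarrow> same_real S_base S_ival x y" for x y
    unfolding maximal_iff_single S_sim_base_iff same_real_def by auto
  then show ?thesis unfolding eqS_def S.eqD_def by simp
qed

section \<open>Comparing the hierarchies\<close>

lemma inj_on_image_real:
  fixes c :: "'a \<Rightarrow> real"
  assumes "inj_on c X"
  shows "\<exists>g :: 'b \<Rightarrow> real. inj_on g (f ` X)"
proof -
  have "inj_on (c \<circ> inv_into X f) (f ` X)"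
    by (rule comp_inj_on[OF inj_on_inv_into[OF order_refl]])
      (rule inj_on_subset[OF assms], auto simp: inv_into_into)
  then show ?thesis by blast
qed

context real_types
begin

context
  fixes v :: "'b hval \<Rightarrow> real"
  assumes v: "\<And>x w. x \<in> Field B \<Longrightarrow> I x = {w} \<Longrightarrow> v x = w"
begin

lemma same_real_iff:
  "same_real B I x x \<Longrightarrow> same_real B I y y \<Longrightarrow> same_real B I x y \<longleftrightarrow> v x = v y"
  unfolding same_real_def using v by (metis singleton_inject)

lemma same_real_v: "same_real B I x y \<Longrightarrow> v x = v y"
  unfolding same_real_def using v by metis

text \<open>The embedded zero functional makes the graph nonempty, and the domain bounds its size by
  the continuum, so the code determines the graph.\<close>

lemma rho_graph:
  "\<exists>p. rho eqD v (Suc k) f = Graph p \<and> range p = (\<lambda>y. (rho eqD v k y, Base (v (app f y)))) ` total eqD k"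
proof -
  have "pi k (N_zero k) \<in> total eqD k" using pi_eq[OF eqN_zero] by (simp add: total_def)
  then have ne: "(\<lambda>y. (rho eqD v k y, Base (v (app f y)))) ` total eqD k \<noteq> {}" by blast
  obtain c :: "'b hval \<Rightarrow> real" where "inj_on c (Field (D k))" using sfp.inj_real[OF sfp_D] by blast
  then have "inj_on c (total eqD k)"
    by (rule inj_on_subset) (auto simp: total_def dest: eqD_field)
  then obtain g :: "real hval \<times> real hval \<Rightarrow> real"
    where g: "inj_on g ((\<lambda>y. (rho eqD v k y, Base (v (app f y)))) ` total eqD k)"
    using inj_on_image_real by blast
  show ?thesis
    by (rule graph_code_range[OF ne g]) (simp add: exI)
qed

text \<open>Equal graphs match values at possibly different representatives of an argument. By
  induction these are equivalent, and totality moves the value to the given representative.\<close>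

lemma rho_eq_iff:
  "eqD k x x \<Longrightarrow> eqD k y y \<Longrightarrow> rho eqD v k x = rho eqD v k y \<longleftrightarrow> eqD k x y"
proof (induction k arbitrary: x y)
  case 0
  then show ?case using same_real_iff[of x y] by (simp add: eqD_0)
next
  case (Suc k)
  have xs: "same_real B I (app x a) (app x b)" and ys: "same_real B I (app y a) (app y b)"
    if "eqD k a b" for a b using Suc.prems that by (simp_all add: eqD_Suc)
  show ?case
  proof
    assume eq: "rho eqD v (Suc k) x = rho eqD v (Suc k) y"
    obtain p where "rho eqD v (Suc k) x = Graph p"
      "range p = (\<lambda>z. (rho eqD v k z, Base (v (app x z)))) ` total eqD k"
      using rho_graph by blast
    moreover obtain p' where "rho eqD v (Suc k) y = Graph p'"
      "range p' = (\<lambda>z. (rho eqD v k z, Base (v (app y z)))) ` total eqD k"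
      using rho_graph by blast
    ultimately have G: "(\<lambda>z. (rho eqD v k z, Base (v (app x z)))) ` total eqD k =
        (\<lambda>z. (rho eqD v k z, Base (v (app y z)))) ` total eqD k"
      using eq by (metis hval.inject(2))
    have "same_real B I (app x a) (app y b)" if ab: "eqD k a b" for a b
    proof -
      have a: "eqD k a a" and b: "eqD k b b" using ab eqD_refl1 eqD_refl2 by blast+
      then have "(rho eqD v k a, Base (v (app x a))) \<in> (\<lambda>z. (rho eqD v k z, Base (v (app x z)))) ` total eqD k"
        by (auto simp: total_def)
      then obtain c where c: "eqD k c c" "rho eqD v k c = rho eqD v k a" "v (app x a) = v (app y c)"
        unfolding G by (auto simp: total_def)
      then have "eqD k c a" using Suc.IH[OF c(1) a] by blast
      then have "eqD k c b" using eqD_trans ab by blast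
      then have "v (app y c) = v (app y b)" using same_real_v ys by blast
      then show ?thesis using same_real_iff[OF xs[OF a] ys[OF b]] c(3) by simp
    qed
    then show "eqD (Suc k) x y" using Suc.prems by (simp add: eqD_Suc)
  next
    assume xy: "eqD (Suc k) x y"
    have "(rho eqD v k z, Base (v (app x z))) = (rho eqD v k z, Base (v (app y z)))"
      if "z \<in> total eqD k" for z
      using xy that same_real_v unfolding eqD_Suc total_def by simp
    then show "rho eqD v (Suc k) x = rho eqD v (Suc k) y"
      by (auto intro!: arg_cong[where f = graph_code] image_cong)
  qed
qed

end

end

subsection \<open>Values at embedded functionals\<close>

definition natural_on :: "nat \<Rightarrow> nat option hval \<Rightarrow> (nat option hval \<Rightarrow> real) \<Rightarrow> bool" where
  "natural_on k a Y \<longleftrightarrow> (\<forall>z. eqN (k - 1) z z \<longrightarrow> (\<exists>m. nval k a z = Num m \<and> Y z = real m))"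

text \<open>Continuity of \<open>c\<close> at \<open>a\<close> with respect to the total objects, in
  terms of deflations.\<close>

definition near_continuous :: "nat \<Rightarrow> (nat option hval \<Rightarrow> real) \<Rightarrow> nat option hval \<Rightarrow> bool" where
  "near_continuous k c a \<longleftrightarrow>
     (\<forall>e>0. \<exists>n. \<forall>z. eqN k z z \<longrightarrow> (N_p k n a, z) \<in> N_dom k \<longrightarrow> \<bar>c z - c a\<bar> \<le> e)"

text \<open>The approximant is \<open>a\<close> with arguments truncated by \<open>tau\<close>; it
  lies above the \<open>n\<close>-th deflation of \<open>a\<close> because truncation lies above
  deflation.\<close>

lemma approximates_at_natural:
  assumes a: "eqN k a a" and Y: "natural_on k a Y" and nj: "n \<le> j"
  shows "\<exists>b. approximates k Y (Suc j) b \<and> (N_p k n a, b) \<in> N_dom k"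
proof -
  have af: "a \<in> Field (N_dom k)" using eqN_field a by blast
  define b where "b = (case k of 0 \<Rightarrow> a | Suc l \<Rightarrow> fun_code (Field (N_dom l)) (\<lambda>z. app a (tau l j z)))"
  have nval_b: "nval k b z = nval k a (tau (k - 1) j z)" if "z \<in> Field (N_dom (k - 1))" for z
    using that by (cases k) (auto simp: b_def)
  have b: "b \<in> Field (N_dom k) \<and> (N_p k n a, b) \<in> N_dom k"
  proof (cases k)
    case 0
    then show ?thesis using af N.p_le[OF af] by (simp add: b_def)
  next
    case (Suc l)
    have af': "a \<in> Field (N_dom (Suc l))" using af Suc by simp
    have "cnt (N_dom l) (N_p l) flatN flat_p (\<lambda>z. app a (tau l j z))"
      by (rule cnt_compose[OF cnt_tau N_field_cnt[OF af'] sfp_N sfp_N sfp_flatN])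
    then have bf: "b \<in> Field (N_dom (Suc l))" using N_code_field by (simp add: b_def Suc)
    moreover have "(N_p (Suc l) n a, b) \<in> N_dom (Suc l)"
      unfolding N_rel
    proof (intro conjI ballI bf N.p_field[OF af'])
      fix z assume z: "z \<in> Field (N_dom l)"
      have "(app a (N_p l n z), app a (tau l j z)) \<in> flatN"
        using cnt_mono[OF N_field_cnt[OF af'] p_le_tau[OF nj z]] .
      moreover have "(flat_p n (app a (N_p l n z)), app a (N_p l n z)) \<in> flatN"
        by (rule sfp.p_le[OF sfp_flatN N_app_field[OF af' N.p_field[OF z]]])
      ultimately have "(flat_p n (app a (N_p l n z)), app a (tau l j z)) \<in> flatN"
        by (meson sfp.ord_trans[OF sfp_flatN])
      then show "(app (N_p (Suc l) n a) z, app b z) \<in> flatN"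
        unfolding N_p_app[OF z] using z by (simp add: b_def Suc)
    qed
    ultimately show ?thesis using Suc by simp
  qed
  have "eqN k b b"
  proof (rule eqN_nvalI)
    fix z z' assume zz: "eqN (k - 1) z z'"
    have t: "eqN (k - 1) (tau (k - 1) j z) (tau (k - 1) j z')" using eqN_tau[OF zz] .
    have f: "z \<in> Field (N_dom (k - 1))" "z' \<in> Field (N_dom (k - 1))" using eqN_field zz by auto
    show "\<exists>m. nval k b z = Num m \<and> nval k b z' = Num m"
      unfolding nval_b[OF f(1)] nval_b[OF f(2)] using a t
      by (cases k) (auto simp: eqN_0 eqN_Suc)
  qed (use b in auto)
  moreover have "\<exists>m. nval k b z = Num m \<and> \<bar>Y (tau (k - 1) j z) - real m\<bar> < 1 / 4"
    if z: "eqN (k - 1) z z" for z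
  proof -
    obtain m where "nval k a (tau (k - 1) j z) = Num m" "Y (tau (k - 1) j z) = real m"
      using Y eqN_tau[OF z] unfolding natural_on_def by blast
    then show ?thesis using nval_b eqN_field(1)[OF z] by simp
  qed
  ultimately show ?thesis using b unfolding approximates_def by blast
qed

text \<open>All \<open>delta\<close> vanish, so the interpolation is a limit of values of
  \<open>c\<close> at approximants that converge to \<open>a\<close>; continuity identifies it as
  \<open>c a\<close>.\<close>

lemma interpolates_at_natural:
  assumes a: "eqN k a a" and Y: "natural_on k a Y" and w: "interpolates k c Y w"
    and c: "\<And>b b'. eqN k b b' \<Longrightarrow> c b = c b'" and near: "near_continuous k c a"
  shows "w = c a"
proof -
  have d: "smp.delta (k - 1) Y j = 0" for j
  proof -
    have "nat_dist (Y z) = 0" if "z \<in> samples (k - 1) j" for z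
      using Y samples_total[OF that] unfolding natural_on_def by fastforce
    then have "smp.delta (k - 1) Y j \<le> 0" by (simp add: smp.delta_le_iff)
    then show ?thesis using smp.delta_nonneg[of "k - 1" Y j] by simp
  qed
  obtain v where v: "w = smp.interp (k - 1) Y v" "\<And>i. \<exists>b. approximates k Y i b \<and> v i = c b"
    using w d unfolding interpolates_def by auto
  have "\<bar>w - c a\<bar> \<le> e" if "e > 0" for e
    unfolding v(1)
  proof -
    obtain n where n: "\<And>z. eqN k z z \<Longrightarrow> (N_p k n a, z) \<in> N_dom k \<Longrightarrow> \<bar>c z - c a\<bar> \<le> e"
      using near \<open>e > 0\<close> unfolding near_continuous_def by blast
    show "\<bar>smp.interp (k - 1) Y v - c a\<bar> \<le> e"
    proof (rule smp.interp_enclosed[of "Suc n"])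
      show "smp.wt (k - 1) Y j = 1" for j by (rule smp.wt_one) (use d[of j] in simp)
      fix i assume "i \<ge> Suc n"
      then obtain j where j: "i = Suc j" "n \<le> j" by (cases i) auto
      obtain b where b: "approximates k Y i b" "v i = c b" using v(2) by blast
      obtain b' where b': "approximates k Y i b'" "(N_p k n a, b') \<in> N_dom k"
        using approximates_at_natural[OF a Y j(2)] j(1) by blast
      have "c b = c b'" by (rule c[OF approximates_unique[OF b(1) b'(1)]]) simp
      then show "\<bar>v i - c a\<bar> \<le> e" using n[of b'] b' b(2) by (simp add: approximates_def)
    qed
  qed
  then have "\<bar>w - c a\<bar> \<le> 0" by (rule field_le_epsilon) simp
  then show ?thesis by simp
qed

lemma num_val_cong: "eqN (Suc k) x x' \<Longrightarrow> eqN k b b' \<Longrightarrow> num_val x b = num_val x' b'"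
  unfolding eqN_Suc num_val_def by metis

lemma near_continuous_num_val:
  assumes x: "eqN (Suc k) x x" and a: "eqN k a a"
  shows "near_continuous k (num_val x) a"
proof -
  have xf: "x \<in> Field (N_dom (Suc k))" and af: "a \<in> Field (N_dom k)" using eqN_field x a by auto
  obtain u where u: "app x a = Num u" using x a unfolding eqN_Suc by blast
  obtain n where n: "app x (N_p k n a) = Num u" using cnt_flatD[OF N_field_cnt[OF xf] sfp_N af u] by blast
  have "app x z = Num u" if "(N_p k n a, z) \<in> N_dom k" for z
    using cnt_flat_mono[OF N_field_cnt[OF xf] that n] .
  then show ?thesis
    unfolding near_continuous_def num_val_def using u by (intro allI impI exI[of _ n]) simp
qed

context real_types
begin

text \<open>The embedding really extends \<open>x\<close>: at an embedded argument the probes are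
  natural by induction, so the interpolation collapses to the value of \<open>x\<close>.\<close>

lemma natural_on_pi: "eqN k x x \<Longrightarrow> natural_on k x (pval k (pi (k - 1)) (pi k x))"
proof (induction k arbitrary: x)
  case 0
  then show ?case by (auto simp: natural_on_def pval_def eqN_0 emb_Num)
next
  case (Suc l)
  have "\<exists>m. nval (Suc l) x a = Num m \<and> pval (Suc l) (pi l) (pi (Suc l) x) a = real m"
    if a: "eqN l a a" for a
  proof -
    obtain m where m: "app x a = Num m" using Suc.prems a unfolding eqN_Suc by blast
    obtain w where w: "I (app (pi (Suc l) x) (pi l a)) = {w}"
      "interpolates l (num_val x) (pval l (pi (l - 1)) (pi l a)) w"
      using pi_value[OF Suc.prems pi_eq[OF a]] by blast
    have "w = num_val x a"
      by (rule interpolates_at_natural[OF a Suc.IH[OF a] w(2) num_val_cong[OF Suc.prems]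
            near_continuous_num_val[OF Suc.prems a]])
    then have "pval (Suc l) (pi l) (pi (Suc l) x) a = real m"
      using w(1) m by (simp add: pval_def num_val_def del: pi.simps)
    then show ?thesis using m by simp
  qed
  then show ?case by (simp add: natural_on_def del: pi.simps)
qed

end

subsection \<open>The two embeddings represent the same functionals\<close>

definition E_real :: "real set set hval \<Rightarrow> real" where
  "E_real a = the_elem (\<Inter>(base_val a))"

abbreviation "rhoE \<equiv> rho eqE E_real"
abbreviation "rhoS \<equiv> rho eqS S_val"

lemma E_real: "x \<in> Field E_base \<Longrightarrow> E_val x = {w} \<Longrightarrow> E_real x = w"
  by (simp add: E_real_def E_val_def)

lemma S_real: "x \<in> Field S_base \<Longrightarrow> S_ival x = {w} \<Longrightarrow> S_val x = w"
  using maximal_iff_single S_ival_maximal by (metis singleton_inject)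

lemma rhoE_graph:
  "\<exists>p. rhoE (Suc k) f = Graph p \<and> range p = (\<lambda>y. (rhoE k y, Base (E_real (app f y)))) ` total eqE k"
  unfolding eqE_eq by (rule E.rho_graph) (rule E_real)

lemma rhoS_graph:
  "\<exists>p. rhoS (Suc k) f = Graph p \<and> range p = (\<lambda>y. (rhoS k y, Base (S_val (app f y)))) ` total eqS k"
  unfolding eqS_eq by (rule S.rho_graph) (rule S_real)

lemma rhoS_eq_iff:
  "eqS k x x \<Longrightarrow> eqS k y y \<Longrightarrow> rhoS k x = rhoS k y \<longleftrightarrow> eqS k x y"
  unfolding eqS_eq by (rule S.rho_eq_iff) (rule S_real)

lemma Ct_E_Suc: "Ct_E (Suc k) = rhoE (Suc k) ` total eqE (Suc k)"
  by (simp add: Ct_E_def E_real_def[abs_def])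

lemma Ct_S_Suc: "Ct_S (Suc k) = rhoS (Suc k) ` total eqS (Suc k)"
  by (simp add: Ct_S_def)

lemma rho_graphs_eq:
  assumes "rhoE (Suc k) f = rhoS (Suc k) f'"
  shows "(\<lambda>y. (rhoE k y, Base (E_real (app f y)))) ` total eqE k =
    (\<lambda>y. (rhoS k y, Base (S_val (app f' y)))) ` total eqS k"
proof -
  obtain p where p: "rhoE (Suc k) f = Graph p"
    "range p = (\<lambda>y. (rhoE k y, Base (E_real (app f y)))) ` total eqE k"
    using rhoE_graph by blast
  obtain p' where p': "rhoS (Suc k) f' = Graph p'"
    "range p' = (\<lambda>y. (rhoS k y, Base (S_val (app f' y)))) ` total eqS k"
    using rhoS_graph by blast
  have "p = p'" using assms unfolding p(1) p'(1) by simp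
  then show ?thesis using p(2) p'(2) by simp
qed

text \<open>The domain of a functional is the first projection of its graph. One functional common
  to both hierarchies therefore transfers the equality to the type below.\<close>

lemma images_down:
  assumes eq: "rhoE (Suc k) ` total eqE (Suc k) = rhoS (Suc k) ` total eqS (Suc k)"
  shows "rhoE k ` total eqE k = rhoS k ` total eqS k"
proof -
  have "E.pi (Suc k) (N_zero (Suc k)) \<in> total eqE (Suc k)"
    using E.pi_eq[OF eqN_zero] unfolding total_def eqE_eq by blast
  then obtain f' where "rhoE (Suc k) (E.pi (Suc k) (N_zero (Suc k))) = rhoS (Suc k) f'"
    using eq by (metis (no_types, lifting) imageE imageI)
  from arg_cong[OF rho_graphs_eq[OF this], of "image fst"] show ?thesis
    by (simp add: image_image)
qed

lemma app_value_match:
  assumes y: "eqS (Suc l) y' y'" and eq: "rhoE (Suc l) y = rhoS (Suc l) y'"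
    and z: "eqE l z z" "eqS l z' z'" "rhoE l z = rhoS l z'"
  shows "E_real (app y z) = S_val (app y' z')"
proof -
  have "(rhoE l z, Base (E_real (app y z))) \<in> (\<lambda>y'a. (rhoS l y'a, Base (S_val (app y' y'a)))) ` total eqS l"
    unfolding rho_graphs_eq[OF eq, symmetric] using z(1) by (auto simp: total_def)
  then obtain t where t: "eqS l t t" "rhoS l t = rhoE l z" "S_val (app y' t) = E_real (app y z)"
    by (auto simp: total_def)
  then have "eqS l t z'" using rhoS_eq_iff[OF t(1) z(2)] z(3) by simp
  then have "same_real S_base S_ival (app y' t) (app y' z')"
    using y unfolding eqS_eq S.eqD_Suc by blast
  then have "S_val (app y' t) = S_val (app y' z')"
    by (rule S.same_real_v[rotated]) (rule S_real)
  then show ?thesis using t(3) by simp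
qed

lemma pval_match:
  assumes y: "eqE k y y" "eqS k y' y'" and eq: "rhoE k y = rhoS k y'" and z: "eqN (k - 1) z z"
    and pi: "k > 0 \<Longrightarrow> rhoE (k - 1) (E.pi (k - 1) z) = rhoS (k - 1) (S.pi (k - 1) z)"
  shows "E.pval k (E.pi (k - 1)) y z = S.pval k (S.pi (k - 1)) y' z"
proof -
  have E: "E_val (E.probe k (E.pi (k - 1)) z y) = {E.pval k (E.pi (k - 1)) y z}"
    "E.probe k (E.pi (k - 1)) z y \<in> Field E_base"
    using E.I_probe[OF E.good_pi _ z] E.probe_field[OF E.good_pi] y(1) eqN_field[OF z] E.eqD_field
    unfolding eqE_eq by blast+
  have S: "S_ival (S.probe k (S.pi (k - 1)) z y') = {S.pval k (S.pi (k - 1)) y' z}"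
    "S.probe k (S.pi (k - 1)) z y' \<in> Field S_base"
    using S.I_probe[OF S.good_pi _ z] S.probe_field[OF S.good_pi] y(2) eqN_field[OF z] S.eqD_field
    unfolding eqS_eq by blast+
  have "E_real (E.probe k (E.pi (k - 1)) z y) = S_val (S.probe k (S.pi (k - 1)) z y')"
  proof (cases k)
    case 0
    then show ?thesis using eq by simp
  next
    case (Suc l)
    have z': "eqE l (E.pi l z) (E.pi l z)" "eqS l (S.pi l z) (S.pi l z)"
      using E.pi_eq S.pi_eq z Suc unfolding eqE_eq eqS_eq by auto
    show ?thesis
      using app_value_match[OF _ _ z'] y(2) eq pi unfolding Suc by simp
  qed
  then show ?thesis using E_real[OF E(2,1)] S_real[OF S(2,1)] by simp
qed

text \<open>Both realizers satisfy the same \<open>interpolates\<close> specification, with equal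
  probe values by induction. Agreement at lower types is needed for the two graphs to have the same
  domain.\<close>

lemma pi_match:
  assumes images: "\<And>l. l \<le> n \<Longrightarrow> rhoE l ` total eqE l = rhoS l ` total eqS l"
  shows "k \<le> n \<Longrightarrow> eqN k x x \<Longrightarrow> rhoE k (E.pi k x) = rhoS k (S.pi k x)"
proof (induction k arbitrary: x rule: less_induct)
  case (less k)
  show ?case
  proof (cases k)
    case 0
    then obtain m where m: "x = Num m" using less.prems by (auto simp: eqN_0)
    have fE: "E_emb (Num m) \<in> Field E_base" "S_emb (Num m) \<in> Field S_base"
      using cnt_field[OF E.cnt_emb sfp_flatN] cnt_field[OF S.cnt_emb sfp_flatN] by (auto simp: Field_flatN)
    then show ?thesis
      unfolding 0 m using E_real[OF fE(1) E.emb_Num] S_real[OF fE(2) S.emb_Num] by simp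
  next
    case (Suc l)
    have x: "eqN (Suc l) x x" using less.prems Suc by simp
    have val: "E_real (app (E.pi (Suc l) x) y) = S_val (app (S.pi (Suc l) x) y')"
      if y: "eqE l y y" "eqS l y' y'" "rhoE l y = rhoS l y'" for y y'
    proof -
      obtain w where w: "E_val (app (E.pi (Suc l) x) y) = {w}"
        "interpolates l (num_val x) (E.pval l (E.pi (l - 1)) y) w"
        using E.pi_value[OF x] y(1) unfolding eqE_eq by blast
      obtain w' where w': "S_ival (app (S.pi (Suc l) x) y') = {w'}"
        "interpolates l (num_val x) (S.pval l (S.pi (l - 1)) y') w'"
        using S.pi_value[OF x] y(2) unfolding eqS_eq by blast
      have "w = w'"
      proof (rule interpolates_unique[OF w(2) w'(2)])
        fix z assume z: "eqN (l - 1) z z"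
        show "E.pval l (E.pi (l - 1)) y z = S.pval l (S.pi (l - 1)) y' z"
        proof (rule pval_match[OF y z])
          show "rhoE (l - 1) (E.pi (l - 1) z) = rhoS (l - 1) (S.pi (l - 1) z)"
            using less.IH[of "l - 1" z] less.prems Suc z by simp
        qed
      qed (rule num_val_cong[OF x])
      moreover have "app (E.pi (Suc l) x) y \<in> Field E_base" "app (S.pi (Suc l) x) y' \<in> Field S_base"
        using E.D_app_field S.D_app_field E.pi_eq[OF x] S.pi_eq[OF x] y(1,2) E.eqD_field S.eqD_field
        unfolding eqE_eq eqS_eq by blast+
      ultimately show ?thesis using E_real w(1) S_real w'(1) by metis
    qed
    have im: "rhoE l ` total eqE l = rhoS l ` total eqS l" using images[of l] less.prems Suc by simp
    have "(\<lambda>y. (rhoE l y, Base (E_real (app (E.pi (Suc l) x) y)) :: real hval)) ` total eqE l =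
        (\<lambda>y. (rhoS l y, Base (S_val (app (S.pi (Suc l) x) y)))) ` total eqS l"
    proof (intro equalityI image_subsetI)
      fix y assume "y \<in> total eqE l"
      moreover then obtain y' where "y' \<in> total eqS l" "rhoE l y = rhoS l y'" using im by blast
      ultimately show "(rhoE l y, Base (E_real (app (E.pi (Suc l) x) y)) :: real hval) \<in>
          (\<lambda>y. (rhoS l y, Base (S_val (app (S.pi (Suc l) x) y)))) ` total eqS l"
        using val[of y y'] by (intro image_eqI[of _ _ y']) (auto simp: total_def)
    next
      fix y' assume "y' \<in> total eqS l"
      moreover then obtain y where "y \<in> total eqE l" "rhoS l y' = rhoE l y" using im by blast
      ultimately show "(rhoS l y', Base (S_val (app (S.pi (Suc l) x) y')) :: real hval) \<in>
          (\<lambda>y. (rhoE l y, Base (E_real (app (E.pi (Suc l) x) y)))) ` total eqE l"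
        using val[of y y'] by (intro image_eqI[of _ _ y]) (auto simp: total_def)
    qed
    then show ?thesis unfolding Suc rho.simps by (rule arg_cong)
  qed
qed

section \<open>Extending functions on the Kleene-Kreisel functionals\<close>

text \<open>The sets are nonempty by density. They may contain arbitrary reals, which suits the
  extensional outputs.\<close>

definition fun_family :: "nat \<Rightarrow> (nat option hval \<Rightarrow> real) \<Rightarrow> nat \<Rightarrow> nat option hval \<Rightarrow> real set" where
  "fun_family k c m b = {c z | z. eqN k z z \<and> (N_p k m b, z) \<in> N_dom k}"

context
  fixes n :: nat and c :: "nat option hval \<Rightarrow> real"
  assumes c: "\<And>x x'. eqN n x x' \<Longrightarrow> c x = c x'" and near: "\<And>x. eqN n x x \<Longrightarrow> near_continuous n c x"
begin

lemma family_fun: "E.family n (fun_family n c)"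
  unfolding E.family_def
proof (intro conjI allI impI ballI)
  show "fun_family n c m b \<noteq> {}" if "b \<in> Field (N_dom n)" for m b
    using N_dense[OF that, of m] unfolding fun_family_def by blast
  fix m m' :: nat and b b' assume "m \<le> m'" and b: "(b, b') \<in> N_dom n"
  have "(N_p n m b, N_p n m b') \<in> N_dom n" "(N_p n m b', N_p n m' b') \<in> N_dom n"
    using N.p_mono[OF b] N.p_chain[OF FieldI2[OF b] \<open>m \<le> m'\<close>] by auto
  then have "(N_p n m b, N_p n m' b') \<in> N_dom n" by (rule N.ord_trans)
  then have "(N_p n m' b', z) \<in> N_dom n \<Longrightarrow> (N_p n m b, z) \<in> N_dom n" for z by (rule N.ord_trans)
  then show "fun_family n c m' b' \<subseteq> fun_family n c m b" unfolding fun_family_def by blast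
qed

lemma encloses_fun: "encloses n (fun_family n c) c"
  unfolding encloses_def
proof (intro conjI allI impI)
  fix b :: "nat option hval" assume b: "eqN n b b"
  then have bf: "b \<in> Field (N_dom n)" using eqN_field by blast
  {
    fix e :: real assume "e > 0"
    then obtain m where m: "\<And>z. eqN n z z \<Longrightarrow> (N_p n m b, z) \<in> N_dom n \<Longrightarrow> \<bar>c z - c b\<bar> \<le> e"
      using near[OF b] unfolding near_continuous_def by blast
    obtain j where j: "N_p n m b = N_p n m (N_p n j b)" using N.p_p_att[OF bf] by blast
    have "fun_family n c m (N_p n j b) \<subseteq> {c b - e..c b + e}"
      unfolding fun_family_def j[symmetric] using m by (force simp: abs_le_iff)
    then show "\<exists>m j. fun_family n c m (N_p n j b) \<subseteq> {c b - e..c b + e}" by blast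
  }
  fix b' :: "nat option hval" and m :: nat assume b': "(b', b) \<in> N_dom n"
  have "(N_p n m b', b) \<in> N_dom n" using N.ord_trans[OF N.p_le[OF FieldI1[OF b']] b'] .
  then show "c b \<in> fun_family n c m b'" using b unfolding fun_family_def by blast
qed

lemma E_extension:
  "\<exists>\<Phi>. eqE (Suc n) \<Phi> \<Phi> \<and> (\<forall>x. eqN n x x \<longrightarrow> E_real (app \<Phi> (E.pi n x)) = c x)"
proof -
  let ?h = "E.extension n (E.pi (n - 1)) (fun_family n c)"
  define \<Phi> where "\<Phi> = fun_code (Field (E_dom n)) ?h"
  have cnt_h: "cnt (E_dom n) (lev_p E_dom E_p n) E_base E_p ?h"
    by (rule E.cnt_extension[OF E.good_pi family_fun])
  interpret fun_domain "E_dom n" "lev_p E_dom E_p n" E_base E_p UNIV by (rule E.D_domain)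
  have \<Phi>f: "\<Phi> \<in> Field (E_dom (Suc n))" using code_field[OF cnt_h] by (simp add: \<Phi>_def)
  have app: "app \<Phi> y = ?h y" if "y \<in> Field (E_dom n)" for y
    using that by (simp add: \<Phi>_def)
  have val: "\<exists>w. E_val (app \<Phi> y) = {w} \<and> interpolates n c (E.pval n (E.pi (n - 1)) y) w" if "E.eqD n y y" for y
    using E.extension_value_pi[OF family_fun encloses_fun that] app E.eqD_field[OF that] by simp
  have "E.eqD (Suc n) \<Phi> \<Phi>"
    unfolding E.eqD_Suc
  proof (intro conjI allI impI \<Phi>f)
    fix y y' assume yy: "E.eqD n y y'"
    obtain w where w: "E_val (app \<Phi> y) = {w}" "interpolates n c (E.pval n (E.pi (n - 1)) y) w"
      using val[OF E.eqD_refl1[OF yy]] by blast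
    obtain w' where w': "E_val (app \<Phi> y') = {w'}" "interpolates n c (E.pval n (E.pi (n - 1)) y') w'"
      using val[OF E.eqD_refl2[OF yy]] by blast
    have "w = w'"
      by (rule interpolates_unique[OF w(2) w'(2) E.pval_cong[OF E.good_pi yy] c])
    moreover have "app \<Phi> y \<in> Field E_base" "app \<Phi> y' \<in> Field E_base"
      using E.D_app_field[OF \<Phi>f] E.eqD_field[OF yy] by auto
    ultimately show "same_real E_base E_val (app \<Phi> y) (app \<Phi> y')"
      using w(1) w'(1) by (simp add: same_real_def)
  qed
  moreover have "E_real (app \<Phi> (E.pi n x)) = c x" if x: "eqN n x x" for x
  proof -
    obtain w where w: "E_val (app \<Phi> (E.pi n x)) = {w}"
      "interpolates n c (E.pval n (E.pi (n - 1)) (E.pi n x)) w"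
      using val[OF E.pi_eq[OF x]] by blast
    have "w = c x" by (rule interpolates_at_natural[OF x E.natural_on_pi[OF x] w(2) c near[OF x]])
    then show ?thesis
      using E_real[OF E.D_app_field[OF \<Phi>f] w(1)] E.eqD_field(1)[OF E.pi_eq[OF x]] by simp
  qed
  ultimately show ?thesis unfolding eqE_eq by blast
qed

text \<open>The values of \<open>c\<close> are computed as digit sequences that depend only on the functional: two
  representatives of a functional have a common total lower bound, whose digit sequence is maximal.\<close>

lemma digit_factorization:
  assumes Ct: "Ct_E (n + 1) = Ct_S (n + 1)"
  obtains g where "cnt (N_dom n) (N_p n) S_base S_p g"
    and "\<And>x. eqN n x x \<Longrightarrow> maximal_in S_base (g x) \<and> S_val (g x) = c x"
    and "\<And>x x'. eqN n x x' \<Longrightarrow> g x = g x'"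
proof -
  have top: "rhoE (Suc n) ` total eqE (Suc n) = rhoS (Suc n) ` total eqS (Suc n)"
    using Ct by (simp only: Suc_eq_plus1[symmetric] Ct_E_Suc Ct_S_Suc)
  have images: "rhoE l ` total eqE l = rhoS l ` total eqS l" if "l \<le> Suc n" for l
    using that by (induction l rule: inc_induct) (use top images_down in auto)
  obtain \<Phi> where \<Phi>: "eqE (Suc n) \<Phi> \<Phi>" "\<And>x. eqN n x x \<Longrightarrow> E_real (app \<Phi> (E.pi n x)) = c x"
    using E_extension by blast
  have "rhoE (Suc n) \<Phi> \<in> rhoS (Suc n) ` total eqS (Suc n)"
    unfolding top[symmetric] using \<Phi>(1) by (auto simp: total_def)
  then obtain F where F: "eqS (Suc n) F F" "rhoE (Suc n) \<Phi> = rhoS (Suc n) F"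
    by (auto simp: total_def)
  define g where "g x = app F (S.pi n x)" for x
  have Ff: "F \<in> Field (S_dom (Suc n))" using F(1) S.eqD_field unfolding eqS_eq by blast
  have cnt_g: "cnt (N_dom n) (N_p n) S_base S_p g"
    unfolding g_def
    by (rule cnt_compose[OF S.cnt_pi S.D_field_cnt[OF Ff] sfp_N S.sfp_D sfp_S_base])
  have max: "maximal_in S_base (g x)" if x: "eqN n x x" for x
  proof -
    have "same_real S_base S_ival (g x) (g x)"
      using F(1) S.pi_eq[OF x] unfolding eqS_eq S.eqD_Suc g_def by blast
    then show ?thesis unfolding same_real_def maximal_iff_single by blast
  qed
  have "S_val (g x) = c x" if x: "eqN n x x" for x
  proof -
    have "E_real (app \<Phi> (E.pi n x)) = S_val (app F (S.pi n x))"
    proof (rule app_value_match[OF F])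
      show "eqE n (E.pi n x) (E.pi n x)" using E.pi_eq[OF x] by (simp add: eqE_eq)
      show "eqS n (S.pi n x) (S.pi n x)" using S.pi_eq[OF x] by (simp add: eqS_eq)
      show "rhoE n (E.pi n x) = rhoS n (S.pi n x)"
        by (rule pi_match[OF images order_refl x]) simp
    qed
    then show ?thesis using \<Phi>(2)[OF x] by (simp add: g_def)
  qed
  moreover have "g x = g x'" if xx: "eqN n x x'" for x x'
  proof -
    obtain z where z: "eqN n z z" "(z, x) \<in> N_dom n" "(z, x') \<in> N_dom n"
      using eqN_lower[OF xx] by blast
    have "(g z, g x) \<in> S_base" "(g z, g x') \<in> S_base" using cnt_mono[OF cnt_g] z(2,3) by auto
    then show ?thesis using max[OF z(1)] unfolding maximal_in_def by metis
  qed
  ultimately show thesis using that cnt_g max by blast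
qed

end

section \<open>Clopen sets\<close>

lemma scott_open_prefix:
  assumes "\<And>i. i \<le> m \<Longrightarrow> \<sigma> i \<noteq> None"
  shows "scott_open S_base {t \<in> Field S_base. \<forall>i\<le>m. base_val t i = \<sigma> i}"
  unfolding scott_open_def
proof (intro conjI allI impI)
  fix t t' assume t: "t \<in> {t \<in> Field S_base. \<forall>i\<le>m. base_val t i = \<sigma> i} \<and> (t, t') \<in> S_base"
  then have le: "base_val t \<subseteq>\<^sub>m base_val t'" unfolding S_base_iff by blast
  have "base_val t' i = \<sigma> i" if i: "i \<le> m" for i
  proof -
    have "base_val t i = \<sigma> i" using t i by blast
    moreover from this have "i \<in> dom (base_val t)" using assms[OF i] by (simp add: domIff)
    ultimately show ?thesis using le by (simp add: map_le_def)
  qed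
  then show "t' \<in> {t \<in> Field S_base. \<forall>i\<le>m. base_val t i = \<sigma> i}" using t by (auto intro: FieldI2)
next
  fix A t assume A: "directed_in S_base A \<and> is_lub_in S_base A t \<and>
    t \<in> {t \<in> Field S_base. \<forall>i\<le>m. base_val t i = \<sigma> i}"
  then have t: "t \<in> Field S_base" "\<And>i. i \<le> m \<Longrightarrow> base_val t i = \<sigma> i" by auto
  obtain j where j: "\<And>k. k \<le> m \<Longrightarrow> trunc_seq j (base_val t) k = base_val t k"
    using trunc_seq_eventually[OF S_field_seq[OF t(1)], of m] t(2)[of m] assms[of m] by auto
  obtain a where a: "a \<in> A" "S_p j t = S_p j a" using sfp.p_att[OF sfp_S_base] A by blast
  have "base_val a i = \<sigma> i" if i: "i \<le> m" for i
  proof -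
    have "trunc_seq j (base_val a) i = \<sigma> i" using a(2) j[OF i] t(2)[OF i] by (simp add: S_p_def)
    then show ?thesis using assms[OF i] by (auto simp: trunc_seq_def split: if_splits)
  qed
  then show "A \<inter> {t \<in> Field S_base. \<forall>i\<le>m. base_val t i = \<sigma> i} \<noteq> {}"
    using a(1) A by (auto simp: directed_in_def)
qed auto

context
  fixes n :: nat
begin

definition reps :: "nat option hval topology" where
  "reps = subtopology (scott_topology (N_dom n)) (total eqN n)"

definition cls :: "nat option hval \<Rightarrow> nat option hval set" where
  "cls x = {(x, y). eqN n x y} `` {x}"

lemma topspace_reps: "topspace reps = total eqN n"
  using eqN_field N.topspace_scott by (auto simp: reps_def total_def)

lemma openin_reps: "scott_open (N_dom n) U \<Longrightarrow> openin reps (total eqN n \<inter> U)"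
  unfolding reps_def openin_subtopology by (auto simp: openin_scott_topology)

lemma cls_eq_iff: "eqN n x x \<Longrightarrow> eqN n y y \<Longrightarrow> cls x = cls y \<longleftrightarrow> eqN n x y"
  unfolding cls_def using eqN_sym eqN_trans by blast

lemma openin_Ct_N:
  "openin (Ct_N n) V \<longleftrightarrow> V \<subseteq> cls ` total eqN n \<and> openin reps {x \<in> total eqN n. cls x \<in> V}"
proof -
  have "total eqN n // {(x, y). eqN n x y} = cls ` total eqN n"
    by (auto simp: quotient_def cls_def)
  then show ?thesis
    unfolding Ct_N_def openin_quotient_topology reps_def[symmetric] topspace_reps
    by (simp add: cls_def)
qed

lemma topspace_Ct_N: "topspace (Ct_N n) = cls ` total eqN n"
proof -
  have "openin (Ct_N n) (cls ` total eqN n)"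
    unfolding openin_Ct_N using openin_topspace[of reps] by (simp add: topspace_reps cong: conj_cong)
  then show ?thesis
    unfolding topspace_def by (auto simp: openin_Ct_N)
qed

lemma continuous_cls: "continuous_map reps (Ct_N n) cls"
  unfolding continuous_map_def topspace_reps topspace_Ct_N by (auto simp: openin_Ct_N)

text \<open>Each subspace is a continuous image of its preimage among the representatives, which is
  second countable; the Lindelof property passes to such images.\<close>

lemma hereditarily_Lindelof_Ct_N: "hereditarily Lindelof_space (Ct_N n)"
  unfolding hereditarily
proof
  fix S
  define X where "X = subtopology reps {x \<in> total eqN n. cls x \<in> S}"
  have "second_countable X"
    unfolding X_def reps_def by (intro second_countable_subtopology N.second_countable_scott)
  then have "Lindelof_space X" by (rule second_countable_imp_Lindelof_space)
  then show "Lindelof_space (subtopology (Ct_N n) S)"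
  proof (rule Lindelof_space_continuous_map_image)
    show "continuous_map X (subtopology (Ct_N n) S) cls"
      unfolding X_def continuous_map_in_subtopology
      using continuous_map_from_subtopology[OF continuous_cls] by auto
    show "cls ` topspace X = topspace (subtopology (Ct_N n) S)"
      by (auto simp: X_def topspace_reps topspace_Ct_N)
  qed
qed

lemmas openin_R_Ct_N = openin_R_topology[OF hereditarily_Lindelof_Ct_N]

lemma topspace_R: "topspace (R_topology (Ct_N n)) = topspace (Ct_N n)"
proof -
  have "openin (R_topology (Ct_N n)) (topspace (Ct_N n))"
    unfolding openin_R_Ct_N by (intro exI[of _ "\<lambda>_. 0"] exI[of _ UNIV]) auto
  then have "topspace (Ct_N n) \<subseteq> topspace (R_topology (Ct_N n))" by (rule openin_subset)
  moreover obtain f :: "nat option hval set \<Rightarrow> real" and W where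
    "topspace (R_topology (Ct_N n)) = {x \<in> topspace (Ct_N n). f x \<in> W}"
    using openin_topspace[of "R_topology (Ct_N n)"] unfolding openin_R_Ct_N by blast
  ultimately show ?thesis by blast
qed

text \<open>The indicator function of a clopen set is continuous and recovers the set.\<close>

lemma openin_R_clopen:
  assumes C: "openin (Ct_N n) C" "openin (Ct_N n) (topspace (Ct_N n) - C)"
  shows "openin (R_topology (Ct_N n)) C"
  unfolding openin_R_Ct_N
proof (intro exI conjI)
  let ?f = "\<lambda>x. if x \<in> C then 1 else 0 :: real"
  have sub: "C \<subseteq> topspace (Ct_N n)" using C(1) openin_subset by blast
  show "continuous_map (Ct_N n) euclideanreal ?f"
    unfolding continuous_map_def
  proof (intro conjI allI impI)
    fix U :: "real set"
    have "{x \<in> topspace (Ct_N n). ?f x \<in> U} =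
        (if 1 \<in> U then C else {}) \<union> (if 0 \<in> U then topspace (Ct_N n) - C else {})"
      using sub by auto
    then show "openin (Ct_N n) {x \<in> topspace (Ct_N n). ?f x \<in> U}" using C by auto
  qed simp
  show "open {0::real<..}" by simp
  show "C = {x \<in> topspace (Ct_N n). ?f x \<in> {0<..}}" using sub by auto
qed

lemma clopen_basis:
  assumes Ct: "Ct_E (n + 1) = Ct_S (n + 1)"
    and f: "continuous_map (Ct_N n) euclideanreal f" and W: "open W"
    and x0: "eqN n x0 x0" "f (cls x0) \<in> W"
  shows "\<exists>C. openin (Ct_N n) C \<and> openin (Ct_N n) (topspace (Ct_N n) - C) \<and> cls x0 \<in> C \<and>
    C \<subseteq> {x \<in> topspace (Ct_N n). f x \<in> W}"
proof -
  define c where "c x = f (cls x)" for x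
  have c_cong: "c x = c x'" if "eqN n x x'" for x x'
    using cls_eq_iff[OF eqN_refl1[OF that] eqN_refl2[OF that]] that by (simp add: c_def)
  have cont: "continuous_map reps euclideanreal c"
    unfolding c_def using continuous_map_compose[OF continuous_cls f] by (simp add: o_def)
  have near: "near_continuous n c x" if x: "eqN n x x" for x
    unfolding near_continuous_def
  proof (intro allI impI)
    fix e :: real assume "e > 0"
    have "openin reps {z \<in> topspace reps. c z \<in> ball (c x) e}"
      by (rule openin_continuous_map_preimage[OF cont]) simp
    then obtain U where U: "scott_open (N_dom n) U"
      "{z \<in> topspace reps. c z \<in> ball (c x) e} = U \<inter> total eqN n"
      unfolding reps_def openin_subtopology openin_scott_topology by blast
    have "x \<in> {z \<in> topspace reps. c z \<in> ball (c x) e}"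
      using x \<open>e > 0\<close> by (simp add: topspace_reps total_def)
    then have "x \<in> U" unfolding U(2) by blast
    then obtain m where m: "N_p n m x \<in> U" using N.scott_open_p[OF U(1)] by blast
    have "\<bar>c z - c x\<bar> \<le> e" if z: "eqN n z z" "(N_p n m x, z) \<in> N_dom n" for z
    proof -
      have "z \<in> U \<inter> total eqN n" using scott_open_up[OF U(1) m z(2)] z(1) by (simp add: total_def)
      then show ?thesis unfolding U(2)[symmetric] by (auto simp: dist_real_def)
    qed
    then show "\<exists>m. \<forall>z. eqN n z z \<longrightarrow> (N_p n m x, z) \<in> N_dom n \<longrightarrow> \<bar>c z - c x\<bar> \<le> e" by blast
  qed
  obtain g where g: "cnt (N_dom n) (N_p n) S_base S_p g"
    "\<And>x. eqN n x x \<Longrightarrow> maximal_in S_base (g x) \<and> S_val (g x) = c x"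
    "\<And>x x'. eqN n x x' \<Longrightarrow> g x = g x'"
    using digit_factorization[OF c_cong near Ct] by blast
  have gval: "S_ival (g x) = {c x}" and gtot: "base_val (g x) i \<noteq> None" if "eqN n x x" for x i
    using g(2)[OF that] S_ival_maximal[of "g x"] maximal_S_base[of "g x"] by (auto simp: total_seq_def)
  obtain e where e: "e > 0" "ball (c x0) e \<subseteq> W"
    using W x0(2) unfolding open_contains_ball c_def by blast
  \<comment> \<open>Sequences agreeing up to index \<open>m\<close> have values within
    \<open>1 / 2 ^ m\<close> of the same partial value, hence less than \<open>e\<close>
    apart.\<close>
  obtain m where m: "1 / 2 ^ m < e / 2" using small_power[of "e / 2"] e(1) by auto
  define \<sigma> where "\<sigma> = base_val (g x0)"
  define pre where "pre \<tau> = {x \<in> total eqN n. \<forall>i\<le>m. base_val (g x) i = \<tau> i}" for \<tau>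
  define C where "C = cls ` pre \<sigma>"
  have open_pre: "openin reps (pre \<tau>)" if "\<And>i. i \<le> m \<Longrightarrow> \<tau> i \<noteq> None" for \<tau>
  proof -
    have cm: "continuous_map (scott_topology (N_dom n)) (scott_topology S_base) g"
      using g(1) cnt_iff_continuous_map[OF sfp_N sfp_S_base] by blast
    have "scott_open (N_dom n) {x \<in> Field (N_dom n). g x \<in> {t \<in> Field S_base. \<forall>i\<le>m. base_val t i = \<tau> i}}"
      using openin_continuous_map_preimage[OF cm, of "{t \<in> Field S_base. \<forall>i\<le>m. base_val t i = \<tau> i}"]
        scott_open_prefix[of m \<tau>, OF that]
      by (simp add: openin_scott_topology N.topspace_scott)
    moreover have "pre \<tau> = total eqN n \<inter>
        {x \<in> Field (N_dom n). g x \<in> {t \<in> Field S_base. \<forall>i\<le>m. base_val t i = \<tau> i}}"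
      using eqN_field cnt_field[OF g(1) sfp_N] by (auto simp: pre_def total_def)
    ultimately show ?thesis using openin_reps by simp
  qed
  have cls_pre: "cls x \<in> cls ` pre \<tau> \<longleftrightarrow> x \<in> pre \<tau>" if x: "x \<in> total eqN n" for x \<tau>
  proof
    assume "cls x \<in> cls ` pre \<tau>"
    then obtain x' where x': "x' \<in> pre \<tau>" "cls x = cls x'" by blast
    then have "eqN n x x'" using cls_eq_iff x by (auto simp: pre_def total_def)
    then have "g x = g x'" by (rule g(3))
    then show "x \<in> pre \<tau>" using x' x by (simp add: pre_def)
  qed blast
  have tot: "pre \<tau> \<subseteq> total eqN n" for \<tau> by (auto simp: pre_def)
  have "openin (Ct_N n) C"
    unfolding openin_Ct_N
  proof
    show "C \<subseteq> cls ` total eqN n" using tot by (auto simp: C_def)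
    have "{x \<in> total eqN n. cls x \<in> C} = pre \<sigma>" using cls_pre tot[of \<sigma>] by (auto simp: C_def)
    then show "openin reps {x \<in> total eqN n. cls x \<in> C}"
      using open_pre[of \<sigma>] gtot[OF x0(1)] by (simp add: \<sigma>_def)
  qed
  moreover have "openin (Ct_N n) (topspace (Ct_N n) - C)"
    unfolding openin_Ct_N
  proof
    show "topspace (Ct_N n) - C \<subseteq> cls ` total eqN n" by (auto simp: topspace_Ct_N)
    \<comment> \<open>All digits exist at total objects, so the complement consists of the sets
      prescribing some other prefix, each of which is open.\<close>
    have "{x \<in> total eqN n. cls x \<in> topspace (Ct_N n) - C} =
        \<Union>{pre \<tau> | \<tau>. (\<forall>i\<le>m. \<tau> i \<noteq> None) \<and> (\<exists>i\<le>m. \<tau> i \<noteq> \<sigma> i)}"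
    proof (intro equalityI subsetI)
      fix x assume x: "x \<in> {x \<in> total eqN n. cls x \<in> topspace (Ct_N n) - C}"
      then have "x \<notin> pre \<sigma>" by (auto simp: C_def)
      then have "\<exists>i\<le>m. base_val (g x) i \<noteq> \<sigma> i" using x by (auto simp: pre_def)
      moreover have "\<forall>i\<le>m. base_val (g x) i \<noteq> None" using gtot x by (auto simp: total_def)
      moreover have "x \<in> pre (base_val (g x))" using x by (simp add: pre_def)
      ultimately show "x \<in> \<Union>{pre \<tau> | \<tau>. (\<forall>i\<le>m. \<tau> i \<noteq> None) \<and> (\<exists>i\<le>m. \<tau> i \<noteq> \<sigma> i)}" by blast
    next
      fix x assume "x \<in> \<Union>{pre \<tau> | \<tau>. (\<forall>i\<le>m. \<tau> i \<noteq> None) \<and> (\<exists>i\<le>m. \<tau> i \<noteq> \<sigma> i)}"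
      then obtain \<tau> i where \<tau>: "x \<in> pre \<tau>" "i \<le> m" "\<tau> i \<noteq> \<sigma> i" by blast
      then have "x \<in> total eqN n" "x \<notin> pre \<sigma>" by (auto simp: pre_def)
      then show "x \<in> {x \<in> total eqN n. cls x \<in> topspace (Ct_N n) - C}"
        using cls_pre by (auto simp: C_def topspace_Ct_N)
    qed
    moreover have "openin reps (\<Union>{pre \<tau> | \<tau>. (\<forall>i\<le>m. \<tau> i \<noteq> None) \<and> (\<exists>i\<le>m. \<tau> i \<noteq> \<sigma> i)})"
      by (rule openin_Union) (use open_pre in blast)
    ultimately show "openin reps {x \<in> total eqN n. cls x \<in> topspace (Ct_N n) - C}" by simp
  qed
  moreover have "cls x0 \<in> C" using x0(1) by (auto simp: C_def pre_def \<sigma>_def total_def)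
  moreover have "C \<subseteq> {x \<in> topspace (Ct_N n). f x \<in> W}"
  proof
    fix y assume "y \<in> C"
    then obtain x where x: "x \<in> pre \<sigma>" "y = cls x" by (auto simp: C_def)
    then have xt: "eqN n x x" by (auto simp: pre_def total_def)
    have pv: "part_val (base_val (g x)) m = part_val \<sigma> m"
      by (rule part_val_cong) (use x in \<open>simp add: pre_def\<close>)
    have "c x \<in> seq_val (base_val (g x))" "c x0 \<in> seq_val \<sigma>"
      using gval[OF xt] gval[OF x0(1)] by (auto simp: S_ival_def \<sigma>_def)
    then have "\<bar>c x - part_val \<sigma> m\<bar> \<le> 1 / 2 ^ m" "\<bar>c x0 - part_val \<sigma> m\<bar> \<le> 1 / 2 ^ m"
      using gtot[OF xt, of m] gtot[OF x0(1), of m] pv by (auto simp: seq_val_def \<sigma>_def)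
    then have "\<bar>c x0 - c x\<bar> < e" using m by linarith
    then have "c x \<in> W" using e(2) by (auto simp: dist_real_def)
    then show "y \<in> {x \<in> topspace (Ct_N n). f x \<in> W}"
      using x xt by (auto simp: c_def topspace_Ct_N total_def)
  qed
  ultimately show ?thesis by blast
qed

end

theorem theorem5p5:
  fixes n :: nat
  assumes "Ct_E (n + 1) = Ct_S (n + 1)"
  shows "zero_dimensional (R_topology (Ct_N n))"
proof -
  let ?R = "R_topology (Ct_N n)"
  have R: "openin ?R C" "closedin ?R C"
    if C: "openin (Ct_N n) C" "openin (Ct_N n) (topspace (Ct_N n) - C)" for C
  proof -
    show "openin ?R C" using openin_R_clopen[OF C] .
    have sub: "C \<subseteq> topspace (Ct_N n)" using C(1) by (rule openin_subset)
    then have "topspace (Ct_N n) - (topspace (Ct_N n) - C) = C" by blast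
    then have "openin ?R (topspace (Ct_N n) - C)" using openin_R_clopen[OF C(2)] C(1) by simp
    then show "closedin ?R C" using sub by (simp add: closedin_def topspace_R)
  qed
  have "openin ?R = arbitrary union_of (\<lambda>C. C \<in> {C. openin ?R C \<and> closedin ?R C})"
    unfolding openin_topology_base_unique
  proof (intro conjI allI impI)
    fix U y assume U: "openin ?R U \<and> y \<in> U"
    then obtain f W where f: "continuous_map (Ct_N n) euclideanreal f" "open W"
      and UW: "U = {x \<in> topspace (Ct_N n). f x \<in> W}"
      unfolding openin_R_Ct_N by blast
    obtain x0 where x0: "eqN n x0 x0" "y = cls n x0"
      using U UW by (auto simp: topspace_Ct_N total_def)
    then show "\<exists>C. C \<in> {C. openin ?R C \<and> closedin ?R C} \<and> y \<in> C \<and> C \<subseteq> U"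
      using clopen_basis[OF assms f x0(1)] U UW R by blast
  qed auto
  then show ?thesis
    unfolding zero_dimensional_def by (intro exI[of _ "{C. openin ?R C \<and> closedin ?R C}"]) auto
qed

end
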